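(* Let $p>1$, let $V,\Gamma:\mathbb{R}^3\to\mathbb{R}$ be measurable with $\Gamma\in L^\infty_{loc}(\mathbb{R}^3)$, and assume that $V=V(r,x_3)$ and $\Gamma=\Gamma(r,x_3)$ have cylindrical symmetry (where $r=\sqrt{x_1^2+x_2^2}$) and satisfy (i) $\Gamma(x)\le -C(1+|x|)^\alpha$ in $\mathbb{R}^3$ with some $\alpha>\frac32(p-1)$ and $C>0$, (ii) $V\in L^\infty(\mathbb{R}^3)$ and $\operatorname{ess\,sup}_{\mathbb{R}^3}V<0$. Then the equation $$\nabla\times\nabla\times U+V(x)U=\Gamma(x)|U|^{p-1}U\quad\text{in }\mathbb{R}^3$$ has a ground state on $X_{G_1}$.
   Context: $H(\mathrm{curl};\mathbb{R}^3)$ is the space of $U\in L^2(\mathbb{R}^3;\mathbb{R}^3)$ whose distributional curl lies in $L^2$; $L^{p+1}_{|\Gamma|}(\mathbb{R}^3)$ is the space of measurable $U:\mathbb{R}^3\to\mathbb{R}^3$ with $\int_{\mathbb{R}^3}|\Gamma||U|^{p+1}dx<\infty$; $X=H(\mathrm{curl};\mathbb{R}^3)\cap L^{p+1}_{|\Gamma|}(\mathbb{R}^3)$. The energy functional is $$J[U]=\int_{\mathbb{R}^3}\frac12\left(|\nabla\times U|^2+V(x)|U|^2\right)-\frac{\Gamma(x)}{p+1}|U|^{p+1}\,dx,\qquad U\in X.$$ Weak solutions of the equation in $X$ are the critical points of $J$ on $X$. $X_{G_1}$ is the subspace of those $U\in X$ of the form $U(x)=\frac{q(r,x_3)}{r}(-x_2,x_1,0)^T$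 for a.a. $x$, with $q:(0,\infty)\times\mathbb{R}\to\mathbb{R}$ measurable. (Equivalently: $U(x)=M^TU(Mx)$ for all rotations $M$ about the $x_3$-axis, and $g_1U=U$, where, writing the unique decomposition of such a field as $U=Q+S+T$ with $Q=\frac{q(r,x_3)}{r}(-x_2,x_1,0)^T$, $S=\frac{s(r,x_3)}{r}(x_1,x_2,0)^T$, $T=(0,0,t(r,x_3))^T$, one sets $g_1U=Q-S-T$.) A ground state on $X_{G_1}$ (in this defocusing case) is a nontrivial function $U\in X_{G_1}\setminus\{0\}$ which minimizes $J$ over $X_{G_1}$ and is a weak solution of the equation. *)

theory Defs
  imports "HOL-Analysis.Analysis" "HOL-Probability.Essential_Supremum"
begin

text \<open>Elements of the function spaces below are represented by Lebesgue measurable functions;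
  equality of the corresponding classes is equality almost everywhere.\<close>

type_synonym vfield = "real^3 \<Rightarrow> real^3"


definition partial_deriv :: "3 \<Rightarrow> vfield \<Rightarrow> vfield" where
  "partial_deriv j f x = frechet_derivative f (at x) (axis j 1)"

text \<open>The classical curl; it is only applied to differentiable fields.\<close>

definition curl :: "vfield \<Rightarrow> vfield" where
  "curl f x = vector
     [partial_deriv 2 f x $ 3 - partial_deriv 3 f x $ 2,
      partial_deriv 3 f x $ 1 - partial_deriv 1 f x $ 3,
      partial_deriv 1 f x $ 2 - partial_deriv 2 f x $ 1]"

primrec Ck :: "nat \<Rightarrow> vfield \<Rightarrow> bool" where
  "Ck 0 f \<longleftrightarrow> continuous_on UNIV f"
| "Ck (Suc k) f \<longleftrightarrow> (\<forall>x. f differentiable (at x)) \<and> (\<forall>j. Ck k (partial_deriv j f))"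

definition test_fields :: "vfield set" where
  "test_fields = {\<phi>. (\<forall>k. Ck k \<phi>) \<and> compact (closure {x. \<phi> x \<noteq> 0})}"


definition L2 :: "vfield set" where
  "L2 = {U \<in> borel_measurable lebesgue. integrable lebesgue (\<lambda>x. (norm (U x))\<^sup>2)}"

text \<open>The Bochner integral is total (zero for non-integrable functions). This relation is only
  used for \<open>U\<close> and \<open>W\<close> in \<open>L2\<close>, where both integrands are integrable.\<close>

definition is_weak_curl :: "vfield \<Rightarrow> vfield \<Rightarrow> bool" where
  "is_weak_curl U W \<longleftrightarrow>
     (\<forall>\<phi>\<in>test_fields. (LINT x|lebesgue. U x \<bullet> curl \<phi> x) = (LINT x|lebesgue. W x \<bullet> \<phi> x))"

definition H_curl :: "vfield set" where
  "H_curl = {U \<in> L2. \<exists>W\<in>L2. is_weak_curl U W}"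

text \<open>A representative of the distributional curl of \<open>U \<in> H_curl\<close>, which is unique almost
  everywhere.\<close>

definition weak_curl :: "vfield \<Rightarrow> vfield" where
  "weak_curl U = (SOME W. W \<in> L2 \<and> is_weak_curl U W)"

definition L_weighted :: "real \<Rightarrow> (real^3 \<Rightarrow> real) \<Rightarrow> vfield set" where
  "L_weighted p \<Gamma> = {U \<in> borel_measurable lebesgue.
     integrable lebesgue (\<lambda>x. \<bar>\<Gamma> x\<bar> * norm (U x) powr (p + 1))}"

definition X :: "real \<Rightarrow> (real^3 \<Rightarrow> real) \<Rightarrow> vfield set" where
  "X p \<Gamma> = H_curl \<inter> L_weighted p \<Gamma>"

definition norm_X :: "real \<Rightarrow> (real^3 \<Rightarrow> real) \<Rightarrow> vfield \<Rightarrow> real" where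
  "norm_X p \<Gamma> U =
     sqrt ((LINT x|lebesgue. (norm (U x))\<^sup>2) + (LINT x|lebesgue. (norm (weak_curl U x))\<^sup>2))
     + (LINT x|lebesgue. \<bar>\<Gamma> x\<bar> * norm (U x) powr (p + 1)) powr (1 / (p + 1))"

definition J :: "real \<Rightarrow> (real^3 \<Rightarrow> real) \<Rightarrow> (real^3 \<Rightarrow> real) \<Rightarrow> vfield \<Rightarrow> real" where
  "J p V \<Gamma> U = (LINT x|lebesgue.
     1 / 2 * ((norm (weak_curl U x))\<^sup>2 + V x * (norm (U x))\<^sup>2)
     - \<Gamma> x / (p + 1) * norm (U x) powr (p + 1))"

text \<open>The Frechet derivative of \<open>J\<close> at \<open>U\<close> with respect to \<open>norm_X\<close> exists and vanishes. As
  \<open>X\<close> depends on \<open>p\<close> and \<open>\<Gamma>\<close>, it is a set and not a type, so that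
  \<^const>\<open>has_derivative\<close> does not apply.\<close>

definition critical_point ::
    "real \<Rightarrow> (real^3 \<Rightarrow> real) \<Rightarrow> (real^3 \<Rightarrow> real) \<Rightarrow> vfield \<Rightarrow> bool" where
  "critical_point p V \<Gamma> U \<longleftrightarrow> U \<in> X p \<Gamma> \<and>
     (\<forall>\<epsilon>>0. \<exists>\<delta>>0. \<forall>H\<in>X p \<Gamma>. norm_X p \<Gamma> H < \<delta> \<longrightarrow>
        \<bar>J p V \<Gamma> (\<lambda>x. U x + H x) - J p V \<Gamma> U\<bar> \<le> \<epsilon> * norm_X p \<Gamma> H)"

text \<open>Weak solutions of \<open>\<nabla> \<times> \<nabla> \<times> U + V U = \<Gamma> |U|^(p-1) U\<close> in \<open>X\<close> are by definition the critical
  points of the energy.\<close>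

definition weak_solution ::
    "real \<Rightarrow> (real^3 \<Rightarrow> real) \<Rightarrow> (real^3 \<Rightarrow> real) \<Rightarrow> vfield \<Rightarrow> bool" where
  "weak_solution p V \<Gamma> U \<longleftrightarrow> critical_point p V \<Gamma> U"


definition cyl_radius :: "real^3 \<Rightarrow> real" where
  "cyl_radius x = sqrt ((x $ 1)\<^sup>2 + (x $ 2)\<^sup>2)"

definition cylindrically_symmetric :: "(real^3 \<Rightarrow> real) \<Rightarrow> bool" where
  "cylindrically_symmetric f \<longleftrightarrow> (\<exists>g. \<forall>x. f x = g (cyl_radius x) (x $ 3))"

definition X_G1 :: "real \<Rightarrow> (real^3 \<Rightarrow> real) \<Rightarrow> vfield set" where
  "X_G1 p \<Gamma> = {U \<in> X p \<Gamma>.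
     \<exists>q \<in> borel_measurable (lebesgue_on ({0<..} \<times> (UNIV :: real set))).
       AE x in lebesgue.
         U x = (q (cyl_radius x, x $ 3) / cyl_radius x) *\<^sub>R vector [- (x $ 2), x $ 1, 0]}"

definition ground_state ::
    "real \<Rightarrow> (real^3 \<Rightarrow> real) \<Rightarrow> (real^3 \<Rightarrow> real) \<Rightarrow> vfield \<Rightarrow> bool" where
  "ground_state p V \<Gamma> U \<longleftrightarrow>
     U \<in> X_G1 p \<Gamma> \<and> \<not> (AE x in lebesgue. U x = 0) \<and>
     (\<forall>W\<in>X_G1 p \<Gamma>. J p V \<Gamma> U \<le> J p V \<Gamma> W) \<and>
     weak_solution p V \<Gamma> U"


definition L_inf :: "(real^3) measure \<Rightarrow> (real^3 \<Rightarrow> real) \<Rightarrow> bool" where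
  "L_inf M f \<longleftrightarrow> f \<in> borel_measurable M \<and> (\<exists>B. AE x in M. \<bar>f x\<bar> \<le> B)"

definition L_inf_loc :: "(real^3 \<Rightarrow> real) \<Rightarrow> bool" where
  "L_inf_loc f \<longleftrightarrow> (\<forall>K. compact K \<longrightarrow> L_inf (lebesgue_on K) f)"

end

theory Submission
  imports Defs "HOL-Probability.Probability_Measure" "HOL-Computational_Algebra.Polynomial"
    "HOL-Library.Diagonal_Subsequence"
begin

text \<open>
  The energy is bounded below because \<open>t^2 \<le> \<epsilon> |\<Gamma>| t powr (p + 1) + c \<epsilon> |\<Gamma>| powr (- 2 / (p - 1))\<close> and the
  last term is integrable by the growth of \<open>\<Gamma>\<close>. The same inequality controls the tails of a minimizing
  sequence in \<open>L2\<close>. Local compactness comes from the scalar function \<open>r q\<close> attached to a field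
  \<open>(q / r) (- x2, x1, 0)\<close>: its weak gradient is bounded by the curl, and Rellich's theorem applies. For
  an \<open>L2\<close>-Cauchy minimizing sequence the parallelogram identity makes the curls Cauchy as well, and
  Fatou's lemma gives a minimizer. Slowly varying fields have negative energy since \<open>V\<close> is
  negative, so the minimizer is not zero. Its derivative vanishes on \<open>X_G1\<close>; being invariant under the
  rotations about the axis and odd under the reflection of the second coordinate, it takes the same value
  at a field and at its projection onto \<open>X_G1\<close>, hence it vanishes on all of \<open>X\<close>.
\<close>

section \<open>The space of square integrable fields\<close>

text \<open>As \<open>V\<close> is negative, the quadratic part of the energy is indefinite and
  coercivity must come from the weighted term alone; the Young remainder decays like |x| to the
  power -2\<alpha>/(p-1), and \<alpha> > 3/2(p-1) says that this exponent is below -3. On all of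
  \<open>X\<close> gradient fields have zero curl, so a bound on the curl gives no compactness.
  Azimuthal fields are divergence free, and for them the curl controls a full gradient. Compactness
  first appears in L1 on balls and only for r q; the weighted bound raises it to L2 away from the
  axis and from infinity. Strong L2 convergence also replaces the missing convexity: at a midpoint
  \<open>V\<close> costs only a multiple of the squared L2 distance. For the last step a symmetry is
  needed that acts on arbitrary fields and respects the curl, whereas g1 is defined through the
  decomposition Q + S + T. On rotation equivariant fields g1 is minus the conjugation by
  \<open>refl2\<close>, and this conjugation commutes with the curl up to a sign.\<close>

lemma fatou_real:
  fixes f :: "nat \<Rightarrow> 'a \<Rightarrow> real"
  assumes int: "\<And>k. integrable M (f k)"
    and nonneg: "\<And>k. AE x in M. 0 \<le> f k x"
    and lim: "AE x in M. (\<lambda>k. f k x) \<longlonglongrightarrow> g x"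
    and g: "g \<in> borel_measurable M"
    and bound: "\<forall>\<^sub>F k in sequentially. integral\<^sup>L M (f k) \<le> c"
  shows "integrable M g" "integral\<^sup>L M g \<le> c"
proof -
  have nonneg': "AE x in M. \<forall>k. 0 \<le> f k x"
    using nonneg by (simp add: AE_all_countable)
  have g_nonneg: "AE x in M. 0 \<le> g x"
    using nonneg' lim by eventually_elim (auto intro: LIMSEQ_le_const)
  have c: "0 \<le> c"
  proof -
    obtain k where "integral\<^sup>L M (f k) \<le> c"
      using bound unfolding eventually_sequentially by blast
    moreover have "0 \<le> integral\<^sup>L M (f k)"
      using nonneg by (rule integral_nonneg_AE)
    ultimately show ?thesis by simp
  qed
  have "(\<integral>\<^sup>+x. ennreal (g x) \<partial>M) = (\<integral>\<^sup>+x. liminf (\<lambda>k. ennreal (f k x)) \<partial>M)"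
  proof (rule nn_integral_cong_AE)
    show "AE x in M. ennreal (g x) = liminf (\<lambda>k. ennreal (f k x))"
      using lim
    proof eventually_elim
      case (elim x)
      have "(\<lambda>k. ennreal (f k x)) \<longlonglongrightarrow> ennreal (g x)"
        using elim by (rule tendsto_ennrealI)
      then show ?case
        by (simp add: lim_imp_Liminf)
    qed
  qed
  also have "\<dots> \<le> liminf (\<lambda>k. \<integral>\<^sup>+x. ennreal (f k x) \<partial>M)"
    by (rule nn_integral_liminf) (use int in measurable)
  also have "\<dots> \<le> ennreal c"
  proof (rule Liminf_le)
    show "\<forall>\<^sub>F k in sequentially. (\<integral>\<^sup>+x. ennreal (f k x) \<partial>M) \<le> ennreal c"
      using bound
    proof eventually_elim
      case (elim k)
      have "(\<integral>\<^sup>+x. ennreal (f k x) \<partial>M) = ennreal (integral\<^sup>L M (f k))"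
        using int nonneg by (rule nn_integral_eq_integral)
      then show ?case using elim by (simp add: ennreal_leI)
    qed
  qed simp
  finally have le: "(\<integral>\<^sup>+x. ennreal (g x) \<partial>M) \<le> ennreal c" .
  show int_g: "integrable M g"
    using g g_nonneg le by (intro integrableI_nonneg) (auto simp: order_le_less_trans)
  have "ennreal (integral\<^sup>L M g) \<le> ennreal c"
    using le nn_integral_eq_integral[OF int_g g_nonneg] by simp
  then show "integral\<^sup>L M g \<le> c"
    using c by (simp add: ennreal_le_iff)
qed

lemma norm_diff_sq_le:
  fixes a b :: "'a::real_inner"
  shows "(norm (a - b))\<^sup>2 \<le> 2 * (norm a)\<^sup>2 + 2 * (norm b)\<^sup>2"
proof -
  have "0 \<le> (norm (a + b))\<^sup>2" by simp
  then show ?thesis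
    by (simp add: power2_norm_eq_inner inner_simps inner_commute)
qed

lemma norm_add_sq_le:
  fixes a b :: "'a::real_inner"
  shows "(norm (a + b))\<^sup>2 \<le> 2 * (norm a)\<^sup>2 + 2 * (norm b)\<^sup>2"
  using norm_diff_sq_le[of a "- b"] by simp

lemma abs_mult_le_sum_sq: "\<bar>a * b\<bar> \<le> a\<^sup>2 + (b::real)\<^sup>2"
proof -
  have "2 * (\<bar>a\<bar> * \<bar>b\<bar>) \<le> a\<^sup>2 + b\<^sup>2"
    using sum_squares_bound[of "\<bar>a\<bar>" "\<bar>b\<bar>"] by simp
  moreover have "0 \<le> \<bar>a\<bar> * \<bar>b\<bar>" by simp
  ultimately show ?thesis unfolding abs_mult by linarith
qed

lemma L2_measurable [measurable_dest]: "U \<in> L2 \<Longrightarrow> U \<in> borel_measurable lebesgue"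
  by (simp add: L2_def)

lemma L2_integrable: "U \<in> L2 \<Longrightarrow> integrable lebesgue (\<lambda>x. (norm (U x))\<^sup>2)"
  by (simp add: L2_def)

lemma L2I:
  "U \<in> borel_measurable lebesgue \<Longrightarrow> integrable lebesgue (\<lambda>x. (norm (U x))\<^sup>2) \<Longrightarrow> U \<in> L2"
  by (simp add: L2_def)

lemma L2_bound:
  assumes f: "integrable lebesgue f" and U: "U \<in> borel_measurable lebesgue"
    and le: "AE x in lebesgue. (norm (U x))\<^sup>2 \<le> f x"
  shows "U \<in> L2"
proof (rule L2I[OF U])
  note [measurable] = U
  show "integrable lebesgue (\<lambda>x. (norm (U x))\<^sup>2)"
  proof (rule Bochner_Integration.integrable_bound[OF f])
    show "(\<lambda>x. (norm (U x))\<^sup>2) \<in> borel_measurable lebesgue" by measurable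
    show "AE x in lebesgue. norm ((norm (U x))\<^sup>2) \<le> norm (f x)"
      using le by eventually_elim (auto intro: order_trans[OF _ abs_ge_self])
  qed
qed

lemma L2_add: assumes U: "U \<in> L2" and W: "W \<in> L2" shows "(\<lambda>x. U x + W x) \<in> L2"
proof (rule L2_bound)
  note [measurable] = L2_measurable[OF U] L2_measurable[OF W]
  show "integrable lebesgue (\<lambda>x. 2 * (norm (U x))\<^sup>2 + 2 * (norm (W x))\<^sup>2)"
    using L2_integrable[OF U] L2_integrable[OF W] by simp
  show "(\<lambda>x. U x + W x) \<in> borel_measurable lebesgue" by measurable
qed (simp add: norm_add_sq_le)

lemma L2_scaleR: assumes U: "U \<in> L2" shows "(\<lambda>x. c *\<^sub>R U x) \<in> L2"
proof (rule L2_bound)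
  note [measurable] = L2_measurable[OF U]
  show "integrable lebesgue (\<lambda>x. c\<^sup>2 * (norm (U x))\<^sup>2)"
    using L2_integrable[OF U] by simp
  show "(\<lambda>x. c *\<^sub>R U x) \<in> borel_measurable lebesgue" by measurable
qed (simp add: power_mult_distrib)

lemma L2_diff: assumes "U \<in> L2" and "W \<in> L2" shows "(\<lambda>x. U x - W x) \<in> L2"
  using L2_add[OF assms(1) L2_scaleR[OF assms(2), of "-1"]] by simp

lemma L2_zero [simp]: "(\<lambda>x. 0) \<in> L2"
  by (simp add: L2_def)

lemma L2_cong:
  assumes U: "U \<in> L2" and W: "W \<in> borel_measurable lebesgue" and eq: "AE x in lebesgue. U x = W x"
  shows "W \<in> L2"
  by (rule L2_bound[OF L2_integrable[OF U] W]) (use eq in eventually_elim, simp)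

lemma L2_norm_mult_integrable:
  assumes U: "U \<in> L2" and W: "W \<in> L2"
  shows "integrable lebesgue (\<lambda>x. norm (U x) * norm (W x))"
proof (rule Bochner_Integration.integrable_bound)
  note [measurable] = L2_measurable[OF U] L2_measurable[OF W]
  show "integrable lebesgue (\<lambda>x. (norm (U x))\<^sup>2 + (norm (W x))\<^sup>2)"
    using L2_integrable[OF U] L2_integrable[OF W] by simp
  show "(\<lambda>x. norm (U x) * norm (W x)) \<in> borel_measurable lebesgue" by measurable
  show "AE x in lebesgue. norm (norm (U x) * norm (W x)) \<le> norm ((norm (U x))\<^sup>2 + (norm (W x))\<^sup>2)"
    using abs_mult_le_sum_sq[of "norm (U _)" "norm (W _)"] by (intro AE_I2) (auto intro: order_trans)
qed

lemma L2_inner_integrable: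
  assumes U: "U \<in> L2" and W: "W \<in> L2"
  shows "integrable lebesgue (\<lambda>x. U x \<bullet> W x)"
proof (rule Bochner_Integration.integrable_bound[OF L2_norm_mult_integrable[OF assms]])
  note [measurable] = L2_measurable[OF U] L2_measurable[OF W]
  show "(\<lambda>x. U x \<bullet> W x) \<in> borel_measurable lebesgue" by measurable
qed (simp add: Cauchy_Schwarz_ineq2)

text \<open>The pointwise bound a b \<le> a^2 / t + t b^2 with a suitable \<open>t\<close> does the
  work of the Cauchy-Schwarz inequality for integrals.\<close>

lemma L2_inner_tendsto:
  assumes F: "\<And>n. F n \<in> L2" and F': "F' \<in> L2" and G: "G \<in> L2"
    and lim: "(\<lambda>n. LINT x|lebesgue. (norm (F n x - F' x))\<^sup>2) \<longlonglongrightarrow> 0"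
  shows "(\<lambda>n. LINT x|lebesgue. F n x \<bullet> G x) \<longlonglongrightarrow> (LINT x|lebesgue. F' x \<bullet> G x)"
proof (rule LIMSEQ_I)
  fix e :: real assume e: "0 < e"
  define g where "g = (LINT x|lebesgue. (norm (G x))\<^sup>2) + 1"
  have "0 \<le> (LINT x|lebesgue. (norm (G x))\<^sup>2)" by simp
  then have g: "0 < g" unfolding g_def by linarith
  \<comment> \<open>With this \<open>t\<close> both halves of the final bound are e/2: (1/t) (t e /
    2) from the convergence and t g from the fixed \<open>G\<close>. The summand 1 in
    \<open>g\<close> keeps the division legitimate when \<open>G\<close> vanishes.\<close>
  define t where "t = e / (2 * g)"
  have t: "0 < t" using e g by (simp add: t_def)
  have "\<forall>\<^sub>F n in sequentially. (LINT x|lebesgue. (norm (F n x - F' x))\<^sup>2) < t * e / 2"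
    using order_tendstoD(2)[OF lim, of "t * e / 2"] t e by simp
  then obtain N where N: "\<And>n. N \<le> n \<Longrightarrow> (LINT x|lebesgue. (norm (F n x - F' x))\<^sup>2) < t * e / 2"
    by (auto simp: eventually_sequentially)
  show "\<exists>no. \<forall>n\<ge>no. norm ((LINT x|lebesgue. F n x \<bullet> G x) - (LINT x|lebesgue. F' x \<bullet> G x)) < e"
  proof (intro exI allI impI)
    fix n assume n: "N \<le> n"
    have D: "(\<lambda>x. F n x - F' x) \<in> L2" by (rule L2_diff[OF F F'])
    have "(LINT x|lebesgue. F n x \<bullet> G x) - (LINT x|lebesgue. F' x \<bullet> G x)
        = (LINT x|lebesgue. (F n x - F' x) \<bullet> G x)"
      using L2_inner_integrable[OF F G] L2_inner_integrable[OF F' G]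
      by (simp add: inner_diff_left)
    also have "norm \<dots> \<le> (LINT x|lebesgue. norm ((F n x - F' x) \<bullet> G x))"
      by (rule integral_norm_bound)
    also have "\<dots> \<le> (LINT x|lebesgue. (1/t) * (norm (F n x - F' x))\<^sup>2 + t * (norm (G x))\<^sup>2)"
    proof (rule integral_mono)
      show "integrable lebesgue (\<lambda>x. norm ((F n x - F' x) \<bullet> G x))"
        using L2_inner_integrable[OF D G] by (rule integrable_norm)
      show "integrable lebesgue (\<lambda>x. (1/t) * (norm (F n x - F' x))\<^sup>2 + t * (norm (G x))\<^sup>2)"
        using L2_integrable[OF D] L2_integrable[OF G] by simp
      fix x
      have "norm ((F n x - F' x) \<bullet> G x) \<le> norm (F n x - F' x) * norm (G x)"
        by (simp add: Cauchy_Schwarz_ineq2)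
      also have "\<dots> = (norm (F n x - F' x) / sqrt t) * (sqrt t * norm (G x))"
        using t by simp
      also have "\<dots> \<le> (norm (F n x - F' x) / sqrt t)\<^sup>2 + (sqrt t * norm (G x))\<^sup>2"
        using abs_mult_le_sum_sq[of "norm (F n x - F' x) / sqrt t" "sqrt t * norm (G x)"]
        by linarith
      also have "\<dots> = (1/t) * (norm (F n x - F' x))\<^sup>2 + t * (norm (G x))\<^sup>2"
        using t by (simp add: power_mult_distrib power_divide)
      finally show "norm ((F n x - F' x) \<bullet> G x) \<le> (1/t) * (norm (F n x - F' x))\<^sup>2 + t * (norm (G x))\<^sup>2" .
    qed
    also have "\<dots> = (1/t) * (LINT x|lebesgue. (norm (F n x - F' x))\<^sup>2) + t * (g - 1)"
      using L2_integrable[OF D] L2_integrable[OF G] by (simp add: g_def)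
    also have "\<dots> < (1/t) * (t * e / 2) + t * g"
      using N[OF n] t by (intro add_strict_mono mult_strict_left_mono) auto
    also have "\<dots> = e"
      using t g by (simp add: t_def)
    finally show "norm ((LINT x|lebesgue. F n x \<bullet> G x) - (LINT x|lebesgue. F' x \<bullet> G x)) < e" .
  qed
qed

lemma L2_fatou:
  assumes F: "\<And>n. F n \<in> L2" and F': "F' \<in> borel_measurable lebesgue"
    and lim: "AE x in lebesgue. (\<lambda>n. F n x) \<longlonglongrightarrow> F' x"
    and bound: "\<forall>\<^sub>F n in sequentially. (LINT x|lebesgue. (norm (F n x))\<^sup>2) \<le> c"
  shows "F' \<in> L2" "(LINT x|lebesgue. (norm (F' x))\<^sup>2) \<le> c"
proof -
  note [measurable] = F'
  have "AE x in lebesgue. (\<lambda>n. (norm (F n x))\<^sup>2) \<longlonglongrightarrow> (norm (F' x))\<^sup>2"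
    using lim by eventually_elim (intro tendsto_intros)
  note * = fatou_real[OF L2_integrable[OF F] _ this _ bound]
  show "F' \<in> L2" by (rule L2I[OF F' *(1)]) auto
  show "(LINT x|lebesgue. (norm (F' x))\<^sup>2) \<le> c" by (rule *(2)) auto
qed

text \<open>Summing the shifted thresholds \<open>Suc (N i)\<close> gives strict monotonicity and
  \<open>N k \<le> r k\<close> at once, without a recursive choice of indices.\<close>

lemma fast_subsequence:
  fixes d :: "nat \<Rightarrow> nat \<Rightarrow> real" and e :: "nat \<Rightarrow> real"
  assumes "\<And>e. 0 < e \<Longrightarrow> \<exists>N. \<forall>m\<ge>N. \<forall>n\<ge>N. d m n < e"
    and e: "\<And>k. 0 < e k"
  obtains r where "strict_mono r" "\<And>k m n. r k \<le> m \<Longrightarrow> r k \<le> n \<Longrightarrow> d m n < e k"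
proof -
  obtain N where N: "\<And>k m n. N k \<le> m \<Longrightarrow> N k \<le> n \<Longrightarrow> d m n < e k"
    using assms(1)[OF e] by metis
  define r where "r k = (\<Sum>i\<le>k. Suc (N i))" for k
  have "strict_mono r" by (simp add: strict_mono_Suc_iff r_def)
  moreover have "N k \<le> r k" for k
    by (induction k) (auto simp: r_def)
  ultimately show ?thesis using N by (intro that[of r]) (meson order_trans)+
qed

text \<open>The pointwise convergent subsequence is part of the conclusion because Fatou's lemma
  will be applied along it.\<close>

theorem L2_complete:
  assumes F: "\<And>n. F n \<in> L2"
    and cauchy: "\<And>e. 0 < e \<Longrightarrow> \<exists>N. \<forall>m\<ge>N. \<forall>n\<ge>N. (LINT x|lebesgue. (norm (F m x - F n x))\<^sup>2) < e"
  obtains F' r where "F' \<in> L2" "strict_mono r" "AE x in lebesgue. (\<lambda>k. F (r k) x) \<longlonglongrightarrow> F' x"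
    "(\<lambda>n. LINT x|lebesgue. (norm (F n x - F' x))\<^sup>2) \<longlonglongrightarrow> 0"
proof -
  obtain r where r: "strict_mono r"
    and le: "\<And>k m n. r k \<le> m \<Longrightarrow> r k \<le> n \<Longrightarrow> (LINT x|lebesgue. (norm (F m x - F n x))\<^sup>2) < (1/4)^k"
    using fast_subsequence[of "\<lambda>m n. LINT x|lebesgue. (norm (F m x - F n x))\<^sup>2" "\<lambda>k. (1/4)^k"] cauchy
    by auto
  note [measurable] = L2_measurable[OF F]
  \<comment> \<open>The increments have squared norm below (1/4)^k, so their integrals remain
    summable after weighting by 2^k. The weight is what turns summable squares into summable norms
    below.\<close>
  define D where "D k x = F (r (Suc k)) x - F (r k) x" for k x
  have D: "D k \<in> L2" for k
    unfolding D_def[abs_def] by (intro L2_diff F)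
  note [measurable] = L2_measurable[OF D]
  have "(\<integral>\<^sup>+x. (\<Sum>k. ennreal (2^k * (norm (D k x))\<^sup>2)) \<partial>lebesgue)
      = (\<Sum>k. \<integral>\<^sup>+x. ennreal (2^k * (norm (D k x))\<^sup>2) \<partial>lebesgue)"
    by (rule nn_integral_suminf) measurable
  also have "\<dots> \<le> (\<Sum>k. ennreal ((1/2)^k))"
  proof (intro suminf_le allI)
    fix k
    have "(\<integral>\<^sup>+x. ennreal (2^k * (norm (D k x))\<^sup>2) \<partial>lebesgue) = ennreal (LINT x|lebesgue. 2^k * (norm (D k x))\<^sup>2)"
      using L2_integrable[OF D] by (intro nn_integral_eq_integral) auto
    also have "(LINT x|lebesgue. 2^k * (norm (D k x))\<^sup>2) \<le> 2^k * (1/4)^k"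
      using le[of k "r (Suc k)" "r k"] r by (auto simp: D_def strict_mono_less_eq)
    also have "2^k * (1/4)^k = (1/2::real)^k"
      by (simp add: power_mult_distrib[symmetric])
    finally show "(\<integral>\<^sup>+x. ennreal (2^k * (norm (D k x))\<^sup>2) \<partial>lebesgue) \<le> ennreal ((1/2)^k)"
      by (simp add: ennreal_leI)
  qed auto
  also have "\<dots> = ennreal (\<Sum>k. (1/2)^k)"
    by (rule suminf_ennreal2) auto
  also have "\<dots> < \<infinity>" by simp
  finally have fin: "(\<integral>\<^sup>+x. (\<Sum>k. ennreal (2^k * (norm (D k x))\<^sup>2)) \<partial>lebesgue) \<noteq> \<infinity>" by simp
  have "AE x in lebesgue. (\<Sum>k. ennreal (2^k * (norm (D k x))\<^sup>2)) \<noteq> \<infinity>"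
    by (rule nn_integral_PInf_AE[OF _ fin]) measurable
  then have conv: "AE x in lebesgue. convergent (\<lambda>k. F (r k) x)"
  proof eventually_elim
    case (elim x)
    have s1: "summable (\<lambda>k. 2^k * (norm (D k x))\<^sup>2)"
      by (rule summable_suminf_not_top) (use elim in auto)
    have s2: "summable (\<lambda>k. (1/2::real)^k + 2^k * (norm (D k x))\<^sup>2)"
      by (intro summable_add s1) simp
    have "norm (norm (D k x)) \<le> (1/2::real)^k + 2^k * (norm (D k x))\<^sup>2" for k
    proof -
      have "norm (D k x) = sqrt ((1/2)^k) * (sqrt (2^k) * norm (D k x))"
        by (simp add: real_sqrt_mult[symmetric] power_mult_distrib[symmetric])
      also have "\<dots> \<le> (sqrt ((1/2)^k))\<^sup>2 + (sqrt (2^k) * norm (D k x))\<^sup>2"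
        using abs_mult_le_sum_sq[of "sqrt ((1/2)^k)" "sqrt (2^k) * norm (D k x)"] by linarith
      also have "\<dots> = (1/2)^k + 2^k * (norm (D k x))\<^sup>2"
        by (simp add: power_mult_distrib)
      finally show ?thesis by simp
    qed
    then have "summable (\<lambda>k. norm (D k x))"
      by (rule summable_comparison_test'[OF s2, of 0])
    then have "summable (\<lambda>k. D k x)" by (rule summable_norm_cancel)
    then have "summable (\<lambda>k. F (r (Suc k)) x - F (r k) x)" by (simp add: D_def)
    then have "convergent (\<lambda>n. \<Sum>k<n. F (r (Suc k)) x - F (r k) x)"
      by (simp add: summable_iff_convergent)
    then have "convergent (\<lambda>n. (\<Sum>k<n. F (r (Suc k)) x - F (r k) x) + F (r 0) x)"
      by (intro convergent_add convergent_const)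
    then show ?case by (simp add: sum_lessThan_telescope[of "\<lambda>k. F (r k) x"])
  qed
  define F' where "F' x = lim (\<lambda>k. F (r k) x)" for x
  have F' [measurable]: "F' \<in> borel_measurable lebesgue"
    unfolding F'_def by (rule borel_measurable_lim_metric) measurable
  have lim: "AE x in lebesgue. (\<lambda>k. F (r k) x) \<longlonglongrightarrow> F' x"
    using conv by eventually_elim (simp add: F'_def convergent_LIMSEQ_iff)
  \<comment> \<open>The Cauchy bound passes to the limit by Fatou along the subsequence, which
    yields both membership in \<open>L2\<close> and the rate.\<close>
  have est: "(\<lambda>x. F n x - F' x) \<in> L2 \<and> (LINT x|lebesgue. (norm (F n x - F' x))\<^sup>2) \<le> (1/4)^j" if n: "r j \<le> n" for n j
  proof -
    have l: "AE x in lebesgue. (\<lambda>k. F n x - F (r k) x) \<longlonglongrightarrow> F n x - F' x"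
      using lim by eventually_elim (intro tendsto_intros)
    have b: "\<forall>\<^sub>F k in sequentially. (LINT x|lebesgue. (norm (F n x - F (r k) x))\<^sup>2) \<le> (1/4)^j"
      unfolding eventually_sequentially
      using le[OF n] r by (intro exI[of _ j]) (auto simp: strict_mono_less_eq intro: less_imp_le)
    show ?thesis
      using L2_fatou[OF L2_diff[OF F F] _ l b] by auto
  qed
  have "(\<lambda>x. F (r 0) x - (F (r 0) x - F' x)) \<in> L2"
    by (intro L2_diff[OF F est[of 0 "r 0", THEN conjunct1]]) simp
  moreover have "(\<lambda>x. F (r 0) x - (F (r 0) x - F' x)) = F'" by auto
  ultimately have F'_L2: "F' \<in> L2" by metis
  have "(\<lambda>n. LINT x|lebesgue. (norm (F n x - F' x))\<^sup>2) \<longlonglongrightarrow> 0"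
  proof (rule LIMSEQ_I)
    fix e :: real assume "0 < e"
    then obtain j where j: "(1/4::real)^j < e"
      using real_arch_pow_inv[of e "1/4"] by auto
    have "norm ((LINT x|lebesgue. (norm (F n x - F' x))\<^sup>2) - 0) < e" if "r j \<le> n" for n
      using est[OF that] j by simp
    then show "\<exists>no. \<forall>n\<ge>no. norm ((LINT x|lebesgue. (norm (F n x - F' x))\<^sup>2) - 0) < e"
      by blast
  qed
  then show ?thesis by (rule that[OF F'_L2 r lim])
qed

section \<open>Smooth functions and test fields\<close>

text \<open>Scalar twin of \<open>partial_deriv\<close>. The calculus is carried out for components
  and transferred back by \<open>Ck_iff\<close>, so that product and chain rules are only needed for
  real functions.\<close>

definition pd :: "3 \<Rightarrow> (real^3 \<Rightarrow> real) \<Rightarrow> real^3 \<Rightarrow> real" where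
  "pd j f x = frechet_derivative f (at x) (axis j 1)"

primrec Cks :: "nat \<Rightarrow> (real^3 \<Rightarrow> real) \<Rightarrow> bool" where
  "Cks 0 f \<longleftrightarrow> continuous_on UNIV f"
| "Cks (Suc k) f \<longleftrightarrow> (\<forall>x. f differentiable (at x)) \<and> (\<forall>j. Cks k (pd j f))"

definition smooth :: "(real^3 \<Rightarrow> real) \<Rightarrow> bool" where
  "smooth f \<longleftrightarrow> (\<forall>k. Cks k f)"

lemma Cks_SucD: "Cks (Suc k) f \<Longrightarrow> Cks k f"
proof (induction k arbitrary: f)
  case 0
  then show ?case
    by (auto intro!: continuous_at_imp_continuous_on differentiable_imp_continuous_within)
next
  case (Suc k)
  have "\<And>j. Cks (Suc k) (pd j f)" using Suc.prems by auto
  then have "\<And>j. Cks k (pd j f)" using Suc.IH by blast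
  then show ?case using Suc.prems by simp
qed

lemma pd_eqI: "(f has_derivative f') (at x) \<Longrightarrow> pd j f x = f' (axis j 1)"
  by (metis pd_def frechet_derivative_at)

lemma has_derivative_pd: "f differentiable (at x) \<Longrightarrow> (f has_derivative frechet_derivative f (at x)) (at x)"
  by (simp add: frechet_derivative_works)

lemma differentiable_real_mult:
  fixes f g :: "real^3 \<Rightarrow> real"
  shows "f differentiable (at x) \<Longrightarrow> g differentiable (at x) \<Longrightarrow> (\<lambda>x. f x * g x) differentiable (at x)"
  by (rule differentiable_mult)

lemma pd_add: "f differentiable (at x) \<Longrightarrow> g differentiable (at x) \<Longrightarrow> pd j (\<lambda>x. f x + g x) x = pd j f x + pd j g x"
  by (subst pd_eqI, rule has_derivative_add, erule has_derivative_pd, erule has_derivative_pd)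
    (simp add: pd_def)

lemma pd_mult: "f differentiable (at x) \<Longrightarrow> g differentiable (at x) \<Longrightarrow>
    pd j (\<lambda>x. f x * g x) x = f x * pd j g x + pd j f x * g x"
  by (subst pd_eqI, rule has_derivative_mult, erule has_derivative_pd, erule has_derivative_pd)
    (simp add: pd_def)

lemma pd_cmult: "f differentiable (at x) \<Longrightarrow> pd j (\<lambda>x. c * f x) x = c * pd j f x"
  by (subst pd_eqI, rule has_derivative_mult_right, erule has_derivative_pd) (simp add: pd_def)

lemma pd_const [simp]: "pd j (\<lambda>x. c) x = 0"
  by (simp add: pd_eqI[OF has_derivative_const])

lemma pd_nth [simp]: "pd j (\<lambda>x. x $ i) x = (if i = j then 1 else 0)"
proof -
  have "((\<lambda>x::real^3. x $ i) has_derivative (\<lambda>h. h $ i)) (at x)"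
    by (rule bounded_linear_imp_has_derivative[OF bounded_linear_vec_nth])
  from pd_eqI[OF this] show ?thesis by (auto simp: axis_def)
qed

lemma differentiable_nth [simp]: "(\<lambda>x::real^3. x $ i) differentiable (at x)"
  using bounded_linear_imp_has_derivative[OF bounded_linear_vec_nth] unfolding differentiable_def by blast

lemma pd_comp:
  assumes "f differentiable (at x)" and "(h has_real_derivative h') (at (f x))"
  shows "pd j (\<lambda>x. h (f x)) x = h' * pd j f x" "(\<lambda>x. h (f x)) differentiable (at x)"
proof -
  have "((\<lambda>x. h (f x)) has_derivative (\<lambda>v. h' * frechet_derivative f (at x) v)) (at x)"
    using has_derivative_compose[OF has_derivative_pd[OF assms(1)], of h "(*) h'"] assms(2)
    by (simp add: has_field_derivative_def)
  from pd_eqI[OF this] this show "pd j (\<lambda>x. h (f x)) x = h' * pd j f x" "(\<lambda>x. h (f x)) differentiable (at x)"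
    by (auto simp: pd_def differentiable_def)
qed

lemma pd_affine:
  assumes "f differentiable (at (M *v x + a))"
  shows "pd j (\<lambda>x. f (M *v x + a)) x = (\<Sum>i\<in>UNIV. M $ i $ j * pd i f (M *v x + a))"
    "(\<lambda>x. f (M *v x + a)) differentiable (at x)"
proof -
  let ?D = "frechet_derivative f (at (M *v x + a))"
  have l: "linear ?D"
    using has_derivative_linear[OF has_derivative_pd[OF assms]] .
  have A: "((\<lambda>x. M *v x + a) has_derivative (\<lambda>v. M *v v)) (at x)"
    by (auto intro!: derivative_eq_intros bounded_linear_imp_has_derivative)
  have d: "((\<lambda>x. f (M *v x + a)) has_derivative (\<lambda>v. ?D (M *v v))) (at x)"
    by (rule has_derivative_compose[OF A has_derivative_pd[OF assms]])
  have "M *v axis j 1 = (\<Sum>i\<in>UNIV. M $ i $ j *\<^sub>R axis i 1)"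
    by (simp add: vec_eq_iff matrix_vector_mult_def axis_def if_distrib cong: if_cong)
  then have "?D (M *v axis j 1) = (\<Sum>i\<in>UNIV. M $ i $ j * ?D (axis i 1))"
    by (simp add: linear_sum[OF l] linear_scale[OF l])
  then show "pd j (\<lambda>x. f (M *v x + a)) x = (\<Sum>i\<in>UNIV. M $ i $ j * pd i f (M *v x + a))"
    using pd_eqI[OF d] by (simp add: pd_def)
  show "(\<lambda>x. f (M *v x + a)) differentiable (at x)"
    using d by (auto simp: differentiable_def)
qed

lemma Cks_const: "Cks k (\<lambda>x. c)"
  by (induction k arbitrary: c) (auto simp: pd_def[abs_def])

lemma Cks_add: "Cks k f \<Longrightarrow> Cks k g \<Longrightarrow> Cks k (\<lambda>x. f x + g x)"
proof (induction k arbitrary: f g)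
  case (Suc k)
  then have "pd j (\<lambda>x. f x + g x) = (\<lambda>x. pd j f x + pd j g x)" for j
    by (auto simp: pd_add)
  then show ?case using Suc by (auto intro: differentiable_add)
qed (simp add: continuous_on_add)

lemma Cks_mult: "Cks k f \<Longrightarrow> Cks k g \<Longrightarrow> Cks k (\<lambda>x. f x * g x)"
proof (induction k arbitrary: f g)
  case (Suc k)
  then have "pd j (\<lambda>x. f x * g x) = (\<lambda>x. f x * pd j g x + pd j f x * g x)" for j
    by (auto simp: pd_mult)
  moreover have "Cks k f" "Cks k g" using Suc.prems Cks_SucD by blast+
  ultimately show ?case using Suc by (auto intro!: differentiable_real_mult Cks_add)
qed (simp add: continuous_on_mult)

lemma Cks_nth: "Cks k (\<lambda>x. x $ i)"
proof (cases k)
  case (Suc k)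
  have "pd j (\<lambda>x. x $ i) = (\<lambda>x. if i = j then 1 else 0)" for j by auto
  then show ?thesis unfolding Suc by (auto intro: Cks_const)
qed (simp add: continuous_on_component)

lemma Cks_affine: "Cks k f \<Longrightarrow> Cks k (\<lambda>x. f (M *v x + a))"
proof (induction k arbitrary: f)
  case 0
  have "continuous_on UNIV (\<lambda>x. M *v x + a)" by (intro continuous_intros)
  from continuous_on_compose2[OF _ this, of UNIV f] 0 show ?case by simp
next
  case (Suc k)
  have "pd j (\<lambda>x. f (M *v x + a)) = (\<lambda>x. M $ 1 $ j * pd 1 f (M *v x + a)
      + (M $ 2 $ j * pd 2 f (M *v x + a) + M $ 3 $ j * pd 3 f (M *v x + a)))" for j
  proof
    fix x
    have "f differentiable (at (M *v x + a))" using Suc.prems by simp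
    from pd_affine(1)[OF this]
    show "pd j (\<lambda>x. f (M *v x + a)) x = M $ 1 $ j * pd 1 f (M *v x + a)
      + (M $ 2 $ j * pd 2 f (M *v x + a) + M $ 3 $ j * pd 3 f (M *v x + a))"
      by (simp only: UNIV_3) simp
  qed
  moreover have "Cks k (\<lambda>x. c * pd i f (M *v x + a))" for c i
    using Suc by (intro Cks_mult Cks_const) auto
  ultimately have "Cks k (pd j (\<lambda>x. f (M *v x + a)))" for j
    by (simp only: Cks_add)
  moreover have "(\<lambda>x. f (M *v x + a)) differentiable (at x)" for x
    using Suc.prems by (intro pd_affine(2)) simp
  ultimately show ?case by simp
qed

text \<open>A coinductive form of infinite differentiability: membership in a set closed under
  taking derivatives. A whole family such as \<open>range flat_exp\<close> serves as witness, with
  no formula for the n-th derivative.\<close>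

definition smooth_real :: "(real \<Rightarrow> real) \<Rightarrow> bool" where
  "smooth_real h \<longleftrightarrow> (\<exists>S. h \<in> S \<and> (\<forall>f\<in>S. \<exists>f'\<in>S. \<forall>t. (f has_real_derivative f' t) (at t)))"

lemma smooth_realE:
  assumes "smooth_real h"
  obtains h' where "smooth_real h'" "\<And>t. (h has_real_derivative h' t) (at t)"
  using assms unfolding smooth_real_def by blast

lemma Cks_comp: "smooth_real h \<Longrightarrow> Cks k f \<Longrightarrow> Cks k (\<lambda>x. h (f x))"
proof (induction k arbitrary: h)
  case 0
  obtain h' where h': "\<And>t. (h has_real_derivative h' t) (at t)" using smooth_realE[OF 0(1)] by blast
  then have "continuous_on UNIV h" by (auto intro!: DERIV_continuous_on)
  then show ?case using 0(2) continuous_on_compose2[of UNIV h UNIV f] by auto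
next
  case (Suc k)
  obtain h' where h': "smooth_real h'" "\<And>t. (h has_real_derivative h' t) (at t)"
    using smooth_realE[OF Suc.prems(1)] by blast
  have "pd j (\<lambda>x. h (f x)) = (\<lambda>x. h' (f x) * pd j f x)" for j
    using pd_comp(1)[OF _ h'(2)] Suc.prems by auto
  moreover have "Cks k f" using Suc.prems Cks_SucD by blast
  ultimately show ?case
    using pd_comp(2)[OF _ h'(2)] Suc.prems h'(1) by (auto intro!: Cks_mult Suc.IH)
qed

lemma smooth_const: "smooth (\<lambda>x. c)" by (simp add: smooth_def Cks_const)
lemma smooth_add: "smooth f \<Longrightarrow> smooth g \<Longrightarrow> smooth (\<lambda>x. f x + g x)" by (simp add: smooth_def Cks_add)
lemma smooth_mult: "smooth f \<Longrightarrow> smooth g \<Longrightarrow> smooth (\<lambda>x. f x * g x)" by (simp add: smooth_def Cks_mult)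
lemma smooth_minus: "smooth f \<Longrightarrow> smooth (\<lambda>x. - f x)"
  using smooth_mult[OF smooth_const[of "-1"]] by simp
lemma smooth_diff: "smooth f \<Longrightarrow> smooth g \<Longrightarrow> smooth (\<lambda>x. f x - g x)"
  using smooth_add[OF _ smooth_minus] by simp
lemma smooth_nth: "smooth (\<lambda>x. x $ i)" by (simp add: smooth_def Cks_nth)
lemma smooth_affine: "smooth f \<Longrightarrow> smooth (\<lambda>x. f (M *v x + a))" by (simp add: smooth_def Cks_affine)
lemma smooth_comp: "smooth_real h \<Longrightarrow> smooth f \<Longrightarrow> smooth (\<lambda>x. h (f x))" by (simp add: smooth_def Cks_comp)
lemma smooth_pd: "smooth f \<Longrightarrow> smooth (pd j f)"
  unfolding smooth_def by (meson Cks.simps(2))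
lemma smooth_differentiable: "smooth f \<Longrightarrow> f differentiable (at x)"
  unfolding smooth_def by (meson Cks.simps(2))
lemma smooth_continuous: "smooth f \<Longrightarrow> continuous_on UNIV f"
  unfolding smooth_def by (meson Cks.simps(1))

lemmas smooth_intros = smooth_const smooth_add smooth_mult smooth_minus smooth_diff smooth_nth

lemma smooth_real_exp: "smooth_real (\<lambda>s. exp (c * s))"
  unfolding smooth_real_def
proof (intro exI[of _ "range (\<lambda>a s. a * exp (c * s))"] conjI ballI)
  show "(\<lambda>s. exp (c * s)) \<in> range (\<lambda>a s. a * exp (c * s))"
    by (rule image_eqI[of _ _ 1]) auto
  fix f assume "f \<in> range (\<lambda>a s. a * exp (c * s))"
  then obtain a where f: "f = (\<lambda>s. a * exp (c * s))" by auto
  show "\<exists>f'\<in>range (\<lambda>a s. a * exp (c * s)). \<forall>t. (f has_real_derivative f' t) (at t)"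
    unfolding f by (rule bexI[of _ "\<lambda>s. (a * c) * exp (c * s)"]) (auto intro!: derivative_eq_intros)
qed

definition flat_exp :: "real poly \<Rightarrow> real \<Rightarrow> real" where
  "flat_exp P t = (if 0 < t then poly P (1 / t) * exp (- (1 / t)) else 0)"

lemma poly_exp_tendsto_0: "((\<lambda>u. poly P u * exp (- u)) \<longlongrightarrow> (0::real)) at_top"
proof -
  have "((\<lambda>u. \<Sum>i\<le>degree P. coeff P i * (u ^ i / exp u)) \<longlongrightarrow> (\<Sum>i\<le>degree P. coeff P i * 0)) at_top"
    by (intro tendsto_sum tendsto_mult tendsto_const tendsto_power_div_exp_0)
  then show ?thesis
    by (simp add: poly_altdef sum_distrib_right exp_minus divide_inverse mult.assoc)
qed

text \<open>For t > 0 the derivative of P(1/t) exp(-1/t) is t^-2 (P - P')(1/t) exp(-1/t), whence the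
  factor \<open>monom 1 2\<close>. At 0 the difference quotient from the right is u P(u) exp(-u)
  with u = 1/h, and the exponential wins.\<close>

lemma flat_exp_deriv:
  "(flat_exp P has_real_derivative flat_exp (monom 1 2 * (P - pderiv P)) t) (at t)"
proof (cases "t = 0")
  case True
  have "((\<lambda>h. flat_exp P h / h) \<longlongrightarrow> 0) (at 0)"
  proof (rule filterlim_split_at)
    have "\<forall>\<^sub>F h in at_left (0::real). 0 = flat_exp P h / h"
      unfolding eventually_at_filter by (auto simp: flat_exp_def)
    then show "((\<lambda>h. flat_exp P h / h) \<longlongrightarrow> 0) (at_left 0)"
      by (rule Lim_transform_eventually[OF tendsto_const])
    have "((\<lambda>h. poly (monom 1 1 * P) (inverse h) * exp (- inverse h)) \<longlongrightarrow> 0) (at_right 0)"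
      by (rule filterlim_compose[OF poly_exp_tendsto_0 filterlim_inverse_at_top_right])
    moreover have "\<forall>\<^sub>F h in at_right (0::real). poly (monom 1 1 * P) (inverse h) * exp (- inverse h) = flat_exp P h / h"
      unfolding eventually_at_filter by (auto simp: flat_exp_def poly_monom field_simps)
    ultimately show "((\<lambda>h. flat_exp P h / h) \<longlongrightarrow> 0) (at_right 0)"
      by (rule Lim_transform_eventually)
  qed
  then show ?thesis using True by (simp add: DERIV_def flat_exp_def)
next
  case False
  show ?thesis
  proof (cases "0 < t")
    case True
    have "((\<lambda>t. poly P (1 / t) * exp (- (1 / t))) has_real_derivative
        flat_exp (monom 1 2 * (P - pderiv P)) t) (at t)"
      using True
      by (auto intro!: derivative_eq_intros simp: flat_exp_def poly_monom field_simps power2_eq_square)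
    then show ?thesis
      by (rule has_field_derivative_transform_within_open[of _ _ _ "{0<..}"]) (use True in \<open>auto simp: flat_exp_def\<close>)
  next
    case False
    with \<open>t \<noteq> 0\<close> have t: "t < 0" by simp
    have "((\<lambda>t. 0) has_real_derivative 0) (at t)" by simp
    then have "(flat_exp P has_real_derivative 0) (at t)"
      by (rule has_field_derivative_transform_within_open[of _ _ _ "{..<0}"]) (use t in \<open>auto simp: flat_exp_def\<close>)
    then show ?thesis using t by (simp add: flat_exp_def)
  qed
qed

lemma smooth_real_flat_exp: "smooth_real (flat_exp P)"
  unfolding smooth_real_def
  by (rule exI[of _ "range flat_exp"]) (use flat_exp_deriv in blast)

lemma flat_exp_1_pos: "0 < flat_exp 1 t \<longleftrightarrow> 0 < t" "0 \<le> flat_exp 1 t" "flat_exp 1 t = 0 \<longleftrightarrow> t \<le> 0"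
  by (auto simp: flat_exp_def)

definition test_fun :: "(real^3 \<Rightarrow> real) \<Rightarrow> bool" where
  "test_fun f \<longleftrightarrow> smooth f \<and> bounded {x. f x \<noteq> 0}"

lemma test_fun_smooth: "test_fun f \<Longrightarrow> smooth f" by (simp add: test_fun_def)

lemma test_fun_mult_left: "smooth f \<Longrightarrow> test_fun g \<Longrightarrow> test_fun (\<lambda>x. f x * g x)"
  unfolding test_fun_def by (auto intro: smooth_mult bounded_subset)

lemma test_fun_mult_right: "test_fun f \<Longrightarrow> smooth g \<Longrightarrow> test_fun (\<lambda>x. f x * g x)"
  unfolding test_fun_def by (auto intro: smooth_mult bounded_subset)

lemma test_fun_add: assumes "test_fun f" "test_fun g" shows "test_fun (\<lambda>x. f x + g x)"
  unfolding test_fun_def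
proof
  have "bounded ({x. f x \<noteq> 0} \<union> {x. g x \<noteq> 0})" using assms by (simp add: test_fun_def)
  then show "bounded {x. f x + g x \<noteq> 0}" by (rule bounded_subset) auto
qed (use assms in \<open>auto simp: test_fun_def intro: smooth_add\<close>)

lemma test_fun_minus: "test_fun f \<Longrightarrow> test_fun (\<lambda>x. - f x)"
  unfolding test_fun_def by (simp add: smooth_minus)

lemma test_fun_zero: "test_fun (\<lambda>x. 0)"
  by (simp add: test_fun_def smooth_const)

lemma test_fun_pd: assumes "test_fun f" shows "test_fun (pd j f)"
  unfolding test_fun_def
proof
  have "pd j f x = 0" if x: "x \<notin> closure {x. f x \<noteq> 0}" for x
  proof -
    have "((\<lambda>x. 0) has_derivative (\<lambda>h. 0)) (at x)" by simp
    then have "(f has_derivative (\<lambda>h. 0)) (at x)"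
      by (rule has_derivative_transform_within_open[of _ _ _ _ "- closure {x. f x \<noteq> 0}"])
        (use x closure_subset[of "{x. f x \<noteq> 0}"] in auto)
    from pd_eqI[OF this] show ?thesis by simp
  qed
  then have "{x. pd j f x \<noteq> 0} \<subseteq> closure {x. f x \<noteq> 0}" by blast
  moreover have "bounded (closure {x. f x \<noteq> 0})" using assms by (simp add: test_fun_def bounded_closure)
  ultimately show "bounded {x. pd j f x \<noteq> 0}" by (rule bounded_subset[rotated])
qed (use assms in \<open>simp add: test_fun_def smooth_pd\<close>)

lemma test_fun_affine:
  assumes f: "test_fun f" and inv: "M' ** M = mat 1"
  shows "test_fun (\<lambda>x. f (M *v x + a))"
  unfolding test_fun_def
proof
  have "bounded ((\<lambda>y. M' *v (y - a)) ` {x. f x \<noteq> 0})"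
  proof -
    have "bounded ((\<lambda>y. y - a) ` {x. f x \<noteq> 0})"
      using f bounded_translation_minus by (auto simp: test_fun_def)
    from bounded_linear_image[OF this matrix_vector_mul_bounded_linear[of M']] show ?thesis
      by (simp add: image_image)
  qed
  moreover have "{x. f (M *v x + a) \<noteq> 0} \<subseteq> (\<lambda>y. M' *v (y - a)) ` {x. f x \<noteq> 0}"
  proof
    fix x assume "x \<in> {x. f (M *v x + a) \<noteq> 0}"
    moreover have "x = M' *v ((M *v x + a) - a)" by (simp add: matrix_vector_mul_assoc inv)
    ultimately show "x \<in> (\<lambda>y. M' *v (y - a)) ` {x. f x \<noteq> 0}" by blast
  qed
  ultimately show "bounded {x. f (M *v x + a) \<noteq> 0}" by (rule bounded_subset)
qed (use f in \<open>simp add: test_fun_def smooth_affine\<close>)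

lemma test_fun_translate: "test_fun f \<Longrightarrow> test_fun (\<lambda>x. f (x + a))"
  using test_fun_affine[of f "mat 1" "mat 1" a] by simp

lemma test_fun_bounded:
  assumes "test_fun f" obtains B where "\<And>x. \<bar>f x\<bar> \<le> B" "0 \<le> B"
proof -
  let ?K = "closure {x. f x \<noteq> 0}"
  have K: "compact ?K" using assms by (simp add: test_fun_def compact_closure)
  have "continuous_on ?K f"
    using smooth_continuous[of f] assms by (auto simp: test_fun_def intro: continuous_on_subset)
  then have "bounded (f ` ?K)" using K by (intro compact_imp_bounded compact_continuous_image)
  then obtain B where B: "\<And>x. x \<in> ?K \<Longrightarrow> \<bar>f x\<bar> \<le> B" "0 < B"
    unfolding bounded_pos by (auto simp: image_iff)
  have "\<bar>f x\<bar> \<le> B" for x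
    using B closure_subset[of "{x. f x \<noteq> 0}"] by (cases "f x = 0") auto
  then show ?thesis by (intro that[of B]) (use B(2) in auto)
qed

lemma test_fun_support:
  assumes "test_fun f" obtains R where "0 < R" "\<And>x. f x \<noteq> 0 \<Longrightarrow> norm x < R"
proof -
  obtain R where "0 < R" "\<And>x. f x \<noteq> 0 \<Longrightarrow> norm x \<le> R"
    using assms unfolding test_fun_def bounded_pos by auto
  then have "norm x < R + 1" if "f x \<noteq> 0" for x using that by fastforce
  then show ?thesis using \<open>0 < R\<close> by (intro that[of "R + 1"]) auto
qed

lemma test_fun_borel: "test_fun f \<Longrightarrow> f \<in> borel_measurable borel"
  by (intro borel_measurable_continuous_onI smooth_continuous test_fun_smooth)

lemma has_derivative_of_nth:
  fixes \<phi> :: vfield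
  assumes "\<And>i. ((\<lambda>x. \<phi> x $ i) has_derivative (\<lambda>h. D h $ i)) (at x)"
  shows "(\<phi> has_derivative D) (at x)"
  by (rule has_derivative_componentwise_within[THEN iffD2])
    (use assms in \<open>auto simp: Basis_vec_def inner_axis\<close>)

lemma has_derivative_nth:
  fixes \<phi> :: vfield
  assumes "(\<phi> has_derivative D) (at x)"
  shows "((\<lambda>x. \<phi> x $ i) has_derivative (\<lambda>h. D h $ i)) (at x)"
  by (rule bounded_linear.has_derivative[OF bounded_linear_vec_nth assms])

lemma differentiable_iff_nth:
  fixes \<phi> :: vfield
  shows "\<phi> differentiable (at x) \<longleftrightarrow> (\<forall>i. (\<lambda>x. \<phi> x $ i) differentiable (at x))"
proof
  assume "\<forall>i. (\<lambda>x. \<phi> x $ i) differentiable (at x)"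
  then obtain D where D: "\<And>i. ((\<lambda>x. \<phi> x $ i) has_derivative D i) (at x)"
    unfolding differentiable_def by metis
  have "(\<phi> has_derivative (\<lambda>h. \<chi> i. D i h)) (at x)"
    by (rule has_derivative_of_nth) (simp add: D)
  then show "\<phi> differentiable (at x)" by (auto simp: differentiable_def)
qed (auto simp: differentiable_def intro: has_derivative_nth)

lemma partial_deriv_nth:
  "\<phi> differentiable (at x) \<Longrightarrow> partial_deriv j \<phi> x $ i = pd j (\<lambda>x. \<phi> x $ i) x"
  unfolding partial_deriv_def
  by (subst pd_eqI[OF has_derivative_nth]) (auto simp: frechet_derivative_works)

lemma Ck_iff: "Ck k \<phi> \<longleftrightarrow> (\<forall>i. Cks k (\<lambda>x. \<phi> x $ i))"
proof (induction k arbitrary: \<phi>)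
  case 0
  show ?case
  proof
    assume "\<forall>i. Cks 0 (\<lambda>x. \<phi> x $ i)"
    then have "continuous_on UNIV (\<lambda>x. \<chi> i. \<phi> x $ i)" by (intro continuous_on_vec_lambda) auto
    then show "Ck 0 \<phi>" by simp
  qed (auto intro: continuous_intros)
next
  case (Suc k)
  show ?case
  proof (cases "\<forall>x. \<phi> differentiable (at x)")
    case True
    then have "(\<lambda>x. partial_deriv j \<phi> x $ i) = pd j (\<lambda>x. \<phi> x $ i)" for i j
      by (auto simp: partial_deriv_nth)
    then show ?thesis using True by (auto simp: Suc differentiable_iff_nth)
  qed (auto simp: differentiable_iff_nth)
qed

text \<open>By Heine-Borel a compact closure of the support set amounts to boundedness, which passes
  to components and back.\<close>

lemma test_fields_iff: "\<phi> \<in> test_fields \<longleftrightarrow> (\<forall>i. test_fun (\<lambda>x. \<phi> x $ i))"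
proof -
  have "bounded {x. \<phi> x \<noteq> 0} \<longleftrightarrow> (\<forall>i. bounded {x. \<phi> x $ i \<noteq> 0})"
  proof -
    have "{x. \<phi> x \<noteq> 0} = (\<Union>i. {x. \<phi> x $ i \<noteq> 0})" by (auto simp: vec_eq_iff)
    then show ?thesis by (auto intro: bounded_subset)
  qed
  then show ?thesis
    by (auto simp: test_fields_def test_fun_def smooth_def Ck_iff)
qed

lemma curl_vector:
  assumes "\<And>i. smooth (\<lambda>x. \<phi> x $ i)"
  shows "curl \<phi> x = vector
     [pd 2 (\<lambda>x. \<phi> x $ 3) x - pd 3 (\<lambda>x. \<phi> x $ 2) x,
      pd 3 (\<lambda>x. \<phi> x $ 1) x - pd 1 (\<lambda>x. \<phi> x $ 3) x,
      pd 1 (\<lambda>x. \<phi> x $ 2) x - pd 2 (\<lambda>x. \<phi> x $ 1) x]"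
proof -
  have "\<phi> differentiable (at x)" using assms by (simp add: differentiable_iff_nth smooth_differentiable)
  then show ?thesis by (simp add: curl_def partial_deriv_nth)
qed

lemma curl_test_field: "\<phi> \<in> test_fields \<Longrightarrow> curl \<phi> \<in> test_fields"
  unfolding test_fields_iff
proof
  fix i assume \<phi>: "\<forall>i. test_fun (\<lambda>x. \<phi> x $ i)"
  then have s: "smooth (\<lambda>x. \<phi> x $ i)" for i by (simp add: test_fun_smooth)
  have d: "test_fun (\<lambda>x. pd i (\<lambda>x. \<phi> x $ j) x - pd k (\<lambda>x. \<phi> x $ l) x)" for i j k l
    using test_fun_add[OF test_fun_pd[of "\<lambda>x. \<phi> x $ j" i] test_fun_minus[OF test_fun_pd[of "\<lambda>x. \<phi> x $ l" k]]] \<phi>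
    by simp
  show "test_fun (\<lambda>x. curl \<phi> x $ i)"
    using exhaust_3[of i] d by (auto simp: curl_vector[OF s])
qed

section \<open>The fundamental lemma of the calculus of variations\<close>

lemma borel_measurable_nth [measurable (raw)]:
  fixes f :: "'a \<Rightarrow> real^3"
  assumes "f \<in> borel_measurable M" shows "(\<lambda>x. f x $ i) \<in> borel_measurable M"
  using measurable_compose[OF assms, of "\<lambda>y. y $ i" borel]
  by (simp add: borel_measurable_continuous_onI continuous_on_component)

lemma borel_measurable_vecI:
  fixes f :: "'a \<Rightarrow> real^3"
  assumes "\<And>i. (\<lambda>x. f x $ i) \<in> borel_measurable M" shows "f \<in> borel_measurable M"
  by (rule borel_measurable_euclidean_space[THEN iffD2])
    (use assms in \<open>auto simp: Basis_vec_def inner_axis\<close>)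

lemma ball_sets_lebesgue [measurable]: "ball a R \<in> sets lebesgue" by simp

lemma box_sets_lebesgue [measurable]: "box l u \<in> sets lebesgue" by simp

text \<open>Local integrability: every compact set lies in a ball about the origin.\<close>

definition locint :: "(real^3 \<Rightarrow> real) \<Rightarrow> bool" where
  "locint f \<longleftrightarrow> f \<in> borel_measurable lebesgue \<and> (\<forall>R. integrable lebesgue (\<lambda>x. indicator (ball 0 R) x * f x))"

lemma locint_measurable: "locint f \<Longrightarrow> f \<in> borel_measurable lebesgue"
  by (simp add: locint_def)

lemma locint_mult_continuous:
  assumes f: "locint f" and g: "continuous_on UNIV g"
  shows "locint (\<lambda>x. g x * f x)"
  unfolding locint_def
proof (intro conjI allI)
  have g' [measurable]: "g \<in> borel_measurable lebesgue"
    by (intro measurable_completion) (simp add: borel_measurable_continuous_onI[OF g])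
  note [measurable] = locint_measurable[OF f]
  show "(\<lambda>x. g x * f x) \<in> borel_measurable lebesgue" by measurable
  fix R
  have "bounded (g ` cball 0 R)"
    using g by (intro compact_imp_bounded compact_continuous_image) (auto intro: continuous_on_subset)
  then obtain B where "\<forall>y\<in>g ` cball 0 R. norm y \<le> B"
    unfolding bounded_iff by blast
  then have B: "\<And>x. norm x \<le> R \<Longrightarrow> \<bar>g x\<bar> \<le> B" by simp
  have i: "integrable lebesgue (\<lambda>x. B * (indicator (ball 0 R) x * f x))"
    using f by (simp add: locint_def)
  show "integrable lebesgue (\<lambda>x. indicator (ball 0 R) x * (g x * f x))"
  proof (rule Bochner_Integration.integrable_bound[OF i])
    show "AE x in lebesgue. norm (indicator (ball 0 R) x * (g x * f x)) \<le> norm (B * (indicator (ball 0 R) x * f x))"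
    proof (rule AE_I2)
      fix x
      have "\<bar>g x\<bar> \<le> \<bar>B\<bar>" if "norm x < R" using B[of x] that by linarith
      then show "norm (indicator (ball 0 R) x * (g x * f x)) \<le> norm (B * (indicator (ball 0 R) x * f x))"
        by (auto simp: indicator_def abs_mult mult_right_mono)
    qed
  qed measurable
qed

lemma locint_add: "locint f \<Longrightarrow> locint g \<Longrightarrow> locint (\<lambda>x. f x + g x)"
  unfolding locint_def by (auto simp: distrib_left)

lemma locint_diff: "locint f \<Longrightarrow> locint g \<Longrightarrow> locint (\<lambda>x. f x - g x)"
  unfolding locint_def by (auto simp: right_diff_distrib)

lemma integrable_indicator_ball: "integrable lebesgue (\<lambda>x::real^3. indicator (ball 0 R) x :: real)"
  by (rule integrable_real_indicator) (use emeasure_bounded_finite[OF bounded_ball] in auto)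

lemma L2_locint:
  assumes U: "U \<in> L2" shows "locint (\<lambda>x. U x $ i)"
  unfolding locint_def
proof (intro conjI allI)
  note [measurable] = L2_measurable[OF U]
  show m [measurable]: "(\<lambda>x. U x $ i) \<in> borel_measurable lebesgue" by measurable
  fix R
  have i: "integrable lebesgue (\<lambda>x. indicator (ball 0 R) x + (norm (U x))\<^sup>2)"
    using L2_integrable[OF U] integrable_indicator_ball by (rule Bochner_Integration.integrable_add[rotated])
  show "integrable lebesgue (\<lambda>x. indicator (ball 0 R) x * U x $ i)"
  proof (rule Bochner_Integration.integrable_bound[OF i])
    show "AE x in lebesgue. norm (indicator (ball 0 R) x * U x $ i) \<le> norm (indicator (ball 0 R) x + (norm (U x))\<^sup>2)"
    proof (rule AE_I2)
      fix x
      have "norm (indicator (ball 0 R) x * U x $ i) \<le> indicator (ball 0 R) x * norm (U x)"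
        by (simp add: indicator_def component_le_norm_cart)
      also have "\<dots> \<le> (indicator (ball 0 R) x)\<^sup>2 + (norm (U x))\<^sup>2"
        using abs_mult_le_sum_sq[of "indicator (ball 0 R) x" "norm (U x)"] by linarith
      also have "\<dots> = indicator (ball 0 R) x + (norm (U x))\<^sup>2" by (simp add: indicator_def)
      finally show "norm (indicator (ball 0 R) x * U x $ i) \<le> norm (indicator (ball 0 R) x + (norm (U x))\<^sup>2)" by simp
    qed
  qed measurable
qed

lemma test_fun_lebesgue: "test_fun f \<Longrightarrow> f \<in> borel_measurable lebesgue"
  by (intro measurable_completion) (simp add: test_fun_borel)

lemma locint_test_fun:
  assumes f: "locint f" and \<eta>: "test_fun \<eta>"
  shows "integrable lebesgue (\<lambda>x. f x * \<eta> x)"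
proof -
  obtain R where R: "\<And>x. \<eta> x \<noteq> 0 \<Longrightarrow> norm x < R" using test_fun_support[OF \<eta>] by blast
  have "locint (\<lambda>x. \<eta> x * f x)"
    by (rule locint_mult_continuous[OF f smooth_continuous[OF test_fun_smooth[OF \<eta>]]])
  then have "integrable lebesgue (\<lambda>x. indicator (ball 0 R) x * (\<eta> x * f x))" by (simp add: locint_def)
  moreover have "(\<lambda>x. indicator (ball 0 R) x * (\<eta> x * f x)) = (\<lambda>x. f x * \<eta> x)"
    using R by (auto simp: fun_eq_iff indicator_def)
  ultimately show ?thesis by simp
qed

lemma locint_const: "locint (\<lambda>x. c)"
  unfolding locint_def using integrable_indicator_ball by simp

lemma test_fun_integrable: "test_fun \<eta> \<Longrightarrow> integrable lebesgue \<eta>"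
  using locint_test_fun[OF locint_const[of 1]] by simp

lemma test_fields_L2:
  assumes "\<phi> \<in> test_fields" shows "\<phi> \<in> L2"
proof (rule L2_bound)
  have t: "test_fun (\<lambda>x. \<phi> x $ i)" for i using assms by (simp add: test_fields_iff)
  have "integrable lebesgue (\<lambda>x. (\<phi> x $ i) * (\<phi> x $ i))" for i
    by (rule test_fun_integrable[OF test_fun_mult_left[OF test_fun_smooth[OF t] t]])
  then show "integrable lebesgue (\<lambda>x. \<Sum>i\<in>UNIV. (\<phi> x $ i) * (\<phi> x $ i))" by simp
  show "\<phi> \<in> borel_measurable lebesgue"
    by (rule borel_measurable_vecI[OF test_fun_lebesgue[OF t]])
  show "AE x in lebesgue. (norm (\<phi> x))\<^sup>2 \<le> (\<Sum>i\<in>UNIV. (\<phi> x $ i) * (\<phi> x $ i))"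
    by (simp add: power2_norm_eq_inner inner_vec_def)
qed

text \<open>The positive and negative parts of \<open>g\<close>, read as densities, have the same
  mass on every box. Boxes are stable under intersection and generate the Borel sets, so the two
  measures and hence the densities agree.\<close>

lemma integral_box_zero_imp_AE_zero:
  fixes g :: "'a::euclidean_space \<Rightarrow> real"
  assumes g: "integrable lborel g" and zero: "\<And>l u. (LINT x|lborel. indicator (box l u) x * g x) = 0"
  shows "AE x in lborel. g x = 0"
proof -
  note [measurable] = borel_measurable_integrable[OF g]
  have eq: "density lborel (\<lambda>x. ennreal (g x)) = density lborel (\<lambda>x. ennreal (- g x))"
  proof (rule measure_eqI_generator_eq)
    let ?E = "range (\<lambda>(a, b). box a b::'a set)"
    show "Int_stable ?E"
      by (auto simp: Int_stable_def box_Int_box)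
    show "?E \<subseteq> Pow UNIV"
      "sets (density lborel (\<lambda>x. ennreal (g x))) = sigma_sets UNIV ?E"
      "sets (density lborel (\<lambda>x. ennreal (- g x))) = sigma_sets UNIV ?E"
      by (simp_all add: borel_eq_box)
    let ?A = "\<lambda>n::nat. box (- (real n *\<^sub>R One)) (real n *\<^sub>R One) :: 'a set"
    show "range ?A \<subseteq> ?E" "(\<Union>i. ?A i) = UNIV"
      unfolding UN_box_eq_UNIV by auto
    have em: "emeasure (density lborel (\<lambda>x. ennreal (s * g x))) (box l u)
        = ennreal (LINT x|lborel. indicator (box l u) x * max 0 (s * g x))"
      and int: "integrable lborel (\<lambda>x. indicator (box l u) x * max 0 (s * g x))" for l u s
    proof -
      have "integrable lborel (\<lambda>x. max 0 (s * g x))" using g by auto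
      then have "integrable lborel (\<lambda>x. indicator (box l u) x *\<^sub>R max 0 (s * g x))"
        by (intro integrable_mult_indicator) auto
      then show i: "integrable lborel (\<lambda>x. indicator (box l u) x * max 0 (s * g x))" by simp
      have "emeasure (density lborel (\<lambda>x. ennreal (s * g x))) (box l u)
          = (\<integral>\<^sup>+x. ennreal (s * g x) * indicator (box l u) x \<partial>lborel)"
        by (simp add: emeasure_density)
      also have "\<dots> = (\<integral>\<^sup>+x. ennreal (indicator (box l u) x * max 0 (s * g x)) \<partial>lborel)"
        by (intro nn_integral_cong) (auto simp: indicator_def max_def ennreal_neg)
      also have "\<dots> = ennreal (LINT x|lborel. indicator (box l u) x * max 0 (s * g x))"
        using i by (intro nn_integral_eq_integral) auto
      finally show "emeasure (density lborel (\<lambda>x. ennreal (s * g x))) (box l u)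
        = ennreal (LINT x|lborel. indicator (box l u) x * max 0 (s * g x))" .
    qed
    show "emeasure (density lborel (\<lambda>x. ennreal (g x))) (?A i) \<noteq> \<infinity>" for i
      using em[of 1] by simp
    fix X assume "X \<in> ?E"
    then obtain l u where X: "X = box l u" by auto
    have "(LINT x|lborel. indicator X x * max 0 (1 * g x)) - (LINT x|lborel. indicator X x * max 0 ((-1) * g x))
        = (LINT x|lborel. indicator X x * max 0 (1 * g x) - indicator X x * max 0 ((-1) * g x))"
      unfolding X by (rule Bochner_Integration.integral_diff[symmetric]) (rule int)+
    also have "\<dots> = (LINT x|lborel. indicator X x * g x)"
      by (intro Bochner_Integration.integral_cong) (auto simp: indicator_def max_def)
    also have "\<dots> = 0" unfolding X by (rule zero)
    finally have "(LINT x|lborel. indicator X x * max 0 (1 * g x)) = (LINT x|lborel. indicator X x * max 0 ((-1) * g x))"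
      by simp
    then show "emeasure (density lborel (\<lambda>x. ennreal (g x))) X = emeasure (density lborel (\<lambda>x. ennreal (- g x))) X"
      using em[of 1] em[of "-1"] unfolding X by simp
  qed
  \<comment> \<open>\<open>ennreal\<close> truncates negative values to 0, so this equality at a
    point leaves no room for a nonzero value of either sign.\<close>
  have "AE x in lborel. ennreal (g x) = ennreal (- g x)"
    by (rule sigma_finite_measure.density_unique[OF sigma_finite_lborel _ _ eq]) measurable
  then show ?thesis
  proof eventually_elim
    case (elim x)
    show ?case
    proof (rule ccontr)
      assume "g x \<noteq> 0"
      then consider "0 < g x" | "0 < - g x" by linarith
      then show False using elim by cases (auto simp: ennreal_neg)
    qed
  qed
qed

section \<open>Test functions approximating the indicator of a box\<close>

definition box_bump :: "real^3 \<Rightarrow> real^3 \<Rightarrow> real^3 \<Rightarrow> real" where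
  "box_bump l u x = (flat_exp 1 (x $ 1 - l $ 1) * flat_exp 1 (u $ 1 - x $ 1)) *
    ((flat_exp 1 (x $ 2 - l $ 2) * flat_exp 1 (u $ 2 - x $ 2)) *
    (flat_exp 1 (x $ 3 - l $ 3) * flat_exp 1 (u $ 3 - x $ 3)))"

lemma box_bump_nonneg: "0 \<le> box_bump l u x"
  unfolding box_bump_def by (intro mult_nonneg_nonneg flat_exp_1_pos)

lemma box_bump_eq_0: "box_bump l u x = 0 \<longleftrightarrow> x \<notin> box l u"
  by (auto simp: box_bump_def flat_exp_1_pos mem_box_cart forall_3)

lemma smooth_box_bump: "smooth (box_bump l u)"
  unfolding box_bump_def[abs_def]
  by (intro smooth_mult smooth_comp[OF smooth_real_flat_exp] smooth_intros)

text \<open>As \<open>n\<close> grows these functions increase to the indicator of the box, because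
  \<open>box_bump\<close> is positive exactly there; its vanishing outside keeps the support
  bounded.\<close>

definition box_test :: "nat \<Rightarrow> real^3 \<Rightarrow> real^3 \<Rightarrow> real^3 \<Rightarrow> real" where
  "box_test n l u x = 1 - exp (- real n * box_bump l u x)"

lemma box_test_bounds: "0 \<le> box_test n l u x" "box_test n l u x \<le> indicator (box l u) x"
  using box_bump_nonneg[of l u x] box_bump_eq_0[of l u x]
  by (auto simp: box_test_def indicator_def)

lemma test_fun_box_test: "test_fun (box_test n l u)"
  unfolding test_fun_def
proof
  show "smooth (box_test n l u)"
    unfolding box_test_def[abs_def]
    by (intro smooth_diff smooth_const smooth_comp[OF smooth_real_exp] smooth_box_bump)
  have "{x. box_test n l u x \<noteq> 0} \<subseteq> box l u"
    by (auto simp: box_test_def box_bump_eq_0)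
  then show "bounded {x. box_test n l u x \<noteq> 0}" by (rule bounded_subset[OF bounded_box])
qed

lemma box_test_tendsto: "(\<lambda>n. box_test n l u x) \<longlonglongrightarrow> indicator (box l u) x"
proof (cases "x \<in> box l u")
  case True
  then have "0 < box_bump l u x" using box_bump_nonneg[of l u x] box_bump_eq_0[of l u x] by linarith
  then have "(\<lambda>n. 1 - exp (- real n * box_bump l u x)) \<longlonglongrightarrow> 1 - 0"
    by (intro tendsto_diff tendsto_const filterlim_compose[OF exp_at_bot]) real_asymp
  then show ?thesis using True by (simp add: box_test_def)
next
  case False
  then show ?thesis using box_bump_eq_0[of l u x] by (simp add: box_test_def)
qed

text \<open>Dominated convergence along \<open>box_test\<close> turns the hypothesis into vanishing
  integrals over boxes. A Borel representative is taken because the uniqueness argument for boxes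
  lives on \<open>lborel\<close>.\<close>

theorem fundamental_lemma:
  assumes f: "locint f" and zero: "\<And>\<eta>. test_fun \<eta> \<Longrightarrow> (LINT x|lebesgue. f x * \<eta> x) = 0"
  shows "AE x in lebesgue. f x = 0"
proof -
  note [measurable] = locint_measurable[OF f]
  obtain f' where f' [measurable]: "f' \<in> borel_measurable lborel" and eq: "AE x in lborel. f x = f' x"
    using completion_ex_borel_measurable_real[OF locint_measurable[OF f]] by auto
  have eq': "AE x in lebesgue. f x = f' x" using eq by (rule AE_completion)
  have [measurable]: "f' \<in> borel_measurable lebesgue" using f' by (rule measurable_completion)
  have box0: "(LINT x|lebesgue. indicator (box l u) x * f x) = 0" 
    and box_int: "integrable lebesgue (\<lambda>x. indicator (box l u) x * f x)" for l u
  proof -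
    obtain R where R: "box l u \<subseteq> ball 0 R"
      using bounded_subset_ballD[OF bounded_box] by blast
    have i: "integrable lebesgue (\<lambda>x. \<bar>indicator (ball 0 R) x * f x\<bar>)" using f by (simp add: locint_def)
    have m: "(\<lambda>x. indicator (box l u) x * f x) \<in> borel_measurable lebesgue" by measurable
    show "integrable lebesgue (\<lambda>x. indicator (box l u) x * f x)"
      by (rule Bochner_Integration.integrable_bound[OF i m]) (use R in \<open>auto simp: indicator_def subset_iff\<close>)
    have "(\<lambda>n. LINT x|lebesgue. f x * box_test n l u x) \<longlonglongrightarrow> (LINT x|lebesgue. indicator (box l u) x * f x)"
    proof (rule integral_dominated_convergence[OF m _ i])
      show "(\<lambda>x. f x * box_test n l u x) \<in> borel_measurable lebesgue" for n
        by (intro borel_measurable_times locint_measurable[OF f] test_fun_lebesgue test_fun_box_test)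
      show "AE x in lebesgue. (\<lambda>n. f x * box_test n l u x) \<longlonglongrightarrow> indicator (box l u) x * f x"
        using tendsto_mult[OF tendsto_const box_test_tendsto] by (auto simp: mult.commute)
      show "AE x in lebesgue. norm (f x * box_test n l u x) \<le> \<bar>indicator (ball 0 R) x * f x\<bar>" for n
      proof (rule AE_I2)
        fix x
        have "\<bar>f x\<bar> * box_test n l u x \<le> \<bar>f x\<bar> * indicator (ball 0 R) x"
          using R by (intro mult_left_mono order_trans[OF box_test_bounds(2)]) (auto simp: indicator_def subset_iff)
        then show "norm (f x * box_test n l u x) \<le> \<bar>indicator (ball 0 R) x * f x\<bar>"
          using box_test_bounds(1)[of n l u x] by (simp add: abs_mult mult.commute)
      qed
    qed
    then show "(LINT x|lebesgue. indicator (box l u) x * f x) = 0"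
      using zero[OF test_fun_box_test] LIMSEQ_unique[OF _ tendsto_const] by simp
  qed
  \<comment> \<open>The function is only locally integrable, so it is first cut off to a large box.
    A box intersected with such a box is again a box, hence the integrals still vanish.\<close>
  have "AE x in lborel. \<forall>N::nat. indicator (box (- (real N *\<^sub>R One)) (real N *\<^sub>R One)) x * f' x = 0"
    unfolding AE_all_countable
  proof (intro allI integral_box_zero_imp_AE_zero)
    fix N :: nat
    have c: "AE x in lebesgue. indicator (box l u) x * f x = indicator (box l u) x * f' x" for l u
      using eq' by eventually_elim simp
    have "integrable lebesgue (\<lambda>x. indicator (box l u) x * f' x)" for l u
      by (rule integrable_cong_AE_imp[OF box_int _ c]) measurable
    then show "integrable lborel (\<lambda>x. indicator (box (- (real N *\<^sub>R One)) (real N *\<^sub>R One)) x * f' x)"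
      by (simp add: integrable_completion)
    fix l u :: "real^3"
    obtain l' u' where b: "box l u \<inter> box (- (real N *\<^sub>R One)) (real N *\<^sub>R One) = box l' u'"
      using box_Int_box[of l u "- (real N *\<^sub>R One)" "real N *\<^sub>R One"] that by (simp only:)
    have "(LINT x|lborel. indicator (box l u) x * (indicator (box (- (real N *\<^sub>R One)) (real N *\<^sub>R One)) x * f' x))
        = (LINT x|lborel. indicator (box l' u') x * f' x)"
      by (intro Bochner_Integration.integral_cong refl)
        (simp only: b[symmetric] indicator_inter_arith mult.assoc)
    also have "\<dots> = (LINT x|lebesgue. indicator (box l' u') x * f' x)"
      by (rule integral_completion[symmetric]) measurable
    also have "\<dots> = (LINT x|lebesgue. indicator (box l' u') x * f x)"
    proof (rule integral_cong_AE)
      show "AE x in lebesgue. indicator (box l' u') x * f' x = indicator (box l' u') x * f x"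
        using c[of l' u'] by eventually_elim (rule sym)
    qed measurable
    finally show "(LINT x|lborel. indicator (box l u) x * (indicator (box (- (real N *\<^sub>R One)) (real N *\<^sub>R One)) x * f' x)) = 0"
      by (simp add: box0)
  qed
  then have "AE x in lborel. f x = 0"
    using eq
  proof eventually_elim
    case (elim x)
    have "x \<in> (\<Union>N::nat. box (- (real N *\<^sub>R One)) (real N *\<^sub>R One))"
      unfolding UN_box_eq_UNIV by simp
    then show ?case using elim by (auto simp: indicator_def split: if_splits)
  qed
  then show ?thesis by (rule AE_completion)
qed

section \<open>Fubini along one-parameter groups and the weak curl\<close>

text \<open>Tonelli with the parameter outside: each \<open>T s\<close> preserves Lebesgue measure,
  so every slice has the L1 norm of \<open>f\<close>, and the finite mass of \<open>M\<close> bounds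
  the double integral. \<open>T\<close> will be a translation along a line or the identity.\<close>

lemma shear_integrable:
  fixes T :: "real \<Rightarrow> 'a::euclidean_space \<Rightarrow> 'a" and f :: "'a \<Rightarrow> real"
  assumes M: "finite_measure M" "sets M = sets borel"
    and T: "(\<lambda>(s, x). T s x) \<in> borel \<Otimes>\<^sub>M borel \<rightarrow>\<^sub>M borel"
    and inv: "\<And>s. distr lborel borel (T s) = lborel"
    and f: "integrable lborel f"
  shows "integrable (M \<Otimes>\<^sub>M lborel) (\<lambda>(s, x). f (T s x))"
proof -
  interpret finite_measure M by (rule M(1))
  interpret pair_sigma_finite M lborel ..
  have T' [measurable]: "(\<lambda>(s, x). T s x) \<in> M \<Otimes>\<^sub>M lborel \<rightarrow>\<^sub>M borel"
    using T M(2) by (simp cong: measurable_cong_sets sets_pair_measure_cong)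
  have Ts [measurable]: "T s \<in> borel \<rightarrow>\<^sub>M borel" for s
    using measurable_Pair_compose_split[OF T, of "\<lambda>x. s" borel "\<lambda>x. x"] by simp
  have f' [measurable]: "f \<in> borel_measurable borel" using borel_measurable_integrable[OF f] by simp
  have m: "(\<lambda>(s, x). f (T s x)) \<in> borel_measurable (M \<Otimes>\<^sub>M lborel)"
    using measurable_compose[OF T' f'] by (simp add: case_prod_unfold)
  show ?thesis
  proof (rule integrableI_bounded[OF m])
    have "(\<integral>\<^sup>+ p. ennreal (norm (case p of (s, x) \<Rightarrow> f (T s x))) \<partial>(M \<Otimes>\<^sub>M lborel))
        = (\<integral>\<^sup>+ s. \<integral>\<^sup>+ x. ennreal (norm (f (T s x))) \<partial>lborel \<partial>M)"
      using m by (subst lborel.nn_integral_fst[symmetric]) auto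
    also have "\<dots> = (\<integral>\<^sup>+ s. \<integral>\<^sup>+ x. ennreal (norm (f x)) \<partial>lborel \<partial>M)"
    proof (rule nn_integral_cong)
      fix s
      have "(\<integral>\<^sup>+ x. ennreal (norm (f (T s x))) \<partial>lborel) = (\<integral>\<^sup>+ x. ennreal (norm (f x)) \<partial>distr lborel borel (T s))"
        by (subst nn_integral_distr) auto
      then show "(\<integral>\<^sup>+ x. ennreal (norm (f (T s x))) \<partial>lborel) = (\<integral>\<^sup>+ x. ennreal (norm (f x)) \<partial>lborel)"
        by (simp add: inv)
    qed
    also have "\<dots> = (\<integral>\<^sup>+ x. ennreal (norm (f x)) \<partial>lborel) * emeasure M (space M)"
      by simp
    also have "\<dots> < \<infinity>"
    proof -
      have "emeasure M (space M) < top" by (rule finite_emeasure_space[unfolded infinity_ennreal_def, THEN less_top[THEN iffD1]])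
      then show ?thesis using f by (simp add: integrable_iff_bounded ennreal_mult_less_top)
    qed
    finally show "(\<integral>\<^sup>+ p. ennreal (norm (case p of (s, x) \<Rightarrow> f (T s x))) \<partial>(M \<Otimes>\<^sub>M lborel)) < \<infinity>" .
  qed
qed

text \<open>The bound is asked only for parameters in \<open>A\<close>, because
  \<open>unif a b\<close> is a measure on the whole line and estimates such as |s| \<le> 1 hold only
  on its support.\<close>

lemma shear_bound_integrable:
  fixes T :: "real \<Rightarrow> 'a::euclidean_space \<Rightarrow> 'a" and f F :: "_ \<Rightarrow> real"
  assumes M: "finite_measure M" "sets M = sets borel"
    and T: "(\<lambda>(s, x). T s x) \<in> borel \<Otimes>\<^sub>M borel \<rightarrow>\<^sub>M borel"
    and inv: "\<And>s. distr lborel borel (T s) = lborel"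
    and f: "integrable lborel f"
    and F: "F \<in> borel_measurable (borel \<Otimes>\<^sub>M borel)"
    and A: "A \<in> sets borel" "AE s in M. s \<in> A"
    and le: "\<And>s x. s \<in> A \<Longrightarrow> \<bar>F (s, x)\<bar> \<le> \<bar>f (T s x)\<bar>"
  shows "integrable (M \<Otimes>\<^sub>M lborel) F"
proof -
  interpret finite_measure M by (rule M(1))
  interpret pair_sigma_finite M "lborel :: 'a measure" ..
  have F' [measurable]: "F \<in> borel_measurable (M \<Otimes>\<^sub>M lborel)"
    using F M(2) by (simp cong: measurable_cong_sets sets_pair_measure_cong)
  have [measurable]: "A \<in> sets M" using A(1) M(2) by simp
  have "AE p in M \<Otimes>\<^sub>M (lborel :: 'a measure). fst p \<in> A"
  proof (rule AE_pair_measure)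
    show "AE s in M. AE x in (lborel :: 'a measure). fst (s, x) \<in> A"
      using A(2) by eventually_elim simp
  qed measurable
  then have "AE p in M \<Otimes>\<^sub>M lborel. norm (F p) \<le> norm (case p of (s, x) \<Rightarrow> f (T s x))"
    by eventually_elim (auto intro: le)
  then show ?thesis
    by (rule Bochner_Integration.integrable_bound[OF shear_integrable[OF M T inv f] F'])
qed

text \<open>Being a probability measure, it returns a constant when integrating it, and it enters
  Fubini arguments without restriction to an interval.\<close>

definition unif :: "real \<Rightarrow> real \<Rightarrow> real measure" where
  "unif a b = density lborel (\<lambda>x. ennreal (indicator {a..b} x / (b - a)))"

lemma sets_unif [simp, measurable_cong]: "sets (unif a b) = sets borel"
  by (simp add: unif_def)

lemma space_unif [simp]: "space (unif a b) = UNIV"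
  by (simp add: unif_def)

lemma prob_space_unif: assumes "a < b" shows "prob_space (unif a b)"
proof (rule prob_spaceI)
  have "emeasure (unif a b) (space (unif a b)) = (\<integral>\<^sup>+x. ennreal (1 / (b - a)) * indicator {a..b} x \<partial>lborel)"
    unfolding unif_def by (subst emeasure_density) (auto intro!: nn_integral_cong simp: indicator_def)
  also have "\<dots> = ennreal (1 / (b - a)) * ennreal (b - a)"
    using assms by (subst nn_integral_cmult_indicator) auto
  also have "\<dots> = 1" using assms by (simp add: ennreal_mult[symmetric])
  finally show "emeasure (unif a b) (space (unif a b)) = 1" .
qed

lemma integral_unif:
  fixes f :: "real \<Rightarrow> 'a::{banach, second_countable_topology}"
  assumes "a < b" and [measurable]: "f \<in> borel_measurable borel"
  shows "(LINT s|unif a b. f s) = (1 / (b - a)) *\<^sub>R (LINT s|lborel. indicator {a..b} s *\<^sub>R f s)"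
proof -
  have "(LINT s|unif a b. f s) = (LINT s|lborel. (indicator {a..b} s / (b - a)) *\<^sub>R f s)"
    unfolding unif_def using assms by (intro integral_density) auto
  also have "\<dots> = (LINT s|lborel. (1 / (b - a)) *\<^sub>R (indicator {a..b} s *\<^sub>R f s))"
    by (intro Bochner_Integration.integral_cong) auto
  also have "\<dots> = (1 / (b - a)) *\<^sub>R (LINT s|lborel. indicator {a..b} s *\<^sub>R f s)"
    by (rule integral_scaleR_right)
  finally show ?thesis .
qed

lemma AE_unif: assumes "a < b" shows "AE s in unif a b. s \<in> {a..b}"
  unfolding unif_def by (subst AE_density) (auto simp: indicator_def)

lemma unif_FTC:
  fixes F :: "real \<Rightarrow> real"
  assumes ab: "a < b" and F: "\<And>s. (F has_real_derivative f s) (at s)" and f: "continuous_on UNIV f"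
  shows "(LINT s|unif a b. f s) = (F b - F a) / (b - a)"
proof -
  have "(LINT s|lborel. indicator {a..b} s *\<^sub>R f s) = F b - F a"
  proof (rule integral_FTC_Icc)
    show "(F has_vector_derivative f x) (at x within {a..b})" for x
      using F[of x] by (simp add: has_real_derivative_iff_has_vector_derivative has_vector_derivative_at_within)
    show "continuous_on {a..b} f" using f by (rule continuous_on_subset) auto
  qed (use ab in auto)
  then show ?thesis using integral_unif[OF ab, of f] f by (simp add: borel_measurable_continuous_onI)
qed

lemma has_derivative_smooth:
  assumes f: "smooth f"
  shows "(f has_derivative (\<lambda>v. \<Sum>j\<in>UNIV. v $ j * pd j f x)) (at x)"
proof -
  let ?D = "frechet_derivative f (at x)"
  have fd: "(f has_derivative ?D) (at x)"
    by (rule has_derivative_pd[OF smooth_differentiable[OF f]])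
  have l: "linear ?D" by (rule has_derivative_linear[OF fd])
  have "?D v = (\<Sum>j\<in>UNIV. v $ j * pd j f x)" for v
  proof -
    have "v = (\<Sum>j\<in>UNIV. v $ j *\<^sub>R axis j 1)"
      by (simp add: vec_eq_iff axis_def if_distrib cong: if_cong)
    then have "?D v = ?D (\<Sum>j\<in>UNIV. v $ j *\<^sub>R axis j 1)" by simp
    also have "\<dots> = (\<Sum>j\<in>UNIV. v $ j * pd j f x)"
      by (simp add: linear_sum[OF l] linear_scale[OF l] pd_def)
    finally show ?thesis .
  qed
  then have "?D = (\<lambda>v. \<Sum>j\<in>UNIV. v $ j * pd j f x)" by (simp only: fun_eq_iff simp_thms)
  with fd show ?thesis by (simp only:)
qed

lemma smooth_line_derivative:
  assumes f: "smooth f"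
  shows "((\<lambda>s. f (x + s *\<^sub>R h)) has_real_derivative (\<Sum>j\<in>UNIV. h $ j * pd j f (x + s *\<^sub>R h))) (at s)"
proof -
  have "((\<lambda>s. x + s *\<^sub>R h) has_derivative (\<lambda>t. t *\<^sub>R h)) (at s)"
    by (auto intro!: derivative_eq_intros)
  from has_derivative_compose[OF this has_derivative_smooth[OF f]]
  have "((\<lambda>s. f (x + s *\<^sub>R h)) has_derivative (\<lambda>t. \<Sum>j\<in>UNIV. (t *\<^sub>R h) $ j * pd j f (x + s *\<^sub>R h))) (at s)" .
  then show ?thesis
    unfolding has_field_derivative_def
    by (rule has_derivative_eq_rhs) (simp add: fun_eq_iff sum_3 algebra_simps)
qed

lemma smooth_line_continuous:
  assumes "smooth f" shows "continuous_on UNIV (\<lambda>s. f (x + s *\<^sub>R h))"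
proof (rule continuous_on_compose2[OF smooth_continuous[OF assms]])
  show "continuous_on UNIV (\<lambda>s. x + s *\<^sub>R h)" by (intro continuous_intros)
qed simp

lemma smooth_translate_FTC:
  assumes f: "smooth f"
  shows "(LINT s|unif 0 1. (\<Sum>j\<in>UNIV. h $ j * pd j f (x + s *\<^sub>R h))) = f (x + h) - f x"
  using unif_FTC[of 0 1, OF _ smooth_line_derivative[OF f, of x h]]
  by (simp add: continuous_on_sum continuous_on_mult_left smooth_line_continuous smooth_pd f)

lemma distr_translate: "distr lborel borel (\<lambda>x. x + a) = (lborel :: 'a::euclidean_space measure)"
proof -
  have "(\<lambda>x. x + a) = (+) a" by (simp add: fun_eq_iff add.commute)
  then show ?thesis by (simp only: lborel_distr_plus)
qed

lemma integral_translate: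
  fixes f :: "'a::euclidean_space \<Rightarrow> real"
  assumes [measurable]: "f \<in> borel_measurable borel"
  shows "(LINT x|lborel. f (x + a)) = (LINT x|lborel. f x)"
  using integral_distr[of "\<lambda>x. x + a" lborel borel f] by (simp add: distr_translate)

lemma integrable_translate:
  fixes f :: "'a::euclidean_space \<Rightarrow> real"
  assumes "integrable lborel f"
  shows "integrable lborel (\<lambda>x. f (x + a))"
  using integrable_distr_eq[of "\<lambda>x. x + a" lborel borel f] assms by (simp add: distr_translate)

lemma test_fun_integrable_lborel: "test_fun f \<Longrightarrow> integrable lborel f"
  using test_fun_integrable[of f] test_fun_borel[of f] by (simp add: integrable_completion)

text \<open>Translation invariance makes the integral of f(x + e_j) - f(x) vanish. By the
  fundamental theorem this difference is an average of translates of \<open>pd j f\<close>, all with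
  the same integral.\<close>

lemma integral_pd_zero:
  assumes f: "test_fun f"
  shows "(LINT x|lebesgue. pd j f x) = 0"
proof -
  interpret prob_space "unif 0 1" by (rule prob_space_unif) simp
  interpret pair_sigma_finite "unif 0 1" "lborel :: (real^3) measure" ..
  let ?h = "axis j 1 :: real^3"
  have p: "integrable lborel (pd j f)" by (rule test_fun_integrable_lborel[OF test_fun_pd[OF f]])
  note [measurable] = test_fun_borel[OF f] test_fun_borel[OF test_fun_pd[OF f, of j]]
  have int: "integrable (unif 0 1 \<Otimes>\<^sub>M lborel) (\<lambda>(s, x). pd j f (x + s *\<^sub>R ?h))"
    by (rule shear_integrable[OF _ _ _ _ p]) (auto simp: distr_translate finite_measure_axioms)
  have "0 = (LINT x|lborel. f (x + ?h) - f x)"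
    using integral_translate[of f ?h] integrable_translate[of f ?h] test_fun_integrable_lborel[OF f] by simp
  also have "\<dots> = (LINT x|lborel. (LINT s|unif 0 1. pd j f (x + s *\<^sub>R ?h)))"
    by (simp add: smooth_translate_FTC[OF test_fun_smooth[OF f], symmetric] axis_def if_distrib if_distribR cong: if_cong)
  also have "\<dots> = (LINT s|unif 0 1. (LINT x|lborel. pd j f (x + s *\<^sub>R ?h)))"
    by (rule Fubini_integral[OF int])
  also have "\<dots> = (LINT s|unif 0 1. (LINT x|lborel. pd j f x))"
    by (simp add: integral_translate)
  also have "\<dots> = (LINT x|lborel. pd j f x)" using prob_space by simp
  finally show ?thesis by (simp add: integral_completion)
qed

lemma integral_by_parts:
  assumes f: "test_fun f" and g: "smooth g"
  shows "(LINT x|lebesgue. f x * pd j g x) = - (LINT x|lebesgue. pd j f x * g x)"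
proof -
  have "pd j (\<lambda>x. f x * g x) x = f x * pd j g x + pd j f x * g x" for x
    by (rule pd_mult) (auto intro: smooth_differentiable g test_fun_smooth f)
  then have "(LINT x|lebesgue. f x * pd j g x + pd j f x * g x) = 0"
    using integral_pd_zero[OF test_fun_mult_right[OF f g], of j] by simp
  moreover have "integrable lebesgue (\<lambda>x. f x * pd j g x)" "integrable lebesgue (\<lambda>x. pd j f x * g x)"
    by (intro test_fun_integrable test_fun_mult_right test_fun_pd smooth_pd f g)+
  ultimately show ?thesis by simp
qed

lemma vector_inner_3: "(vector [a, b, c] :: real^3) \<bullet> v = a * v $ 1 + b * v $ 2 + c * v $ 3"
  by (simp add: inner_vec_def sum_3)

lemma inner_vector_3: "v \<bullet> (vector [a, b, c] :: real^3) = v $ 1 * a + v $ 2 * b + v $ 3 * c"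
  by (simp add: inner_vec_def sum_3)

lemma inner_3: "(v :: real^3) \<bullet> w = v $ 1 * w $ 1 + v $ 2 * w $ 2 + v $ 3 * w $ 3"
  by (simp add: inner_vec_def sum_3)

section \<open>The weak curl: uniqueness, linearity, closedness\<close>

lemma test_field_weak_curl:
  assumes U: "U \<in> test_fields"
  shows "is_weak_curl U (curl U)"
  unfolding is_weak_curl_def
proof
  fix \<phi> assume \<phi>: "\<phi> \<in> test_fields"
  have tU: "test_fun (\<lambda>x. U x $ i)" and t\<phi>: "test_fun (\<lambda>x. \<phi> x $ i)" for i
    using U \<phi> by (auto simp: test_fields_iff)
  have sU: "smooth (\<lambda>x. U x $ i)" and s\<phi>: "smooth (\<lambda>x. \<phi> x $ i)" for i
    using tU t\<phi> by (auto intro: test_fun_smooth)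
  have i1: "integrable lebesgue (\<lambda>x. U x $ i * pd j (\<lambda>x. \<phi> x $ k) x)" for i j k
    by (intro test_fun_integrable test_fun_mult_right tU smooth_pd s\<phi>)
  have i2: "integrable lebesgue (\<lambda>x. pd j (\<lambda>x. U x $ i) x * \<phi> x $ k)" for i j k
    by (intro test_fun_integrable test_fun_mult_left t\<phi> smooth_pd sU)
  have ibp: "(LINT x|lebesgue. U x $ i * pd j (\<lambda>x. \<phi> x $ k) x) = - (LINT x|lebesgue. pd j (\<lambda>x. U x $ i) x * \<phi> x $ k)" for i j k
    by (rule integral_by_parts[OF tU s\<phi>])
  show "(LINT x|lebesgue. U x \<bullet> curl \<phi> x) = (LINT x|lebesgue. curl U x \<bullet> \<phi> x)"
    unfolding curl_vector[OF s\<phi>] curl_vector[OF sU] inner_vector_3 vector_inner_3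
      left_diff_distrib right_diff_distrib
    by (simp add: i1 i2 ibp)
qed

text \<open>Test fields pointing along one axis isolate a single component, to which the fundamental
  lemma applies.\<close>

lemma is_weak_curl_unique:
  assumes W: "W \<in> L2" and W': "W' \<in> L2" and "is_weak_curl U W" "is_weak_curl U W'"
  shows "AE x in lebesgue. W x = W' x"
proof -
  have "AE x in lebesgue. (W x - W' x) $ i = 0" for i
  proof (rule fundamental_lemma)
    show "locint (\<lambda>x. (W x - W' x) $ i)" by (rule L2_locint[OF L2_diff[OF W W']])
    fix \<eta> assume \<eta>: "test_fun \<eta>"
    define \<phi> :: vfield where "\<phi> x = \<eta> x *\<^sub>R axis i 1" for x
    have \<phi>: "\<phi> \<in> test_fields"
      unfolding test_fields_iff
    proof
      fix k
      have "(\<lambda>x. \<phi> x $ k) = (if k = i then \<eta> else (\<lambda>x. 0))" by (auto simp: \<phi>_def axis_def)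
      then show "test_fun (\<lambda>x. \<phi> x $ k)" using \<eta> test_fun_zero by simp
    qed
    have "(LINT x|lebesgue. (W x - W' x) $ i * \<eta> x) = (LINT x|lebesgue. W x \<bullet> \<phi> x - W' x \<bullet> \<phi> x)"
      by (intro Bochner_Integration.integral_cong) (auto simp: \<phi>_def inner_axis algebra_simps)
    also have "\<dots> = (LINT x|lebesgue. W x \<bullet> \<phi> x) - (LINT x|lebesgue. W' x \<bullet> \<phi> x)"
      by (intro Bochner_Integration.integral_diff L2_inner_integrable W W' test_fields_L2 \<phi>)
    also have "\<dots> = 0" using assms(3,4) \<phi> by (simp add: is_weak_curl_def)
    finally show "(LINT x|lebesgue. (W x - W' x) $ i * \<eta> x) = 0" .
  qed
  then have "AE x in lebesgue. \<forall>i. (W x - W' x) $ i = 0"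
    by (simp add: AE_all_countable)
  then show ?thesis by eventually_elim (simp add: vec_eq_iff)
qed

lemma H_curlI: "U \<in> L2 \<Longrightarrow> W \<in> L2 \<Longrightarrow> is_weak_curl U W \<Longrightarrow> U \<in> H_curl"
  by (auto simp: H_curl_def)

lemma H_curl_L2: "U \<in> H_curl \<Longrightarrow> U \<in> L2" by (simp add: H_curl_def)

lemma weak_curl:
  assumes "U \<in> H_curl" shows "weak_curl U \<in> L2" "is_weak_curl U (weak_curl U)"
proof -
  have "weak_curl U \<in> L2 \<and> is_weak_curl U (weak_curl U)"
    unfolding weak_curl_def
  proof (rule someI_ex[where P = "\<lambda>W. W \<in> L2 \<and> is_weak_curl U W"])
    show "\<exists>W. W \<in> L2 \<and> is_weak_curl U W" using assms by (auto simp: H_curl_def)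
  qed
  then show "weak_curl U \<in> L2" "is_weak_curl U (weak_curl U)" by auto
qed

text \<open>\<open>weak_curl\<close> is picked by \<open>SOME\<close>; this lets any convenient
  representative stand in for it, at the price of working almost everywhere.\<close>

lemma weak_curl_eq:
  assumes "U \<in> L2" "W \<in> L2" "is_weak_curl U W"
  shows "AE x in lebesgue. weak_curl U x = W x"
  using is_weak_curl_unique[OF weak_curl(1) _ weak_curl(2)] H_curlI[OF assms] assms by blast

lemma is_weak_curl_lincomb:
  assumes U: "U \<in> L2" "W \<in> L2" "is_weak_curl U W" and U': "U' \<in> L2" "W' \<in> L2" "is_weak_curl U' W'"
  shows "is_weak_curl (\<lambda>x. a *\<^sub>R U x + b *\<^sub>R U' x) (\<lambda>x. a *\<^sub>R W x + b *\<^sub>R W' x)"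
  unfolding is_weak_curl_def
proof
  fix \<phi> assume \<phi>: "\<phi> \<in> test_fields"
  note t = test_fields_L2[OF \<phi>] test_fields_L2[OF curl_test_field[OF \<phi>]]
  show "(LINT x|lebesgue. (a *\<^sub>R U x + b *\<^sub>R U' x) \<bullet> curl \<phi> x) = (LINT x|lebesgue. (a *\<^sub>R W x + b *\<^sub>R W' x) \<bullet> \<phi> x)"
    using U U' \<phi> L2_inner_integrable[OF U(1) t(2)] L2_inner_integrable[OF U'(1) t(2)]
      L2_inner_integrable[OF U(2) t(1)] L2_inner_integrable[OF U'(2) t(1)]
    by (simp add: inner_add_left is_weak_curl_def)
qed

lemma weak_curl_lincomb:
  assumes U: "U \<in> H_curl" and U': "U' \<in> H_curl"
  shows "(\<lambda>x. a *\<^sub>R U x + b *\<^sub>R U' x) \<in> H_curl"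
    "AE x in lebesgue. weak_curl (\<lambda>x. a *\<^sub>R U x + b *\<^sub>R U' x) x = a *\<^sub>R weak_curl U x + b *\<^sub>R weak_curl U' x"
proof -
  note l = is_weak_curl_lincomb[OF H_curl_L2[OF U] weak_curl[OF U] H_curl_L2[OF U'] weak_curl[OF U'], of a b]
  have "(\<lambda>x. a *\<^sub>R U x + b *\<^sub>R U' x) \<in> L2" "(\<lambda>x. a *\<^sub>R weak_curl U x + b *\<^sub>R weak_curl U' x) \<in> L2"
    by (intro L2_add L2_scaleR H_curl_L2 weak_curl U U')+
  with l show "(\<lambda>x. a *\<^sub>R U x + b *\<^sub>R U' x) \<in> H_curl"
    "AE x in lebesgue. weak_curl (\<lambda>x. a *\<^sub>R U x + b *\<^sub>R U' x) x = a *\<^sub>R weak_curl U x + b *\<^sub>R weak_curl U' x"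
    by (auto intro: H_curlI weak_curl_eq)
qed

lemma is_weak_curl_cong_AE:
  assumes eq: "AE x in lebesgue. U x = U' x" and U: "U \<in> borel_measurable lebesgue" "U' \<in> borel_measurable lebesgue"
  shows "is_weak_curl U W \<longleftrightarrow> is_weak_curl U' W"
proof -
  have "(LINT x|lebesgue. U x \<bullet> curl \<phi> x) = (LINT x|lebesgue. U' x \<bullet> curl \<phi> x)" if "\<phi> \<in> test_fields" for \<phi>
  proof (rule integral_cong_AE)
    note [measurable] = U L2_measurable[OF test_fields_L2[OF curl_test_field[OF that]]]
    show "(\<lambda>x. U x \<bullet> curl \<phi> x) \<in> borel_measurable lebesgue" "(\<lambda>x. U' x \<bullet> curl \<phi> x) \<in> borel_measurable lebesgue"
      by measurable
    show "AE x in lebesgue. U x \<bullet> curl \<phi> x = U' x \<bullet> curl \<phi> x"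
      using eq by eventually_elim simp
  qed
  then show ?thesis by (simp add: is_weak_curl_def)
qed

text \<open>The curl is a closed operator: both sides of the defining identity are L2 pairings with
  a fixed field, hence continuous.\<close>

lemma is_weak_curl_tendsto:
  assumes U: "\<And>n. U n \<in> L2" and U': "U' \<in> L2" and W: "\<And>n. W n \<in> L2" and W': "W' \<in> L2"
    and curl: "\<And>n. is_weak_curl (U n) (W n)"
    and limU: "(\<lambda>n. LINT x|lebesgue. (norm (U n x - U' x))\<^sup>2) \<longlonglongrightarrow> 0"
    and limW: "(\<lambda>n. LINT x|lebesgue. (norm (W n x - W' x))\<^sup>2) \<longlonglongrightarrow> 0"
  shows "is_weak_curl U' W'"
  unfolding is_weak_curl_def
proof
  fix \<phi> assume \<phi>: "\<phi> \<in> test_fields"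
  have "(\<lambda>n. LINT x|lebesgue. U n x \<bullet> curl \<phi> x) \<longlonglongrightarrow> (LINT x|lebesgue. U' x \<bullet> curl \<phi> x)"
    by (rule L2_inner_tendsto[OF U U' test_fields_L2[OF curl_test_field[OF \<phi>]] limU])
  moreover have "(\<lambda>n. LINT x|lebesgue. U n x \<bullet> curl \<phi> x) \<longlonglongrightarrow> (LINT x|lebesgue. W' x \<bullet> \<phi> x)"
    using L2_inner_tendsto[OF W W' test_fields_L2[OF \<phi>] limW] curl \<phi> by (simp add: is_weak_curl_def)
  ultimately show "(LINT x|lebesgue. U' x \<bullet> curl \<phi> x) = (LINT x|lebesgue. W' x \<bullet> \<phi> x)"
    by (rule LIMSEQ_unique)
qed

section \<open>Translation estimates\<close>

declare ball_sets_lebesgue [measurable del] box_sets_lebesgue [measurable del]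

lemma ball_sets_borel [measurable]: "ball a R \<in> sets (borel :: 'a::metric_space measure)"
  by (simp add: borel_open)

text \<open>Passage from the completed measure to Borel representatives and \<open>lborel\<close>,
  on which the product measure arguments below are carried out.\<close>

lemma locint_lborel:
  assumes "locint f" "f \<in> borel_measurable borel"
  shows "integrable lborel (\<lambda>x. indicator (ball 0 R) x * f x)"
proof -
  note [measurable] = assms(2)
  have "(\<lambda>x. indicator (ball 0 R) x * f x) \<in> borel_measurable lborel" by measurable
  then show ?thesis using assms(1) by (simp add: locint_def integrable_completion)
qed

lemma locint_borelI:
  assumes "f \<in> borel_measurable borel" "\<And>R. integrable lborel (\<lambda>x. indicator (ball 0 R) x * f x)"
  shows "locint f"
proof -
  note [measurable] = assms(1)
  have "(\<lambda>x. indicator (ball 0 R) x * f x) \<in> borel_measurable lborel" for R by measurable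
  then show ?thesis using assms by (simp add: locint_def integrable_completion measurable_completion)
qed

lemma locint_translate:
  assumes f: "locint f" and m [measurable]: "f \<in> borel_measurable borel"
  shows "locint (\<lambda>x. f (x + h))"
proof (rule locint_borelI)
  fix R
  have i: "integrable lborel (\<lambda>x. indicator (ball 0 (R + norm h)) (x + h) * f (x + h))"
    using integrable_translate[OF locint_lborel[OF f m], of "R + norm h" h] .
  show "integrable lborel (\<lambda>x. indicator (ball 0 R) x * f (x + h))"
  proof (rule Bochner_Integration.integrable_bound[OF i])
    show "AE x in lborel. norm (indicator (ball 0 R) x * f (x + h))
        \<le> norm (indicator (ball 0 (R + norm h)) (x + h) * f (x + h))"
    proof (rule AE_I2)
      fix x
      have "norm (x + h) \<le> norm x + norm h" by (rule norm_triangle_ineq)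
      then show "norm (indicator (ball 0 R) x * f (x + h))
        \<le> norm (indicator (ball 0 (R + norm h)) (x + h) * f (x + h))"
        by (auto simp: indicator_def)
    qed
  qed measurable
qed measurable

text \<open>A point of the ball of radius \<open>R\<close>, moved by at most |h|, stays in the ball
  of radius R + |h|; so a translate of \<open>g\<close> cut off to the larger ball
  dominates.\<close>

lemma line_integrable:
  fixes g :: "real^3 \<Rightarrow> real"
  assumes g: "locint g" and m [measurable]: "g \<in> borel_measurable borel"
    and k: "k \<in> borel_measurable borel" "\<And>x. \<bar>k x\<bar> \<le> B * indicator (ball 0 R) x"
  shows "integrable (unif 0 1 \<Otimes>\<^sub>M lborel) (\<lambda>(s, x). k x * g (x + s *\<^sub>R h))"
proof (rule shear_bound_integrable[where T = "\<lambda>s x. x + s *\<^sub>R h" and A = "{0..1}"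
      and f = "\<lambda>x. B * (indicator (ball 0 (R + norm h)) x * g x)"])
  note [measurable] = k(1)
  show "finite_measure (unif 0 1)"
    using prob_space_unif[of 0 1] by (simp add: prob_space.finite_measure)
  show "integrable lborel (\<lambda>x. B * (indicator (ball 0 (R + norm h)) x * g x))"
    using locint_lborel[OF g m] by simp
  show "(\<lambda>(s, x). k x * g (x + s *\<^sub>R h)) \<in> borel_measurable (borel \<Otimes>\<^sub>M borel)" by measurable
  show "AE s in unif 0 1. s \<in> {0..1}" by (rule AE_unif) simp
  fix s :: real and x assume s: "s \<in> {0..1}"
  have "norm (x + s *\<^sub>R h) \<le> norm x + \<bar>s\<bar> * norm h"
    using norm_triangle_ineq[of x "s *\<^sub>R h"] by simp
  also have "\<dots> \<le> norm x + 1 * norm h"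
    using s by (intro add_left_mono mult_right_mono) auto
  finally have n: "norm (x + s *\<^sub>R h) \<le> norm x + norm h" by simp
  have "\<bar>k x * g (x + s *\<^sub>R h)\<bar> \<le> (B * indicator (ball 0 R) x) * \<bar>g (x + s *\<^sub>R h)\<bar>"
    unfolding abs_mult by (intro mult_right_mono k) auto
  also have "\<dots> \<le> \<bar>B * (indicator (ball 0 (R + norm h)) (x + s *\<^sub>R h) * g (x + s *\<^sub>R h))\<bar>"
    using n by (auto simp: indicator_def abs_mult mult_right_mono)
  finally show "\<bar>case (s, x) of (s, x) \<Rightarrow> k x * g (x + s *\<^sub>R h)\<bar>
      \<le> \<bar>B * (indicator (ball 0 (R + norm h)) (x + s *\<^sub>R h) * g (x + s *\<^sub>R h))\<bar>" by simp
qed (auto simp: distr_translate)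

lemma pd_translate:
  assumes "f differentiable (at (x + a))"
  shows "pd j (\<lambda>x. f (x + a)) x = pd j f (x + a)"
  using pd_affine(1)[of f "mat 1" x a j, unfolded matrix_vector_mul_lid, OF assms]
  by (simp add: mat_def if_distrib if_distribR cong: if_cong)

definition weak_gradient :: "(real^3 \<Rightarrow> real) \<Rightarrow> (3 \<Rightarrow> real^3 \<Rightarrow> real) \<Rightarrow> bool" where
  "weak_gradient \<psi> G \<longleftrightarrow> (\<forall>\<eta> j. test_fun \<eta> \<longrightarrow>
    (LINT x|lebesgue. \<psi> x * pd j \<eta> x) = - (LINT x|lebesgue. G j x * \<eta> x))"

text \<open>The fundamental theorem of calculus along segments, for a function with only a weak
  gradient. Integrated against a test function, the difference is moved onto that function, where
  the classical theorem applies; the weak gradient moves the derivative back and Fubini assembles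
  the average. The fundamental lemma then removes the test function.\<close>

lemma translation_identity:
  assumes \<psi>: "locint \<psi>" and \<psi>_m [measurable]: "\<psi> \<in> borel_measurable borel"
    and G: "\<And>j. locint (G j)" and G_m [measurable]: "\<And>j. G j \<in> borel_measurable borel"
    and grad: "weak_gradient \<psi> G"
  shows "AE x in lborel. \<psi> (x + h) - \<psi> x = (LINT s|unif 0 1. (\<Sum>j\<in>UNIV. h $ j * G j (x + s *\<^sub>R h)))"
proof -
  interpret prob_space "unif 0 1" by (rule prob_space_unif) simp
  interpret pair_sigma_finite "unif 0 1" "lborel :: (real^3) measure" ..
  define g where "g x = (\<Sum>j\<in>UNIV. h $ j * G j x)" for x
  have g: "locint g"
  proof -
    have "locint (\<lambda>x. h $ 1 * G 1 x + (h $ 2 * G 2 x + h $ 3 * G 3 x))"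
      by (intro locint_add locint_mult_continuous G continuous_on_const)
    then show ?thesis unfolding g_def by (simp add: sum_3 add.assoc)
  qed
  have g_m [measurable]: "g \<in> borel_measurable borel" unfolding g_def by measurable
  define D where "D x = (LINT s|unif 0 1. g (x + s *\<^sub>R h))" for x
  have "AE x in lebesgue. \<psi> (x + h) - \<psi> x - D x = 0"
  proof (rule fundamental_lemma)
    have D: "locint D"
    proof (rule locint_borelI)
      have "(\<lambda>x. LINT s|unif 0 1. g (x + s *\<^sub>R h)) \<in> borel_measurable borel"
        by measurable
      then show "D \<in> borel_measurable borel" by (simp add: D_def[abs_def])
      fix R
      have "integrable (unif 0 1 \<Otimes>\<^sub>M lborel) (\<lambda>(s, x). indicator (ball 0 R) x * g (x + s *\<^sub>R h))"
        by (rule line_integrable[OF g g_m, of _ 1 R]) auto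
      from integrable_snd[OF this]
      show "integrable lborel (\<lambda>x. indicator (ball 0 R) x * D x)" by (simp add: D_def)
    qed
    show "locint (\<lambda>x. \<psi> (x + h) - \<psi> x - D x)"
      by (intro locint_diff locint_translate \<psi> \<psi>_m D)
    have D_m [measurable]: "D \<in> borel_measurable borel" unfolding D_def[abs_def] by measurable
    fix \<eta> assume \<eta>: "test_fun \<eta>"
    note [measurable] = test_fun_borel[OF \<eta>]
    obtain R where R: "0 < R" "\<And>x. \<eta> x \<noteq> 0 \<Longrightarrow> norm x < R" using test_fun_support[OF \<eta>] by blast
    have \<eta>': "test_fun (\<lambda>y. \<eta> (y + a))" for a by (rule test_fun_translate[OF \<eta>])
    have int_test: "integrable lborel (\<lambda>x. f x * \<zeta> x)" if "locint f" "f \<in> borel_measurable borel" "test_fun \<zeta>" for f \<zeta>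
    proof -
      have [measurable]: "f \<in> borel_measurable borel" "\<zeta> \<in> borel_measurable borel"
        using that by (auto intro: test_fun_borel)
      show ?thesis using locint_test_fun[OF that(1,3)] by (simp add: integrable_completion)
    qed
    \<comment> \<open>Moving the difference onto the test function reverses the shift to -h; the
      minus sign in the definition of a weak gradient restores h.\<close>
    have wk: "(LINT y|lborel. \<psi> y * (\<Sum>j\<in>UNIV. (- h) $ j * pd j \<zeta> y)) = (LINT y|lborel. g y * \<zeta> y)"
      if \<zeta>: "test_fun \<zeta>" for \<zeta>
    proof -
      note [measurable] = test_fun_borel[OF \<zeta>] test_fun_borel[OF test_fun_pd[OF \<zeta>]]
      have i1: "integrable lborel (\<lambda>y. \<psi> y * pd j \<zeta> y)" for j
        by (rule int_test[OF \<psi> \<psi>_m test_fun_pd[OF \<zeta>]])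
      have i2: "integrable lborel (\<lambda>y. G j y * \<zeta> y)" for j
        by (rule int_test[OF G G_m \<zeta>])
      have gr: "(LINT y|lborel. \<psi> y * pd j \<zeta> y) = - (LINT y|lborel. G j y * \<zeta> y)" for j
        using grad \<zeta> integral_completion[OF borel_measurable_integrable[OF i1]]
          integral_completion[OF borel_measurable_integrable[OF i2]] by (simp add: weak_gradient_def)
      have "(LINT y|lborel. \<psi> y * (\<Sum>j\<in>UNIV. (- h) $ j * pd j \<zeta> y))
          = (LINT y|lborel. (\<Sum>j\<in>UNIV. (- h $ j) * (\<psi> y * pd j \<zeta> y)))"
        by (intro Bochner_Integration.integral_cong) (auto simp: sum_distrib_left mult_ac intro!: sum.cong)
      also have "\<dots> = (\<Sum>j\<in>UNIV. (- h $ j) * (LINT y|lborel. \<psi> y * pd j \<zeta> y))"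
        using i1 by (subst Bochner_Integration.integral_sum) auto
      also have "\<dots> = (\<Sum>j\<in>UNIV. h $ j * (LINT y|lborel. G j y * \<zeta> y))"
        by (simp add: gr)
      also have "\<dots> = (LINT y|lborel. (\<Sum>j\<in>UNIV. h $ j * (G j y * \<zeta> y)))"
        using i2 by (subst Bochner_Integration.integral_sum) auto
      also have "\<dots> = (LINT y|lborel. g y * \<zeta> y)"
        by (intro Bochner_Integration.integral_cong) (auto simp: g_def sum_distrib_right mult.assoc)
      finally show ?thesis .
    qed
    have lhs: "(LINT x|lborel. (\<psi> (x + h) - \<psi> x) * \<eta> x) = (LINT s|unif 0 1. (LINT y|lborel. g y * \<eta> (y - s *\<^sub>R h)))"
    proof -
      have it: "integrable lborel (\<lambda>x. \<psi> (x + h) * \<eta> x)"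
        by (rule int_test[OF locint_translate[OF \<psi> \<psi>_m] _ \<eta>]) measurable
      have "(LINT x|lborel. (\<psi> (x + h) - \<psi> x) * \<eta> x) = (LINT x|lborel. \<psi> (x + h) * \<eta> x) - (LINT x|lborel. \<psi> x * \<eta> x)"
        using it int_test[OF \<psi> \<psi>_m \<eta>] by (simp add: left_diff_distrib)
      also have "(LINT x|lborel. \<psi> (x + h) * \<eta> x) = (LINT y|lborel. \<psi> y * \<eta> (y - h))"
        using integral_translate[of "\<lambda>x. \<psi> x * \<eta> (x - h)" h] by simp
      also have "(LINT y|lborel. \<psi> y * \<eta> (y - h)) - (LINT x|lborel. \<psi> x * \<eta> x)
          = (LINT y|lborel. \<psi> y * (\<eta> (y - h) - \<eta> y))"
        using int_test[OF \<psi> \<psi>_m \<eta>] int_test[OF \<psi> \<psi>_m \<eta>'[of "- h"]] by (simp add: right_diff_distrib)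
      also have "\<dots> = (LINT y|lborel. (LINT s|unif 0 1. \<psi> y * (\<Sum>j\<in>UNIV. (- h) $ j * pd j \<eta> (y + s *\<^sub>R (- h)))))"
        using smooth_translate_FTC[OF test_fun_smooth[OF \<eta>], of "- h"] by simp
      also have "\<dots> = (LINT s|unif 0 1. (LINT y|lborel. \<psi> y * (\<Sum>j\<in>UNIV. (- h) $ j * pd j \<eta> (y + s *\<^sub>R (- h)))))"
      proof (rule Fubini_integral)
        have pm: "pd j \<eta> \<in> borel_measurable borel" for j by (rule test_fun_borel[OF test_fun_pd[OF \<eta>]])
        have "continuous_on UNIV (\<lambda>x. \<Sum>j\<in>UNIV. (- h) $ j * pd j \<eta> x)"
          by (intro continuous_on_sum continuous_on_mult_left smooth_continuous smooth_pd test_fun_smooth \<eta>)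
        then have qm [measurable]: "(\<lambda>x. \<Sum>j\<in>UNIV. (- h) $ j * pd j \<eta> x) \<in> borel_measurable borel"
          by (rule borel_measurable_continuous_onI)
        obtain B where B: "\<And>x. \<bar>\<Sum>j\<in>UNIV. (- h) $ j * pd j \<eta> x\<bar> \<le> B" "0 \<le> B"
        proof -
          have c: "test_fun (\<lambda>x. (- h) $ j * pd j \<eta> x)" for j
            by (rule test_fun_mult_left[OF smooth_const test_fun_pd[OF \<eta>]])
          have "test_fun (\<lambda>x. \<Sum>j\<in>UNIV. (- h) $ j * pd j \<eta> x)"
            unfolding sum_3 by (intro test_fun_add c)
          then show ?thesis using test_fun_bounded that by blast
        qed
        obtain R' where R': "\<And>x j. pd j \<eta> x \<noteq> 0 \<Longrightarrow> norm x < R'"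
        proof -
          have "\<exists>r. \<forall>x. pd j \<eta> x \<noteq> 0 \<longrightarrow> norm x < r" for j
            using test_fun_support[OF test_fun_pd[OF \<eta>, of j]] by blast
          then obtain r where r: "\<And>x j. pd j \<eta> x \<noteq> 0 \<Longrightarrow> norm x < r j"
            by metis
          show ?thesis
            by (rule that[of "max (r 1) (max (r 2) (r 3))"]) (use r exhaust_3 in \<open>metis less_max_iff_disj\<close>)
        qed
        show "integrable (unif 0 1 \<Otimes>\<^sub>M lborel) (\<lambda>(s, y). \<psi> y * (\<Sum>j\<in>UNIV. (- h) $ j * pd j \<eta> (y + s *\<^sub>R (- h))))"
        \<comment> \<open>Here the test function moves and \<psi> stays, so the shear is the
          identity; for s in [0,1] the moving support remains in one fixed ball.\<close>
        proof (rule shear_bound_integrable[where T = "\<lambda>s x. x" and A = "{0..1}"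
              and f = "\<lambda>x. B * (indicator (ball 0 (R' + norm h)) x * \<psi> x)"])
          show "integrable lborel (\<lambda>x. B * (indicator (ball 0 (R' + norm h)) x * \<psi> x))"
            using locint_lborel[OF \<psi> \<psi>_m] by simp
          have "(\<lambda>p. (case p of (s, y) \<Rightarrow> \<psi> y) * (case p of (s, y) \<Rightarrow> (\<Sum>j\<in>UNIV. (- h) $ j * pd j \<eta> (y + s *\<^sub>R (- h)))))
              \<in> borel_measurable (borel \<Otimes>\<^sub>M borel)"
          proof (rule borel_measurable_times)
            have "(\<lambda>(s::real, y). y + s *\<^sub>R (- h)) \<in> borel \<Otimes>\<^sub>M borel \<rightarrow>\<^sub>M borel" by measurable
            from measurable_compose[OF this qm]
            show "(\<lambda>p. case p of (s, y) \<Rightarrow> (\<Sum>j\<in>UNIV. (- h) $ j * pd j \<eta> (y + s *\<^sub>R (- h)))) \<in> borel_measurable (borel \<Otimes>\<^sub>M borel)"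
              by (simp add: case_prod_unfold)
          qed measurable
          then show "(\<lambda>(s, y). \<psi> y * (\<Sum>j\<in>UNIV. (- h) $ j * pd j \<eta> (y + s *\<^sub>R (- h)))) \<in> borel_measurable (borel \<Otimes>\<^sub>M borel)"
            by (simp add: case_prod_unfold)
          show "AE s in unif 0 1. s \<in> {0..1}" by (rule AE_unif) simp
          fix s :: real and y assume s: "s \<in> {0..1}"
          let ?S = "\<Sum>j\<in>UNIV. (- h) $ j * pd j \<eta> (y + s *\<^sub>R (- h))"
          have "?S = 0" if y: "\<not> norm y < R' + norm h"
          proof -
            have "norm y \<le> norm (y + s *\<^sub>R (- h)) + \<bar>s\<bar> * norm h"
              using norm_triangle_ineq[of "y + s *\<^sub>R (- h)" "s *\<^sub>R h"] by simp
            also have "\<dots> \<le> norm (y + s *\<^sub>R (- h)) + 1 * norm h"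
              using s by (intro add_left_mono mult_right_mono) auto
            finally have "\<not> norm (y + s *\<^sub>R (- h)) < R'" using y by linarith
            then have "pd j \<eta> (y + s *\<^sub>R (- h)) = 0" for j using R' by blast
            then show ?thesis by simp
          qed
          then show "\<bar>case (s, y) of (s, y) \<Rightarrow> \<psi> y * (\<Sum>j\<in>UNIV. (- h) $ j * pd j \<eta> (y + s *\<^sub>R (- h)))\<bar>
              \<le> \<bar>B * (indicator (ball 0 (R' + norm h)) y * \<psi> y)\<bar>"
            using B(1)[of "y + s *\<^sub>R (- h)"] B(2) mult_right_mono[OF B(1)[of "y + s *\<^sub>R (- h)"], of "\<bar>\<psi> y\<bar>"]
            by (auto simp: indicator_def abs_mult mult.commute[of "\<bar>\<psi> y\<bar>"])
        qed (auto simp: finite_measure_axioms distr_id2)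
      qed
      also have "\<dots> = (LINT s|unif 0 1. (LINT y|lborel. g y * \<eta> (y - s *\<^sub>R h)))"
      proof (rule Bochner_Integration.integral_cong[OF refl])
        fix s :: real
        have "pd j (\<lambda>y. \<eta> (y + s *\<^sub>R (- h))) y = pd j \<eta> (y + s *\<^sub>R (- h))" for j y
          by (rule pd_translate[OF smooth_differentiable[OF test_fun_smooth[OF \<eta>]]])
        then show "(LINT y|lborel. \<psi> y * (\<Sum>j\<in>UNIV. (- h) $ j * pd j \<eta> (y + s *\<^sub>R (- h)))) = (LINT y|lborel. g y * \<eta> (y - s *\<^sub>R h))"
          using wk[OF \<eta>'[of "s *\<^sub>R (- h)"]] by simp
      qed
      finally show ?thesis .
    qed
    have rhs: "(LINT x|lborel. D x * \<eta> x) = (LINT s|unif 0 1. (LINT y|lborel. g y * \<eta> (y - s *\<^sub>R h)))"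
    proof -
      obtain B where B: "\<And>x. \<bar>\<eta> x\<bar> \<le> B" using test_fun_bounded[OF \<eta>] by blast
      have "integrable (unif 0 1 \<Otimes>\<^sub>M lborel) (\<lambda>(s, x). \<eta> x * g (x + s *\<^sub>R h))"
        by (rule line_integrable[OF g g_m, of _ B R]) (use B R in \<open>auto simp: indicator_def\<close>)
      from Fubini_integral[OF this]
      have "(LINT x|lborel. LINT s|unif 0 1. \<eta> x * g (x + s *\<^sub>R h)) = (LINT s|unif 0 1. LINT x|lborel. \<eta> x * g (x + s *\<^sub>R h))" .
      moreover have "(LINT x|lborel. \<eta> x * g (x + s *\<^sub>R h)) = (LINT y|lborel. g y * \<eta> (y - s *\<^sub>R h))" for s
        using integral_translate[of "\<lambda>x. g x * \<eta> (x - s *\<^sub>R h)" "s *\<^sub>R h"] by (simp add: mult.commute)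
      ultimately show ?thesis by (simp add: D_def mult.commute)
    qed
    have "(LINT x|lebesgue. (\<psi> (x + h) - \<psi> x - D x) * \<eta> x) = (LINT x|lborel. (\<psi> (x + h) - \<psi> x) * \<eta> x - D x * \<eta> x)"
      by (simp add: integral_completion left_diff_distrib)
    also have "\<dots> = (LINT x|lborel. (\<psi> (x + h) - \<psi> x) * \<eta> x) - (LINT x|lborel. D x * \<eta> x)"
      by (rule Bochner_Integration.integral_diff; rule int_test)
        (use locint_diff[OF locint_translate[OF \<psi> \<psi>_m] \<psi>] D \<eta> in auto)
    finally show "(LINT x|lebesgue. (\<psi> (x + h) - \<psi> x - D x) * \<eta> x) = 0" by (simp add: lhs rhs)
  qed
  then have "AE x in lborel. \<psi> (x + h) - \<psi> x - D x = 0" by (simp add: AE_completion_iff)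
  then show ?thesis by (simp add: D_def g_def)
qed

text \<open>The identity is integrated over a ball, and for s in [0,1] the shifted ball stays in the
  one of radius R + |h|. A bound on the gradients in L1 thus gives a common modulus of continuity
  under translation, which is what Rellich's argument consumes.\<close>

lemma translation_estimate:
  assumes \<psi>: "locint \<psi>" and \<psi>_m [measurable]: "\<psi> \<in> borel_measurable borel"
    and G: "\<And>j. locint (G j)" and G_m [measurable]: "\<And>j. G j \<in> borel_measurable borel"
    and grad: "weak_gradient \<psi> G"
  shows "(LINT x|lborel. indicator (ball 0 R) x * \<bar>\<psi> (x + h) - \<psi> x\<bar>)
    \<le> norm h * (LINT x|lborel. indicator (ball 0 (R + norm h)) x * (\<Sum>j\<in>UNIV. \<bar>G j x\<bar>))"
proof -
  interpret prob_space "unif 0 1" by (rule prob_space_unif) simp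
  interpret pair_sigma_finite "unif 0 1" "lborel :: (real^3) measure" ..
  define g where "g x = (\<Sum>j\<in>UNIV. \<bar>G j x\<bar>)" for x
  have absG: "locint (\<lambda>x. \<bar>G j x\<bar>)" for j
  proof (rule locint_borelI)
    show "integrable lborel (\<lambda>x. indicator (ball 0 R) x * \<bar>G j x\<bar>)" for R
      using integrable_abs[OF locint_lborel[OF G G_m, of R j]] by (simp add: abs_mult)
  qed measurable
  have g: "locint g"
  proof -
    have "locint (\<lambda>x. \<bar>G 1 x\<bar> + \<bar>G 2 x\<bar> + \<bar>G 3 x\<bar>)" by (intro locint_add absG)
    then show ?thesis unfolding g_def by (simp add: sum_3)
  qed
  have g_m [measurable]: "g \<in> borel_measurable borel" unfolding g_def by measurable
  have int: "integrable (unif 0 1 \<Otimes>\<^sub>M lborel) (\<lambda>(s, x). (norm h * indicator (ball 0 R) x) * g (x + s *\<^sub>R h))"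
    by (rule line_integrable[OF g g_m, of _ "norm h" R]) auto
  have absd: "integrable lborel (\<lambda>x. indicator (ball 0 R) x * \<bar>\<psi> (x + h) - \<psi> x\<bar>)"
    using integrable_abs[OF locint_lborel[OF locint_diff[OF locint_translate[OF \<psi> \<psi>_m] \<psi>], of h R]]
    by (simp add: abs_mult)
  have gi: "AE x in lborel. integrable (unif 0 1) (\<lambda>s. (norm h * indicator (ball 0 R) x) * g (x + s *\<^sub>R h))"
    using AE_integrable_snd[OF int] by simp
  have "(LINT x|lborel. indicator (ball 0 R) x * \<bar>\<psi> (x + h) - \<psi> x\<bar>)
      \<le> (LINT x|lborel. LINT s|unif 0 1. (norm h * indicator (ball 0 R) x) * g (x + s *\<^sub>R h))"
  proof (rule integral_mono_AE[OF absd])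
    show "integrable lborel (\<lambda>x. LINT s|unif 0 1. (norm h * indicator (ball 0 R) x) * g (x + s *\<^sub>R h))"
      using integrable_snd[OF int] by simp
    show "AE x in lborel. indicator (ball 0 R) x * \<bar>\<psi> (x + h) - \<psi> x\<bar>
        \<le> (LINT s|unif 0 1. (norm h * indicator (ball 0 R) x) * g (x + s *\<^sub>R h))"
      using translation_identity[OF \<psi> \<psi>_m G G_m grad, of h] gi
    proof eventually_elim
      case (elim x)
      have "indicator (ball 0 R) x * \<bar>\<psi> (x + h) - \<psi> x\<bar>
          = \<bar>LINT s|unif 0 1. indicator (ball 0 R) x * (\<Sum>j\<in>UNIV. h $ j * G j (x + s *\<^sub>R h))\<bar>"
        using elim(1) by (simp add: abs_mult)
      also have "\<dots> \<le> (LINT s|unif 0 1. \<bar>indicator (ball 0 R) x * (\<Sum>j\<in>UNIV. h $ j * G j (x + s *\<^sub>R h))\<bar>)"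
        using integral_norm_bound[of "unif 0 1" "\<lambda>s. indicator (ball 0 R) x * (\<Sum>j\<in>UNIV. h $ j * G j (x + s *\<^sub>R h))"] by simp
      also have "\<dots> \<le> (LINT s|unif 0 1. (norm h * indicator (ball 0 R) x) * g (x + s *\<^sub>R h))"
      proof (rule integral_mono')
        show "integrable (unif 0 1) (\<lambda>s. (norm h * indicator (ball 0 R) x) * g (x + s *\<^sub>R h))" by (rule elim(2))
        fix s
        have "\<bar>\<Sum>j\<in>UNIV. h $ j * G j (x + s *\<^sub>R h)\<bar> \<le> (\<Sum>j\<in>UNIV. norm h * \<bar>G j (x + s *\<^sub>R h)\<bar>)"
          by (intro order_trans[OF sum_abs] sum_mono) (auto simp: abs_mult component_le_norm_cart intro: mult_right_mono)
        then have "\<bar>\<Sum>j\<in>UNIV. h $ j * G j (x + s *\<^sub>R h)\<bar> \<le> norm h * g (x + s *\<^sub>R h)"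
          by (simp add: g_def sum_distrib_left)
        then show "\<bar>indicator (ball 0 R) x * (\<Sum>j\<in>UNIV. h $ j * G j (x + s *\<^sub>R h))\<bar>
            \<le> (norm h * indicator (ball 0 R) x) * g (x + s *\<^sub>R h)"
          by (auto simp: indicator_def)
        show "0 \<le> (norm h * indicator (ball 0 R) x) * g (x + s *\<^sub>R h)"
          by (auto simp: g_def intro!: mult_nonneg_nonneg sum_nonneg)
      qed
      finally show ?case .
    qed
  qed
  also have "\<dots> = (LINT s|unif 0 1. LINT x|lborel. (norm h * indicator (ball 0 R) x) * g (x + s *\<^sub>R h))"
    by (rule Fubini_integral[OF int])
  also have "\<dots> \<le> (LINT s|unif 0 1. norm h * (LINT x|lborel. indicator (ball 0 (R + norm h)) x * g x))"
  proof (rule integral_mono_AE)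
    show "integrable (unif 0 1) (\<lambda>s. LINT x|lborel. (norm h * indicator (ball 0 R) x) * g (x + s *\<^sub>R h))"
      using integrable_fst[OF int] by simp
    show "AE s in unif 0 1. (LINT x|lborel. (norm h * indicator (ball 0 R) x) * g (x + s *\<^sub>R h))
        \<le> norm h * (LINT x|lborel. indicator (ball 0 (R + norm h)) x * g x)"
      using AE_unif[OF zero_less_one]
    proof eventually_elim
      fix s :: real assume s: "s \<in> {0..1}"
      have "(LINT x|lborel. (norm h * indicator (ball 0 R) x) * g (x + s *\<^sub>R h))
          \<le> (LINT x|lborel. norm h * (indicator (ball 0 (R + norm h)) (x + s *\<^sub>R h) * g (x + s *\<^sub>R h)))"
      proof (rule integral_mono')
        show "integrable lborel (\<lambda>x. norm h * (indicator (ball 0 (R + norm h)) (x + s *\<^sub>R h) * g (x + s *\<^sub>R h)))"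
          using integrable_translate[OF locint_lborel[OF g g_m, of "R + norm h"], of "s *\<^sub>R h"] by simp
        fix x
        have g0: "0 \<le> g y" for y by (simp add: g_def sum_nonneg)
        have "norm (x + s *\<^sub>R h) \<le> norm x + \<bar>s\<bar> * norm h"
          using norm_triangle_ineq[of x "s *\<^sub>R h"] by simp
        also have "\<dots> \<le> norm x + 1 * norm h"
          using s by (intro add_left_mono mult_right_mono) auto
        finally show "(norm h * indicator (ball 0 R) x) * g (x + s *\<^sub>R h)
            \<le> norm h * (indicator (ball 0 (R + norm h)) (x + s *\<^sub>R h) * g (x + s *\<^sub>R h))"
          using g0 by (auto simp: indicator_def)
        show "0 \<le> norm h * (indicator (ball 0 (R + norm h)) (x + s *\<^sub>R h) * g (x + s *\<^sub>R h))"
          using g0 by (simp add: indicator_def)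
      qed
      also have "\<dots> = norm h * (LINT x|lborel. indicator (ball 0 (R + norm h)) x * g x)"
        using integral_translate[of "\<lambda>x. indicator (ball 0 (R + norm h)) x * g x" "s *\<^sub>R h"] by simp
      finally show "(LINT x|lborel. (norm h * indicator (ball 0 R) x) * g (x + s *\<^sub>R h))
          \<le> norm h * (LINT x|lborel. indicator (ball 0 (R + norm h)) x * g x)" .
    qed
  qed auto
  also have "\<dots> = norm h * (LINT x|lborel. indicator (ball 0 (R + norm h)) x * g x)"
    using prob_space by simp
  finally show ?thesis by (simp add: g_def)
qed

section \<open>Azimuthal fields\<close>

lemma distr_orthogonal:
  fixes f :: "real^3 \<Rightarrow> real^3"
  assumes f: "orthogonal_transformation f"
  shows "distr lborel borel f = lborel"
proof (rule lborel_eqI[symmetric])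
  have lin: "linear f" using f by (rule orthogonal_transformation_linear)
  have [measurable]: "f \<in> borel_measurable borel"
    by (intro borel_measurable_continuous_onI linear_continuous_on linear_conv_bounded_linear[THEN iffD1] lin)
  fix l u :: "real^3" assume lu: "\<And>b. b \<in> Basis \<Longrightarrow> l \<bullet> b \<le> u \<bullet> b"
  have inv: "f -` box l u = inv f ` box l u"
    using orthogonal_transformation_bij[OF f] by (rule bij_vimage_eq_inv_image)
  have "emeasure (distr lborel borel f) (box l u) = emeasure lebesgue (f -` box l u)"
    by (subst emeasure_distr) (auto simp: emeasure_completion measurable_sets_borel[of f borel, simplified])
  also have "\<dots> = ennreal (measure lebesgue (inv f ` box l u))"
    unfolding inv
    by (intro emeasure_eq_measure2 measurable_orthogonal_image orthogonal_transformation_inv f lmeasurable_box)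
  also have "measure lebesgue (inv f ` box l u) = measure lebesgue (box l u)"
    by (intro measure_orthogonal_image orthogonal_transformation_inv f lmeasurable_box)
  also have "ennreal (measure lebesgue (box l u)) = emeasure lborel (box l u)"
    using emeasure_eq_measure2[OF lmeasurable_box[of l u]] by (simp add: emeasure_completion)
  also have "\<dots> = (\<Prod>b\<in>Basis. (u - l) \<bullet> b)"
    using lu by (simp add: emeasure_lborel_box)
  finally show "emeasure (distr lborel borel f) (box l u) = (\<Prod>b\<in>Basis. (u - l) \<bullet> b)" .
qed simp

definition rot :: "real \<Rightarrow> real^3 \<Rightarrow> real^3" where
  "rot \<theta> x = vector [cos \<theta> * x $ 1 - sin \<theta> * x $ 2, sin \<theta> * x $ 1 + cos \<theta> * x $ 2, x $ 3]"

text \<open>Conjugation by this reflection reverses Q and fixes S and T in the decomposition Q + S +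
  T, so it is -g1 on rotation equivariant fields.\<close>

definition refl2 :: "real^3 \<Rightarrow> real^3" where
  "refl2 x = vector [x $ 1, - x $ 2, x $ 3]"

lemma rot_nth [simp]:
  "rot \<theta> x $ 1 = cos \<theta> * x $ 1 - sin \<theta> * x $ 2"
  "rot \<theta> x $ 2 = sin \<theta> * x $ 1 + cos \<theta> * x $ 2"
  "rot \<theta> x $ 3 = x $ 3"
  by (simp_all add: rot_def)

lemma refl2_nth [simp]: "refl2 x $ 1 = x $ 1" "refl2 x $ 2 = - x $ 2" "refl2 x $ 3 = x $ 3"
  by (simp_all add: refl2_def)

lemma vec_eq_3: "(v :: real^3) = w \<longleftrightarrow> v $ 1 = w $ 1 \<and> v $ 2 = w $ 2 \<and> v $ 3 = w $ 3"
  by (simp add: vec_eq_iff forall_3)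

lemma rot_sq: "(rot \<theta> x $ 1)\<^sup>2 + (rot \<theta> x $ 2)\<^sup>2 = (x $ 1)\<^sup>2 + (x $ 2)\<^sup>2"
proof -
  have "(rot \<theta> x $ 1)\<^sup>2 + (rot \<theta> x $ 2)\<^sup>2 = ((sin \<theta>)\<^sup>2 + (cos \<theta>)\<^sup>2) * ((x $ 1)\<^sup>2 + (x $ 2)\<^sup>2)"
    unfolding rot_nth by algebra
  then show ?thesis by simp
qed

lemma rot_inner: "rot \<theta> x \<bullet> rot \<theta> y = x \<bullet> y"
proof -
  have "rot \<theta> x \<bullet> rot \<theta> y = ((sin \<theta>)\<^sup>2 + (cos \<theta>)\<^sup>2) * (x $ 1 * y $ 1 + x $ 2 * y $ 2) + x $ 3 * y $ 3"
    unfolding inner_3 rot_nth by algebra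
  then show ?thesis by (simp add: inner_3)
qed

lemma norm_rot [simp]: "norm (rot \<theta> x) = norm x"
  by (simp add: norm_eq_sqrt_inner rot_inner)

lemma cyl_radius_rot [simp]: "cyl_radius (rot \<theta> x) = cyl_radius x"
  unfolding cyl_radius_def rot_sq ..

lemma linear_rot: "linear (rot \<theta>)"
  by (rule linearI) (auto simp: vec_eq_3 algebra_simps)

lemma orthogonal_rot: "orthogonal_transformation (rot \<theta>)"
  unfolding orthogonal_transformation by (auto simp: linear_rot)

lemma refl2_inner: "refl2 x \<bullet> refl2 y = x \<bullet> y"
  by (simp add: inner_3)

lemma norm_refl2 [simp]: "norm (refl2 x) = norm x"
  by (simp add: norm_eq_sqrt_inner refl2_inner)

lemma cyl_radius_refl2 [simp]: "cyl_radius (refl2 x) = cyl_radius x"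
  by (simp add: cyl_radius_def)

lemma linear_refl2: "linear refl2"
  by (rule linearI) (auto simp: vec_eq_3 algebra_simps)

lemma orthogonal_refl2: "orthogonal_transformation refl2"
  unfolding orthogonal_transformation by (auto simp: linear_refl2)

lemma rot_add: "rot \<theta> (rot \<phi> x) = rot (\<theta> + \<phi>) x"
  by (simp add: vec_eq_3 cos_add sin_add algebra_simps)

lemma rot_0 [simp]: "rot 0 x = x"
  by (simp add: vec_eq_3)

lemma rot_minus_rot [simp]: "rot (- \<theta>) (rot \<theta> x) = x" "rot \<theta> (rot (- \<theta>) x) = x"
  by (simp_all add: rot_add)

lemma refl2_refl2 [simp]: "refl2 (refl2 x) = x"
  by (simp add: vec_eq_3)

lemma rot_refl2: "rot \<theta> (refl2 x) = refl2 (rot (- \<theta>) x)"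
  by (simp add: vec_eq_3)

lemma rot_borel [measurable]: "rot \<theta> \<in> borel_measurable borel"
  by (intro borel_measurable_continuous_onI linear_continuous_on linear_conv_bounded_linear[THEN iffD1] linear_rot)

lemma refl2_borel [measurable]: "refl2 \<in> borel_measurable borel"
  by (intro borel_measurable_continuous_onI linear_continuous_on linear_conv_bounded_linear[THEN iffD1] linear_refl2)

lemma borel_measurable_nth_borel [measurable]: "(\<lambda>x::real^3. x $ i) \<in> borel_measurable borel"
  by (intro borel_measurable_continuous_onI continuous_on_component continuous_on_id)

lemma rot_pair_borel [measurable]: "(\<lambda>(\<theta>, x). rot \<theta> x) \<in> borel \<Otimes>\<^sub>M borel \<rightarrow>\<^sub>M borel"
proof (rule borel_measurable_vecI)
  fix i :: 3
  show "(\<lambda>p. (case p of (\<theta>, x) \<Rightarrow> rot \<theta> x) $ i) \<in> borel_measurable (borel \<Otimes>\<^sub>M borel)"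
    using exhaust_3[of i] by (auto simp: case_prod_unfold)
qed

lemma AE_orthogonal:
  fixes f :: "real^3 \<Rightarrow> real^3"
  assumes f: "orthogonal_transformation f" and P: "AE x in lebesgue. P x"
  shows "AE x in lebesgue. P (f x)"
proof -
  have [measurable]: "f \<in> borel_measurable borel"
    by (intro borel_measurable_continuous_onI linear_continuous_on linear_conv_bounded_linear[THEN iffD1]
        orthogonal_transformation_linear f)
  have "AE x in distr lborel borel f. P x"
    unfolding distr_orthogonal[OF f] using P by (simp add: AE_completion_iff)
  then have "AE x in lborel. P (f x)"
    by (rule AE_distrD[rotated]) simp
  then show ?thesis by (simp add: AE_completion_iff)
qed

lemma AE_rot: "AE x in lebesgue. P x \<Longrightarrow> AE x in lebesgue. P (rot \<theta> x)"
  by (rule AE_orthogonal[OF orthogonal_rot])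

lemma integral_orthogonal:
  fixes f :: "real^3 \<Rightarrow> real^3" and h :: "real^3 \<Rightarrow> real"
  assumes f: "orthogonal_transformation f" and h [measurable]: "h \<in> borel_measurable borel"
  shows "(LINT x|lborel. h (f x)) = (LINT x|lborel. h x)"
proof -
  have [measurable]: "f \<in> borel_measurable borel"
    by (intro borel_measurable_continuous_onI linear_continuous_on linear_conv_bounded_linear[THEN iffD1]
        orthogonal_transformation_linear f)
  show ?thesis
    using integral_distr[of f lborel borel h] by (simp add: distr_orthogonal[OF f])
qed

lemma AE_nth_neq_0: "AE x in lebesgue. (x :: real^3) $ i \<noteq> 0"
proof -
  have "negligible {x::real^3. x \<bullet> axis i 1 = 0}"
    by (rule negligible_standard_hyperplane) (auto simp: axis_in_Basis_iff)
  then have "{x::real^3. x $ i = 0} \<in> null_sets lebesgue"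
    by (simp add: inner_axis negligible_iff_null_sets)
  from AE_not_in[OF this] show ?thesis by simp
qed

lemma AE_cyl_radius_pos: "AE x in lebesgue. 0 < cyl_radius x"
  using AE_nth_neq_0[of 1]
proof eventually_elim
  case (elim x)
  then have "0 < (x $ 1)\<^sup>2 + (x $ 2)\<^sup>2" by (simp add: add_pos_nonneg)
  then show ?case by (simp add: cyl_radius_def)
qed

text \<open>The shape of the fields in \<open>X_G1\<close> without the profile \<open>q\<close>:
  equivariance under each single rotation together with the pointwise direction. This form survives
  changes on null sets, in particular the passage to Borel representatives.\<close>

definition azimuthal :: "vfield \<Rightarrow> bool" where
  "azimuthal U \<longleftrightarrow> (\<forall>\<theta>. AE x in lebesgue. U (rot \<theta> x) = rot \<theta> (U x)) \<and>
    (AE x in lebesgue. U x $ 3 = 0 \<and> x $ 1 * U x $ 1 + x $ 2 * U x $ 2 = 0)"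

lemma azimuthalI:
  assumes "AE x in lebesgue. U x = (q (cyl_radius x, x $ 3) / cyl_radius x) *\<^sub>R vector [- (x $ 2), x $ 1, 0]"
  shows "azimuthal U"
  unfolding azimuthal_def
proof (intro conjI allI)
  fix \<theta>
  show "AE x in lebesgue. U (rot \<theta> x) = rot \<theta> (U x)"
    using assms AE_rot[OF assms, of \<theta>]
    by eventually_elim (simp add: vec_eq_3 algebra_simps)
  show "AE x in lebesgue. U x $ 3 = 0 \<and> x $ 1 * U x $ 1 + x $ 2 * U x $ 2 = 0"
    using assms by eventually_elim simp
qed

lemma X_G1_azimuthal: "U \<in> X_G1 p \<Gamma> \<Longrightarrow> azimuthal U"
  unfolding X_G1_def by (auto intro: azimuthalI)

text \<open>For \<open>U = (q / r) (- x2, x1, 0)\<close> the swirl is \<open>r q\<close>. Its gradient depends on the curl of \<open>U\<close> with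
  polynomial coefficients, so that the axis \<open>r = 0\<close> needs no special treatment.\<close>

definition swirl :: "vfield \<Rightarrow> real^3 \<Rightarrow> real" where
  "swirl U x = x $ 1 * U x $ 2 - x $ 2 * U x $ 1"

text \<open>The curl of (q / r) (-x2, x1, 0) has third component (1/r) d_r(r q) and horizontal part
  -(d_3 q / r) (x1, x2). Multiplication by the coordinates turns these into the derivatives of r q
  and removes every quotient by r.\<close>

definition swirl_grad :: "vfield \<Rightarrow> 3 \<Rightarrow> real^3 \<Rightarrow> real" where
  "swirl_grad W j x = (if j = 3 then - (x $ 1 * W x $ 1 + x $ 2 * W x $ 2) else x $ j * W x $ 3)"

lemma borel_rep:
  fixes U :: vfield
  assumes U: "U \<in> borel_measurable lebesgue"
  obtains U' where "U' \<in> borel_measurable borel" "AE x in lebesgue. U x = U' x"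
proof -
  have "\<forall>i. \<exists>u. u \<in> borel_measurable borel \<and> (AE x in lebesgue. U x $ i = u x)"
  proof
    fix i
    have "(\<lambda>x. U x $ i) \<in> borel_measurable lebesgue" using U by (rule borel_measurable_nth)
    from completion_ex_borel_measurable_real[OF this]
    show "\<exists>u. u \<in> borel_measurable borel \<and> (AE x in lebesgue. U x $ i = u x)"
      by (auto simp: AE_completion_iff)
  qed
  from choice[OF this] obtain u where u: "\<And>i. u i \<in> borel_measurable borel" "\<And>i. AE x in lebesgue. U x $ i = u i x"
    by blast
  define U' :: vfield where "U' x = (\<chi> i. u i x)" for x
  have 1: "U' \<in> borel_measurable borel"
    by (rule borel_measurable_vecI) (simp add: U'_def u(1))
  have "AE x in lebesgue. \<forall>i. U x $ i = u i x" using u(2) by (simp add: AE_all_countable)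
  then have "AE x in lebesgue. U x = U' x" by eventually_elim (simp add: U'_def vec_eq_iff)
  with 1 show ?thesis by (rule that)
qed

lemma L2_borel_rep:
  assumes U: "U \<in> L2"
  obtains U' where "U' \<in> borel_measurable borel" "U' \<in> L2" "AE x in lebesgue. U x = U' x"
proof -
  obtain U' where U': "U' \<in> borel_measurable borel" and eq: "AE x in lebesgue. U x = U' x"
    by (rule borel_rep[OF L2_measurable[OF U]])
  have "U' \<in> borel_measurable lebesgue" using U' by (simp add: measurable_completion)
  from that[OF U' L2_cong[OF U this eq] eq] show ?thesis .
qed

lemma locint_abs: assumes "locint f" shows "locint (\<lambda>x. \<bar>f x\<bar>)"
  unfolding locint_def
proof (intro conjI allI)
  note [measurable] = locint_measurable[OF assms]
  show "(\<lambda>x. \<bar>f x\<bar>) \<in> borel_measurable lebesgue" by measurable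
  fix R
  have "integrable lebesgue (\<lambda>x. \<bar>indicator (ball 0 R) x * f x\<bar>)"
    using assms by (simp add: locint_def)
  then show "integrable lebesgue (\<lambda>x. indicator (ball 0 R) x * \<bar>f x\<bar>)" by (simp add: abs_mult)
qed

lemma locint_bound:
  assumes f: "locint f" and g [measurable]: "g \<in> borel_measurable borel" and le: "\<And>x. \<bar>g x\<bar> \<le> f x"
  shows "locint g"
  unfolding locint_def
proof (intro conjI allI)
  show [measurable]: "g \<in> borel_measurable lebesgue" using g by (simp add: measurable_completion)
  fix R
  have i: "integrable lebesgue (\<lambda>x. indicator (ball 0 R) x * f x)" using f by (simp add: locint_def)
  show "integrable lebesgue (\<lambda>x. indicator (ball 0 R) x * g x)"
  proof (rule Bochner_Integration.integrable_bound[OF i])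
    have "(\<lambda>x. indicator (ball 0 R) x * g x) \<in> borel_measurable borel" by measurable
    then show "(\<lambda>x. indicator (ball 0 R) x * g x) \<in> borel_measurable lebesgue"
      by (simp add: measurable_completion)
    show "AE x in lebesgue. norm (indicator (ball 0 R) x * g x) \<le> norm (indicator (ball 0 R) x * f x)"
      using order_trans[OF le abs_ge_self] by (auto simp: indicator_def)
  qed
qed

lemma rot_orbit_derivative:
  assumes g: "smooth g"
  shows "((\<lambda>\<theta>. g (rot \<theta> x)) has_real_derivative
    (rot \<theta> x $ 1 * pd 2 g (rot \<theta> x) - rot \<theta> x $ 2 * pd 1 g (rot \<theta> x))) (at \<theta>)"
proof -
  let ?v = "vector [- (rot \<theta> x $ 2), rot \<theta> x $ 1, 0] :: real^3"
  have eq: "(\<lambda>\<theta>. rot \<theta> x) = (\<lambda>\<theta>. cos \<theta> *\<^sub>R vector [x $ 1, x $ 2, 0] + sin \<theta> *\<^sub>R vector [- (x $ 2), x $ 1, 0] + vector [0, 0, x $ 3])"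
    by (simp add: fun_eq_iff vec_eq_3)
  have "((\<lambda>\<theta>. rot \<theta> x) has_derivative (\<lambda>t. t *\<^sub>R ?v)) (at \<theta>)"
    unfolding eq by (auto intro!: derivative_eq_intros simp: fun_eq_iff vec_eq_3 algebra_simps)
  from has_derivative_compose[OF this has_derivative_smooth[OF g]]
  have "((\<lambda>\<theta>. g (rot \<theta> x)) has_derivative (\<lambda>t. \<Sum>j\<in>UNIV. (t *\<^sub>R ?v) $ j * pd j g (rot \<theta> x))) (at \<theta>)" .
  then show ?thesis
    unfolding has_field_derivative_def
    by (rule has_derivative_eq_rhs) (simp add: fun_eq_iff sum_3 algebra_simps del: rot_nth)
qed

lemma rotation_determinant:
  fixes c s x y u v :: real
  shows "(c * x - s * y) * (s * u + c * v) - (s * x + c * y) * (c * u - s * v) = (s\<^sup>2 + c\<^sup>2) * (x * v - y * u)"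
  by algebra

text \<open>Averaging over the rotation angle turns the integrand into the derivative of a periodic function.\<close>

lemma azimuthal_div_free:
  assumes U: "U \<in> L2" and az: "azimuthal U" and g: "test_fun g"
  shows "(LINT x|lebesgue. U x $ 1 * pd 1 g x + U x $ 2 * pd 2 g x) = 0"
proof -
  have pi: "- pi < pi" by simp
  interpret prob_space "unif (- pi) pi" by (rule prob_space_unif[OF pi])
  interpret pair_sigma_finite "unif (- pi) pi" "lborel :: (real^3) measure" ..
  obtain U' where U' [measurable]: "U' \<in> borel_measurable borel" and U'_L2: "U' \<in> L2" and eq: "AE x in lebesgue. U x = U' x"
    by (rule L2_borel_rep[OF U])
  \<comment> \<open>The angular velocity, so that the field is \<kappa> (-x2, x1, 0). It behaves
    like q / r near the axis and is integrated only together with a factor of order r. The function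
    \<open>a\<close> below is the derivative of \<open>g\<close> along the rotation.\<close>
  define \<kappa> where "\<kappa> x = (x $ 1 * U' x $ 2 - x $ 2 * U' x $ 1) / (cyl_radius x)\<^sup>2" for x
  define a where "a y = y $ 1 * pd 2 g y - y $ 2 * pd 1 g y" for y
  have cr [measurable]: "cyl_radius \<in> borel_measurable borel" unfolding cyl_radius_def[abs_def] by measurable
  have \<kappa> [measurable]: "\<kappa> \<in> borel_measurable borel" unfolding \<kappa>_def[abs_def] by measurable
  note [measurable] = test_fun_borel[OF g] test_fun_borel[OF test_fun_pd[OF g]]
  have a_test: "test_fun a"
    unfolding a_def[abs_def] diff_conv_add_uminus
    by (intro test_fun_add test_fun_minus test_fun_mult_left smooth_nth test_fun_pd g)
  note [measurable] = test_fun_borel[OF a_test]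
  have U_eq: "AE x in lebesgue. U x = \<kappa> x *\<^sub>R vector [- (x $ 2), x $ 1, 0]"
    using az[unfolded azimuthal_def, THEN conjunct2] eq AE_cyl_radius_pos
  proof eventually_elim
    case (elim x)
    define r2 where "r2 = (x $ 1)\<^sup>2 + (x $ 2)\<^sup>2"
    have r: "0 < r2" "(cyl_radius x)\<^sup>2 = r2"
      using elim(3) by (auto simp: cyl_radius_def r2_def)
    have o: "x $ 1 * U' x $ 1 = - (x $ 2 * U' x $ 2)" "U' x $ 3 = 0" using elim by auto
    have "U' x $ 1 * r2 = - (x $ 2) * (x $ 1 * U' x $ 2 - x $ 2 * U' x $ 1)"
      using o(1) unfolding r2_def by algebra
    moreover have "U' x $ 2 * r2 = x $ 1 * (x $ 1 * U' x $ 2 - x $ 2 * U' x $ 1)"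
      using o(1) unfolding r2_def by algebra
    ultimately show ?case
      using r o elim(2) by (simp add: vec_eq_3 \<kappa>_def field_simps)
  qed
  have \<kappa>_rot: "AE x in lebesgue. \<kappa> (rot \<theta> x) = \<kappa> x" for \<theta>
    using az[unfolded azimuthal_def, THEN conjunct1, THEN spec[of _ \<theta>]] eq AE_rot[OF eq, of \<theta>]
  proof eventually_elim
    case (elim x)
    then have "U' (rot \<theta> x) = rot \<theta> (U' x)" by simp
    then have "rot \<theta> x $ 1 * U' (rot \<theta> x) $ 2 - rot \<theta> x $ 2 * U' (rot \<theta> x) $ 1
        = ((sin \<theta>)\<^sup>2 + (cos \<theta>)\<^sup>2) * (x $ 1 * U' x $ 2 - x $ 2 * U' x $ 1)"
      by (simp only: rot_nth rotation_determinant)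
    then show ?case unfolding \<kappa>_def by simp
  qed
  have k: "locint (\<lambda>x. \<kappa> x * cyl_radius x)"
  proof (rule locint_bound)
    show "locint (\<lambda>x. \<bar>U' x $ 1\<bar> + \<bar>U' x $ 2\<bar>)" by (intro locint_add locint_abs L2_locint U'_L2)
    show "(\<lambda>x. \<kappa> x * cyl_radius x) \<in> borel_measurable borel" by measurable
    fix x
    show "\<bar>\<kappa> x * cyl_radius x\<bar> \<le> \<bar>U' x $ 1\<bar> + \<bar>U' x $ 2\<bar>"
    proof (cases "cyl_radius x = 0")
      case False
      have cn: "0 \<le> cyl_radius x" by (simp add: cyl_radius_def)
      then have c: "0 < cyl_radius x" using False by simp
      have "\<bar>x $ 1\<bar> \<le> cyl_radius x" "\<bar>x $ 2\<bar> \<le> cyl_radius x"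
        by (simp_all add: cyl_radius_def real_le_rsqrt)
      then have "\<bar>x $ 1 * U' x $ 2 - x $ 2 * U' x $ 1\<bar> \<le> cyl_radius x * \<bar>U' x $ 2\<bar> + cyl_radius x * \<bar>U' x $ 1\<bar>"
        by (intro order_trans[OF abs_triangle_ineq4] add_mono) (auto simp: abs_mult intro: mult_right_mono)
      then have "\<bar>x $ 1 * U' x $ 2 - x $ 2 * U' x $ 1\<bar> / cyl_radius x \<le> \<bar>U' x $ 1\<bar> + \<bar>U' x $ 2\<bar>"
        using c by (simp add: divide_le_eq algebra_simps)
      moreover have "\<kappa> x * cyl_radius x = (x $ 1 * U' x $ 2 - x $ 2 * U' x $ 1) / cyl_radius x"
        using c by (simp add: \<kappa>_def power2_eq_square)
      ultimately show ?thesis using c by simp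
    qed simp
  qed
  define I where "I = (LINT x|lebesgue. U x $ 1 * pd 1 g x + U x $ 2 * pd 2 g x)"
  have I_eq: "(LINT x|lborel. \<kappa> x * a (rot \<theta> x)) = I" for \<theta>
  proof -
    have "(LINT x|lborel. \<kappa> x * a (rot \<theta> x)) = (LINT x|lborel. \<kappa> (rot \<theta> x) * a (rot \<theta> x))"
      using \<kappa>_rot[of \<theta>] by (intro integral_cong_AE) (auto simp: AE_completion_iff)
    also have "\<dots> = (LINT x|lborel. \<kappa> x * a x)"
      by (rule integral_orthogonal[OF orthogonal_rot]) measurable
    also have "\<dots> = (LINT x|lebesgue. \<kappa> x * a x)" by (simp add: integral_completion)
    also have "\<dots> = I"
      unfolding I_def
    proof (rule integral_cong_AE)
      show "AE x in lebesgue. \<kappa> x * a x = U x $ 1 * pd 1 g x + U x $ 2 * pd 2 g x"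
        using U_eq by eventually_elim (simp add: a_def algebra_simps)
      note [measurable] = test_fun_lebesgue[OF test_fun_pd[OF g]] L2_measurable[OF U]
      show "(\<lambda>x. U x $ 1 * pd 1 g x + U x $ 2 * pd 2 g x) \<in> borel_measurable lebesgue" by measurable
      have "(\<lambda>x. \<kappa> x * a x) \<in> borel_measurable borel" by measurable
      then show "(\<lambda>x. \<kappa> x * a x) \<in> borel_measurable lebesgue" by (simp add: measurable_completion)
    qed
    finally show ?thesis .
  qed
  obtain B where B: "\<And>y. \<bar>pd 1 g y\<bar> \<le> B" "\<And>y. \<bar>pd 2 g y\<bar> \<le> B" "0 \<le> B"
  proof -
    obtain B1 where "\<And>y. \<bar>pd 1 g y\<bar> \<le> B1" "0 \<le> B1" using test_fun_bounded[OF test_fun_pd[OF g]] by blast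
    moreover obtain B2 where "\<And>y. \<bar>pd 2 g y\<bar> \<le> B2" "0 \<le> B2" using test_fun_bounded[OF test_fun_pd[OF g]] by blast
    ultimately show ?thesis by (intro that[of "max B1 B2"]) (auto simp: le_max_iff_disj)
  qed
  obtain R where R: "\<And>y. a y \<noteq> 0 \<Longrightarrow> norm y < R" using test_fun_support[OF a_test] by blast
  \<comment> \<open>The angular derivative \<open>a\<close> is bounded by a multiple of r, which
    rotations preserve; this pays for the singularity of \<kappa>.\<close>
  have int: "integrable (unif (- pi) pi \<Otimes>\<^sub>M lborel) (\<lambda>(\<theta>, x). \<kappa> x * a (rot \<theta> x))"
  proof (rule shear_bound_integrable[where T = "\<lambda>s x. x" and A = UNIV
        and f = "\<lambda>x. 2 * B * (indicator (ball 0 R) x * (\<kappa> x * cyl_radius x))"])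
    show "integrable lborel (\<lambda>x. 2 * B * (indicator (ball 0 R) x * (\<kappa> x * cyl_radius x)))"
      using locint_lborel[OF k, of R] by simp
    show "(\<lambda>(\<theta>, x). \<kappa> x * a (rot \<theta> x)) \<in> borel_measurable (borel \<Otimes>\<^sub>M borel)" by measurable
    fix \<theta> x
    have c: "\<bar>y $ 1\<bar> \<le> cyl_radius y" "\<bar>y $ 2\<bar> \<le> cyl_radius y" for y
      by (simp_all add: cyl_radius_def real_le_rsqrt)
    have "\<bar>a y\<bar> \<le> cyl_radius y * B + cyl_radius y * B" for y
      unfolding a_def
      by (intro order_trans[OF abs_triangle_ineq4] add_mono)
        (auto simp: abs_mult c B order_trans[OF abs_ge_zero c(1)] intro!: mult_mono)
    from this[of "rot \<theta> x"] have 1: "\<bar>a (rot \<theta> x)\<bar> \<le> 2 * B * cyl_radius x" by simp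
    have "a (rot \<theta> x) = 0" if "\<not> norm x < R" using R[of "rot \<theta> x"] that by auto
    then have "\<bar>a (rot \<theta> x)\<bar> \<le> 2 * B * (indicator (ball 0 R) x * cyl_radius x)"
      using 1 by (auto simp: indicator_def)
    from mult_left_mono[OF this, of "\<bar>\<kappa> x\<bar>"]
    have "\<bar>\<kappa> x * a (rot \<theta> x)\<bar> \<le> 2 * B * (indicator (ball 0 R) x * (\<bar>\<kappa> x\<bar> * cyl_radius x))"
      by (simp add: abs_mult mult_ac)
    also have "\<dots> \<le> \<bar>2 * B * (indicator (ball 0 R) x * (\<kappa> x * cyl_radius x))\<bar>"
      using B(3) by (simp add: abs_mult cyl_radius_def)
    finally show "\<bar>case (\<theta>, x) of (\<theta>, x) \<Rightarrow> \<kappa> x * a (rot \<theta> x)\<bar>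
        \<le> \<bar>2 * B * (indicator (ball 0 R) x * (\<kappa> x * cyl_radius x))\<bar>" by simp
  qed (auto simp: finite_measure_axioms distr_id2)
  have inner: "(LINT \<theta>|unif (- pi) pi. \<kappa> x * a (rot \<theta> x)) = 0" for x
  proof -
    have "continuous_on UNIV (\<lambda>\<theta>. rot \<theta> x)"
    proof -
      have "(\<lambda>\<theta>. rot \<theta> x) = (\<lambda>\<theta>. cos \<theta> *\<^sub>R vector [x $ 1, x $ 2, 0] + sin \<theta> *\<^sub>R vector [- (x $ 2), x $ 1, 0] + vector [0, 0, x $ 3])"
        by (simp add: fun_eq_iff vec_eq_3)
      then show ?thesis by (simp only:) (intro continuous_intros)
    qed
    then have "continuous_on UNIV (\<lambda>\<theta>. a (rot \<theta> x))"
      by (rule continuous_on_compose2[OF smooth_continuous[OF test_fun_smooth[OF a_test]]]) simp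
    from unif_FTC[OF pi rot_orbit_derivative[OF test_fun_smooth[OF g], of x, folded a_def] this]
    have "(LINT \<theta>|unif (- pi) pi. a (rot \<theta> x)) = (g (rot pi x) - g (rot (- pi) x)) / (2 * pi)" by simp
    also have "rot pi x = rot (- pi) x" by (simp add: vec_eq_3)
    finally show ?thesis by simp
  qed
  have "0 = (LINT x|lborel. LINT \<theta>|unif (- pi) pi. \<kappa> x * a (rot \<theta> x))" by (simp only: inner) simp
  also have "\<dots> = (LINT \<theta>|unif (- pi) pi. LINT x|lborel. \<kappa> x * a (rot \<theta> x))"
    by (rule Fubini_integral[OF int])
  also have "\<dots> = I" using prob_space by (simp add: I_eq)
  finally show ?thesis by (simp add: I_def)
qed

lemma test_field_vector:
  assumes "test_fun a" "test_fun b" "test_fun c"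
  shows "(\<lambda>x. vector [a x, b x, c x]) \<in> test_fields"
  unfolding test_fields_iff by (simp add: forall_3 assms)

lemma pd_nth_mult:
  assumes "test_fun \<eta>"
  shows "pd j (\<lambda>x. x $ i * \<eta> x) x = x $ i * pd j \<eta> x + (if i = j then \<eta> x else 0)"
  by (subst pd_mult) (auto simp: smooth_differentiable[OF test_fun_smooth[OF assms]])

text \<open>For the vertical derivative the test field \<eta> (x1, x2, 0) has a curl that produces
  the swirl directly. For a horizontal derivative (0, 0, x_j \<eta>) produces only a part of it, and
  the remainder integrates to zero because azimuthal fields are divergence free.\<close>

lemma swirl_weak_gradient:
  assumes U: "U \<in> L2" and W: "W \<in> L2" and curl: "is_weak_curl U W" and az: "azimuthal U"
  shows "weak_gradient (swirl U) (swirl_grad W)"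
  unfolding weak_gradient_def
proof (intro allI impI)
  fix \<eta> and j :: 3 assume \<eta>: "test_fun \<eta>"
  have t: "test_fun (\<lambda>x. x $ i * \<eta> x)" for i by (rule test_fun_mult_left[OF smooth_nth \<eta>])
  note pd = pd_nth_mult[OF \<eta>]
  note m = L2_measurable[OF U] L2_measurable[OF W] test_fun_lebesgue[OF \<eta>] test_fun_lebesgue[OF test_fun_pd[OF \<eta>]]
  have nth_m [measurable]: "(\<lambda>x::real^3. x $ i) \<in> borel_measurable lebesgue" for i :: 3
    by (intro measurable_completion) (simp add: borel_measurable_nth_borel)
  have orth: "AE x in lebesgue. U x $ 3 = 0 \<and> x $ 1 * U x $ 1 + x $ 2 * U x $ 2 = 0"
    using az by (simp add: azimuthal_def)
  have curl_int: "(LINT x|lebesgue. U x \<bullet> curl \<phi> x) = (LINT x|lebesgue. W x \<bullet> \<phi> x)"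
    "integrable lebesgue (\<lambda>x. U x \<bullet> curl \<phi> x)" if "\<phi> \<in> test_fields" for \<phi>
    using curl that by (auto simp: is_weak_curl_def intro: L2_inner_integrable U test_fields_L2 curl_test_field)
  consider "j = 1" | "j = 2" | "j = 3" using exhaust_3 by blast
  then show "(LINT x|lebesgue. swirl U x * pd j \<eta> x) = - (LINT x|lebesgue. swirl_grad W j x * \<eta> x)"
  proof cases
    case 3
    define \<phi> :: vfield where "\<phi> x = vector [x $ 1 * \<eta> x, x $ 2 * \<eta> x, 0]" for x
    have \<phi>: "\<phi> \<in> test_fields" unfolding \<phi>_def[abs_def] by (intro test_field_vector t test_fun_zero)
    have sm: "smooth (\<lambda>x. \<phi> x $ i)" for i using \<phi> by (auto simp: test_fields_iff intro: test_fun_smooth)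
    have c: "curl \<phi> x = vector [- (x $ 2 * pd 3 \<eta> x), x $ 1 * pd 3 \<eta> x, x $ 2 * pd 1 \<eta> x - x $ 1 * pd 2 \<eta> x]" for x
      unfolding curl_vector[OF sm] by (simp add: \<phi>_def pd)
    have "(LINT x|lebesgue. swirl U x * pd 3 \<eta> x) = (LINT x|lebesgue. U x \<bullet> curl \<phi> x)"
    proof (rule integral_cong_AE)
      note [measurable] = m L2_measurable[OF test_fields_L2[OF curl_test_field[OF \<phi>]]]
      show "(\<lambda>x. swirl U x * pd 3 \<eta> x) \<in> borel_measurable lebesgue" unfolding swirl_def by measurable
      show "(\<lambda>x. U x \<bullet> curl \<phi> x) \<in> borel_measurable lebesgue" by measurable
      show "AE x in lebesgue. swirl U x * pd 3 \<eta> x = U x \<bullet> curl \<phi> x"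
        using orth by eventually_elim (simp add: swirl_def c inner_3 algebra_simps)
    qed
    also have "\<dots> = (LINT x|lebesgue. W x \<bullet> \<phi> x)" by (rule curl_int(1)[OF \<phi>])
    also have "\<dots> = - (LINT x|lebesgue. swirl_grad W 3 x * \<eta> x)"
      unfolding integral_minus[symmetric]
      by (intro Bochner_Integration.integral_cong) (auto simp: swirl_grad_def \<phi>_def inner_3 algebra_simps)
    finally show ?thesis using 3 by simp
  next
    case 1
    define \<phi> :: vfield where "\<phi> x = vector [0, 0, x $ 1 * \<eta> x]" for x
    have \<phi>: "\<phi> \<in> test_fields" unfolding \<phi>_def[abs_def] by (intro test_field_vector t test_fun_zero)
    have sm: "smooth (\<lambda>x. \<phi> x $ i)" for i using \<phi> by (auto simp: test_fields_iff intro: test_fun_smooth)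
    have c: "curl \<phi> x = vector [x $ 1 * pd 2 \<eta> x, - (x $ 1 * pd 1 \<eta> x + \<eta> x), 0]" for x
      unfolding curl_vector[OF sm] by (simp add: \<phi>_def pd)
    \<comment> \<open>The missing part is the divergence identity for the test function x2 \<eta>;
      for the second coordinate below it will be x1 \<eta>.\<close>
    define d where "d x = U x $ 1 * pd 1 (\<lambda>x. x $ 2 * \<eta> x) x + U x $ 2 * pd 2 (\<lambda>x. x $ 2 * \<eta> x) x" for x
    have d: "integrable lebesgue d" unfolding d_def
      by (intro Bochner_Integration.integrable_add locint_test_fun L2_locint U test_fun_pd t)
    have d0: "(LINT x|lebesgue. d x) = 0" unfolding d_def by (rule azimuthal_div_free[OF U az t])
    have "(LINT x|lebesgue. swirl U x * pd 1 \<eta> x) = (LINT x|lebesgue. - (U x \<bullet> curl \<phi> x) - d x)"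
    proof (rule integral_cong_AE)
      note [measurable] = m L2_measurable[OF test_fields_L2[OF curl_test_field[OF \<phi>]]] borel_measurable_integrable[OF d]
      show "(\<lambda>x. swirl U x * pd 1 \<eta> x) \<in> borel_measurable lebesgue" unfolding swirl_def by measurable
      show "(\<lambda>x. - (U x \<bullet> curl \<phi> x) - d x) \<in> borel_measurable lebesgue" by measurable
      show "AE x in lebesgue. swirl U x * pd 1 \<eta> x = - (U x \<bullet> curl \<phi> x) - d x"
        using orth
      proof eventually_elim
        case (elim x)
        then have "x $ 1 * U x $ 1 = - (x $ 2 * U x $ 2)" by simp
        then show ?case by (simp add: swirl_def c inner_3 d_def pd) algebra
      qed
    qed
    also have "\<dots> = - (LINT x|lebesgue. W x \<bullet> \<phi> x)"
      using curl_int[OF \<phi>] d d0 by simp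
    also have "\<dots> = - (LINT x|lebesgue. swirl_grad W 1 x * \<eta> x)"
      by (intro arg_cong[of _ _ uminus] Bochner_Integration.integral_cong)
        (auto simp: swirl_grad_def \<phi>_def inner_3 algebra_simps)
    finally show ?thesis using 1 by simp
  next
    case 2
    define \<phi> :: vfield where "\<phi> x = vector [0, 0, x $ 2 * \<eta> x]" for x
    have \<phi>: "\<phi> \<in> test_fields" unfolding \<phi>_def[abs_def] by (intro test_field_vector t test_fun_zero)
    have sm: "smooth (\<lambda>x. \<phi> x $ i)" for i using \<phi> by (auto simp: test_fields_iff intro: test_fun_smooth)
    have c: "curl \<phi> x = vector [x $ 2 * pd 2 \<eta> x + \<eta> x, - (x $ 2 * pd 1 \<eta> x), 0]" for x
      unfolding curl_vector[OF sm] by (simp add: \<phi>_def pd)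
    define d where "d x = U x $ 1 * pd 1 (\<lambda>x. x $ 1 * \<eta> x) x + U x $ 2 * pd 2 (\<lambda>x. x $ 1 * \<eta> x) x" for x
    have d: "integrable lebesgue d" unfolding d_def
      by (intro Bochner_Integration.integrable_add locint_test_fun L2_locint U test_fun_pd t)
    have d0: "(LINT x|lebesgue. d x) = 0" unfolding d_def by (rule azimuthal_div_free[OF U az t])
    have "(LINT x|lebesgue. swirl U x * pd 2 \<eta> x) = (LINT x|lebesgue. d x - U x \<bullet> curl \<phi> x)"
    proof (rule integral_cong_AE)
      note [measurable] = m L2_measurable[OF test_fields_L2[OF curl_test_field[OF \<phi>]]] borel_measurable_integrable[OF d]
      show "(\<lambda>x. swirl U x * pd 2 \<eta> x) \<in> borel_measurable lebesgue" unfolding swirl_def by measurable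
      show "(\<lambda>x. d x - U x \<bullet> curl \<phi> x) \<in> borel_measurable lebesgue" by measurable
      show "AE x in lebesgue. swirl U x * pd 2 \<eta> x = d x - U x \<bullet> curl \<phi> x"
        using orth
      proof eventually_elim
        case (elim x)
        then have "x $ 1 * U x $ 1 = - (x $ 2 * U x $ 2)" by simp
        then show ?case by (simp add: swirl_def c inner_3 d_def pd) algebra
      qed
    qed
    also have "\<dots> = - (LINT x|lebesgue. W x \<bullet> \<phi> x)"
      using curl_int[OF \<phi>] d d0 by simp
    also have "\<dots> = - (LINT x|lebesgue. swirl_grad W 2 x * \<eta> x)"
      by (intro arg_cong[of _ _ uminus] Bochner_Integration.integral_cong)
        (auto simp: swirl_grad_def \<phi>_def inner_3 algebra_simps)
    finally show ?thesis using 2 by simp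
  qed
qed

section \<open>Local compactness\<close>

lemma bounded_diagonal_subsequence:
  fixes f :: "nat \<Rightarrow> 'i::countable \<Rightarrow> real"
  assumes bound: "\<And>i. \<exists>B. \<forall>n. \<bar>f n i\<bar> \<le> B"
  obtains r where "strict_mono r" "\<And>i. convergent (\<lambda>n. f (r n) i)"
proof -
  define P where "P k s \<longleftrightarrow> convergent (\<lambda>n. f (s n) (from_nat k))" for k and s :: "nat \<Rightarrow> nat"
  interpret subseqs P
  proof
    fix k and s :: "nat \<Rightarrow> nat"
    obtain B where "\<And>n. \<bar>f n (from_nat k)\<bar> \<le> B" using bound by blast
    then have "bounded (range (\<lambda>n. f (s n) (from_nat k)))"
      by (auto simp: bounded_iff)
    then obtain l t where "strict_mono t" "((\<lambda>n. f (s n) (from_nat k)) \<circ> t) \<longlonglongrightarrow> l"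
      using bounded_imp_convergent_subsequence by blast
    then show "\<exists>r'. strict_mono r' \<and> P k (s \<circ> r')"
      by (auto simp: P_def convergent_def comp_def)
  qed
  have sub: "P k (s \<circ> t)" if "strict_mono t" "P k s" for s t k
    using that convergent_subseq_convergent[of "\<lambda>n. f (s n) (from_nat k)" t] by (simp add: P_def comp_def)
  have "convergent (\<lambda>n. f (diagseq n) i)" for i
  proof -
    \<comment> \<open>The diagonal sequence is guaranteed to be a subsequence of the i-th one only
      from index i + 1 on; convergence ignores the beginning.\<close>
    have "P (to_nat i) (diagseq \<circ> ((+) (Suc (to_nat i))))"
      by (rule diagseq_holds) (rule sub)
    then have "convergent (\<lambda>n. f (diagseq (n + Suc (to_nat i))) i)"
      by (simp add: P_def comp_def add.commute)
    then show ?thesis by (subst (asm) convergent_ignore_initial_segment)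
  qed
  then show ?thesis using that subseq_diagseq by blast
qed

section \<open>Averages over the cells of dyadic grids\<close>

definition cell_base :: "nat \<Rightarrow> int \<times> int \<times> int \<Rightarrow> real^3" where
  "cell_base m k = (case k of (a, b, c) \<Rightarrow> vector [of_int a / 2^m, of_int b / 2^m, of_int c / 2^m])"

definition cell_index :: "nat \<Rightarrow> real^3 \<Rightarrow> int \<times> int \<times> int" where
  "cell_index m x = (\<lfloor>2^m * x $ 1\<rfloor>, \<lfloor>2^m * x $ 2\<rfloor>, \<lfloor>2^m * x $ 3\<rfloor>)"

text \<open>Open cubes, to which the facts on boxes apply directly. A point on a face of the grid
  lies in no cell, yet \<open>cell_index\<close> assigns it an adjacent one by rounding
  down.\<close>

definition cell :: "nat \<Rightarrow> int \<times> int \<times> int \<Rightarrow> (real^3) set" where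
  "cell m k = box (cell_base m k) (cell_base m k + (\<chi> i. (1/2)^m))"

definition cell_average :: "nat \<Rightarrow> (real^3 \<Rightarrow> real) \<Rightarrow> int \<times> int \<times> int \<Rightarrow> real" where
  "cell_average m f k = 8^m * (LINT y|lborel. indicator (cell m k) y * f y)"

lemma cube_vec_inner: "b \<in> Basis \<Longrightarrow> ((\<chi> i. d) :: real^3) \<bullet> b = d"
  by (auto simp: Basis_vec_def inner_axis)

lemma half_power_cubed: "((1/2::real)^m)^3 = (1/8)^m"
proof -
  have "((1/2::real)^m)^3 = ((1/2)^3)^m" by (metis power_mult mult.commute)
  then show ?thesis by (simp add: power3_eq_cube)
qed

lemma measure_cell: "emeasure lborel (cell m k) = ennreal ((1/8)^m)"
proof -
  have "emeasure lborel (cell m k) = (\<Prod>b\<in>(Basis :: (real^3) set). (\<chi> i. (1/2)^m) \<bullet> b)"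
    unfolding cell_def by (subst emeasure_lborel_box) (auto simp: inner_add_left cube_vec_inner)
  also have "(\<Prod>b\<in>(Basis :: (real^3) set). (\<chi> i. (1/2)^m) \<bullet> b) = (\<Prod>b\<in>(Basis :: (real^3) set). (1/2)^m)"
    by (intro prod.cong refl cube_vec_inner)
  also have "\<dots> = ((1/2)^m)^3" by simp
  finally show ?thesis by (simp only: half_power_cubed)
qed

lemma cell_close:
  assumes "y \<in> cell m (cell_index m x)"
  shows "\<bar>y $ i - x $ i\<bar> < (1/2)^m"
proof -
  have c: "cell_base m (cell_index m x) $ i = of_int \<lfloor>2^m * x $ i\<rfloor> / 2^m" for i
    using exhaust_3[of i] by (auto simp: cell_base_def cell_index_def)
  have y: "of_int \<lfloor>2^m * x $ i\<rfloor> / 2^m < y $ i" "y $ i < of_int \<lfloor>2^m * x $ i\<rfloor> / 2^m + (1/2)^m"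
    using assms by (auto simp: cell_def mem_box_cart c)
  have "of_int \<lfloor>2^m * x $ i\<rfloor> \<le> 2^m * x $ i" "2^m * x $ i < of_int \<lfloor>2^m * x $ i\<rfloor> + 1"
    by (simp_all add: floor_correct)
  then have x: "of_int \<lfloor>2^m * x $ i\<rfloor> / 2^m \<le> x $ i" "x $ i < of_int \<lfloor>2^m * x $ i\<rfloor> / 2^m + (1/2)^m"
    by (simp_all add: field_simps)
  show ?thesis using x y by linarith
qed

lemma norm_le_of_nth:
  fixes h :: "real^3"
  assumes "\<And>i. \<bar>h $ i\<bar> \<le> d" shows "norm h \<le> 3 * d"
proof -
  have "norm h \<le> (\<Sum>i\<in>UNIV. \<bar>h $ i\<bar>)" by (rule norm_le_l1_cart)
  also have "\<dots> \<le> (\<Sum>i\<in>(UNIV::3 set). d)" by (intro sum_mono assms)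
  finally show ?thesis by simp
qed

lemma cell_index_measurable [measurable]: "cell_index m \<in> borel \<rightarrow>\<^sub>M count_space UNIV"
proof -
  have [measurable]: "(\<lambda>x. \<lfloor>2^m * x $ i\<rfloor>) \<in> (borel :: (real^3) measure) \<rightarrow>\<^sub>M count_space UNIV" for i
    by measurable
  have "(\<lambda>x. (\<lfloor>2^m * x $ 1\<rfloor>, \<lfloor>2^m * x $ 2\<rfloor>, \<lfloor>2^m * x $ 3\<rfloor>)) \<in> (borel :: (real^3) measure) \<rightarrow>\<^sub>M
      (count_space UNIV \<Otimes>\<^sub>M (count_space UNIV \<Otimes>\<^sub>M count_space UNIV) :: (int \<times> int \<times> int) measure)"
    by measurable
  then show ?thesis
    by (simp add: cell_index_def[abs_def] pair_measure_countable)
qed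

lemma cell_subset_ball: obtains R where "cell m k \<subseteq> ball 0 R"
  using bounded_subset_ballD[OF bounded_box] unfolding cell_def by blast

lemma cell_borel [measurable]: "cell m k \<in> sets borel"
  by (simp add: cell_def)

lemma cell_integrable:
  assumes f: "locint f" and m [measurable]: "f \<in> borel_measurable borel"
  shows "integrable lborel (\<lambda>y. indicator (cell m k) y * f y)"
proof -
  obtain R where R: "cell m k \<subseteq> ball 0 R" by (rule cell_subset_ball)
  show ?thesis
    by (rule Bochner_Integration.integrable_bound[OF locint_lborel[OF f m, of R]])
      (use R in \<open>auto simp: indicator_def subset_iff\<close>)
qed

text \<open>The cell of \<open>x\<close> lies in x + \<open>?Q\<close>, with \<open>?Q\<close> the
  centred cube of twice the side. Integrating over \<open>?Q\<close> instead of the cell makes the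
  range of the shifts independent of \<open>x\<close>, so that the integrals can be exchanged; the
  volume ratio 8 is the constant in the conclusion.\<close>

lemma cell_average_approx:
  assumes \<psi>: "locint \<psi>" and \<psi>_m [measurable]: "\<psi> \<in> borel_measurable borel"
    and tr: "\<And>h. norm h \<le> 3 * (1/2)^m \<Longrightarrow> (LINT x|lborel. indicator (ball 0 R) x * \<bar>\<psi> (x + h) - \<psi> x\<bar>) \<le> \<delta>"
  shows "(LINT x|lborel. indicator (ball 0 R) x * \<bar>\<psi> x - cell_average m \<psi> (cell_index m x)\<bar>) \<le> 8 * \<delta>"
    and "integrable lborel (\<lambda>x. indicator (ball 0 R) x * \<bar>\<psi> x - cell_average m \<psi> (cell_index m x)\<bar>)"
proof -
  let ?A = "\<lambda>x. cell_average m \<psi> (cell_index m x)"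
  let ?Q = "box (\<chi> i. - ((1/2)^m)) (\<chi> i. (1/2)^m) :: (real^3) set"
  have A_m [measurable]: "?A \<in> borel_measurable borel"
    by (rule measurable_compose[OF cell_index_measurable]) simp
  have \<delta>0: "0 \<le> \<delta>"
  proof -
    have "0 \<le> (LINT x|lborel. indicator (ball 0 R) x * \<bar>\<psi> (x + 0) - \<psi> x\<bar>)" by simp
    also have "\<dots> \<le> \<delta>" by (rule tr) simp
    finally show ?thesis .
  qed
  have pw: "ennreal \<bar>\<psi> x - ?A x\<bar> \<le> 8^m * (\<integral>\<^sup>+h. indicator ?Q h * ennreal \<bar>\<psi> (x + h) - \<psi> x\<bar> \<partial>lborel)" for x
  proof -
    let ?C = "cell m (cell_index m x)"
    have ci: "integrable lborel (\<lambda>y. indicator ?C y * \<psi> y)" by (rule cell_integrable[OF \<psi> \<psi>_m])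
    have c1: "integrable lborel (indicator ?C :: _ \<Rightarrow> real)" and c2: "(LINT y|lborel. (indicator ?C y :: real)) = (1/8)^m"
      using measure_cell[of m "cell_index m x"] by (auto simp: measure_def)
    have "8^m * (LINT y|lborel. indicator ?C y * (\<psi> x - \<psi> y)) = \<psi> x - ?A x"
    proof -
      have "(LINT y|lborel. indicator ?C y * (\<psi> x - \<psi> y)) = (1/8)^m * \<psi> x - (LINT y|lborel. indicator ?C y * \<psi> y)"
        using ci c1 c2 by (simp add: right_diff_distrib)
      then show ?thesis by (simp add: cell_average_def right_diff_distrib power_mult_distrib[symmetric] flip: mult.assoc)
    qed
    then have "\<bar>\<psi> x - ?A x\<bar> = 8^m * \<bar>LINT y|lborel. indicator ?C y * (\<psi> x - \<psi> y)\<bar>"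
      by (metis abs_mult abs_numeral power_abs)
    also have "\<dots> \<le> 8^m * (LINT y|lborel. \<bar>indicator ?C y * (\<psi> x - \<psi> y)\<bar>)"
      using integral_norm_bound[of lborel "\<lambda>y. indicator ?C y * (\<psi> x - \<psi> y)"] by (intro mult_left_mono) auto
    finally have "ennreal \<bar>\<psi> x - ?A x\<bar> \<le> ennreal (8^m * (LINT y|lborel. \<bar>indicator ?C y * (\<psi> x - \<psi> y)\<bar>))"
      by (rule ennreal_leI)
    also have "\<dots> = 8^m * ennreal (LINT y|lborel. \<bar>indicator ?C y * (\<psi> x - \<psi> y)\<bar>)"
      by (simp add: ennreal_mult ennreal_power[symmetric])
    also have "ennreal (LINT y|lborel. \<bar>indicator ?C y * (\<psi> x - \<psi> y)\<bar>)
        = (\<integral>\<^sup>+y. ennreal \<bar>indicator ?C y * (\<psi> x - \<psi> y)\<bar> \<partial>lborel)"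
      using ci c1 by (intro nn_integral_eq_integral[symmetric]) (auto simp: right_diff_distrib)
    also have "\<dots> \<le> (\<integral>\<^sup>+y. indicator ?Q (y - x) * ennreal \<bar>\<psi> (x + (y - x)) - \<psi> x\<bar> \<partial>lborel)"
    proof (rule nn_integral_mono)
      fix y
      have "y - x \<in> ?Q" if "y \<in> ?C"
      proof -
        have "\<bar>y $ i - x $ i\<bar> < (1/2)^m" for i by (rule cell_close[OF that])
        then show ?thesis by (auto simp: mem_box_cart abs_less_iff minus_less_iff)
      qed
      then show "ennreal \<bar>indicator ?C y * (\<psi> x - \<psi> y)\<bar> \<le> indicator ?Q (y - x) * ennreal \<bar>\<psi> (x + (y - x)) - \<psi> x\<bar>"
        by (auto simp: indicator_def abs_minus_commute)
    qed
    also have "\<dots> = (\<integral>\<^sup>+h. indicator ?Q h * ennreal \<bar>\<psi> (x + h) - \<psi> x\<bar> \<partial>distr lborel borel (\<lambda>y. y + (- x)))"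
      by (subst nn_integral_distr) auto
    finally show ?thesis by (simp only: distr_translate) (simp add: mult_left_mono)
  qed
  have vol: "emeasure lborel ?Q = ennreal (8 * (1/8)^m)"
  proof -
    have "emeasure lborel ?Q = (\<Prod>b\<in>(Basis :: (real^3) set). ((\<chi> i. (1/2)^m) - (\<chi> i. - ((1/2)^m))) \<bullet> b)"
      by (subst emeasure_lborel_box) (auto simp: cube_vec_inner)
    also have "(\<Prod>b\<in>(Basis :: (real^3) set). ((\<chi> i. (1/2)^m) - (\<chi> i. - ((1/2)^m))) \<bullet> b) = (\<Prod>b\<in>(Basis :: (real^3) set). 2 * (1/2)^m)"
      by (intro prod.cong) (auto simp: inner_diff_left cube_vec_inner)
    also have "\<dots> = (2 * (1/2)^m)^3" by simp
    also have "\<dots> = 8 * (1/8)^m" by (simp only: power_mult_distrib half_power_cubed) simp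
    finally show ?thesis .
  qed
  have "(\<integral>\<^sup>+x. ennreal (indicator (ball 0 R) x * \<bar>\<psi> x - ?A x\<bar>) \<partial>lborel)
      \<le> (\<integral>\<^sup>+x. \<integral>\<^sup>+h. 8^m * (indicator ?Q h * ennreal (indicator (ball 0 R) x * \<bar>\<psi> (x + h) - \<psi> x\<bar>)) \<partial>lborel \<partial>lborel)"
  proof (rule nn_integral_mono)
    fix x
    show "ennreal (indicator (ball 0 R) x * \<bar>\<psi> x - ?A x\<bar>)
        \<le> (\<integral>\<^sup>+h. 8^m * (indicator ?Q h * ennreal (indicator (ball 0 R) x * \<bar>\<psi> (x + h) - \<psi> x\<bar>)) \<partial>lborel)"
    proof (cases "x \<in> ball 0 R")
      case True
      have "(\<integral>\<^sup>+h. 8^m * (indicator ?Q h * ennreal \<bar>\<psi> (x + h) - \<psi> x\<bar>) \<partial>lborel)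
          = 8^m * (\<integral>\<^sup>+h. indicator ?Q h * ennreal \<bar>\<psi> (x + h) - \<psi> x\<bar> \<partial>lborel)"
        by (rule nn_integral_cmult) measurable
      then show ?thesis using pw[of x] True by simp
    qed simp
  qed
  also have "\<dots> = (\<integral>\<^sup>+h. \<integral>\<^sup>+x. 8^m * (indicator ?Q h * ennreal (indicator (ball 0 R) x * \<bar>\<psi> (x + h) - \<psi> x\<bar>)) \<partial>lborel \<partial>lborel)"
    by (rule lborel_pair.Fubini') measurable
  also have "\<dots> \<le> (\<integral>\<^sup>+h. ennreal (8^m * \<delta>) * indicator ?Q h \<partial>lborel)"
  proof (rule nn_integral_mono)
    fix h
    show "(\<integral>\<^sup>+x. 8^m * (indicator ?Q h * ennreal (indicator (ball 0 R) x * \<bar>\<psi> (x + h) - \<psi> x\<bar>)) \<partial>lborel)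
        \<le> ennreal (8^m * \<delta>) * indicator ?Q h"
    proof (cases "h \<in> ?Q")
      case True
      then have h: "- ((1/2)^m) < h $ i \<and> h $ i < (1/2)^m" for i by (simp add: mem_box_cart)
      have "\<bar>h $ i\<bar> \<le> (1/2)^m" for i using h[of i] by linarith
      then have nh: "norm h \<le> 3 * (1/2)^m" by (rule norm_le_of_nth)
      have i: "integrable lborel (\<lambda>x. indicator (ball 0 R) x * \<bar>\<psi> (x + h) - \<psi> x\<bar>)"
        using integrable_abs[OF locint_lborel[OF locint_diff[OF locint_translate[OF \<psi> \<psi>_m] \<psi>], of h R]]
        by (simp add: abs_mult)
      have "(\<integral>\<^sup>+x. 8^m * (indicator ?Q h * ennreal (indicator (ball 0 R) x * \<bar>\<psi> (x + h) - \<psi> x\<bar>)) \<partial>lborel)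
          = 8^m * (\<integral>\<^sup>+x. ennreal (indicator (ball 0 R) x * \<bar>\<psi> (x + h) - \<psi> x\<bar>) \<partial>lborel)"
        using True by (simp add: nn_integral_cmult)
      also have "\<dots> = 8^m * ennreal (LINT x|lborel. indicator (ball 0 R) x * \<bar>\<psi> (x + h) - \<psi> x\<bar>)"
        using i by (subst nn_integral_eq_integral) auto
      also have "\<dots> \<le> 8^m * ennreal \<delta>"
        by (intro mult_left_mono ennreal_leI tr nh) simp
      also have "\<dots> = ennreal (8^m * \<delta>)"
        using \<delta>0 by (simp add: ennreal_mult ennreal_power[symmetric])
      finally show ?thesis using True by simp
    qed simp
  qed
  also have "\<dots> = ennreal (8^m * \<delta>) * ennreal (8 * (1/8)^m)"
    by (subst nn_integral_cmult_indicator) (auto simp: vol)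
  also have "\<dots> = ennreal (8 * \<delta>)"
    using \<delta>0 by (simp add: ennreal_mult[symmetric] power_mult_distrib[symmetric] power_divide)
  finally have nn: "(\<integral>\<^sup>+x. ennreal (indicator (ball 0 R) x * \<bar>\<psi> x - ?A x\<bar>) \<partial>lborel) \<le> ennreal (8 * \<delta>)" .
  show int: "integrable lborel (\<lambda>x. indicator (ball 0 R) x * \<bar>\<psi> x - ?A x\<bar>)"
    by (rule integrableI_nonneg) (use nn in \<open>auto intro: order_le_less_trans\<close>)
  have "ennreal (LINT x|lborel. indicator (ball 0 R) x * \<bar>\<psi> x - ?A x\<bar>) \<le> ennreal (8 * \<delta>)"
    using nn int by (subst nn_integral_eq_integral[symmetric]) auto
  then show "(LINT x|lborel. indicator (ball 0 R) x * \<bar>\<psi> x - ?A x\<bar>) \<le> 8 * \<delta>"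
    using \<delta>0 by (simp add: ennreal_le_iff)
qed

lemma integrable_indicator_ball_lborel:
  "integrable lborel (indicator (ball 0 R) :: real^3 \<Rightarrow> real)"
  by (rule integrable_real_indicator) (use emeasure_bounded_finite[OF bounded_ball] in auto)

text \<open>The averages over the cells of the dyadic grids form a countable family of bounded sequences; a
  diagonal subsequence makes all of them converge.\<close>

theorem rellich:
  fixes \<psi> :: "nat \<Rightarrow> real^3 \<Rightarrow> real" and G :: "nat \<Rightarrow> 3 \<Rightarrow> real^3 \<Rightarrow> real"
  assumes \<psi>: "\<And>n. locint (\<psi> n)" and \<psi>_m [measurable]: "\<And>n. \<psi> n \<in> borel_measurable borel"
    and G: "\<And>n j. locint (G n j)" and G_m [measurable]: "\<And>n j. G n j \<in> borel_measurable borel"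
    and grad: "\<And>n. weak_gradient (\<psi> n) (G n)"
    and b\<psi>: "\<And>R. \<exists>C. \<forall>n. (LINT x|lborel. indicator (ball 0 R) x * \<bar>\<psi> n x\<bar>) \<le> C"
    and bG: "\<And>R. \<exists>C. \<forall>n. (LINT x|lborel. indicator (ball 0 R) x * (\<Sum>j\<in>UNIV. \<bar>G n j x\<bar>)) \<le> C"
  obtains r :: "nat \<Rightarrow> nat" where "strict_mono r"
    "\<And>R e. 0 < e \<Longrightarrow> \<exists>N. \<forall>m\<ge>N. \<forall>n\<ge>N. (LINT x|lborel. indicator (ball 0 R) x * \<bar>\<psi> (r m) x - \<psi> (r n) x\<bar>) < e"
proof -
  have abs\<psi>: "integrable lborel (\<lambda>x. indicator (ball 0 R) x * \<bar>\<psi> n x\<bar>)" for R n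
    using integrable_abs[OF locint_lborel[OF \<psi> \<psi>_m, of R n]] by (simp add: abs_mult)
  have avg_bound: "\<bar>cell_average m (\<psi> n) k\<bar> \<le> 8^m * (LINT x|lborel. indicator (ball 0 R) x * \<bar>\<psi> n x\<bar>)"
    if "cell m k \<subseteq> ball 0 R" for n m k R
  proof -
    have "\<bar>LINT y|lborel. indicator (cell m k) y * \<psi> n y\<bar> \<le> (LINT y|lborel. \<bar>indicator (cell m k) y * \<psi> n y\<bar>)"
      using integral_norm_bound[of lborel "\<lambda>y. indicator (cell m k) y * \<psi> n y"] by simp
    also have "\<dots> \<le> (LINT x|lborel. indicator (ball 0 R) x * \<bar>\<psi> n x\<bar>)"
      by (rule integral_mono'[OF abs\<psi>]) (use that in \<open>auto simp: indicator_def abs_mult subset_iff\<close>)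
    finally show ?thesis unfolding cell_average_def abs_mult by (simp add: mult_left_mono)
  qed
  define avg where "avg n = (\<lambda>(m, k). cell_average m (\<psi> n) k)" for n
  have avg_bd: "\<exists>B. \<forall>n. \<bar>avg n i\<bar> \<le> B" for i
  proof -
    obtain m k where i: "i = (m, k)" by (cases i)
    obtain R where R: "cell m k \<subseteq> ball 0 R" by (rule cell_subset_ball)
    obtain C where C: "\<And>n. (LINT x|lborel. indicator (ball 0 R) x * \<bar>\<psi> n x\<bar>) \<le> C" using b\<psi> by blast
    have "\<bar>cell_average m (\<psi> n) k\<bar> \<le> 8^m * C" for n
      by (rule order_trans[OF avg_bound[OF R]]) (simp add: C)
    then show ?thesis unfolding i avg_def by auto
  qed
  obtain r where r: "strict_mono r" and conv: "\<And>i. convergent (\<lambda>n. avg (r n) i)"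
    using bounded_diagonal_subsequence[of avg] avg_bd by blast
  have conv: "convergent (\<lambda>n. cell_average m (\<psi> (r n)) k)" for m k
    using conv[of "(m, k)"] by (simp add: avg_def)
  show ?thesis
  proof (rule that[OF r])
    fix R e :: real assume e: "0 < e"
    \<comment> \<open>The shifts that occur have norm at most 3 (1/2)^m \<le> 3, hence the radius R
      + 3.\<close>
    obtain C where C: "\<And>n. (LINT x|lborel. indicator (ball 0 (R + 3)) x * (\<Sum>j\<in>UNIV. \<bar>G n j x\<bar>)) \<le> C" using bG by blast
    have gi: "integrable lborel (\<lambda>x. indicator (ball 0 S) x * (\<Sum>j\<in>UNIV. \<bar>G n j x\<bar>))" for n S
    proof -
      have "integrable lborel (\<lambda>x. \<Sum>j\<in>UNIV. \<bar>indicator (ball 0 S) x * G n j x\<bar>)"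
        by (intro Bochner_Integration.integrable_sum integrable_abs[OF locint_lborel[OF G G_m]])
      moreover have "(\<Sum>j\<in>UNIV. \<bar>indicator (ball 0 S) x * G n j x\<bar>) = indicator (ball 0 S) x * (\<Sum>j\<in>UNIV. \<bar>G n j x\<bar>)" for x
        by (cases "x \<in> ball 0 S") simp_all
      ultimately show ?thesis by (simp only:)
    qed
    have C0: "0 \<le> C"
    proof -
      have "0 \<le> (LINT x|lborel. indicator (ball 0 (R + 3)) x * (\<Sum>j\<in>UNIV. \<bar>G 0 j x\<bar>))"
        by (intro integral_nonneg_AE AE_I2 mult_nonneg_nonneg sum_nonneg) auto
      then show ?thesis using C[of 0] by linarith
    qed
    \<comment> \<open>The cell approximation costs 8 * 3 (1/2)^m C, and with (1/2)^m < t this is at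
      most 24 t (C + 1) = e/4.\<close>
    define t where "t = e / (96 * (C + 1))"
    have t: "0 < t" using e C0 by (simp add: t_def)
    obtain m where m: "(1/2::real)^m < t" using real_arch_pow_inv[OF t, of "1/2"] by auto
    have m1: "(1/2::real)^m \<le> 1" by (simp add: power_le_one)
    define A where "A n x = cell_average m (\<psi> (r n)) (cell_index m x)" for n x
    have A_m [measurable]: "A n \<in> borel_measurable borel" for n
      unfolding A_def[abs_def] by (rule measurable_compose[OF cell_index_measurable]) simp
    have tr: "(LINT x|lborel. indicator (ball 0 R) x * \<bar>\<psi> n (x + h) - \<psi> n x\<bar>) \<le> 3 * (1/2)^m * C"
      if h: "norm h \<le> 3 * (1/2)^m" for h n
    proof -
      have "(LINT x|lborel. indicator (ball 0 R) x * \<bar>\<psi> n (x + h) - \<psi> n x\<bar>)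
          \<le> norm h * (LINT x|lborel. indicator (ball 0 (R + norm h)) x * (\<Sum>j\<in>UNIV. \<bar>G n j x\<bar>))"
        by (rule translation_estimate[OF \<psi> \<psi>_m G G_m grad])
      also have "\<dots> \<le> norm h * (LINT x|lborel. indicator (ball 0 (R + 3)) x * (\<Sum>j\<in>UNIV. \<bar>G n j x\<bar>))"
      proof (intro mult_left_mono integral_mono' gi)
        fix x
        have "norm h \<le> 3" using h m1 by linarith
        then show "indicator (ball 0 (R + norm h)) x * (\<Sum>j\<in>UNIV. \<bar>G n j x\<bar>) \<le> indicator (ball 0 (R + 3)) x * (\<Sum>j\<in>UNIV. \<bar>G n j x\<bar>)"
          by (intro mult_right_mono sum_nonneg) (auto simp: indicator_def)
        show "0 \<le> indicator (ball 0 (R + 3)) x * (\<Sum>j\<in>UNIV. \<bar>G n j x\<bar>)"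
          by (intro mult_nonneg_nonneg sum_nonneg) auto
      qed simp
      also have "\<dots> \<le> (3 * (1/2)^m) * C"
        by (intro mult_mono h C) (auto intro!: integral_nonneg_AE AE_I2 mult_nonneg_nonneg sum_nonneg)
      finally show ?thesis .
    qed
    have approx: "(LINT x|lborel. indicator (ball 0 R) x * \<bar>\<psi> (r n) x - A n x\<bar>) \<le> e / 4"
      and approx_int: "integrable lborel (\<lambda>x. indicator (ball 0 R) x * \<bar>\<psi> (r n) x - A n x\<bar>)" for n
    proof -
      show "integrable lborel (\<lambda>x. indicator (ball 0 R) x * \<bar>\<psi> (r n) x - A n x\<bar>)"
        unfolding A_def using cell_average_approx(2)[OF \<psi> \<psi>_m tr] .
      have "(LINT x|lborel. indicator (ball 0 R) x * \<bar>\<psi> (r n) x - A n x\<bar>) \<le> 8 * (3 * (1/2)^m * C)"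
        unfolding A_def using cell_average_approx(1)[OF \<psi> \<psi>_m tr] .
      also have "\<dots> \<le> 24 * (t * (C + 1))"
      proof -
        have "(1/2)^m * C \<le> t * (C + 1)" using m C0 t by (intro mult_mono) auto
        then show ?thesis by simp
      qed
      also have "\<dots> = e / 4" using C0 by (simp add: t_def field_simps)
      finally show "(LINT x|lborel. indicator (ball 0 R) x * \<bar>\<psi> (r n) x - A n x\<bar>) \<le> e / 4" .
    qed
    \<comment> \<open>At the fixed scale \<open>m\<close> the averages converge at every point and
      are bounded on the ball, so dominated convergence brings each within e/4 of \<Phi>. With two
      approximation errors this makes four quarters of e.\<close>
    define \<Phi> where "\<Phi> x = lim (\<lambda>n. A n x)" for x
    have A_lim: "(\<lambda>n. A n x) \<longlonglongrightarrow> \<Phi> x" for x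
      using conv[of m "cell_index m x"] by (simp add: \<Phi>_def A_def convergent_LIMSEQ_iff)
    have \<Phi>_m [measurable]: "\<Phi> \<in> borel_measurable borel"
      unfolding \<Phi>_def[abs_def] by (rule borel_measurable_lim_metric) measurable
    \<comment> \<open>Cells belonging to points of the ball reach at most 3 beyond it, so the L1
      bound on the ball of radius R + 4 bounds all averages at once.\<close>
    obtain B where B: "\<And>n x. norm x < R \<Longrightarrow> \<bar>A n x\<bar> \<le> B"
    proof -
      obtain C' where C': "\<And>n. (LINT x|lborel. indicator (ball 0 (R + 4)) x * \<bar>\<psi> n x\<bar>) \<le> C'" using b\<psi> by blast
      have "\<bar>A n x\<bar> \<le> 8^m * C'" if x: "norm x < R" for n x
      proof -
        have "cell m (cell_index m x) \<subseteq> ball 0 (R + 4)"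
        proof
          fix y assume "y \<in> cell m (cell_index m x)"
          then have "\<bar>(y - x) $ i\<bar> \<le> (1/2)^m" for i using cell_close[of y m x i] by simp
          then have "norm (y - x) \<le> 3 * (1/2)^m" by (rule norm_le_of_nth)
          then show "y \<in> ball 0 (R + 4)" using norm_triangle_ineq[of x "y - x"] m1 x by simp
        qed
        from order_trans[OF avg_bound[OF this]] show ?thesis unfolding A_def by (simp add: C')
      qed
      then show ?thesis using that by blast
    qed
    have "(\<lambda>n. LINT x|lborel. indicator (ball 0 R) x * \<bar>A n x - \<Phi> x\<bar>) \<longlonglongrightarrow> (LINT x|(lborel :: (real^3) measure). 0)"
    proof (rule integral_dominated_convergence[where w = "\<lambda>x. 2 * B * indicator (ball 0 R) x"])
      show "integrable lborel (\<lambda>x::real^3. 2 * B * indicator (ball 0 R) x)"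
        using integrable_indicator_ball_lborel by simp
      show "AE x in lborel. (\<lambda>n. indicator (ball 0 R) x * \<bar>A n x - \<Phi> x\<bar>) \<longlonglongrightarrow> 0"
      proof (rule AE_I2)
        fix x
        have "(\<lambda>n. indicator (ball 0 R) x * \<bar>A n x - \<Phi> x\<bar>) \<longlonglongrightarrow> indicator (ball 0 R) x * \<bar>\<Phi> x - \<Phi> x\<bar>"
          by (intro tendsto_intros A_lim)
        then show "(\<lambda>n. indicator (ball 0 R) x * \<bar>A n x - \<Phi> x\<bar>) \<longlonglongrightarrow> 0" by simp
      qed
      show "AE x in lborel. norm (indicator (ball 0 R) x * \<bar>A n x - \<Phi> x\<bar>) \<le> 2 * B * indicator (ball 0 R) x" for n
      proof (rule AE_I2)
        fix x
        have "\<bar>\<Phi> x\<bar> \<le> B" if "norm x < R"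
          by (rule LIMSEQ_le_const2[OF tendsto_rabs[OF A_lim]]) (use B[OF that] in auto)
        then show "norm (indicator (ball 0 R) x * \<bar>A n x - \<Phi> x\<bar>) \<le> 2 * B * indicator (ball 0 R) x"
          using B[of x n] by (auto simp: indicator_def)
      qed
    qed measurable
    then have lim0: "(\<lambda>n. LINT x|lborel. indicator (ball 0 R) x * \<bar>A n x - \<Phi> x\<bar>) \<longlonglongrightarrow> 0" by simp
    have A\<Phi>_int: "integrable lborel (\<lambda>x. indicator (ball 0 R) x * \<bar>A n x - \<Phi> x\<bar>)" for n
    proof (rule Bochner_Integration.integrable_bound)
      show "integrable lborel (\<lambda>x::real^3. 2 * B * indicator (ball 0 R) x)"
        using integrable_indicator_ball_lborel by simp
      show "AE x in lborel. norm (indicator (ball 0 R) x * \<bar>A n x - \<Phi> x\<bar>) \<le> norm (2 * B * indicator (ball 0 R) x)"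
      proof (rule AE_I2)
        fix x
        have "\<bar>\<Phi> x\<bar> \<le> B" if "norm x < R"
          by (rule LIMSEQ_le_const2[OF tendsto_rabs[OF A_lim]]) (use B[OF that] in auto)
        then show "norm (indicator (ball 0 R) x * \<bar>A n x - \<Phi> x\<bar>) \<le> norm (2 * B * indicator (ball 0 R) x)"
          using B[of x n] by (auto simp: indicator_def)
      qed
    qed measurable
    obtain N where N: "\<And>n. N \<le> n \<Longrightarrow> (LINT x|lborel. indicator (ball 0 R) x * \<bar>A n x - \<Phi> x\<bar>) < e / 4"
      using order_tendstoD(2)[OF lim0, of "e / 4"] e by (auto simp: eventually_sequentially)
    show "\<exists>N. \<forall>k\<ge>N. \<forall>n\<ge>N. (LINT x|lborel. indicator (ball 0 R) x * \<bar>\<psi> (r k) x - \<psi> (r n) x\<bar>) < e"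
    proof (intro exI[of _ N] allI impI)
      fix k n assume k: "N \<le> k" and n: "N \<le> n"
      let ?I = "\<lambda>f. LINT x|lborel. indicator (ball 0 R) x * \<bar>f x\<bar>"
      have "(LINT x|lborel. indicator (ball 0 R) x * \<bar>\<psi> (r k) x - \<psi> (r n) x\<bar>)
          \<le> (LINT x|lborel. (indicator (ball 0 R) x * \<bar>\<psi> (r k) x - A k x\<bar> + indicator (ball 0 R) x * \<bar>\<psi> (r n) x - A n x\<bar>)
            + (indicator (ball 0 R) x * \<bar>A k x - \<Phi> x\<bar> + indicator (ball 0 R) x * \<bar>A n x - \<Phi> x\<bar>))"
        by (rule integral_mono', intro Bochner_Integration.integrable_add approx_int A\<Phi>_int)
          (auto simp: indicator_def)
      also have "\<dots> = (?I (\<lambda>x. \<psi> (r k) x - A k x) + ?I (\<lambda>x. \<psi> (r n) x - A n x))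
          + (?I (\<lambda>x. A k x - \<Phi> x) + ?I (\<lambda>x. A n x - \<Phi> x))"
        by (simp add: approx_int A\<Phi>_int)
      also have "\<dots> < e"
        using approx[of k] approx[of n] N[OF k] N[OF n] by linarith
      finally show "(LINT x|lborel. indicator (ball 0 R) x * \<bar>\<psi> (r k) x - \<psi> (r n) x\<bar>) < e" .
    qed
  qed
qed

section \<open>The energy and its coercivity\<close>

lemma powr_add_le:
  fixes a b s :: real
  assumes "0 \<le> a" "0 \<le> b" "0 \<le> s"
  shows "(a + b) powr s \<le> 2 powr s * (a powr s + b powr s)"
proof -
  have "(a + b) powr s \<le> (2 * max a b) powr s"
    using assms by (intro powr_mono2) auto
  also have "\<dots> = 2 powr s * max a b powr s"
    using assms by (simp add: powr_mult)
  also have "\<dots> \<le> 2 powr s * (a powr s + b powr s)"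
    by (intro mult_left_mono) (auto simp: max_def)
  finally show ?thesis .
qed

lemma powr_convex_nonneg:
  fixes a b s t :: real
  assumes ab: "0 \<le> a" "0 \<le> b" and s: "1 \<le> s"
  shows "((a + b) / 2) powr s \<le> (a powr s + b powr s) / 2"
proof (cases "a = 0 \<or> b = 0")
  case True
  have "(c / 2) powr s \<le> c powr s / 2" if c: "0 \<le> c" for c
  proof -
    have "(c / 2) powr s = c powr s * (1/2) powr s"
      using c by (simp add: powr_mult[symmetric])
    also have "\<dots> \<le> c powr s * (1/2) powr 1"
      using s by (intro mult_left_mono powr_mono') auto
    finally show ?thesis by simp
  qed
  then show ?thesis using True ab s by auto
next
  case False
  then have "((1 - 1/2) *\<^sub>R a + (1/2) *\<^sub>R b) powr s \<le> (1 - 1/2) * a powr s + 1/2 * b powr s"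
    using ab by (intro convex_onD[OF powr_convex[OF s]]) auto
  then show ?thesis by (simp add: add_divide_distrib)
qed

lemma norm_midpoint_powr:
  fixes a b :: "'a::real_normed_vector"
  assumes "1 \<le> s"
  shows "norm ((1/2) *\<^sub>R a + (1/2) *\<^sub>R b) powr s \<le> (norm a powr s + norm b powr s) / 2"
proof -
  have "norm ((1/2) *\<^sub>R a + (1/2) *\<^sub>R b) \<le> (norm a + norm b) / 2"
    using norm_triangle_ineq[of "(1/2) *\<^sub>R a" "(1/2) *\<^sub>R b"] by simp
  then have "norm ((1/2) *\<^sub>R a + (1/2) *\<^sub>R b) powr s \<le> ((norm a + norm b) / 2) powr s"
    using assms by (intro powr_mono2) auto
  also have "\<dots> \<le> (norm a powr s + norm b powr s) / 2"
    using assms by (intro powr_convex_nonneg) auto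
  finally show ?thesis .
qed

text \<open>A form of Young's inequality in which the two regimes are separated by the size of
  \<open>\<epsilon> w t powr (p - 1)\<close>, so that no sharp constants are needed.\<close>

lemma young_weight:
  fixes t w p \<epsilon> :: real
  assumes t: "0 \<le> t" and w: "0 < w" and \<epsilon>: "0 < \<epsilon>" and p: "1 < p"
  shows "t\<^sup>2 \<le> \<epsilon> * (w * t powr (p + 1)) + \<epsilon> powr (- 2 / (p - 1)) * w powr (- 2 / (p - 1))"
proof (cases "t = 0")
  case False
  then have t: "0 < t" using t by simp
  show ?thesis
  proof (cases "1 \<le> \<epsilon> * w * t powr (p - 1)")
    case True
    have "t\<^sup>2 * 1 \<le> t\<^sup>2 * (\<epsilon> * w * t powr (p - 1))" using True by (intro mult_left_mono) auto
    also have "\<dots> = \<epsilon> * (w * (t powr 2 * t powr (p - 1)))" using t by (simp add: powr_numeral)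
    also have "t powr 2 * t powr (p - 1) = t powr (p + 1)" by (simp add: powr_add[symmetric] add.commute)
    finally show ?thesis by (simp add: add_increasing2)
  next
    case False
    then have "t powr (p - 1) < 1 / (\<epsilon> * w)" using \<epsilon> w by (simp add: field_simps)
    then have "(t powr (p - 1)) powr (2 / (p - 1)) \<le> (1 / (\<epsilon> * w)) powr (2 / (p - 1))"
      using p by (intro powr_mono2) auto
    also have "(t powr (p - 1)) powr (2 / (p - 1)) = t\<^sup>2"
    proof -
      have "d * (2 / d) = 2" if "d \<noteq> 0" for d :: real using that by simp
      from this[of "p - 1"] have "(p - 1) * (2 / (p - 1)) = 2" using p by auto
      then show ?thesis using t by (simp only: powr_powr powr_numeral)
    qed
    also have "(1 / (\<epsilon> * w)) powr (2 / (p - 1)) = \<epsilon> powr (- 2 / (p - 1)) * w powr (- 2 / (p - 1))"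
    proof -
      have "(1 / y) powr a = y powr (- a)" if "0 < y" for y a :: real
        using that by (simp add: powr_divide powr_minus_divide)
      then show ?thesis using \<epsilon> w by (simp add: powr_mult)
    qed
    finally show ?thesis using \<epsilon> w t by (simp add: add_increasing)
  qed
qed simp

text \<open>Interpolation of the square between the powers 1 and p + 1, split at a free level
  \<open>K\<close>. It raises convergence in L1 to convergence in L2, since the coefficient of the
  high power tends to 0 for large \<open>K\<close>.\<close>

lemma sq_le_linear_plus_powr:
  fixes t K p :: real
  assumes t: "0 \<le> t" and K: "0 < K" and p: "1 < p"
  shows "t\<^sup>2 \<le> K * t + K powr (1 - p) * t powr (p + 1)"
proof (cases "t \<le> K")
  case True
  then have "t\<^sup>2 \<le> K * t" using t by (simp add: power2_eq_square mult_right_mono)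
  then show ?thesis by (simp add: add_increasing2)
next
  case False
  then have tK: "K < t" by simp
  have "t powr (1 - p) \<le> K powr (1 - p)" using p K tK by (intro powr_mono2') auto
  then have "t powr (1 - p) * t powr (p + 1) \<le> K powr (1 - p) * t powr (p + 1)"
    by (intro mult_right_mono) auto
  moreover have "t powr (1 - p) * t powr (p + 1) = t\<^sup>2"
    using K tK by (simp add: powr_add[symmetric] powr_numeral)
  ultimately have "t\<^sup>2 \<le> K powr (1 - p) * t powr (p + 1)" by simp
  moreover have "0 \<le> K * t" using K t by simp
  ultimately show ?thesis by linarith
qed

lemma ball_volume_le: "emeasure lborel (ball (0 :: real^3) R) \<le> ennreal (8 * R^3)" if "0 < R"
proof -
  have "ball (0 :: real^3) R \<subseteq> box (\<chi> i. - R) (\<chi> i. R)"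
  proof
    fix x :: "real^3" assume "x \<in> ball 0 R"
    then have "\<bar>x $ i\<bar> < R" for i using component_le_norm_cart[of x i] by simp
    then show "x \<in> box (\<chi> i. - R) (\<chi> i. R)" by (auto simp: mem_box_cart abs_less_iff minus_less_iff)
  qed
  then have "emeasure lborel (ball (0 :: real^3) R) \<le> emeasure lborel (box (\<chi> i. - R) (\<chi> i. R) :: (real^3) set)"
    by (rule emeasure_mono) simp
  also have "\<dots> = (\<Prod>b\<in>(Basis :: (real^3) set). ((\<chi> i. R) - (\<chi> i. - R)) \<bullet> b)"
    using that by (subst emeasure_lborel_box) (auto simp: cube_vec_inner)
  also have "(\<Prod>b\<in>(Basis :: (real^3) set). ((\<chi> i. R) - (\<chi> i. - R)) \<bullet> b) = (\<Prod>b\<in>(Basis :: (real^3) set). 2 * R)"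
    by (intro prod.cong) (auto simp: inner_diff_left cube_vec_inner)
  also have "\<dots> = 8 * R^3" by (simp add: power_mult_distrib)
  finally show ?thesis .
qed

text \<open>Comparison with a series over the balls of radius 2^k: their volume is of order 8^k and
  the coefficient of order q^k, and \<beta> > 3 is what makes 8 q < 1.\<close>

lemma integrable_power_decay:
  assumes \<beta>: "3 < \<beta>"
  shows "integrable lborel (\<lambda>x :: real^3. (1 + norm x) powr (- \<beta>))"
proof (rule integrableI_nonneg)
  define q where "q = 2 powr (- \<beta>)"
  have q: "0 < q" "8 * q < 1"
  proof -
    have "2 powr (- \<beta>) < 2 powr (- 3 :: real)" using \<beta> by (intro powr_less_mono) auto
    also have "2 powr (- 3 :: real) = 1/8" by (simp add: powr_minus powr_numeral)
    finally show "0 < q" "8 * q < 1" by (auto simp: q_def)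
  qed
  have pw: "ennreal ((1 + norm x) powr (- \<beta>)) \<le> (\<Sum>k. ennreal (2 powr \<beta> * q^k) * indicator (ball 0 (2^k)) x)"
    for x :: "real^3"
  proof -
    \<comment> \<open>The first dyadic ball containing \<open>x\<close>. Not lying in the previous
      one bounds the integrand by q^(k-1), and the factor \<open>2 powr \<beta>\<close> pays for
      that shift of the index.\<close>
    define k where "k = (LEAST k. norm x < 2^k)"
    have ex: "\<exists>k. norm x < 2^k" using real_arch_pow[of 2 "norm x"] by auto
    have k: "norm x < 2^k" unfolding k_def using ex by (rule LeastI_ex)
    have "(1 + norm x) powr (- \<beta>) \<le> 2 powr \<beta> * q^k"
    proof (cases k)
      case 0
      have "(1 + norm x) powr (- \<beta>) \<le> 1 powr (- \<beta>)" using \<beta> by (intro powr_mono2') auto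
      also have "\<dots> \<le> 2 powr \<beta>" using \<beta> by (simp add: ge_one_powr_ge_zero)
      finally show ?thesis using 0 by simp
    next
      case (Suc j)
      have "\<not> norm x < 2^j"
        using not_less_Least[of j "\<lambda>k. norm x < 2^k"] Suc by (simp add: k_def)
      then have "(1 + norm x) powr (- \<beta>) \<le> (2^j) powr (- \<beta>)" using \<beta> by (intro powr_mono2') auto
      also have "\<dots> = q^j" by (simp add: q_def powr_power powr_realpow[symmetric] powr_powr mult.commute)
      also have "\<dots> = 2 powr \<beta> * q^k" unfolding Suc by (simp add: q_def powr_minus)
      finally show ?thesis .
    qed
    then have "ennreal ((1 + norm x) powr (- \<beta>)) \<le> ennreal (2 powr \<beta> * q^k) * indicator (ball 0 (2^k)) x"
      using k by (simp add: ennreal_leI)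
    also have "\<dots> \<le> (\<Sum>k. ennreal (2 powr \<beta> * q^k) * indicator (ball 0 (2^k)) x)"
    proof -
      define f where "f k = ennreal (2 powr \<beta> * q^k) * indicator (ball 0 (2^k)) x" for k
      have "f k \<le> (\<Sum>k. f k)" using sum_le_suminf[of f "{k}"] by simp
      then show ?thesis by (simp only: f_def)
    qed
    finally show ?thesis .
  qed
  have "(\<integral>\<^sup>+(x::real^3). ennreal ((1 + norm x) powr (- \<beta>)) \<partial>lborel)
      \<le> (\<integral>\<^sup>+(x::real^3). (\<Sum>k. ennreal (2 powr \<beta> * q^k) * indicator (ball 0 (2^k)) x) \<partial>lborel)"
    by (rule nn_integral_mono) (rule pw)
  also have "\<dots> = (\<Sum>k. \<integral>\<^sup>+(x::real^3). ennreal (2 powr \<beta> * q^k) * indicator (ball 0 (2^k)) x \<partial>lborel)"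
    by (rule nn_integral_suminf) measurable
  also have "\<dots> \<le> (\<Sum>k. ennreal (2 powr \<beta> * 8 * (8 * q)^k))"
  proof (intro suminf_le allI)
    fix k
    have "(\<integral>\<^sup>+(x::real^3). ennreal (2 powr \<beta> * q^k) * indicator (ball 0 (2^k)) x \<partial>lborel)
        = ennreal (2 powr \<beta> * q^k) * emeasure lborel (ball (0::real^3) (2^k))"
      by (subst nn_integral_cmult_indicator) auto
    also have "\<dots> \<le> ennreal (2 powr \<beta> * q^k) * ennreal (8 * (2^k)^3)"
      by (intro mult_left_mono ball_volume_le) auto
    also have "\<dots> = ennreal ((2 powr \<beta> * q^k) * (8 * (2^k)^3))"
      using q by (intro ennreal_mult[symmetric]) auto
    also have "(2 powr \<beta> * q^k) * (8 * (2^k)^3) = 2 powr \<beta> * 8 * (8 * q)^k"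
    proof -
      have "((2::real)^k)^3 = (2^3)^k" by (metis power_mult mult.commute)
      then show ?thesis by (simp add: power_mult_distrib)
    qed
    finally show "(\<integral>\<^sup>+(x::real^3). ennreal (2 powr \<beta> * q^k) * indicator (ball 0 (2^k)) x \<partial>lborel)
        \<le> ennreal (2 powr \<beta> * 8 * (8 * q)^k)" .
  qed auto
  also have "\<dots> = ennreal (\<Sum>k. 2 powr \<beta> * 8 * (8 * q)^k)"
    using q by (intro suminf_ennreal2 summable_mult summable_geometric) auto
  also have "\<dots> < \<infinity>" by simp
  finally show "(\<integral>\<^sup>+(x::real^3). ennreal ((1 + norm x) powr (- \<beta>)) \<partial>lborel) < \<infinity>" .
qed auto

section \<open>The energy under the hypotheses of the theorem\<close>

locale defocusing =
  fixes p :: real and V \<Gamma> :: "real^3 \<Rightarrow> real" and \<alpha> C v v0 :: real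
  assumes p: "1 < p"
    and V_meas [measurable]: "V \<in> borel_measurable lebesgue"
    and \<Gamma>_meas [measurable]: "\<Gamma> \<in> borel_measurable lebesgue"
    and \<Gamma>_loc: "L_inf_loc \<Gamma>"
    and V_sym: "cylindrically_symmetric V" and \<Gamma>_sym: "cylindrically_symmetric \<Gamma>"
    and \<alpha>: "3 / 2 * (p - 1) < \<alpha>" and C: "0 < C"
    and \<Gamma>_le: "\<And>x. \<Gamma> x \<le> - C * (1 + norm x) powr \<alpha>"
    and V_bound: "AE x in lebesgue. \<bar>V x\<bar> \<le> v"
    and V_neg: "AE x in lebesgue. V x \<le> - v0" and v0: "0 < v0" and v: "0 < v"
begin

lemma \<alpha>_pos: "0 < \<alpha>"
  using \<alpha> p by (smt (verit) zero_less_mult_iff divide_pos_pos)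

lemma \<Gamma>_ge: "C * (1 + norm x) powr \<alpha> \<le> \<bar>\<Gamma> x\<bar>" "C \<le> \<bar>\<Gamma> x\<bar>" "0 < \<bar>\<Gamma> x\<bar>" "\<Gamma> x = - \<bar>\<Gamma> x\<bar>"
proof -
  have 1: "C * 1 \<le> C * (1 + norm x) powr \<alpha>"
    using C \<alpha>_pos by (intro mult_left_mono) (auto simp: ge_one_powr_ge_zero)
  then have "\<Gamma> x < 0" using \<Gamma>_le[of x] C by linarith
  then show "C * (1 + norm x) powr \<alpha> \<le> \<bar>\<Gamma> x\<bar>" "C \<le> \<bar>\<Gamma> x\<bar>" "0 < \<bar>\<Gamma> x\<bar>" "\<Gamma> x = - \<bar>\<Gamma> x\<bar>"
    using \<Gamma>_le[of x] 1 by auto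
qed

text \<open>The remainder of \<open>young_weight\<close> for the weight |\<Gamma>|, up to the power
  of \<epsilon>.\<close>

definition decay :: "real^3 \<Rightarrow> real" where "decay x = \<bar>\<Gamma> x\<bar> powr (- 2 / (p - 1))"

lemma decay_meas [measurable]: "decay \<in> borel_measurable lebesgue"
  unfolding decay_def[abs_def] by measurable

lemma decay_nonneg: "0 \<le> decay x" by (simp add: decay_def)

text \<open>The growth condition on \<Gamma> says 2 \<alpha> / (p - 1) > 3, the threshold of
  integrability at infinity in three dimensions.\<close>

lemma decay_integrable: "integrable lebesgue decay"
proof (rule Bochner_Integration.integrable_bound)
  define \<beta> where "\<beta> = 2 * \<alpha> / (p - 1)"
  have \<beta>: "3 < \<beta>" using \<alpha> p by (simp add: \<beta>_def field_simps)
  have "integrable lebesgue (\<lambda>x :: real^3. (1 + norm x) powr (- \<beta>))"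
    using integrable_power_decay[OF \<beta>] by (simp add: integrable_completion)
  then show "integrable lebesgue (\<lambda>x :: real^3. C powr (- 2 / (p - 1)) * (1 + norm x) powr (- \<beta>))" by simp
  show "AE x in lebesgue. norm (decay x) \<le> norm (C powr (- 2 / (p - 1)) * (1 + norm x) powr (- \<beta>))"
  proof (rule AE_I2)
    fix x :: "real^3"
    have "0 < 1 + norm x" by (rule add_pos_nonneg) auto
    then have "(1 + norm x) powr \<alpha> > 0" by simp
    then have "decay x \<le> (C * (1 + norm x) powr \<alpha>) powr (- 2 / (p - 1))"
      unfolding decay_def using \<Gamma>_ge(1)[of x] p C by (intro powr_mono2') auto
    also have "\<dots> = C powr (- 2 / (p - 1)) * (1 + norm x) powr (- \<beta>)"
      using C by (simp add: powr_mult powr_powr \<beta>_def mult.commute[of 2])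
    finally show "norm (decay x) \<le> norm (C powr (- 2 / (p - 1)) * (1 + norm x) powr (- \<beta>))"
      using decay_nonneg by simp
  qed
qed measurable

lemma young_\<Gamma>:
  assumes "0 < \<epsilon>"
  shows "(norm (u :: real^3))\<^sup>2 \<le> \<epsilon> * (\<bar>\<Gamma> x\<bar> * norm u powr (p + 1)) + \<epsilon> powr (- 2 / (p - 1)) * decay x"
  unfolding decay_def using young_weight[OF norm_ge_zero \<Gamma>_ge(3) assms p] .

lemma weighted_integrable_cong:
  assumes "U \<in> borel_measurable lebesgue" "U' \<in> borel_measurable lebesgue" "AE x in lebesgue. U x = U' x"
    "integrable lebesgue (\<lambda>x. \<bar>\<Gamma> x\<bar> * norm (U x :: real^3) powr (p + 1))"
  shows "integrable lebesgue (\<lambda>x. \<bar>\<Gamma> x\<bar> * norm (U' x) powr (p + 1))"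
proof (rule integrable_cong_AE_imp[OF assms(4)])
  note [measurable] = assms(1,2)
  show "(\<lambda>x. \<bar>\<Gamma> x\<bar> * norm (U' x) powr (p + 1)) \<in> borel_measurable lebesgue" by measurable
  show "AE x in lebesgue. \<bar>\<Gamma> x\<bar> * norm (U x) powr (p + 1) = \<bar>\<Gamma> x\<bar> * norm (U' x) powr (p + 1)"
    using assms(3) by eventually_elim simp
qed

lemma X_D:
  assumes "U \<in> X p \<Gamma>"
  shows "U \<in> H_curl" "U \<in> L2" "U \<in> borel_measurable lebesgue" "weak_curl U \<in> L2" "is_weak_curl U (weak_curl U)"
    "integrable lebesgue (\<lambda>x. \<bar>\<Gamma> x\<bar> * norm (U x) powr (p + 1))"
  using assms weak_curl[of U] by (auto simp: X_def L_weighted_def H_curl_def L2_def)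

text \<open>Square integrability comes for free: Young's inequality derives it from the weighted
  integral and the integrability of \<open>decay\<close>.\<close>

lemma X_I:
  assumes U: "U \<in> borel_measurable lebesgue" and W: "W \<in> L2" "is_weak_curl U W"
    and i: "integrable lebesgue (\<lambda>x. \<bar>\<Gamma> x\<bar> * norm (U x) powr (p + 1))"
  shows "U \<in> X p \<Gamma>"
proof -
  have "U \<in> L2"
  proof (rule L2_bound[OF _ U])
    show "integrable lebesgue (\<lambda>x. 1 * (\<bar>\<Gamma> x\<bar> * norm (U x) powr (p + 1)) + 1 powr (- 2 / (p - 1)) * decay x)"
      using i decay_integrable by simp
    show "AE x in lebesgue. (norm (U x))\<^sup>2 \<le> 1 * (\<bar>\<Gamma> x\<bar> * norm (U x) powr (p + 1)) + 1 powr (- 2 / (p - 1)) * decay x"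
      by (intro AE_I2 young_\<Gamma>) simp
  qed
  then show ?thesis using W i U by (auto simp: X_def L_weighted_def intro: H_curlI)
qed

lemma weighted_integrable_lincomb:
  assumes U: "U \<in> borel_measurable lebesgue" "integrable lebesgue (\<lambda>x. \<bar>\<Gamma> x\<bar> * norm (U x :: real^3) powr (p + 1))"
    and U': "U' \<in> borel_measurable lebesgue" "integrable lebesgue (\<lambda>x. \<bar>\<Gamma> x\<bar> * norm (U' x) powr (p + 1))"
  shows "integrable lebesgue (\<lambda>x. \<bar>\<Gamma> x\<bar> * norm (a *\<^sub>R U x + b *\<^sub>R U' x) powr (p + 1))"
    "norm (a *\<^sub>R U x + b *\<^sub>R U' x) powr (p + 1)
      \<le> 2 powr (p + 1) * (\<bar>a\<bar> powr (p + 1) * norm (U x) powr (p + 1) + \<bar>b\<bar> powr (p + 1) * norm (U' x) powr (p + 1))"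
proof -
  note [measurable] = U(1) U'(1)
  have le: "norm (a *\<^sub>R U x + b *\<^sub>R U' x) powr (p + 1)
      \<le> 2 powr (p + 1) * (\<bar>a\<bar> powr (p + 1) * norm (U x) powr (p + 1) + \<bar>b\<bar> powr (p + 1) * norm (U' x) powr (p + 1))" for x
  proof -
    have "norm (a *\<^sub>R U x + b *\<^sub>R U' x) powr (p + 1) \<le> (norm (a *\<^sub>R U x) + norm (b *\<^sub>R U' x)) powr (p + 1)"
      using p by (intro powr_mono2 norm_triangle_ineq) auto
    also have "\<dots> \<le> 2 powr (p + 1) * (norm (a *\<^sub>R U x) powr (p + 1) + norm (b *\<^sub>R U' x) powr (p + 1))"
      using p by (intro powr_add_le) auto
    finally show ?thesis by (simp add: powr_mult)
  qed
  then show "norm (a *\<^sub>R U x + b *\<^sub>R U' x) powr (p + 1)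
      \<le> 2 powr (p + 1) * (\<bar>a\<bar> powr (p + 1) * norm (U x) powr (p + 1) + \<bar>b\<bar> powr (p + 1) * norm (U' x) powr (p + 1))" .
  show "integrable lebesgue (\<lambda>x. \<bar>\<Gamma> x\<bar> * norm (a *\<^sub>R U x + b *\<^sub>R U' x) powr (p + 1))"
  proof (rule Bochner_Integration.integrable_bound)
    show "integrable lebesgue (\<lambda>x. 2 powr (p + 1) * (\<bar>a\<bar> powr (p + 1) * (\<bar>\<Gamma> x\<bar> * norm (U x) powr (p + 1))
        + \<bar>b\<bar> powr (p + 1) * (\<bar>\<Gamma> x\<bar> * norm (U' x) powr (p + 1))))"
      using U(2) U'(2) by simp
    show "AE x in lebesgue. norm (\<bar>\<Gamma> x\<bar> * norm (a *\<^sub>R U x + b *\<^sub>R U' x) powr (p + 1))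
        \<le> norm (2 powr (p + 1) * (\<bar>a\<bar> powr (p + 1) * (\<bar>\<Gamma> x\<bar> * norm (U x) powr (p + 1))
        + \<bar>b\<bar> powr (p + 1) * (\<bar>\<Gamma> x\<bar> * norm (U' x) powr (p + 1))))"
    proof (rule AE_I2)
      fix x
      have "\<bar>\<Gamma> x\<bar> * norm (a *\<^sub>R U x + b *\<^sub>R U' x) powr (p + 1) \<le> \<bar>\<Gamma> x\<bar> * (2 powr (p + 1) *
          (\<bar>a\<bar> powr (p + 1) * norm (U x) powr (p + 1) + \<bar>b\<bar> powr (p + 1) * norm (U' x) powr (p + 1)))"
        by (intro mult_left_mono le) auto
      also have "\<dots> = 2 powr (p + 1) * (\<bar>a\<bar> powr (p + 1) * (\<bar>\<Gamma> x\<bar> * norm (U x) powr (p + 1))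
        + \<bar>b\<bar> powr (p + 1) * (\<bar>\<Gamma> x\<bar> * norm (U' x) powr (p + 1)))"
        by (simp add: algebra_simps)
      finally show "norm (\<bar>\<Gamma> x\<bar> * norm (a *\<^sub>R U x + b *\<^sub>R U' x) powr (p + 1))
        \<le> norm (2 powr (p + 1) * (\<bar>a\<bar> powr (p + 1) * (\<bar>\<Gamma> x\<bar> * norm (U x) powr (p + 1))
        + \<bar>b\<bar> powr (p + 1) * (\<bar>\<Gamma> x\<bar> * norm (U' x) powr (p + 1))))" by simp
    qed
  qed measurable
qed

lemma X_lincomb:
  assumes U: "U \<in> X p \<Gamma>" and U': "U' \<in> X p \<Gamma>"
  shows "(\<lambda>x. a *\<^sub>R U x + b *\<^sub>R U' x) \<in> X p \<Gamma>"
  using weak_curl_lincomb(1)[OF X_D(1)[OF U] X_D(1)[OF U']] weighted_integrable_lincomb(1)[OF X_D(3,6)[OF U] X_D(3,6)[OF U']]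
    X_D(3)[OF U] X_D(3)[OF U']
  by (auto simp: X_def L_weighted_def)

lemma X_G1_lincomb:
  assumes U: "U \<in> X_G1 p \<Gamma>" and U': "U' \<in> X_G1 p \<Gamma>"
  shows "(\<lambda>x. a *\<^sub>R U x + b *\<^sub>R U' x) \<in> X_G1 p \<Gamma>"
proof -
  obtain q q' where q [measurable]: "q \<in> borel_measurable (lebesgue_on ({0<..} \<times> UNIV))"
      "q' \<in> borel_measurable (lebesgue_on ({0<..} \<times> UNIV))"
    and eq: "AE x in lebesgue. U x = (q (cyl_radius x, x $ 3) / cyl_radius x) *\<^sub>R vector [- (x $ 2), x $ 1, 0]"
      "AE x in lebesgue. U' x = (q' (cyl_radius x, x $ 3) / cyl_radius x) *\<^sub>R vector [- (x $ 2), x $ 1, 0]"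
    using U U' unfolding X_G1_def by auto
  have "(\<lambda>x. a *\<^sub>R U x + b *\<^sub>R U' x) \<in> X p \<Gamma>"
    using U U' by (intro X_lincomb) (auto simp: X_G1_def)
  moreover have "(\<lambda>z. a * q z + b * q' z) \<in> borel_measurable (lebesgue_on ({0<..} \<times> UNIV))" by measurable
  moreover have "AE x in lebesgue. a *\<^sub>R U x + b *\<^sub>R U' x
      = ((a * q (cyl_radius x, x $ 3) + b * q' (cyl_radius x, x $ 3)) / cyl_radius x) *\<^sub>R vector [- (x $ 2), x $ 1, 0]"
    using eq by eventually_elim (simp add: scaleR_add_left[symmetric] add_divide_distrib)
  ultimately show ?thesis unfolding X_G1_def by fast
qed

lemma X_G1_X: "U \<in> X_G1 p \<Gamma> \<Longrightarrow> U \<in> X p \<Gamma>" by (simp add: X_G1_def)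

lemma X_zero: "(\<lambda>x. 0) \<in> X p \<Gamma>"
  by (rule X_I[of _ "\<lambda>x. 0"]) (auto simp: is_weak_curl_def)

lemma X_G1_zero: "(\<lambda>x. 0) \<in> X_G1 p \<Gamma>"
  unfolding X_G1_def using X_zero by (auto intro!: bexI[of _ "\<lambda>_. 0"])

text \<open>The curl is a separate argument, so that any representative of it can be inserted;
  \<open>J_eq\<close> leads back to the energy.\<close>

definition dens :: "vfield \<Rightarrow> vfield \<Rightarrow> real^3 \<Rightarrow> real" where
  "dens U W x = 1 / 2 * ((norm (W x))\<^sup>2 + V x * (norm (U x))\<^sup>2) - \<Gamma> x / (p + 1) * norm (U x) powr (p + 1)"

lemma dens_meas [measurable]:
  "U \<in> borel_measurable lebesgue \<Longrightarrow> W \<in> borel_measurable lebesgue \<Longrightarrow> dens U W \<in> borel_measurable lebesgue"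
proof -
  assume [measurable]: "U \<in> borel_measurable lebesgue" "W \<in> borel_measurable lebesgue"
  show "dens U W \<in> borel_measurable lebesgue" unfolding dens_def[abs_def] by measurable
qed

lemma dens_alt: "dens U W x = 1/2 * (norm (W x))\<^sup>2 + 1/2 * (V x * (norm (U x))\<^sup>2) + 1/(p + 1) * (\<bar>\<Gamma> x\<bar> * norm (U x) powr (p + 1))"
  unfolding dens_def by (subst \<Gamma>_ge(4)) (simp add: field_simps)

lemma V_sq_integrable: assumes "U \<in> L2" shows "integrable lebesgue (\<lambda>x. V x * (norm (U x))\<^sup>2)"
proof (rule Bochner_Integration.integrable_bound)
  show "integrable lebesgue (\<lambda>x. v * (norm (U x))\<^sup>2)" using L2_integrable[OF assms] by simp
  note [measurable] = L2_measurable[OF assms]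
  show "(\<lambda>x. V x * (norm (U x))\<^sup>2) \<in> borel_measurable lebesgue" by measurable
  show "AE x in lebesgue. norm (V x * (norm (U x))\<^sup>2) \<le> norm (v * (norm (U x))\<^sup>2)"
    using V_bound by eventually_elim (simp add: abs_mult mult_right_mono)
qed

lemma dens_integrable:
  assumes U: "U \<in> X p \<Gamma>" and W: "W \<in> L2"
  shows "integrable lebesgue (dens U W)"
proof -
  have "integrable lebesgue (\<lambda>x. 1/2 * (norm (W x))\<^sup>2 + 1/2 * (V x * (norm (U x))\<^sup>2) + 1/(p + 1) * (\<bar>\<Gamma> x\<bar> * norm (U x) powr (p + 1)))"
    by (intro Bochner_Integration.integrable_add integrable_mult_right L2_integrable[OF W] V_sq_integrable X_D(6) X_D(2) U)
  then show ?thesis by (simp add: dens_alt[abs_def])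
qed

lemma J_eq:
  assumes U: "U \<in> X p \<Gamma>" and W: "W \<in> L2" "is_weak_curl U W"
  shows "J p V \<Gamma> U = (LINT x|lebesgue. dens U W x)"
proof -
  have "J p V \<Gamma> U = (LINT x|lebesgue. dens U (weak_curl U) x)" by (simp add: J_def dens_def)
  also have "\<dots> = (LINT x|lebesgue. dens U W x)"
  proof (rule integral_cong_AE)
    note [measurable] = X_D(3)[OF U] L2_measurable[OF W(1)] L2_measurable[OF X_D(4)[OF U]]
    show "dens U (weak_curl U) \<in> borel_measurable lebesgue" "dens U W \<in> borel_measurable lebesgue" by measurable
    show "AE x in lebesgue. dens U (weak_curl U) x = dens U W x"
      using weak_curl_eq[OF X_D(2)[OF U] W] by eventually_elim (simp add: dens_def)
  qed
  finally show ?thesis .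
qed

text \<open>The parameter 1 / (v (p + 1)) is the one for which v/2 times the weighted part of
  Young's bound equals half of the coefficient 1 / (p + 1) in the energy.\<close>

definition young_const :: real where "young_const = v / 2 * (1 / (v * (p + 1))) powr (- 2 / (p - 1))"

text \<open>The negative contribution of \<open>V\<close> is absorbed by one half of the weighted
  term. The bound is kept pointwise because it also supplies the nonnegativity that Fatou's lemma
  asks for.\<close>

lemma dens_lower:
  "AE x in lebesgue. 1/2 * (norm (W x))\<^sup>2 + 1/(2 * (p + 1)) * (\<bar>\<Gamma> x\<bar> * norm (U x) powr (p + 1)) \<le> dens U W x + young_const * decay x"
  using V_bound
proof eventually_elim
  case (elim x)
  define T where "T = \<bar>\<Gamma> x\<bar> * norm (U x) powr (p + 1)"
  have e: "0 < 1 / (v * (p + 1))" using v p by simp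
  have "(norm (U x))\<^sup>2 \<le> 1 / (v * (p + 1)) * T + (1 / (v * (p + 1))) powr (- 2 / (p - 1)) * decay x"
    unfolding T_def by (rule young_\<Gamma>[OF e])
  then have "v / 2 * (norm (U x))\<^sup>2 \<le> v / 2 * (1 / (v * (p + 1)) * T + (1 / (v * (p + 1))) powr (- 2 / (p - 1)) * decay x)"
    using v by (intro mult_left_mono) auto
  also have "\<dots> = 1/(2 * (p + 1)) * T + young_const * decay x"
  proof -
    have "v / 2 * (1 / (v * P) * T + b * c) = 1/(2 * P) * T + v / 2 * b * c" if "0 < P" for P b c
      using v that by (simp add: field_simps)
    from this[of "p + 1"] show ?thesis using p by (simp only: young_const_def)
  qed
  finally have 1: "v / 2 * (norm (U x))\<^sup>2 \<le> 1/(2 * (p + 1)) * T + young_const * decay x" .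
  have "(- v) * (norm (U x))\<^sup>2 \<le> V x * (norm (U x))\<^sup>2"
    using elim by (intro mult_right_mono) auto
  then have "- (v / 2 * (norm (U x))\<^sup>2) \<le> 1/2 * (V x * (norm (U x))\<^sup>2)" by simp
  moreover have "1/(p + 1) * T = 1/(2 * (p + 1)) * T + 1/(2 * (p + 1)) * T"
  proof -
    have "1/P * T = 1/(2 * P) * T + 1/(2 * P) * T" if "0 < P" for P
      using that by (simp add: field_simps)
    from this[of "p + 1"] show ?thesis using p by simp
  qed
  moreover have "w + s \<le> w + b + t + k" if "- a \<le> b" "t = s + s" "a \<le> s + k" for w s b t k a :: real
    using that by linarith
  ultimately show ?case using 1 unfolding dens_alt T_def[symmetric] by blast
qed

lemma J_lower:
  assumes U: "U \<in> X p \<Gamma>"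
  shows "1/2 * (LINT x|lebesgue. (norm (weak_curl U x))\<^sup>2)
      + 1/(2 * (p + 1)) * (LINT x|lebesgue. \<bar>\<Gamma> x\<bar> * norm (U x) powr (p + 1))
    \<le> J p V \<Gamma> U + young_const * (LINT x|lebesgue. decay x)"
proof -
  note i = L2_integrable[OF X_D(4)[OF U]] X_D(6)[OF U] dens_integrable[OF U X_D(4)[OF U]] decay_integrable
  have "(LINT x|lebesgue. 1/2 * (norm (weak_curl U x))\<^sup>2 + 1/(2 * (p + 1)) * (\<bar>\<Gamma> x\<bar> * norm (U x) powr (p + 1)))
      \<le> (LINT x|lebesgue. dens U (weak_curl U) x + young_const * decay x)"
    by (rule integral_mono_AE) (use i dens_lower in \<open>auto simp del: times_divide_eq_left\<close>)
  then show ?thesis using i J_eq[OF U X_D(4,5)[OF U]] by simp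
qed

lemma L2_norm_upper:
  assumes U: "U \<in> X p \<Gamma>"
  shows "(LINT x|lebesgue. (norm (U x))\<^sup>2)
    \<le> (LINT x|lebesgue. \<bar>\<Gamma> x\<bar> * norm (U x) powr (p + 1)) + (LINT x|lebesgue. decay x)"
proof -
  have "(LINT x|lebesgue. (norm (U x))\<^sup>2) \<le> (LINT x|lebesgue. \<bar>\<Gamma> x\<bar> * norm (U x) powr (p + 1) + decay x)"
  proof (rule integral_mono)
    show "(norm (U x))\<^sup>2 \<le> \<bar>\<Gamma> x\<bar> * norm (U x) powr (p + 1) + decay x" for x
      using young_\<Gamma>[of 1 "U x" x] by simp
  qed (use L2_integrable[OF X_D(2)[OF U]] X_D(6)[OF U] decay_integrable in auto)
  then show ?thesis using X_D(6)[OF U] decay_integrable by simp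
qed

end

section \<open>Compactness of bounded sequences of azimuthal fields\<close>

lemma azimuthal_cong:
  assumes az: "azimuthal U" and eq: "AE x in lebesgue. U x = U' x"
  shows "azimuthal U'"
  unfolding azimuthal_def
proof (intro conjI allI)
  fix \<theta>
  show "AE x in lebesgue. U' (rot \<theta> x) = rot \<theta> (U' x)"
    using az[unfolded azimuthal_def, THEN conjunct1, THEN spec[of _ \<theta>]] eq AE_rot[OF eq, of \<theta>]
    by eventually_elim simp
  show "AE x in lebesgue. U' x $ 3 = 0 \<and> x $ 1 * U' x $ 1 + x $ 2 * U' x $ 2 = 0"
    using az[unfolded azimuthal_def, THEN conjunct2] eq by eventually_elim simp
qed

lemma is_weak_curl_cong_AE_right:
  assumes eq: "AE x in lebesgue. W x = W' x" and W: "W \<in> borel_measurable lebesgue" "W' \<in> borel_measurable lebesgue"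
  shows "is_weak_curl U W \<longleftrightarrow> is_weak_curl U W'"
proof -
  have "(LINT x|lebesgue. W x \<bullet> \<phi> x) = (LINT x|lebesgue. W' x \<bullet> \<phi> x)" if "\<phi> \<in> test_fields" for \<phi>
  proof (rule integral_cong_AE)
    note [measurable] = W L2_measurable[OF test_fields_L2[OF that]]
    show "(\<lambda>x. W x \<bullet> \<phi> x) \<in> borel_measurable lebesgue" "(\<lambda>x. W' x \<bullet> \<phi> x) \<in> borel_measurable lebesgue"
      by measurable
    show "AE x in lebesgue. W x \<bullet> \<phi> x = W' x \<bullet> \<phi> x" using eq by eventually_elim simp
  qed
  then show ?thesis by (simp add: is_weak_curl_def)
qed

lemma locint_swirl: "U \<in> L2 \<Longrightarrow> locint (swirl U)"
  unfolding swirl_def[abs_def]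
  by (intro locint_diff locint_mult_continuous L2_locint continuous_on_component continuous_on_id)

lemma locint_swirl_grad: assumes "W \<in> L2" shows "locint (swirl_grad W j)"
proof (cases "j = 3")
  case True
  have "locint (\<lambda>x. - 1 * (x $ 1 * W x $ 1 + x $ 2 * W x $ 2))"
    by (intro locint_mult_continuous[of _ "\<lambda>x. - 1"] locint_add locint_mult_continuous L2_locint assms
        continuous_on_component continuous_on_id continuous_on_const)
  then show ?thesis using True by (simp add: swirl_grad_def[abs_def])
next
  case False
  have "locint (\<lambda>x. x $ j * W x $ 3)"
    by (intro locint_mult_continuous L2_locint assms continuous_on_component continuous_on_id)
  then show ?thesis using False by (simp add: swirl_grad_def[abs_def])
qed

lemma swirl_borel: "U \<in> borel_measurable borel \<Longrightarrow> swirl U \<in> borel_measurable borel"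
proof -
  assume [measurable]: "U \<in> borel_measurable borel"
  show ?thesis unfolding swirl_def[abs_def] by measurable
qed

lemma swirl_grad_borel: "W \<in> borel_measurable borel \<Longrightarrow> swirl_grad W j \<in> borel_measurable borel"
proof -
  assume [measurable]: "W \<in> borel_measurable borel"
  show ?thesis unfolding swirl_grad_def[abs_def] by measurable
qed

lemma abs_nth_mult_le:
  fixes x y :: "real^3"
  assumes "norm x < R" shows "\<bar>x $ i * y $ j\<bar> \<le> R * norm y"
  unfolding abs_mult
  using component_le_norm_cart[of x i] component_le_norm_cart[of y j] assms
  by (intro mult_mono) (auto intro: order_trans[OF norm_ge_zero])

lemma swirl_le: assumes "norm x < R" shows "\<bar>swirl U x\<bar> \<le> 2 * R * norm (U x)"
  unfolding swirl_def
  using abs_triangle_ineq4[of "x $ 1 * U x $ 2" "x $ 2 * U x $ 1"]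
    abs_nth_mult_le[OF assms, of 1 "U x" 2] abs_nth_mult_le[OF assms, of 2 "U x" 1] by linarith

lemma swirl_grad_le: assumes "norm x < R" shows "(\<Sum>j\<in>UNIV. \<bar>swirl_grad W j x\<bar>) \<le> 4 * R * norm (W x)"
proof -
  have "\<bar>- (x $ 1 * W x $ 1 + x $ 2 * W x $ 2)\<bar> \<le> \<bar>x $ 1 * W x $ 1\<bar> + \<bar>x $ 2 * W x $ 2\<bar>"
    by (simp only: abs_minus_cancel abs_triangle_ineq)
  then show ?thesis
    using abs_nth_mult_le[OF assms, of 1 "W x" 3] abs_nth_mult_le[OF assms, of 2 "W x" 3]
      abs_nth_mult_le[OF assms, of 1 "W x" 1] abs_nth_mult_le[OF assms, of 2 "W x" 2]
    unfolding sum_3 swirl_grad_def by simp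
qed

text \<open>On a ball, t \<le> 1 + t^2 bounds an L1 norm by the volume plus a squared L2
  norm.\<close>

lemma ball_integral_le:
  assumes Z: "Z \<in> L2" and F: "F \<in> borel_measurable borel" and F0: "\<And>x. 0 \<le> F x"
    and le: "\<And>x. norm x < R \<Longrightarrow> F x \<le> c * norm (Z x)" and c: "0 \<le> c"
  shows "(LINT x|lborel. indicator (ball 0 R) x * F x)
    \<le> c * ((LINT x|lebesgue. indicator (ball (0::real^3) R) x) + (LINT x|lebesgue. (norm (Z x))\<^sup>2))"
proof -
  note [measurable] = F
  have m: "(\<lambda>x. indicator (ball 0 R) x * F x) \<in> borel_measurable lborel" by measurable
  have i: "integrable lebesgue (\<lambda>x. c * (indicator (ball 0 R) x + (norm (Z x))\<^sup>2))"
    using L2_integrable[OF Z] integrable_indicator_ball by simp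
  have "(LINT x|lborel. indicator (ball 0 R) x * F x) = (LINT x|lebesgue. indicator (ball 0 R) x * F x)"
    using m by (simp add: integral_completion)
  also have "\<dots> \<le> (LINT x|lebesgue. c * (indicator (ball 0 R) x + (norm (Z x))\<^sup>2))"
  proof (rule integral_mono'[OF i])
    fix x
    have 1: "norm (Z x) \<le> 1 + (norm (Z x))\<^sup>2" using abs_mult_le_sum_sq[of 1 "norm (Z x)"] by simp
    show "indicator (ball 0 R) x * F x \<le> c * (indicator (ball 0 R) x + (norm (Z x))\<^sup>2)"
    proof (cases "norm x < R")
      case True
      have "F x \<le> c * norm (Z x)" by (rule le[OF True])
      also have "\<dots> \<le> c * (1 + (norm (Z x))\<^sup>2)" by (rule mult_left_mono[OF 1 c])
      finally show ?thesis using True by simp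
    qed (use c in simp)
    show "0 \<le> c * (indicator (ball 0 R) x + (norm (Z x))\<^sup>2)" using c by simp
  qed
  also have "\<dots> = c * ((LINT x|lebesgue. indicator (ball (0::real^3) R) x) + (LINT x|lebesgue. (norm (Z x))\<^sup>2))"
    using L2_integrable[OF Z] integrable_indicator_ball by simp
  finally show ?thesis .
qed

text \<open>Lagrange's identity in the plane: the inner product with (x1, x2) vanishes, so the swirl
  carries the whole product of the norms.\<close>

lemma azimuthal_norm:
  assumes "U $ 3 = 0" "x $ 1 * U $ 1 + x $ 2 * U $ 2 = 0"
  shows "norm (U :: real^3) * cyl_radius x = \<bar>x $ 1 * U $ 2 - x $ 2 * U $ 1\<bar>"
proof -
  have "(norm U * cyl_radius x)\<^sup>2 = ((U $ 1)\<^sup>2 + (U $ 2)\<^sup>2) * ((x $ 1)\<^sup>2 + (x $ 2)\<^sup>2)"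
  proof -
    have "(norm U)\<^sup>2 = (U $ 1)\<^sup>2 + (U $ 2)\<^sup>2"
      using assms(1) by (simp only: power2_norm_eq_inner inner_3) (simp add: power2_eq_square)
    moreover have "(cyl_radius x)\<^sup>2 = (x $ 1)\<^sup>2 + (x $ 2)\<^sup>2" by (simp add: cyl_radius_def)
    ultimately show ?thesis by (simp add: power_mult_distrib)
  qed
  also have "\<dots> = (x $ 1 * U $ 1 + x $ 2 * U $ 2)\<^sup>2 + (x $ 1 * U $ 2 - x $ 2 * U $ 1)\<^sup>2" by algebra
  also have "\<dots> = \<bar>x $ 1 * U $ 2 - x $ 2 * U $ 1\<bar>\<^sup>2" by (simp only: assms(2) power2_abs) simp
  finally have "(norm U * cyl_radius x)\<^sup>2 = \<bar>x $ 1 * U $ 2 - x $ 2 * U $ 1\<bar>\<^sup>2" .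
  then show ?thesis
    by (rule power2_eq_imp_eq) (simp_all add: cyl_radius_def)
qed

context defocusing
begin

text \<open>Away from the axis and from infinity the norm of the field is |swirl| / r, the swirls
  converge in L1 on balls by \<open>rellich\<close>, and the square is interpolated. On the
  remaining set the integral of \<open>decay\<close> is small, uniformly along the sequence.\<close>

theorem X_G1_compact:
  assumes U: "\<And>n. U n \<in> X_G1 p \<Gamma>"
    and bW: "\<And>n. (LINT x|lebesgue. (norm (weak_curl (U n) x))\<^sup>2) \<le> M"
    and b\<Gamma>: "\<And>n. (LINT x|lebesgue. \<bar>\<Gamma> x\<bar> * norm (U n x) powr (p + 1)) \<le> M"
  obtains r :: "nat \<Rightarrow> nat" where "strict_mono r"
    "\<And>e. 0 < e \<Longrightarrow> \<exists>N. \<forall>m\<ge>N. \<forall>n\<ge>N. (LINT x|lebesgue. (norm (U (r m) x - U (r n) x))\<^sup>2) < e"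
proof -
  note UX = X_G1_X[OF U]
  note U2 = X_D(2)[OF UX]
  have "\<exists>U'. U' \<in> borel_measurable borel \<and> U' \<in> L2 \<and> (AE x in lebesgue. U n x = U' x)" for n
    by (rule L2_borel_rep[OF U2[of n]]) blast
  then obtain U' where U': "\<And>n. U' n \<in> borel_measurable borel" "\<And>n. U' n \<in> L2" "\<And>n. AE x in lebesgue. U n x = U' n x"
    by metis
  have "\<exists>W'. W' \<in> borel_measurable borel \<and> W' \<in> L2 \<and> (AE x in lebesgue. weak_curl (U n) x = W' x)" for n
    by (rule L2_borel_rep[OF X_D(4)[OF UX[of n]]]) blast
  then obtain W' where W': "\<And>n. W' n \<in> borel_measurable borel" "\<And>n. W' n \<in> L2" "\<And>n. AE x in lebesgue. weak_curl (U n) x = W' n x"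
    by metis
  have curl: "is_weak_curl (U' n) (W' n)" for n
    using X_D(5)[OF UX[of n]]
      is_weak_curl_cong_AE[OF U'(3)[of n] L2_measurable[OF U2] L2_measurable[OF U'(2)]]
      is_weak_curl_cong_AE_right[OF W'(3)[of n] L2_measurable[OF X_D(4)[OF UX]] L2_measurable[OF W'(2)]]
    by metis
  have az: "azimuthal (U' n)" for n by (rule azimuthal_cong[OF X_G1_azimuthal[OF U] U'(3)])
  define G0 where "G0 = (LINT x|lebesgue. decay x)"
  have bU': "(LINT x|lebesgue. (norm (U' n x))\<^sup>2) \<le> M + G0" for n
  proof -
    have "(LINT x|lebesgue. (norm (U' n x))\<^sup>2) = (LINT x|lebesgue. (norm (U n x))\<^sup>2)"
    proof (rule integral_cong_AE)
      show "AE x in lebesgue. (norm (U' n x))\<^sup>2 = (norm (U n x))\<^sup>2" using U'(3)[of n] by eventually_elim simp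
    qed (use borel_measurable_integrable[OF L2_integrable[OF U2]] borel_measurable_integrable[OF L2_integrable[OF U'(2)]] in auto)
    then show ?thesis using L2_norm_upper[OF UX[of n]] b\<Gamma>[of n] by (simp add: G0_def)
  qed
  have bW': "(LINT x|lebesgue. (norm (W' n x))\<^sup>2) \<le> M" for n
  proof -
    have "(LINT x|lebesgue. (norm (W' n x))\<^sup>2) = (LINT x|lebesgue. (norm (weak_curl (U n) x))\<^sup>2)"
    proof (rule integral_cong_AE)
      show "AE x in lebesgue. (norm (W' n x))\<^sup>2 = (norm (weak_curl (U n) x))\<^sup>2" using W'(3)[of n] by eventually_elim simp
    qed (use borel_measurable_integrable[OF L2_integrable[OF X_D(4)[OF UX]]] borel_measurable_integrable[OF L2_integrable[OF W'(2)]] in auto)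
    then show ?thesis using bW[of n] by simp
  qed
  define \<psi> where "\<psi> n = swirl (U' n)" for n
  have \<psi>_m [measurable]: "\<psi> n \<in> borel_measurable borel" for n
    unfolding \<psi>_def by (rule swirl_borel[OF U'(1)])
  obtain r :: "nat \<Rightarrow> nat" where r: "strict_mono r"
    and \<psi>c: "\<And>R e. 0 < e \<Longrightarrow> \<exists>N. \<forall>m\<ge>N. \<forall>n\<ge>N. (LINT x|lborel. indicator (ball 0 R) x * \<bar>\<psi> (r m) x - \<psi> (r n) x\<bar>) < e"
  proof (rule rellich[of \<psi> "\<lambda>n. swirl_grad (W' n)"])
    show "locint (\<psi> n)" for n unfolding \<psi>_def by (rule locint_swirl[OF U'(2)])
    show "locint (swirl_grad (W' n) j)" for n j by (rule locint_swirl_grad[OF W'(2)])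
    show "swirl_grad (W' n) j \<in> borel_measurable borel" for n j by (rule swirl_grad_borel[OF W'(1)])
    show "weak_gradient (\<psi> n) (swirl_grad (W' n))" for n
      unfolding \<psi>_def by (rule swirl_weak_gradient[OF U'(2) W'(2) curl az])
    fix R
    have m1: "(\<lambda>x. \<bar>\<psi> n x\<bar>) \<in> borel_measurable borel" for n by measurable
    have m2: "(\<lambda>x. \<Sum>j\<in>UNIV. \<bar>swirl_grad (W' n) j x\<bar>) \<in> borel_measurable borel" for n
      using swirl_grad_borel[OF W'(1)] by (intro borel_measurable_sum borel_measurable_abs) auto
    have R: "norm x < R \<Longrightarrow> R \<le> \<bar>R\<bar>" for x :: "real^3" by simp
    have e1: "\<bar>\<psi> n x\<bar> \<le> 2 * \<bar>R\<bar> * norm (U' n x)" if "norm x < R" for n x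
      unfolding \<psi>_def using swirl_le[of x "\<bar>R\<bar>" "U' n"] that by simp
    have e2: "(\<Sum>j\<in>UNIV. \<bar>swirl_grad (W' n) j x\<bar>) \<le> 4 * \<bar>R\<bar> * norm (W' n x)" if "norm x < R" for n x
      using swirl_grad_le[of x "\<bar>R\<bar>" "W' n"] that by simp
    let ?v = "LINT x|lebesgue. indicator (ball (0::real^3) R) x"
    have "(LINT x|lborel. indicator (ball 0 R) x * \<bar>\<psi> n x\<bar>) \<le> 2 * \<bar>R\<bar> * (?v + (M + G0))" for n
      by (rule order_trans[OF ball_integral_le[OF U'(2) m1 _ e1]]) (auto intro!: mult_left_mono bU')
    then show "\<exists>C. \<forall>n. (LINT x|lborel. indicator (ball 0 R) x * \<bar>\<psi> n x\<bar>) \<le> C" by blast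
    have "(LINT x|lborel. indicator (ball 0 R) x * (\<Sum>j\<in>UNIV. \<bar>swirl_grad (W' n) j x\<bar>)) \<le> 4 * \<bar>R\<bar> * (?v + M)" for n
      by (rule order_trans[OF ball_integral_le[OF W'(2) m2 _ e2]]) (auto intro!: mult_left_mono bW' sum_nonneg)
    then show "\<exists>C. \<forall>n. (LINT x|lborel. indicator (ball 0 R) x * (\<Sum>j\<in>UNIV. \<bar>swirl_grad (W' n) j x\<bar>)) \<le> C" by blast
  qed (use \<psi>_m in auto)
  define P where "P = 2 powr (p + 1) * (2 * M)"
  have M0: "0 \<le> M"
  proof -
    have "0 \<le> (LINT x|lebesgue. (norm (weak_curl (U 0) x))\<^sup>2)" by simp
    then show ?thesis using bW[of 0] by linarith
  qed
  then have P0: "0 \<le> P" by (simp add: P_def)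
  have Dint: "integrable lebesgue (\<lambda>x. \<bar>\<Gamma> x\<bar> * norm (U m x - U n x) powr (p + 1))" for m n
    using weighted_integrable_lincomb(1)[OF X_D(3,6)[OF UX[of m]] X_D(3,6)[OF UX[of n]], of 1 "-1"] by simp
  have Dbound: "(LINT x|lebesgue. \<bar>\<Gamma> x\<bar> * norm (U m x - U n x) powr (p + 1)) \<le> P" for m n
  proof -
    have "(LINT x|lebesgue. \<bar>\<Gamma> x\<bar> * norm (U m x - U n x) powr (p + 1))
        \<le> (LINT x|lebesgue. 2 powr (p + 1) * (\<bar>\<Gamma> x\<bar> * norm (U m x) powr (p + 1) + \<bar>\<Gamma> x\<bar> * norm (U n x) powr (p + 1)))"
    proof (rule integral_mono[OF Dint])
      show "integrable lebesgue (\<lambda>x. 2 powr (p + 1) * (\<bar>\<Gamma> x\<bar> * norm (U m x) powr (p + 1) + \<bar>\<Gamma> x\<bar> * norm (U n x) powr (p + 1)))"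
        using X_D(6)[OF UX] by simp
      fix x
      have "norm (U m x - U n x) powr (p + 1) \<le> 2 powr (p + 1) * (norm (U m x) powr (p + 1) + norm (U n x) powr (p + 1))"
        using weighted_integrable_lincomb(2)[OF X_D(3,6)[OF UX[of m]] X_D(3,6)[OF UX[of n]], of 1 x "-1"] by simp
      from mult_left_mono[OF this, of "\<bar>\<Gamma> x\<bar>"]
      show "\<bar>\<Gamma> x\<bar> * norm (U m x - U n x) powr (p + 1)
          \<le> 2 powr (p + 1) * (\<bar>\<Gamma> x\<bar> * norm (U m x) powr (p + 1) + \<bar>\<Gamma> x\<bar> * norm (U n x) powr (p + 1))"
        by (simp add: algebra_simps)
    qed
    also have "\<dots> = 2 powr (p + 1) * ((LINT x|lebesgue. \<bar>\<Gamma> x\<bar> * norm (U m x) powr (p + 1)) + (LINT x|lebesgue. \<bar>\<Gamma> x\<bar> * norm (U n x) powr (p + 1)))"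
      using X_D(6)[OF UX] by simp
    also have "\<dots> \<le> P" unfolding P_def using b\<Gamma>[of m] b\<Gamma>[of n] by (intro mult_left_mono) auto
    finally show ?thesis .
  qed
  \<comment> \<open>These regions exhaust the complement of the axis, so by dominated convergence
    the integral of \<open>decay\<close> outside them tends to 0.\<close>
  define cut where "cut j x = (if norm x < real j + 1 \<and> 1 / (real j + 1) < cyl_radius x then 1 else (0::real))" for j :: nat and x :: "real^3"
  have cr_m: "cyl_radius \<in> borel_measurable borel" unfolding cyl_radius_def[abs_def] by measurable
  have cut_m [measurable]: "cut j \<in> borel_measurable lebesgue" for j
  proof -
    note [measurable] = cr_m
    have "cut j \<in> borel_measurable borel" unfolding cut_def[abs_def] by measurable
    then show ?thesis by (simp add: measurable_completion)
  qed
  have tail: "(\<lambda>j. LINT x|lebesgue. (1 - cut j x) * decay x) \<longlonglongrightarrow> 0"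
  proof -
    have "(\<lambda>j. LINT x|lebesgue. (1 - cut j x) * decay x) \<longlonglongrightarrow> (LINT x|(lebesgue :: (real^3) measure). 0)"
    proof (rule integral_dominated_convergence[OF _ _ decay_integrable])
      show "AE x in lebesgue. (\<lambda>j. (1 - cut j x) * decay x) \<longlonglongrightarrow> 0"
        using AE_cyl_radius_pos
      proof eventually_elim
        case (elim x)
        have "\<forall>\<^sub>F j in sequentially. norm x < real j + 1" by real_asymp
        moreover have "\<forall>\<^sub>F j in sequentially. 1 / (real j + 1) < cyl_radius x"
          using elim by real_asymp
        ultimately have "\<forall>\<^sub>F j in sequentially. (1 - cut j x) * decay x = 0"
          by eventually_elim (simp add: cut_def)
        then show ?case by (rule tendsto_eventually)
      qed
      show "AE x in lebesgue. norm ((1 - cut j x) * decay x) \<le> decay x" for j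
        using decay_nonneg by (simp add: cut_def)
    qed measurable
    then show ?thesis by simp
  qed
  show ?thesis
  proof (rule that[OF r])
    fix e :: real assume e: "0 < e"
    \<comment> \<open>Four errors of size at most e/4 are prepared: \<epsilon> for the weighted norm
      outside the region, \<open>j\<close> for \<open>decay\<close> there, \<delta> for the high
      power inside the region, and \<eta> for the L1 norm of the swirls.\<close>
    define \<epsilon> where "\<epsilon> = e / (4 * (P + 1))"
    have \<epsilon>: "0 < \<epsilon>" "\<epsilon> * P < e / 4"
      using e P0 by (auto simp: \<epsilon>_def field_simps)
    define c where "c = \<epsilon> powr (- 2 / (p - 1))"
    have c: "0 < c" using \<epsilon> by (simp add: c_def)
    obtain j where j: "(LINT x|lebesgue. (1 - cut j x) * decay x) < e / (4 * c)"
      using order_tendstoD(2)[OF tail, of "e / (4 * c)"] e c by (auto simp: eventually_sequentially)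
    define \<delta> where "\<delta> = e * C / (4 * (P + 1))"
    have \<delta>: "0 < \<delta>" using e C P0 by (simp add: \<delta>_def)
    \<comment> \<open>The splitting level in \<open>sq_le_linear_plus_powr\<close>, chosen so that
      the coefficient \<open>k powr (1 - p)\<close> equals \<delta>.\<close>
    define k where "k = \<delta> powr (1 / (1 - p))"
    have k: "0 < k" "k powr (1 - p) = \<delta>"
      using \<delta> p by (auto simp: k_def powr_powr)
    define \<eta> where "\<eta> = e / (4 * (k * (real j + 1)))"
    have \<eta>: "0 < \<eta>" using e k by (simp add: \<eta>_def)
    obtain N where N: "\<And>m n. N \<le> m \<Longrightarrow> N \<le> n \<Longrightarrow> (LINT x|lborel. indicator (ball 0 (real j + 1)) x * \<bar>\<psi> (r m) x - \<psi> (r n) x\<bar>) < \<eta>"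
      using \<psi>c[OF \<eta>, of "real j + 1"] by blast
    show "\<exists>N. \<forall>m\<ge>N. \<forall>n\<ge>N. (LINT x|lebesgue. (norm (U (r m) x - U (r n) x))\<^sup>2) < e"
    proof (intro exI[of _ N] allI impI)
      fix m n assume mn: "N \<le> m" "N \<le> n"
      define D where "D x = U (r m) x - U (r n) x" for x
      define S where "S x = indicator (ball 0 (real j + 1)) x * \<bar>\<psi> (r m) x - \<psi> (r n) x\<bar>" for x
      have S_m: "S \<in> borel_measurable lborel" unfolding S_def[abs_def] by measurable
      have S_int: "integrable lebesgue S"
      proof -
        have "locint (\<lambda>x. \<bar>\<psi> (r m) x - \<psi> (r n) x\<bar>)"
          unfolding \<psi>_def by (intro locint_abs locint_diff locint_swirl U'(2))
        then show ?thesis unfolding S_def by (simp add: locint_def)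
      qed
      have S_eq: "(LINT x|lebesgue. S x) < \<eta>"
        using N[OF mn] unfolding integral_completion[OF S_m] by (simp add: S_def[abs_def])
      have D_int: "integrable lebesgue (\<lambda>x. \<bar>\<Gamma> x\<bar> * norm (D x) powr (p + 1))"
        and D_bound: "(LINT x|lebesgue. \<bar>\<Gamma> x\<bar> * norm (D x) powr (p + 1)) \<le> P"
        unfolding D_def by (rule Dint, rule Dbound)
      have gi: "integrable lebesgue (\<lambda>x. (1 - cut j x) * decay x)"
        by (rule Bochner_Integration.integrable_bound[OF decay_integrable])
          (use decay_nonneg in \<open>measurable, auto simp: cut_def\<close>)
      have pw: "AE x in lebesgue. (norm (D x))\<^sup>2 \<le> \<epsilon> * (\<bar>\<Gamma> x\<bar> * norm (D x) powr (p + 1)) + c * ((1 - cut j x) * decay x)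
          + (k * (real j + 1) * S x + \<delta> / C * (\<bar>\<Gamma> x\<bar> * norm (D x) powr (p + 1)))"
        using az[of "r m", unfolded azimuthal_def, THEN conjunct2] az[of "r n", unfolded azimuthal_def, THEN conjunct2]
          U'(3)[of "r m"] U'(3)[of "r n"]
      proof eventually_elim
        case (elim x)
        let ?T = "\<bar>\<Gamma> x\<bar> * norm (D x) powr (p + 1)"
        have T: "0 \<le> \<epsilon> * ?T" "0 \<le> \<delta> / C * ?T" using \<epsilon> \<delta> C by auto
        have S0: "0 \<le> k * (real j + 1) * S x" using k by (simp add: S_def)
        have Dx: "D x = U' (r m) x - U' (r n) x" using elim by (simp add: D_def)
        show ?case
        proof (cases "norm x < real j + 1 \<and> 1 / (real j + 1) < cyl_radius x")
          case True
          have "norm (D x) * cyl_radius x = \<bar>x $ 1 * D x $ 2 - x $ 2 * D x $ 1\<bar>"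
            by (rule azimuthal_norm) (use elim in \<open>auto simp: Dx algebra_simps\<close>)
          also have "\<dots> = S x"
            using True by (simp add: S_def \<psi>_def swirl_def Dx algebra_simps)
          finally have S: "norm (D x) * cyl_radius x = S x" .
          have "norm (D x) * (1 / (real j + 1)) \<le> norm (D x) * cyl_radius x"
            using True by (intro mult_left_mono) auto
          then have "norm (D x) * (1 / (real j + 1)) \<le> S x" by (simp only: S)
          then have n: "norm (D x) \<le> (real j + 1) * S x" by (simp add: field_simps)
          have "(norm (D x))\<^sup>2 \<le> k * norm (D x) + k powr (1 - p) * norm (D x) powr (p + 1)"
            by (rule sq_le_linear_plus_powr) (use k p in auto)
          also have "\<dots> \<le> k * ((real j + 1) * S x) + \<delta> / C * ?T"
          proof (rule add_mono)
            show "k * norm (D x) \<le> k * ((real j + 1) * S x)" using n k by (intro mult_left_mono) auto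
            \<comment> \<open>The lower bound C for |\<Gamma>| converts the unweighted power into
              the weighted one, whose integral is at most \<open>P\<close>.\<close>
            have "C * norm (D x) powr (p + 1) \<le> ?T" using \<Gamma>_ge(2)[of x] by (intro mult_right_mono) auto
            from mult_left_mono[OF this, of "\<delta> / C"]
            show "k powr (1 - p) * norm (D x) powr (p + 1) \<le> \<delta> / C * ?T"
              using \<delta> C k by simp
          qed
          finally show ?thesis using T True by (simp add: cut_def mult.assoc)
        next
          case False
          have "(norm (D x))\<^sup>2 \<le> \<epsilon> * ?T + c * decay x" unfolding c_def by (rule young_\<Gamma>[OF \<epsilon>(1)])
          moreover have "cut j x = 0" using False by (auto simp: cut_def)
          ultimately show ?thesis using T S0 by simp
        qed
      qed
      have "(LINT x|lebesgue. (norm (D x))\<^sup>2) \<le> (LINT x|lebesgue. \<epsilon> * (\<bar>\<Gamma> x\<bar> * norm (D x) powr (p + 1)) + c * ((1 - cut j x) * decay x)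
          + (k * (real j + 1) * S x + \<delta> / C * (\<bar>\<Gamma> x\<bar> * norm (D x) powr (p + 1))))"
      proof (rule integral_mono_AE[OF _ _ pw])
        show "integrable lebesgue (\<lambda>x. (norm (D x))\<^sup>2)" unfolding D_def by (rule L2_integrable[OF L2_diff[OF U2 U2]])
        show "integrable lebesgue (\<lambda>x. \<epsilon> * (\<bar>\<Gamma> x\<bar> * norm (D x) powr (p + 1)) + c * ((1 - cut j x) * decay x)
          + (k * (real j + 1) * S x + \<delta> / C * (\<bar>\<Gamma> x\<bar> * norm (D x) powr (p + 1))))"
          by (intro Bochner_Integration.integrable_add integrable_mult_right D_int gi S_int)
      qed
      also have "\<dots> = \<epsilon> * (LINT x|lebesgue. \<bar>\<Gamma> x\<bar> * norm (D x) powr (p + 1)) + c * (LINT x|lebesgue. (1 - cut j x) * decay x)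
          + (k * (real j + 1) * (LINT x|lebesgue. S x) + \<delta> / C * (LINT x|lebesgue. \<bar>\<Gamma> x\<bar> * norm (D x) powr (p + 1)))"
      proof -
        have "(LINT x|lebesgue. \<epsilon> * T x + c * E x + (b * S' x + d * T x))
            = \<epsilon> * (LINT x|lebesgue. T x) + c * (LINT x|lebesgue. E x) + (b * (LINT x|lebesgue. S' x) + d * (LINT x|lebesgue. T x))"
          if "integrable lebesgue T" "integrable lebesgue E" "integrable lebesgue S'" for T E S' :: "real^3 \<Rightarrow> real" and b d
          using that by simp
        from this[OF D_int gi S_int] show ?thesis .
      qed
      also have "\<dots> < \<epsilon> * P + c * (e / (4 * c)) + (k * (real j + 1) * \<eta> + \<delta> / C * P)"
      proof -
        have "\<epsilon> * (LINT x|lebesgue. \<bar>\<Gamma> x\<bar> * norm (D x) powr (p + 1)) \<le> \<epsilon> * P"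
          using D_bound \<epsilon> by (intro mult_left_mono) auto
        moreover have "\<delta> / C * (LINT x|lebesgue. \<bar>\<Gamma> x\<bar> * norm (D x) powr (p + 1)) \<le> \<delta> / C * P"
          using D_bound \<delta> C by (intro mult_left_mono) auto
        moreover have "c * (LINT x|lebesgue. (1 - cut j x) * decay x) < c * (e / (4 * c))"
          using j c by (intro mult_strict_left_mono) auto
        moreover have "k * (real j + 1) * (LINT x|lebesgue. S x) < k * (real j + 1) * \<eta>"
          using S_eq k by (intro mult_strict_left_mono) auto
        ultimately show ?thesis by linarith
      qed
      also have "\<dots> \<le> e"
      proof -
        have "c * (e / (4 * c)) = e / 4" using c by simp
        moreover have "k * (real j + 1) * \<eta> = e / 4" using k by (simp add: \<eta>_def)
        moreover have "\<delta> / C * P \<le> e / 4"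
        proof -
          have "\<delta> / C * P = \<epsilon> * P" using C by (simp add: \<delta>_def \<epsilon>_def)
          then show ?thesis using \<epsilon> by simp
        qed
        ultimately show ?thesis using \<epsilon> by linarith
      qed
      finally show "(LINT x|lebesgue. (norm (U (r m) x - U (r n) x))\<^sup>2) < e" by (simp add: D_def)
    qed
  qed
qed

text \<open>The limit profile is formed with the total function \<open>lim\<close> on the whole
  half-plane, so null sets of the half-plane and of space are never compared. At a point with x1
  nonzero the second component of the field recovers the profile, and its convergence is
  given.\<close>

lemma X_G1_limit:
  assumes U: "\<And>n. U n \<in> X_G1 p \<Gamma>" and lim: "AE x in lebesgue. (\<lambda>n. U n x) \<longlonglongrightarrow> U' x" and U': "U' \<in> X p \<Gamma>"
  shows "U' \<in> X_G1 p \<Gamma>"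
proof -
  let ?H = "lebesgue_on ({0<..} \<times> (UNIV :: real set))"
  have "\<forall>n. \<exists>q. q \<in> borel_measurable ?H \<and>
      (AE x in lebesgue. U n x = (q (cyl_radius x, x $ 3) / cyl_radius x) *\<^sub>R vector [- (x $ 2), x $ 1, 0])"
    using U by (auto simp: X_G1_def)
  from choice[OF this] obtain q where q [measurable]: "\<And>n. q n \<in> borel_measurable ?H"
    and eq: "\<And>n. AE x in lebesgue. U n x = (q n (cyl_radius x, x $ 3) / cyl_radius x) *\<^sub>R vector [- (x $ 2), x $ 1, 0]"
    by blast
  define q' where "q' z = lim (\<lambda>n. q n z)" for z
  have q' [measurable]: "q' \<in> borel_measurable ?H"
    unfolding q'_def[abs_def] by (rule borel_measurable_lim_metric) measurable
  have "AE x in lebesgue. \<forall>n. U n x = (q n (cyl_radius x, x $ 3) / cyl_radius x) *\<^sub>R vector [- (x $ 2), x $ 1, 0]"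
    using eq by (simp add: AE_all_countable)
  then have "AE x in lebesgue. U' x = (q' (cyl_radius x, x $ 3) / cyl_radius x) *\<^sub>R vector [- (x $ 2), x $ 1, 0]"
    using lim AE_nth_neq_0[of 1] AE_cyl_radius_pos
  proof eventually_elim
    case (elim x)
    have s: "q n (cyl_radius x, x $ 3) = U n x $ 2 / x $ 1 * cyl_radius x" for n
      using elim(1)[rule_format, of n] elim(3,4) by simp
    have "(\<lambda>n. U n x $ 2 / x $ 1 * cyl_radius x) \<longlonglongrightarrow> U' x $ 2 / x $ 1 * cyl_radius x"
      using elim by (intro tendsto_intros) auto
    then have ql: "(\<lambda>n. q n (cyl_radius x, x $ 3)) \<longlonglongrightarrow> q' (cyl_radius x, x $ 3)"
      unfolding q'_def s by (simp add: limI)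
    have "(\<lambda>n. U n x) \<longlonglongrightarrow> (q' (cyl_radius x, x $ 3) / cyl_radius x) *\<^sub>R vector [- (x $ 2), x $ 1, 0]"
      unfolding elim(1)[rule_format] using elim(4) ql by (intro tendsto_intros) auto
    from LIMSEQ_unique[OF elim(2) this] show ?case .
  qed
  then show ?thesis using U' q' by (auto simp: X_G1_def)
qed

end

section \<open>Existence of a minimizer\<close>

lemma norm_midpoint_sq:
  fixes a b :: "'a::real_inner"
  shows "(norm ((1/2) *\<^sub>R a + (1/2) *\<^sub>R b))\<^sup>2 = 1/2 * (norm a)\<^sup>2 + 1/2 * (norm b)\<^sup>2 - 1/4 * (norm (a - b))\<^sup>2"
  unfolding power2_norm_eq_inner by (simp add: inner_simps inner_commute) (simp add: field_simps)

context defocusing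
begin

text \<open>The parallelogram identity treats both quadratic terms, and convexity the weighted one.
  The defect of the \<open>V\<close> term has the wrong sign, and |V| \<le> v bounds it by v/8 times
  the squared distance.\<close>

lemma dens_midpoint:
  "AE x in lebesgue. dens (\<lambda>x. (1/2) *\<^sub>R U x + (1/2) *\<^sub>R U' x) (\<lambda>x. (1/2) *\<^sub>R W x + (1/2) *\<^sub>R W' x) x
    \<le> 1/2 * dens U W x + 1/2 * dens U' W' x - 1/8 * (norm (W x - W' x))\<^sup>2 + v/8 * (norm (U x - U' x))\<^sup>2"
  using V_bound
proof eventually_elim
  case (elim x)
  have V: "- V x * (norm (U x - U' x))\<^sup>2 \<le> v * (norm (U x - U' x))\<^sup>2"
    using elim by (intro mult_right_mono) auto
  have "norm ((1/2) *\<^sub>R U x + (1/2) *\<^sub>R U' x) powr (p + 1) \<le> (norm (U x) powr (p + 1) + norm (U' x) powr (p + 1)) / 2"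
    using p by (intro norm_midpoint_powr) auto
  from mult_left_mono[OF this, of "1/(p + 1) * \<bar>\<Gamma> x\<bar>"] p
  have G: "1/(p + 1) * (\<bar>\<Gamma> x\<bar> * norm ((1/2) *\<^sub>R U x + (1/2) *\<^sub>R U' x) powr (p + 1))
      \<le> 1/2 * (1/(p + 1) * (\<bar>\<Gamma> x\<bar> * norm (U x) powr (p + 1))) + 1/2 * (1/(p + 1) * (\<bar>\<Gamma> x\<bar> * norm (U' x) powr (p + 1)))"
    by (simp add: algebra_simps add_divide_distrib)
  have *: "1/2 * (1/2 * w1 + 1/2 * w2 - 1/4 * w3) + 1/2 * (V x * (1/2 * u1 + 1/2 * u2 - 1/4 * u3)) + gm
      \<le> 1/2 * (1/2 * w1 + 1/2 * (V x * u1) + g1) + 1/2 * (1/2 * w2 + 1/2 * (V x * u2) + g2) - 1/8 * w3 + v/8 * u3"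
    if "- V x * u3 \<le> v * u3" "gm \<le> 1/2 * g1 + 1/2 * g2" for w1 w2 w3 u1 u2 u3 gm g1 g2
    using that by (simp add: algebra_simps)
  show ?case unfolding dens_alt norm_midpoint_sq by (rule *[OF V G])
qed

theorem minimizer_exists: "\<exists>U\<in>X_G1 p \<Gamma>. \<forall>W\<in>X_G1 p \<Gamma>. J p V \<Gamma> U \<le> J p V \<Gamma> W"
proof -
  define G0 where "G0 = (LINT x|lebesgue. decay x)"
  define m where "m = Inf (J p V \<Gamma> ` X_G1 p \<Gamma>)"
  have low: "- (young_const * G0) \<le> J p V \<Gamma> U" if "U \<in> X p \<Gamma>" for U
  proof -
    have "0 \<le> 1/2 * (LINT x|lebesgue. (norm (weak_curl U x))\<^sup>2)
      + 1/(2 * (p + 1)) * (LINT x|lebesgue. \<bar>\<Gamma> x\<bar> * norm (U x) powr (p + 1))"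
      using p by (intro add_nonneg_nonneg mult_nonneg_nonneg integral_nonneg_AE) auto
    then show ?thesis using J_lower[OF that] by (simp add: G0_def)
  qed
  have bdd: "bdd_below (J p V \<Gamma> ` X_G1 p \<Gamma>)"
    using low X_G1_X by (intro bdd_belowI[of _ "- (young_const * G0)"]) auto
  have m_le: "m \<le> J p V \<Gamma> W" if "W \<in> X_G1 p \<Gamma>" for W
    unfolding m_def using bdd that by (intro cInf_lower) auto
  have "\<exists>U. U \<in> X_G1 p \<Gamma> \<and> J p V \<Gamma> U < m + 1 / (real n + 1)" for n
  proof -
    have "Inf (J p V \<Gamma> ` X_G1 p \<Gamma>) < m + 1 / (real n + 1)"
      unfolding m_def[symmetric] by simp
    then show ?thesis
      using cInf_less_iff[OF _ bdd] X_G1_zero by blast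
  qed
  then obtain U where U: "\<And>n. U n \<in> X_G1 p \<Gamma>" and JU: "\<And>n. J p V \<Gamma> (U n) < m + 1 / (real n + 1)" by metis
  define B where "B = m + 1 + young_const * G0"
  have B: "1/2 * (LINT x|lebesgue. (norm (weak_curl (U n) x))\<^sup>2)
      + 1/(2 * (p + 1)) * (LINT x|lebesgue. \<bar>\<Gamma> x\<bar> * norm (U n x) powr (p + 1)) \<le> B" for n
  proof -
    have "1 / (real n + 1) \<le> 1" by simp
    then show ?thesis using J_lower[OF X_G1_X[OF U[of n]]] JU[of n] unfolding B_def G0_def by linarith
  qed
  \<comment> \<open>Both coefficients in the bound by \<open>B\<close> are at least 1 / (2 (p + 1)),
    so one constant serves the curls and the weighted integrals alike.\<close>
  define M where "M = 2 * (p + 1) * B"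
  have nn: "0 \<le> (LINT x|lebesgue. (norm (weak_curl (U n) x))\<^sup>2)"
    "0 \<le> (LINT x|lebesgue. \<bar>\<Gamma> x\<bar> * norm (U n x) powr (p + 1))" for n
    by (auto intro!: integral_nonneg_AE)
  have bW: "(LINT x|lebesgue. (norm (weak_curl (U n) x))\<^sup>2) \<le> M" for n
  proof -
    have "0 \<le> 1/(2 * (p + 1)) * (LINT x|lebesgue. \<bar>\<Gamma> x\<bar> * norm (U n x) powr (p + 1))" using nn p by simp
    then have 1: "(LINT x|lebesgue. (norm (weak_curl (U n) x))\<^sup>2) \<le> 2 * B" using B[of n] by linarith
    then have "0 \<le> B" using nn(1)[of n] by linarith
    then have "2 * B * 1 \<le> 2 * B * (p + 1)" using p by (intro mult_left_mono) auto
    then show ?thesis using 1 by (simp add: M_def mult_ac)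
  qed
  have b\<Gamma>: "(LINT x|lebesgue. \<bar>\<Gamma> x\<bar> * norm (U n x) powr (p + 1)) \<le> M" for n
  proof -
    have "1/(2 * (p + 1)) * (LINT x|lebesgue. \<bar>\<Gamma> x\<bar> * norm (U n x) powr (p + 1)) \<le> B" using B[of n] nn(1)[of n] by linarith
    then show ?thesis using p by (simp add: M_def field_simps)
  qed
  obtain r :: "nat \<Rightarrow> nat" where r: "strict_mono r"
    and Uc: "\<And>e. 0 < e \<Longrightarrow> \<exists>N. \<forall>m\<ge>N. \<forall>n\<ge>N. (LINT x|lebesgue. (norm (U (r m) x - U (r n) x))\<^sup>2) < e"
    by (rule X_G1_compact[of U, OF U bW b\<Gamma>]) (rule that)
  define Z where "Z n = U (r n)" for n
  define W where "W n = weak_curl (Z n)" for n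
  have Z: "Z n \<in> X_G1 p \<Gamma>" for n by (simp add: Z_def U)
  note ZX = X_G1_X[OF Z]
  have Z2: "Z n \<in> L2" and W2: "W n \<in> L2" and ZW: "is_weak_curl (Z n) (W n)" for n
    using X_D[OF ZX] by (auto simp: W_def)
  have JZ: "J p V \<Gamma> (Z n) < m + 1 / (real n + 1)" for n
  proof -
    have "1 / (real (r n) + 1) \<le> 1 / (real n + 1)"
      using seq_suble[OF r, of n] by (intro divide_left_mono) auto
    then show ?thesis using JU[of "r n"] by (simp add: Z_def)
  qed
  have JZ_eq: "J p V \<Gamma> (Z n) = (LINT x|lebesgue. dens (Z n) (W n) x)" for n
    by (rule J_eq[OF ZX W2 ZW])
  \<comment> \<open>The midpoint is again a competitor, so its energy is at least \<open>m\<close>.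
    Solving the midpoint inequality for the curl term bounds it by the excess energies and the L2
    distance.\<close>
  have par: "(LINT x|lebesgue. (norm (W k x - W n x))\<^sup>2)
      \<le> 4 * (J p V \<Gamma> (Z k) + J p V \<Gamma> (Z n) - 2 * m) + v * (LINT x|lebesgue. (norm (Z k x - Z n x))\<^sup>2)" for k n
  proof -
    let ?U = "\<lambda>x. (1/2) *\<^sub>R Z k x + (1/2) *\<^sub>R Z n x" and ?W = "\<lambda>x. (1/2) *\<^sub>R W k x + (1/2) *\<^sub>R W n x"
    have mid: "?U \<in> X_G1 p \<Gamma>" by (rule X_G1_lincomb[OF Z Z])
    have W2': "?W \<in> L2" by (intro L2_add L2_scaleR W2)
    have wc: "is_weak_curl ?U ?W" by (rule is_weak_curl_lincomb[OF Z2 W2 ZW Z2 W2 ZW])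
    have "m \<le> (LINT x|lebesgue. dens ?U ?W x)"
      using m_le[OF mid] J_eq[OF X_G1_X[OF mid] W2' wc] by simp
    also have "\<dots> \<le> (LINT x|lebesgue. 1/2 * dens (Z k) (W k) x + 1/2 * dens (Z n) (W n) x
        - 1/8 * (norm (W k x - W n x))\<^sup>2 + v/8 * (norm (Z k x - Z n x))\<^sup>2)"
      by (intro integral_mono_AE dens_midpoint dens_integrable X_G1_X[OF mid] W2' Bochner_Integration.integrable_add
        Bochner_Integration.integrable_diff integrable_mult_right ZX W2 L2_integrable L2_diff Z2)
    also have "\<dots> = 1/2 * J p V \<Gamma> (Z k) + 1/2 * J p V \<Gamma> (Z n) - 1/8 * (LINT x|lebesgue. (norm (W k x - W n x))\<^sup>2)
        + v/8 * (LINT x|lebesgue. (norm (Z k x - Z n x))\<^sup>2)"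
      unfolding JZ_eq
      using dens_integrable[OF ZX[of k] W2[of k]] dens_integrable[OF ZX[of n] W2[of n]]
        L2_integrable[OF L2_diff[OF W2[of k] W2[of n]]] L2_integrable[OF L2_diff[OF Z2[of k] Z2[of n]]]
      by simp
    finally show ?thesis by (simp add: field_simps)
  qed
  have Wc: "\<exists>N. \<forall>k\<ge>N. \<forall>n\<ge>N. (LINT x|lebesgue. (norm (W k x - W n x))\<^sup>2) < e" if e: "0 < e" for e
  proof -
    obtain N1 where N1: "\<And>k n. N1 \<le> k \<Longrightarrow> N1 \<le> n \<Longrightarrow> (LINT x|lebesgue. (norm (Z k x - Z n x))\<^sup>2) < e / (2 * v)"
      using Uc[of "e / (2 * v)"] e v by (auto simp: Z_def)
    \<comment> \<open>Two excesses below e/16 each contribute less than e/2 after the factor 4 in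
      \<open>par\<close>; the L2 distance supplies the other half.\<close>
    obtain N2 :: nat where N2: "16 / e < real N2" using reals_Archimedean2 by blast
    have small: "1 / (real n + 1) < e / 16" if "N2 \<le> n" for n
    proof -
      have "16 / e < real n + 1" using N2 that by linarith
      then show ?thesis using e by (simp add: field_simps)
    qed
    show ?thesis
    proof (intro exI[of _ "max N1 N2"] allI impI)
      fix k n assume kn: "max N1 N2 \<le> k" "max N1 N2 \<le> n"
      have "v * (LINT x|lebesgue. (norm (Z k x - Z n x))\<^sup>2) < v * (e / (2 * v))"
        using N1[of k n] kn v by (intro mult_strict_left_mono) auto
      also have "\<dots> = e / 2" using v by simp
      finally show "(LINT x|lebesgue. (norm (W k x - W n x))\<^sup>2) < e"
        using par[of k n] JZ[of k] JZ[of n] small[of k] small[of n] kn by simp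
    qed
  qed
  obtain W' s where W': "W' \<in> L2" and s: "strict_mono s" and Wae: "AE x in lebesgue. (\<lambda>k. W (s k) x) \<longlonglongrightarrow> W' x"
    and Wlim: "(\<lambda>n. LINT x|lebesgue. (norm (W n x - W' x))\<^sup>2) \<longlonglongrightarrow> 0"
    by (rule L2_complete[of W, OF W2 Wc]) (assumption, rule that)
  have Zsc: "\<exists>N. \<forall>k\<ge>N. \<forall>n\<ge>N. (LINT x|lebesgue. (norm (Z (s k) x - Z (s n) x))\<^sup>2) < e" if e: "0 < e" for e
    using Uc[OF e] seq_suble[OF s] unfolding Z_def by (meson order_trans)
  obtain U' t where U'2: "U' \<in> L2" and t: "strict_mono t" and Zae: "AE x in lebesgue. (\<lambda>k. Z (s (t k)) x) \<longlonglongrightarrow> U' x"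
    and Zlim: "(\<lambda>n. LINT x|lebesgue. (norm (Z (s n) x - U' x))\<^sup>2) \<longlonglongrightarrow> 0"
    by (rule L2_complete[of "\<lambda>n. Z (s n)", OF Z2 Zsc]) (assumption, rule that)
  have curl: "is_weak_curl U' W'"
    by (rule is_weak_curl_tendsto[of "\<lambda>n. Z (s n)" _ "\<lambda>n. W (s n)", OF Z2 U'2 W2 W' ZW Zlim])
      (use LIMSEQ_subseq_LIMSEQ[OF Wlim s] in \<open>simp add: comp_def\<close>)
  \<comment> \<open>\<open>s\<close> makes the curls converge pointwise and \<open>t\<close> refines
    it for the fields; along the composition both converge.\<close>
  define y where "y k = s (t k)" for k
  have y: "k \<le> y k" for k using seq_suble[OF s] seq_suble[OF t] unfolding y_def by (meson order_trans)
  have ae: "AE x in lebesgue. (\<lambda>k. Z (y k) x) \<longlonglongrightarrow> U' x \<and> (\<lambda>k. W (y k) x) \<longlonglongrightarrow> W' x"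
    using Zae Wae
  proof eventually_elim
    case (elim x)
    then show ?case using LIMSEQ_subseq_LIMSEQ[OF elim(2) t] by (simp add: y_def comp_def)
  qed
  have pl: "(\<lambda>k. norm (Z (y k) x) powr (p + 1)) \<longlonglongrightarrow> norm (U' x) powr (p + 1)" if "(\<lambda>k. Z (y k) x) \<longlonglongrightarrow> U' x" for x
    using p by (intro tendsto_powr' tendsto_norm[OF that] tendsto_const) auto
  have U'X: "U' \<in> X p \<Gamma>"
  proof (rule X_I[OF L2_measurable[OF U'2] W' curl])
    note [measurable] = L2_measurable[OF U'2]
    show "integrable lebesgue (\<lambda>x. \<bar>\<Gamma> x\<bar> * norm (U' x) powr (p + 1))"
    proof (rule fatou_real(1)[where f = "\<lambda>k x. \<bar>\<Gamma> x\<bar> * norm (Z (y k) x) powr (p + 1)" and c = M])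
      show "AE x in lebesgue. (\<lambda>k. \<bar>\<Gamma> x\<bar> * norm (Z (y k) x) powr (p + 1)) \<longlonglongrightarrow> \<bar>\<Gamma> x\<bar> * norm (U' x) powr (p + 1)"
        using ae by eventually_elim (intro tendsto_mult tendsto_const pl, simp)
      show "\<forall>\<^sub>F k in sequentially. (LINT x|lebesgue. \<bar>\<Gamma> x\<bar> * norm (Z (y k) x) powr (p + 1)) \<le> M"
        by (simp add: Z_def b\<Gamma>)
      show "(\<lambda>x. \<bar>\<Gamma> x\<bar> * norm (U' x) powr (p + 1)) \<in> borel_measurable lebesgue" by measurable
    qed (use X_D(6)[OF ZX] in auto)
  qed
  have U'G: "U' \<in> X_G1 p \<Gamma>"
    by (rule X_G1_limit[of "\<lambda>k. Z (y k)", OF Z _ U'X]) (use Zae in \<open>simp add: y_def\<close>)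
  have "J p V \<Gamma> U' \<le> m"
  proof (rule field_le_epsilon)
    fix e :: real assume e: "0 < e"
    obtain N :: nat where N: "1 / e < real N" using reals_Archimedean2 by blast
    note [measurable] = L2_measurable[OF U'2] L2_measurable[OF W']
    have di: "integrable lebesgue (dens (Z n) (W n))" for n by (rule dens_integrable[OF ZX W2])
    \<comment> \<open>Fatou's lemma asks for nonnegative integrands; adding the integrable function
      \<open>young_const * decay\<close> achieves this by \<open>dens_lower\<close> and shifts both
      sides by the same amount.\<close>
    have "(LINT x|lebesgue. dens U' W' x + young_const * decay x) \<le> m + e + young_const * G0"
    proof (rule fatou_real(2)[where f = "\<lambda>k x. dens (Z (y k)) (W (y k)) x + young_const * decay x"])
      show "integrable lebesgue (\<lambda>x. dens (Z (y k)) (W (y k)) x + young_const * decay x)" for k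
        using di decay_integrable by simp
      show "AE x in lebesgue. 0 \<le> dens (Z (y k)) (W (y k)) x + young_const * decay x" for k
        using dens_lower[of "W (y k)" "Z (y k)"]
      proof eventually_elim
        case (elim x)
        have "0 \<le> 1/2 * (norm (W (y k) x))\<^sup>2 + 1/(2 * (p + 1)) * (\<bar>\<Gamma> x\<bar> * norm (Z (y k) x) powr (p + 1))"
          using p by (intro add_nonneg_nonneg mult_nonneg_nonneg) auto
        then show ?case using elim by linarith
      qed
      show "AE x in lebesgue. (\<lambda>k. dens (Z (y k)) (W (y k)) x + young_const * decay x) \<longlonglongrightarrow> dens U' W' x + young_const * decay x"
        using ae
      proof eventually_elim
        case (elim x)
        then show ?case
          unfolding dens_def by (intro tendsto_intros pl) auto
      qed
      show "(\<lambda>x. dens U' W' x + young_const * decay x) \<in> borel_measurable lebesgue" by measurable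
      show "\<forall>\<^sub>F k in sequentially. (LINT x|lebesgue. dens (Z (y k)) (W (y k)) x + young_const * decay x) \<le> m + e + young_const * G0"
        unfolding eventually_sequentially
      proof (intro exI[of _ N] allI impI)
        fix k assume k: "N \<le> k"
        have "1 / e < real (y k) + 1" using N k y[of k] by linarith
        then have "1 / (real (y k) + 1) < e" using e by (simp add: field_simps)
        then have "J p V \<Gamma> (Z (y k)) \<le> m + e" using JZ[of "y k"] by linarith
        then show "(LINT x|lebesgue. dens (Z (y k)) (W (y k)) x + young_const * decay x) \<le> m + e + young_const * G0"
          using di[of "y k"] decay_integrable by (simp add: JZ_eq G0_def)
      qed
    qed
    moreover have "(LINT x|lebesgue. dens U' W' x + young_const * decay x) = J p V \<Gamma> U' + young_const * G0"
      using dens_integrable[OF U'X W'] decay_integrable J_eq[OF U'X W' curl] by (simp add: G0_def)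
    ultimately show "J p V \<Gamma> U' \<le> m + e" by simp
  qed
  then show ?thesis using U'G m_le by (meson order_trans)
qed

section \<open>Smooth fields of compact support as members of \<open>X_G1\<close>\<close>

definition bump_field :: vfield where
  "bump_field x = (flat_exp 1 (1 - ((x $ 1)\<^sup>2 + (x $ 2)\<^sup>2 + (x $ 3)\<^sup>2))) *\<^sub>R vector [- (x $ 2), x $ 1, 0]"

lemma bump_field_test: "(\<lambda>x. bump_field (c *\<^sub>R x)) \<in> test_fields" if c: "0 < c" for c
proof -
  define \<eta> where "\<eta> x = flat_exp 1 (1 - ((c * x $ 1) * (c * x $ 1) + (c * x $ 2) * (c * x $ 2) + (c * x $ 3) * (c * x $ 3)))" for x :: "real^3"
  have \<eta>: "test_fun \<eta>"
    unfolding test_fun_def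
  proof
    show "smooth \<eta>" unfolding \<eta>_def[abs_def]
      by (intro smooth_comp[OF smooth_real_flat_exp] smooth_intros)
    show "bounded {x. \<eta> x \<noteq> 0}"
    proof (rule boundedI[of _ "1/c"])
      fix x assume "x \<in> {x. \<eta> x \<noteq> 0}"
      then have "\<not> 1 - ((c * x $ 1) * (c * x $ 1) + (c * x $ 2) * (c * x $ 2) + (c * x $ 3) * (c * x $ 3)) \<le> 0"
        by (simp add: \<eta>_def flat_exp_1_pos)
      moreover have "(c * norm x)\<^sup>2 = (c * x $ 1) * (c * x $ 1) + (c * x $ 2) * (c * x $ 2) + (c * x $ 3) * (c * x $ 3)"
        unfolding power_mult_distrib power2_norm_eq_inner inner_3 by (simp add: power2_eq_square algebra_simps)
      ultimately have "(c * norm x)\<^sup>2 < 1\<^sup>2" by simp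
      then have "c * norm x < 1" by (rule power2_less_imp_less) simp
      then show "norm x \<le> 1/c" using c by (simp add: field_simps)
    qed
  qed
  have "(\<lambda>x. bump_field (c *\<^sub>R x)) = (\<lambda>x. vector [\<eta> x * (- (c * x $ 2)), \<eta> x * (c * x $ 1), 0])"
    by (auto simp: fun_eq_iff bump_field_def \<eta>_def vec_eq_3 power2_eq_square)
  moreover have "(\<lambda>x. vector [\<eta> x * (- (c * x $ 2)), \<eta> x * (c * x $ 1), 0]) \<in> test_fields"
    by (intro test_field_vector test_fun_mult_right \<eta> smooth_intros test_fun_zero)
  ultimately show ?thesis by (simp only:)
qed

text \<open>Here the local boundedness of \<Gamma> enters; the growth hypothesis bounds |\<Gamma>|
  only from below.\<close>

lemma test_field_weighted:
  assumes \<phi>: "\<phi> \<in> test_fields"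
  shows "integrable lebesgue (\<lambda>x. \<bar>\<Gamma> x\<bar> * norm (\<phi> x) powr (p + 1))"
proof -
  note [measurable] = L2_measurable[OF test_fields_L2[OF \<phi>]]
  have t: "test_fun (\<lambda>x. \<phi> x $ i)" for i using \<phi> by (simp add: test_fields_iff)
  have "\<exists>B. \<forall>x. \<bar>\<phi> x $ i\<bar> \<le> B" for i using test_fun_bounded[OF t] by metis
  then obtain b where b: "\<And>i x. \<bar>\<phi> x $ i\<bar> \<le> b i" by metis
  have nb: "norm (\<phi> x) \<le> b 1 + b 2 + b 3" for x
    using norm_le_l1_cart[of "\<phi> x"] b[of x 1] b[of x 2] b[of x 3] by (simp add: sum_3)
  obtain R where R: "\<And>x. \<phi> x \<noteq> 0 \<Longrightarrow> norm x \<le> R"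
  proof -
    have "bounded {x. \<phi> x \<noteq> 0}"
      using \<phi> unfolding test_fields_def by (metis (no_types, lifting) bounded_closure_image bounded_subset closure_subset compact_imp_bounded mem_Collect_eq)
    then show ?thesis using that unfolding bounded_iff by auto
  qed
  obtain G where G: "AE x in lebesgue_on (cball 0 R). \<bar>\<Gamma> x\<bar> \<le> G"
    using \<Gamma>_loc[unfolded L_inf_loc_def L_inf_def, rule_format, OF compact_cball, of 0 R] by blast
  then have G: "AE x in lebesgue. x \<in> cball 0 R \<longrightarrow> \<bar>\<Gamma> x\<bar> \<le> G"
    by (subst (asm) AE_restrict_space_iff) auto
  define Q where "Q = (b 1 + b 2 + b 3) powr (p + 1)"
  show ?thesis
  proof (rule Bochner_Integration.integrable_bound)
    show "integrable lebesgue (\<lambda>x::real^3. (\<bar>G\<bar> * Q) * indicator (ball 0 (\<bar>R\<bar> + 1)) x)"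
      using integrable_indicator_ball by simp
    show "AE x in lebesgue. norm (\<bar>\<Gamma> x\<bar> * norm (\<phi> x) powr (p + 1)) \<le> norm ((\<bar>G\<bar> * Q) * indicator (ball 0 (\<bar>R\<bar> + 1)) x)"
      using G
    proof eventually_elim
      case (elim x)
      show ?case
      proof (cases "\<phi> x = 0")
        case False
        then have x: "norm x \<le> R" by (rule R)
        have "\<bar>\<Gamma> x\<bar> * norm (\<phi> x) powr (p + 1) \<le> \<bar>G\<bar> * Q"
          unfolding Q_def using elim x p nb by (intro mult_mono powr_mono2) auto
        then show ?thesis using x by (simp add: Q_def)
      qed simp
    qed
    show "(\<lambda>x. \<bar>\<Gamma> x\<bar> * norm (\<phi> x) powr (p + 1)) \<in> borel_measurable lebesgue" by measurable
  qed
qed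

end

section \<open>Negative energy\<close>

lemma integral_scale:
  fixes h :: "real^3 \<Rightarrow> real"
  assumes c: "0 < c" and h [measurable]: "h \<in> borel_measurable borel"
  shows "(LINT x|lborel. h x) = c^3 * (LINT x|lborel. h (c *\<^sub>R x))"
proof -
  have "(LINT x|lborel. h x) = (LINT x|density (distr lborel borel (\<lambda>x. 0 + c *\<^sub>R x)) (\<lambda>_. ennreal (\<bar>c\<bar>^DIM(real^3))). h x)"
    using c lborel_affine[of c "0 :: real^3"] by simp
  also have "\<dots> = (LINT x|distr lborel borel (\<lambda>x. 0 + c *\<^sub>R x). \<bar>c\<bar>^DIM(real^3) * h x)"
    by (subst integral_density) auto
  also have "\<dots> = (LINT x|lborel. c^3 * h (c *\<^sub>R x))"
    using c by (subst integral_distr) auto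
  finally show ?thesis by simp
qed

lemma pd_scale:
  assumes "f differentiable (at (c *\<^sub>R x))"
  shows "pd j (\<lambda>x. f (c *\<^sub>R x)) x = c * pd j f (c *\<^sub>R x)"
proof -
  have m: "mat c *v x + 0 = c *\<^sub>R x" for x :: "real^3"
    by (simp add: vec_eq_iff matrix_vector_mult_def mat_def if_distrib if_distribR cong: if_cong)
  have "f differentiable (at (mat c *v x + 0))" unfolding m by (rule assms)
  from pd_affine(1)[OF this, of j] show ?thesis
    unfolding m by (simp add: mat_def if_distrib if_distribR cong: if_cong)
qed

lemma curl_scale:
  assumes "\<phi> \<in> test_fields" "(\<lambda>x. \<phi> (c *\<^sub>R x)) \<in> test_fields"
  shows "curl (\<lambda>x. \<phi> (c *\<^sub>R x)) x = c *\<^sub>R curl \<phi> (c *\<^sub>R x)"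
proof -
  have s: "smooth (\<lambda>x. \<phi> x $ i)" "smooth (\<lambda>x. \<phi> (c *\<^sub>R x) $ i)" for i
    using assms by (auto simp: test_fields_iff intro: test_fun_smooth)
  have "pd j (\<lambda>x. \<phi> (c *\<^sub>R x) $ i) x = c * pd j (\<lambda>x. \<phi> x $ i) (c *\<^sub>R x)" for i j
    using pd_scale[of "\<lambda>x. \<phi> x $ i", OF smooth_differentiable[OF s(1)]] .
  then show ?thesis
    unfolding curl_vector[OF s(1)] curl_vector[OF s(2)] by (simp add: vec_eq_3 right_diff_distrib)
qed

lemma test_field_borel: assumes "\<phi> \<in> test_fields" shows "\<phi> \<in> borel_measurable borel"
  by (rule borel_measurable_vecI) (use assms in \<open>auto simp: test_fields_iff intro: test_fun_borel\<close>)

context defocusing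
begin

lemma test_field_X: assumes "\<phi> \<in> test_fields" shows "\<phi> \<in> X p \<Gamma>"
  by (rule X_I[OF L2_measurable[OF test_fields_L2[OF assms]] test_fields_L2[OF curl_test_field[OF assms]]
      test_field_weak_curl[OF assms] test_field_weighted[OF assms]])

lemma bump_field_X_G1: assumes c: "0 < c" shows "(\<lambda>x. bump_field (c *\<^sub>R x)) \<in> X_G1 p \<Gamma>"
proof -
  define q where "q z = (case z of (r, s) \<Rightarrow> c * r * flat_exp 1 (1 - c\<^sup>2 * (r\<^sup>2 + s\<^sup>2)))" for z
  have fe: "continuous_on UNIV (flat_exp 1)"
    using flat_exp_deriv by (intro continuous_at_imp_continuous_on) (auto intro: DERIV_isCont)
  have "continuous_on UNIV (\<lambda>z::real \<times> real. 1 - c\<^sup>2 * ((fst z)\<^sup>2 + (snd z)\<^sup>2))"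
    by (intro continuous_intros)
  from continuous_on_compose2[OF fe this]
  have "continuous_on UNIV (\<lambda>z::real \<times> real. flat_exp 1 (1 - c\<^sup>2 * ((fst z)\<^sup>2 + (snd z)\<^sup>2)))" by simp
  then have "continuous_on UNIV (\<lambda>z::real \<times> real. c * fst z * flat_exp 1 (1 - c\<^sup>2 * ((fst z)\<^sup>2 + (snd z)\<^sup>2)))"
    by (intro continuous_on_mult continuous_on_const continuous_on_fst continuous_on_id)
  then have "q \<in> borel_measurable borel"
    unfolding q_def[abs_def] case_prod_unfold by (rule borel_measurable_continuous_onI)
  then have q: "q \<in> borel_measurable (lebesgue_on ({0<..} \<times> UNIV))"
    by (intro measurable_restrict_space1 measurable_completion) simp
  have "bump_field (c *\<^sub>R x) = (q (cyl_radius x, x $ 3) / cyl_radius x) *\<^sub>R vector [- (x $ 2), x $ 1, 0]" for x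
  proof (cases "cyl_radius x = 0")
    case True
    then have "(x $ 1)\<^sup>2 + (x $ 2)\<^sup>2 = 0" by (simp add: cyl_radius_def)
    then have "x $ 1 = 0 \<and> x $ 2 = 0" by (simp add: sum_power2_eq_zero_iff)
    then show ?thesis by (simp add: bump_field_def vec_eq_3)
  next
    case False
    have "(c * x $ 1)\<^sup>2 + (c * x $ 2)\<^sup>2 + (c * x $ 3)\<^sup>2 = c\<^sup>2 * ((cyl_radius x)\<^sup>2 + (x $ 3)\<^sup>2)"
      by (simp add: cyl_radius_def power_mult_distrib algebra_simps)
    then show ?thesis using False by (simp add: bump_field_def q_def vec_eq_3)
  qed
  then show ?thesis
    using q test_field_X[OF bump_field_test[OF c]] unfolding X_G1_def by blast
qed

lemma bump_field_nonzero: "0 < (LINT x|lebesgue. (norm (bump_field x))\<^sup>2)"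
proof -
  have bf: "bump_field \<in> test_fields" using bump_field_test[of 1] by simp
  have i: "integrable lebesgue (\<lambda>x. (norm (bump_field x))\<^sup>2)" by (rule L2_integrable[OF test_fields_L2[OF bf]])
  have "(LINT x|lebesgue. (norm (bump_field x))\<^sup>2) \<noteq> 0"
  proof
    assume "(LINT x|lebesgue. (norm (bump_field x))\<^sup>2) = 0"
    then have "AE x in lebesgue. (norm (bump_field x))\<^sup>2 = 0"
      using integral_nonneg_eq_0_iff_AE[OF i] by simp
    then have "AE x in lebesgue. x \<notin> ball (0 :: real^3) 1"
      using AE_nth_neq_0[of 1]
    proof eventually_elim
      case (elim x)
      show ?case
      proof
        assume "x \<in> ball 0 1"
        then have "(norm x)\<^sup>2 < 1\<^sup>2" by (intro power_strict_mono) auto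
        then have "0 < 1 - ((x $ 1)\<^sup>2 + (x $ 2)\<^sup>2 + (x $ 3)\<^sup>2)"
          unfolding power2_norm_eq_inner inner_3 by (simp add: power2_eq_square)
        then have "flat_exp 1 (1 - ((x $ 1)\<^sup>2 + (x $ 2)\<^sup>2 + (x $ 3)\<^sup>2)) \<noteq> 0"
          using flat_exp_1_pos(1) by (metis less_irrefl)
        moreover have "bump_field x $ 2 = 0" using elim(1) by simp
        ultimately show False using elim(2) by (simp add: bump_field_def)
      qed
    qed
    then have "negligible (ball (0 :: real^3) 1)"
      unfolding negligible_iff_null_sets by (intro AE_iff_null_sets[THEN iffD2]) auto
    then show False using open_not_negligible[of "ball (0 :: real^3) 1"] by simp
  qed
  moreover have "0 \<le> (LINT x|lebesgue. (norm (bump_field x))\<^sup>2)" by simp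
  ultimately show ?thesis by linarith
qed

text \<open>Dilation by \<open>c\<close> multiplies the curl term by c^2 relative to the L2 term, so
  a slowly varying field makes the quadratic part negative. At small amplitude the term of order p +
  1 > 2 cannot compensate this.\<close>

theorem negative_energy: "\<exists>U\<in>X_G1 p \<Gamma>. J p V \<Gamma> U < 0"
proof -
  have bf: "bump_field \<in> test_fields" using bump_field_test[of 1] by simp
  define A where "A = (LINT x|lebesgue. (norm (curl bump_field x))\<^sup>2)"
  define B where "B = (LINT x|lebesgue. (norm (bump_field x))\<^sup>2)"
  have A: "0 \<le> A" unfolding A_def by simp
  have B: "0 < B" unfolding B_def by (rule bump_field_nonzero)
  \<comment> \<open>Chosen so that c^2 (A + 1) = v0 B / 2, which is below v0 B; the summand 1 makes
    the quotient legitimate also for A = 0.\<close>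
  define c where "c = sqrt (v0 * B / (2 * (A + 1)))"
  have c: "0 < c" using v0 A B by (simp add: c_def)
  have "y / (2 * D) * D = y / 2" if "0 < D" for y D :: real using that by simp
  note half = this[of "A + 1" "v0 * B"]
  have "0 \<le> v0 * B / (2 * (A + 1))" using v0 A B by simp
  then have "c\<^sup>2 = v0 * B / (2 * (A + 1))" unfolding c_def by (rule real_sqrt_pow2)
  then have "c\<^sup>2 * (A + 1) = v0 * B / 2" using half A by simp
  moreover have "c\<^sup>2 * (A + 1) = c\<^sup>2 * A + c\<^sup>2" by (simp add: distrib_left)
  moreover have "0 < c\<^sup>2" using c by simp
  ultimately have cA: "c\<^sup>2 * A < v0 * B"
    using mult_pos_pos[OF v0 B] by linarith
  define \<phi> where "\<phi> x = bump_field (c *\<^sub>R x)" for x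
  have \<phi>: "\<phi> \<in> test_fields" unfolding \<phi>_def by (rule bump_field_test[OF c])
  note \<phi>2 = test_fields_L2[OF \<phi>] and c\<phi>2 = test_fields_L2[OF curl_test_field[OF \<phi>]]
  note [measurable] = test_field_borel[OF bf] test_field_borel[OF \<phi>]
    test_field_borel[OF curl_test_field[OF bf]] test_field_borel[OF curl_test_field[OF \<phi>]]
  have B_eq: "B = c^3 * (LINT x|lebesgue. (norm (\<phi> x))\<^sup>2)"
    unfolding B_def \<phi>_def using integral_scale[OF c, of "\<lambda>x. (norm (bump_field x))\<^sup>2"]
    using \<phi>_def test_field_borel[OF \<phi>] by (simp add: integral_completion)
  have A_eq: "c\<^sup>2 * A = c^3 * (LINT x|lebesgue. (norm (curl \<phi> x))\<^sup>2)"
  proof -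
    have "curl \<phi> x = c *\<^sub>R curl bump_field (c *\<^sub>R x)" for x
      using curl_scale[OF bf \<phi>[unfolded \<phi>_def]] by (simp add: \<phi>_def[abs_def])
    then have "(LINT x|lborel. (norm (curl \<phi> x))\<^sup>2) = c\<^sup>2 * (LINT x|lborel. (norm (curl bump_field (c *\<^sub>R x)))\<^sup>2)"
      by (simp add: power_mult_distrib)
    then show ?thesis
      unfolding A_def using integral_scale[OF c, of "\<lambda>x. (norm (curl bump_field x))\<^sup>2"]
      by (simp add: integral_completion)
  qed
  have c3: "0 < c^3" using c by simp
  define s where "s = (v0 * (LINT x|lebesgue. (norm (\<phi> x))\<^sup>2) - (LINT x|lebesgue. (norm (curl \<phi> x))\<^sup>2)) / 2"
  have s: "0 < s"
  proof -
    have "c^3 * (LINT x|lebesgue. (norm (curl \<phi> x))\<^sup>2) < c^3 * (v0 * (LINT x|lebesgue. (norm (\<phi> x))\<^sup>2))"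
      using cA A_eq B_eq by (simp add: mult.left_commute)
    then show ?thesis using c3 by (simp add: s_def)
  qed
  have Vle: "(LINT x|lebesgue. V x * (norm (\<phi> x))\<^sup>2) \<le> - v0 * (LINT x|lebesgue. (norm (\<phi> x))\<^sup>2)"
  proof -
    have "(LINT x|lebesgue. V x * (norm (\<phi> x))\<^sup>2) \<le> (LINT x|lebesgue. - v0 * (norm (\<phi> x))\<^sup>2)"
    proof (rule integral_mono_AE)
      show "AE x in lebesgue. V x * (norm (\<phi> x))\<^sup>2 \<le> - v0 * (norm (\<phi> x))\<^sup>2"
        using V_neg by eventually_elim (rule mult_right_mono, auto)
    qed (use V_sq_integrable[OF \<phi>2] L2_integrable[OF \<phi>2] in auto)
    then show ?thesis by simp
  qed
  define G where "G = (LINT x|lebesgue. \<bar>\<Gamma> x\<bar> * norm (\<phi> x) powr (p + 1))"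
  have G: "0 \<le> G" unfolding G_def by (intro integral_nonneg_AE) auto
  \<comment> \<open>With t^(p-1) = s / (G + 1) the weighted term is at most t^2 s / (p + 1), less
    than the gain t^2 s.\<close>
  define t where "t = (s / (G + 1)) powr (1 / (p - 1))"
  have t: "0 < t" using s G by (simp add: t_def)
  have tp: "t powr (p - 1) = s / (G + 1)" using s G p by (simp add: t_def powr_powr)
  \<comment> \<open>The summand with coefficient 0 brings the scaled field into the form of the
    lemmas on linear combinations.\<close>
  let ?U = "\<lambda>x. t *\<^sub>R \<phi> x + 0 *\<^sub>R \<phi> x" and ?W = "\<lambda>x. t *\<^sub>R curl \<phi> x + 0 *\<^sub>R curl \<phi> x"
  have UG: "?U \<in> X_G1 p \<Gamma>"
    using bump_field_X_G1[OF c] by (intro X_G1_lincomb) (simp_all add: \<phi>_def[abs_def])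
  have W2: "?W \<in> L2" by (intro L2_add L2_scaleR c\<phi>2)
  have wc: "is_weak_curl ?U ?W"
    by (rule is_weak_curl_lincomb[OF \<phi>2 c\<phi>2 test_field_weak_curl[OF \<phi>] \<phi>2 c\<phi>2 test_field_weak_curl[OF \<phi>]])
  have "J p V \<Gamma> ?U = (LINT x|lebesgue. dens ?U ?W x)" by (rule J_eq[OF X_G1_X[OF UG] W2 wc])
  also have "\<dots> = (LINT x|lebesgue. t\<^sup>2/2 * (norm (curl \<phi> x))\<^sup>2 + t\<^sup>2/2 * (V x * (norm (\<phi> x))\<^sup>2)
      + t powr (p + 1) / (p + 1) * (\<bar>\<Gamma> x\<bar> * norm (\<phi> x) powr (p + 1)))"
    using t by (intro Bochner_Integration.integral_cong) (auto simp: dens_alt power_mult_distrib powr_mult mult.left_commute)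
  also have "\<dots> = t\<^sup>2/2 * (LINT x|lebesgue. (norm (curl \<phi> x))\<^sup>2) + t\<^sup>2/2 * (LINT x|lebesgue. V x * (norm (\<phi> x))\<^sup>2)
      + t powr (p + 1) / (p + 1) * G"
    using L2_integrable[OF c\<phi>2] V_sq_integrable[OF \<phi>2] test_field_weighted[OF \<phi>] by (simp add: G_def)
  also have "\<dots> \<le> t\<^sup>2/2 * (LINT x|lebesgue. (norm (curl \<phi> x))\<^sup>2) + t\<^sup>2/2 * (- v0 * (LINT x|lebesgue. (norm (\<phi> x))\<^sup>2))
      + t powr (p + 1) / (p + 1) * G"
    by (intro add_mono mult_left_mono Vle) (use p in auto)
  also have "\<dots> = t\<^sup>2 * (- s + s / (G + 1) * G / (p + 1))"
  proof -
    have "t powr (p + 1) = t powr 2 * t powr (p - 1)" by (simp add: powr_add[symmetric] add.commute)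
    then have "t powr (p + 1) = t\<^sup>2 * (s / (G + 1))" using t by (simp add: tp powr_numeral)
    then have 1: "t powr (p + 1) / (p + 1) * G = t\<^sup>2 * (s / (G + 1) * G / (p + 1))" by simp
    have "t\<^sup>2/2 * a + t\<^sup>2/2 * (- v0 * b) = t\<^sup>2 * (- ((v0 * b - a) / 2))" for a b
      by (simp add: field_simps)
    then show ?thesis unfolding 1 s_def[symmetric] distrib_left by (simp only: s_def)
  qed
  also have "\<dots> < 0"
  proof -
    have "G / (G + 1) * (1 / (p + 1)) \<le> 1 * (1 / (p + 1))" using G p by (intro mult_right_mono) auto
    also have "\<dots> < 1" using p by simp
    finally have "s * (G / (G + 1) * (1 / (p + 1))) < s * 1" using s by (intro mult_strict_left_mono)
    then have "- s + s / (G + 1) * G / (p + 1) < 0" by simp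
    then show ?thesis using t by (intro mult_pos_neg) auto
  qed
  finally show ?thesis using UG by blast
qed

end

section \<open>The derivative of the energy\<close>

text \<open>The tangent inequality for the convex function \<open>t powr s\<close>. Used at both ends of a segment it
  replaces differentiation of the nonlinear term of the energy.\<close>

lemma powr_tangent:
  fixes a b s :: real
  assumes s: "1 < s" and ab: "0 \<le> a" "0 \<le> b"
  shows "s * (a powr (s - 1) * b) \<le> (s - 1) * a powr s + b powr s"
proof -
  have "a powr (s - 1) * b \<le> (a powr (s - 1)) powr (s / (s - 1)) / (s / (s - 1)) + b powr s / s"
    using s ab by (intro Youngs_inequality) (auto simp: field_simps)
  also have "(a powr (s - 1)) powr (s / (s - 1)) = a powr s" using s by (simp add: powr_powr)
  finally have "s * (a powr (s - 1) * b) \<le> s * (a powr s / (s / (s - 1)) + b powr s / s)"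
    using s by (intro mult_left_mono) auto
  also have "\<dots> = (s - 1) * a powr s + b powr s" using s by (simp add: field_simps)
  finally show ?thesis .
qed

lemma powr_minus_one_mult: "0 \<le> (a::real) \<Longrightarrow> a powr (s - 1) * a = a powr s"
  using powr_mult_base[of a "s - 1"] by (simp add: mult.commute)

text \<open>For p < 2 the power p - 1 is not Lipschitz near 0. The factor \<open>b\<close> repairs
  this, as both cases reduce to the tangent inequality for the power p.\<close>

lemma powr_diff_mult_le:
  fixes a b p :: real
  assumes p: "1 < p" and ab: "0 \<le> a" "0 \<le> b"
  shows "\<bar>a powr (p - 1) - b powr (p - 1)\<bar> * b \<le> p * (max a b powr (p - 1) * \<bar>a - b\<bar>)"
proof (cases "b \<le> a")
  case True
  have m: "b powr (p - 1) \<le> a powr (p - 1)" using True ab p by (intro powr_mono2) auto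
  have "\<bar>a powr (p - 1) - b powr (p - 1)\<bar> * b = a powr (p - 1) * b - b powr p"
    using m powr_minus_one_mult[OF ab(2), of p] by (simp add: left_diff_distrib)
  also have "a powr (p - 1) * b \<le> a powr p"
    using mult_left_mono[OF True, of "a powr (p - 1)"] powr_minus_one_mult[OF ab(1), of p] by simp
  also have "a powr p - b powr p \<le> p * (a powr (p - 1) * (a - b))"
    using powr_tangent[OF p ab] powr_minus_one_mult[OF ab(1), of p] by (simp add: algebra_simps)
  finally show ?thesis using True by (simp add: max_def)
next
  case False
  then have l: "a \<le> b" by simp
  have m: "a powr (p - 1) \<le> b powr (p - 1)" using l ab p by (intro powr_mono2) auto
  have "\<bar>a powr (p - 1) - b powr (p - 1)\<bar> * b = b powr p - a powr (p - 1) * b"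
    using m powr_minus_one_mult[OF ab(2), of p] by (simp add: left_diff_distrib)
  also have "\<dots> \<le> b powr p - a powr p"
    using mult_left_mono[OF l, of "a powr (p - 1)"] powr_minus_one_mult[OF ab(1), of p] by simp
  also have "\<dots> \<le> p * (b powr (p - 1) * (b - a))"
    using powr_tangent[OF p ab(2,1)] powr_minus_one_mult[OF ab(2), of p] by (simp add: algebra_simps)
  finally show ?thesis using l by (simp add: max_def)
qed

lemma norm_powr_tangent:
  fixes u w :: "'a::real_inner"
  assumes p: "1 < p"
  shows "norm u powr (p + 1) + (p + 1) * (norm u powr (p - 1) * (u \<bullet> (w - u))) \<le> norm w powr (p + 1)"
proof -
  have "u \<bullet> w \<le> norm u * norm w" by (rule norm_cauchy_schwarz)
  then have "norm u powr (p - 1) * (u \<bullet> w) \<le> norm u powr (p - 1) * (norm u * norm w)"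
    by (intro mult_left_mono) auto
  also have "\<dots> = norm u powr p * norm w"
    using powr_minus_one_mult[of "norm u" p] by (simp add: mult.assoc[symmetric])
  finally have "(p + 1) * (norm u powr (p - 1) * (u \<bullet> w)) \<le> (p + 1) * (norm u powr p * norm w)"
    using p by (intro mult_left_mono) auto
  also have "\<dots> \<le> p * norm u powr (p + 1) + norm w powr (p + 1)"
    using powr_tangent[of "p + 1" "norm u" "norm w"] p by simp
  finally have 1: "(p + 1) * (norm u powr (p - 1) * (u \<bullet> w)) \<le> p * norm u powr (p + 1) + norm w powr (p + 1)" .
  have "norm u powr (p - 1) * (u \<bullet> u) = norm u powr p * norm u"
    using powr_minus_one_mult[of "norm u" p] by (simp add: power2_norm_eq_inner[symmetric] power2_eq_square mult.assoc[symmetric])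
  also have "\<dots> = norm u powr (p + 1)" using powr_minus_one_mult[of "norm u" "p + 1"] by simp
  finally show ?thesis using 1 by (simp add: inner_diff_right right_diff_distrib algebra_simps)
qed

text \<open>The tangent inequality at \<open>u\<close> gives the sign of the remainder. The one at u
  + h bounds it by the difference of the gradients at the two ends, applied to \<open>h\<close>, so
  first derivatives suffice.\<close>

lemma norm_powr_expansion:
  fixes u h :: "'a::real_inner"
  assumes p: "1 < p"
  defines "R \<equiv> norm (u + h) powr (p + 1) - norm u powr (p + 1) - (p + 1) * (norm u powr (p - 1) * (u \<bullet> h))"
  shows "0 \<le> R" "R \<le> (p + 1)\<^sup>2 * 2 powr (p - 1) * (norm u powr (p - 1) * (norm h)\<^sup>2 + norm h powr (p + 1))"
proof -
  define w where "w = u + h"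
  have h: "h = w - u" by (simp add: w_def)
  show "0 \<le> R" using norm_powr_tangent[OF p, of u w] by (simp add: R_def w_def)
  define M where "M = max (norm w) (norm u)"
  let ?a = "norm w powr (p - 1)" and ?b = "norm u powr (p - 1)"
  have "norm w powr (p + 1) + (p + 1) * (?a * (w \<bullet> (u - w))) \<le> norm u powr (p + 1)"
    by (rule norm_powr_tangent[OF p])
  then have "R \<le> (p + 1) * (?a * (w \<bullet> h)) - (p + 1) * (?b * (u \<bullet> h))"
    by (simp add: R_def w_def[symmetric] h inner_diff_right right_diff_distrib algebra_simps)
  \<comment> \<open>The difference of the gradients splits into a change of the vector and a change
    of the scalar factor; \<open>powr_diff_mult_le\<close> handles the latter.\<close>
  also have "\<dots> = (p + 1) * ((?a *\<^sub>R (w - u) + (?a - ?b) *\<^sub>R u) \<bullet> h)"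
    by (simp add: inner_simps algebra_simps)
  also have "\<dots> \<le> (p + 1) * (norm (?a *\<^sub>R (w - u) + (?a - ?b) *\<^sub>R u) * norm h)"
    using p by (intro mult_left_mono norm_cauchy_schwarz) auto
  also have "\<dots> \<le> (p + 1) * (((p + 1) * (M powr (p - 1) * norm h)) * norm h)"
  proof (intro mult_left_mono mult_right_mono)
    have "norm (?a *\<^sub>R (w - u) + (?a - ?b) *\<^sub>R u) \<le> ?a * norm h + \<bar>?a - ?b\<bar> * norm u"
      by (rule order_trans[OF norm_triangle_ineq]) (simp add: h)
    also have "?a * norm h \<le> M powr (p - 1) * norm h"
      using p by (intro mult_right_mono powr_mono2) (auto simp: M_def)
    also have "\<bar>?a - ?b\<bar> * norm u \<le> p * (M powr (p - 1) * norm h)"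
    proof -
      have "\<bar>norm w - norm u\<bar> \<le> norm h" unfolding h by (rule norm_triangle_ineq3)
      then have "p * (M powr (p - 1) * \<bar>norm w - norm u\<bar>) \<le> p * (M powr (p - 1) * norm h)"
        using p by (intro mult_left_mono) auto
      then show ?thesis using powr_diff_mult_le[OF p, of "norm w" "norm u"] by (simp add: M_def)
    qed
    finally show "norm (?a *\<^sub>R (w - u) + (?a - ?b) *\<^sub>R u) \<le> (p + 1) * (M powr (p - 1) * norm h)"
      by (simp add: algebra_simps)
  qed (use p in auto)
  also have "\<dots> = (p + 1)\<^sup>2 * (M powr (p - 1) * (norm h)\<^sup>2)" by (simp add: power2_eq_square mult_ac)
  also have "\<dots> \<le> (p + 1)\<^sup>2 * ((2 powr (p - 1) * (norm u powr (p - 1) + norm h powr (p - 1))) * (norm h)\<^sup>2)"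
  proof (intro mult_left_mono mult_right_mono)
    have "M \<le> norm u + norm h" using norm_triangle_ineq[of u h] by (simp add: M_def w_def)
    then have "M powr (p - 1) \<le> (norm u + norm h) powr (p - 1)"
      using p by (intro powr_mono2) (auto simp: M_def le_max_iff_disj)
    also have "\<dots> \<le> 2 powr (p - 1) * (norm u powr (p - 1) + norm h powr (p - 1))"
      using p by (intro powr_add_le) auto
    finally show "M powr (p - 1) \<le> 2 powr (p - 1) * (norm u powr (p - 1) + norm h powr (p - 1))" .
  qed auto
  also have "\<dots> = (p + 1)\<^sup>2 * 2 powr (p - 1) * (norm u powr (p - 1) * (norm h)\<^sup>2 + norm h powr (p + 1))"
  proof -
    have "norm h powr (p - 1) * (norm h)\<^sup>2 = norm h powr p * norm h"
      using powr_minus_one_mult[of "norm h" p] by (simp add: power2_eq_square mult.assoc[symmetric])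
    also have "\<dots> = norm h powr (p + 1)" using powr_minus_one_mult[of "norm h" "p + 1"] by simp
    finally show ?thesis by (simp add: algebra_simps)
  qed
  finally show "R \<le> (p + 1)\<^sup>2 * 2 powr (p - 1) * (norm u powr (p - 1) * (norm h)\<^sup>2 + norm h powr (p + 1))" .
qed

text \<open>A scaled Young inequality. In \<open>J_expansion\<close> the number \<open>s\<close>
  bounds the norm of the increment \<open>b\<close>, so the weighted integral of its power is at
  most s^(p+1); the negative power cancels this and the factor s^2 remains.\<close>

lemma powr_mult_sq_le:
  fixes a b s p :: real
  assumes p: "1 < p" and ab: "0 \<le> a" "0 \<le> b" and s: "0 < s"
  shows "a powr (p - 1) * b\<^sup>2 \<le> s\<^sup>2 * (a powr (p + 1) + s powr (- (p + 1)) * b powr (p + 1))"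
proof -
  define c where "c = b / s"
  have c: "0 \<le> c" using ab s by (simp add: c_def)
  define m where "m = max a c"
  have m: "0 \<le> m" using ab by (simp add: m_def le_max_iff_disj)
  have "a powr (p - 1) * c\<^sup>2 \<le> m powr (p - 1) * m\<^sup>2"
    using ab c p by (intro mult_mono powr_mono2 power_mono) (auto simp: m_def)
  also have "\<dots> = m powr p * m"
    using powr_minus_one_mult[OF m, of p] by (simp add: power2_eq_square mult.assoc[symmetric])
  also have "\<dots> = m powr (p + 1)" using powr_minus_one_mult[OF m, of "p + 1"] by simp
  also have "\<dots> \<le> a powr (p + 1) + c powr (p + 1)" by (simp add: m_def max_def)
  finally have "s\<^sup>2 * (a powr (p - 1) * c\<^sup>2) \<le> s\<^sup>2 * (a powr (p + 1) + c powr (p + 1))"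
    by (intro mult_left_mono) auto
  moreover have "b\<^sup>2 = s\<^sup>2 * c\<^sup>2" using s by (simp add: c_def power_divide)
  moreover have "c powr (p + 1) = s powr (- (p + 1)) * b powr (p + 1)"
    unfolding c_def using ab s by (simp only: powr_divide powr_minus) (simp add: divide_inverse)
  ultimately show ?thesis by (simp add: mult.left_commute)
qed

context defocusing
begin

text \<open>The part of the Euler-Lagrange expression without the curl; as \<Gamma> is negative, the
  nonlinear term carries |\<Gamma>|.\<close>

definition slope :: "vfield \<Rightarrow> vfield" where
  "slope U x = (V x + \<bar>\<Gamma> x\<bar> * norm (U x) powr (p - 1)) *\<^sub>R U x"

text \<open>The first variation in direction \<open>H\<close>. Both curls are arguments, so that the
  symmetry argument can work with explicit representatives.\<close>

definition dJ :: "vfield \<Rightarrow> vfield \<Rightarrow> vfield \<Rightarrow> vfield \<Rightarrow> real" where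
  "dJ U W H Y = (LINT x|lebesgue. W x \<bullet> Y x + slope U x \<bullet> H x)"

lemma slope_measurable: "U \<in> borel_measurable lebesgue \<Longrightarrow> slope U \<in> borel_measurable lebesgue"
proof -
  assume [measurable]: "U \<in> borel_measurable lebesgue"
  show ?thesis unfolding slope_def[abs_def] by measurable
qed

lemma slope_mult_integrable:
  assumes U: "U \<in> X p \<Gamma>" and H: "H \<in> X p \<Gamma>"
  shows "integrable lebesgue (\<lambda>x. norm (slope U x) * norm (H x))"
proof (rule Bochner_Integration.integrable_bound)
  note [measurable] = X_D(3)[OF U] X_D(3)[OF H] slope_measurable[OF X_D(3)[OF U]]
  show "(\<lambda>x. norm (slope U x) * norm (H x)) \<in> borel_measurable lebesgue" by measurable
  show "integrable lebesgue (\<lambda>x. v * (norm (U x) * norm (H x))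
      + (\<bar>\<Gamma> x\<bar> * norm (U x) powr (p + 1) + \<bar>\<Gamma> x\<bar> * norm (H x) powr (p + 1)))"
    using L2_norm_mult_integrable[OF X_D(2)[OF U] X_D(2)[OF H]] X_D(6)[OF U] X_D(6)[OF H] by simp
  show "AE x in lebesgue. norm (norm (slope U x) * norm (H x)) \<le> norm (v * (norm (U x) * norm (H x))
      + (\<bar>\<Gamma> x\<bar> * norm (U x) powr (p + 1) + \<bar>\<Gamma> x\<bar> * norm (H x) powr (p + 1)))"
    using V_bound
  proof eventually_elim
    case (elim x)
    define m where "m = max (norm (U x)) (norm (H x))"
    have m: "0 \<le> m" "norm (U x) \<le> m" "norm (H x) \<le> m" by (auto simp: m_def le_max_iff_disj)
    have "norm (U x) powr p * norm (H x) \<le> m powr p * m"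
      using p m by (intro mult_mono powr_mono2) auto
    also have "\<dots> = m powr (p + 1)" using powr_minus_one_mult[OF m(1), of "p + 1"] by simp
    also have "\<dots> \<le> norm (U x) powr (p + 1) + norm (H x) powr (p + 1)" by (simp add: m_def max_def)
    finally have 1: "norm (U x) powr p * norm (H x) \<le> norm (U x) powr (p + 1) + norm (H x) powr (p + 1)" .
    have "norm (slope U x) \<le> (v + \<bar>\<Gamma> x\<bar> * norm (U x) powr (p - 1)) * norm (U x)"
      unfolding slope_def norm_scaleR
      using elim abs_triangle_ineq[of "V x" "\<bar>\<Gamma> x\<bar> * norm (U x) powr (p - 1)"]
      by (intro mult_right_mono) (auto simp: abs_mult)
    also have "\<dots> = v * norm (U x) + \<bar>\<Gamma> x\<bar> * norm (U x) powr p"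
      using powr_minus_one_mult[of "norm (U x)" p] by (simp add: distrib_right mult.assoc)
    finally have "norm (slope U x) * norm (H x) \<le> (v * norm (U x) + \<bar>\<Gamma> x\<bar> * norm (U x) powr p) * norm (H x)"
      by (rule mult_right_mono) simp
    also have "\<dots> \<le> v * (norm (U x) * norm (H x)) + (\<bar>\<Gamma> x\<bar> * norm (U x) powr (p + 1) + \<bar>\<Gamma> x\<bar> * norm (H x) powr (p + 1))"
      using mult_left_mono[OF 1, of "\<bar>\<Gamma> x\<bar>"] by (simp add: algebra_simps)
    finally show ?case by simp
  qed
qed

lemma slope_inner_integrable:
  assumes U: "U \<in> X p \<Gamma>" and H: "H \<in> X p \<Gamma>"
  shows "integrable lebesgue (\<lambda>x. slope U x \<bullet> H x)"
proof (rule Bochner_Integration.integrable_bound[OF slope_mult_integrable[OF assms]])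
  note [measurable] = X_D(3)[OF H] slope_measurable[OF X_D(3)[OF U]]
  show "(\<lambda>x. slope U x \<bullet> H x) \<in> borel_measurable lebesgue" by measurable
qed (simp add: Cauchy_Schwarz_ineq2)

lemma norm_X_bounds:
  assumes H: "H \<in> X p \<Gamma>" and s: "norm_X p \<Gamma> H \<le> s"
  shows "(LINT x|lebesgue. (norm (H x))\<^sup>2) + (LINT x|lebesgue. (norm (weak_curl H x))\<^sup>2) \<le> s\<^sup>2"
    "(LINT x|lebesgue. \<bar>\<Gamma> x\<bar> * norm (H x) powr (p + 1)) \<le> s powr (p + 1)"
proof -
  define a where "a = (LINT x|lebesgue. (norm (H x))\<^sup>2) + (LINT x|lebesgue. (norm (weak_curl H x))\<^sup>2)"
  define b where "b = (LINT x|lebesgue. \<bar>\<Gamma> x\<bar> * norm (H x) powr (p + 1))"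
  have a: "0 \<le> a" unfolding a_def by (intro add_nonneg_nonneg integral_nonneg_AE) auto
  have b: "0 \<le> b" unfolding b_def by (intro integral_nonneg_AE) auto
  have s': "sqrt a + b powr (1 / (p + 1)) \<le> s" using s by (simp add: norm_X_def a_def b_def)
  have "sqrt a \<le> s" using s' powr_ge_zero[of b "1 / (p + 1)"] by linarith
  then have "(sqrt a)\<^sup>2 \<le> s\<^sup>2" using a by (intro power_mono) auto
  then show "(LINT x|lebesgue. (norm (H x))\<^sup>2) + (LINT x|lebesgue. (norm (weak_curl H x))\<^sup>2) \<le> s\<^sup>2"
    using a by (simp add: a_def)
  have "b powr (1 / (p + 1)) \<le> s" using s' real_sqrt_ge_zero[OF a] by linarith
  then have "(b powr (1 / (p + 1))) powr (p + 1) \<le> s powr (p + 1)" using p by (intro powr_mono2) auto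
  then show "(LINT x|lebesgue. \<bar>\<Gamma> x\<bar> * norm (H x) powr (p + 1)) \<le> s powr (p + 1)"
    using b p by (simp add: powr_powr b_def)
qed

text \<open>The error is measured by a number s above the norm rather than by the norm itself:
  \<open>powr_mult_sq_le\<close> asks for s > 0, while the norm may be 0.\<close>

lemma J_expansion:
  assumes U: "U \<in> X p \<Gamma>"
  shows "\<exists>c\<ge>0. \<forall>H\<in>X p \<Gamma>. \<forall>s. norm_X p \<Gamma> H \<le> s \<longrightarrow> 0 < s \<longrightarrow> s \<le> 1 \<longrightarrow>
    \<bar>J p V \<Gamma> (\<lambda>x. U x + H x) - J p V \<Gamma> U - dJ U (weak_curl U) H (weak_curl H)\<bar> \<le> c * s\<^sup>2"
proof -
  define A where "A = (LINT x|lebesgue. \<bar>\<Gamma> x\<bar> * norm (U x) powr (p + 1))"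
  define k where "k = 1 / (p + 1) * ((p + 1)\<^sup>2 * 2 powr (p - 1))"
  have A: "0 \<le> A" unfolding A_def by (intro integral_nonneg_AE) auto
  have k: "0 \<le> k" using p by (simp add: k_def)
  show ?thesis
  proof (intro exI[of _ "1/2 + v/2 + k * (A + 2)"] conjI ballI allI impI)
    show "0 \<le> 1/2 + v/2 + k * (A + 2)" using v k A by simp
    fix H s assume H: "H \<in> X p \<Gamma>" and ns: "norm_X p \<Gamma> H \<le> s" and s: "0 < s" "s \<le> 1"
    define W where "W = weak_curl U"
    define Y where "Y = weak_curl H"
    note hb = norm_X_bounds[OF H ns]
    have UH: "(\<lambda>x. U x + H x) \<in> X p \<Gamma>" using X_lincomb[OF U H, of 1 1] by simp
    have WK: "is_weak_curl (\<lambda>x. U x + H x) (\<lambda>x. W x + Y x)"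
      using is_weak_curl_lincomb[OF X_D(2,4,5)[OF U] X_D(2,4,5)[OF H], of 1 1] by (simp add: W_def Y_def)
    have W2: "W \<in> L2" and K2: "Y \<in> L2" using X_D(4)[OF U] X_D(4)[OF H] by (auto simp: W_def Y_def)
    have WK2: "(\<lambda>x. W x + Y x) \<in> L2" by (rule L2_add[OF W2 K2])
    define T where "T x = dens (\<lambda>x. U x + H x) (\<lambda>x. W x + Y x) x - dens U W x - (W x \<bullet> Y x + slope U x \<bullet> H x)" for x
    have iL: "integrable lebesgue (\<lambda>x. W x \<bullet> Y x + slope U x \<bullet> H x)"
      by (intro Bochner_Integration.integrable_add L2_inner_integrable W2 K2 slope_inner_integrable U H)
    note i1 = dens_integrable[OF UH WK2] and i2 = dens_integrable[OF U W2]
    have iT: "integrable lebesgue T"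
      unfolding T_def by (intro Bochner_Integration.integrable_diff i1 i2 iL)
    have "J p V \<Gamma> (\<lambda>x. U x + H x) - J p V \<Gamma> U - dJ U W H Y = (LINT x|lebesgue. T x)"
      unfolding T_def using i1 i2 iL J_eq[OF UH WK2 WK] J_eq[OF U W2] X_D(5)[OF U] by (simp add: dJ_def W_def)
    then have "\<bar>J p V \<Gamma> (\<lambda>x. U x + H x) - J p V \<Gamma> U - dJ U W H Y\<bar> \<le> (LINT x|lebesgue. \<bar>T x\<bar>)"
      using integral_norm_bound[of lebesgue T] by simp
    also have "\<dots> \<le> (LINT x|lebesgue. 1/2 * (norm (Y x))\<^sup>2 + v/2 * (norm (H x))\<^sup>2
        + k * (s\<^sup>2 * (\<bar>\<Gamma> x\<bar> * norm (U x) powr (p + 1) + s powr (- (p + 1)) * (\<bar>\<Gamma> x\<bar> * norm (H x) powr (p + 1)))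
          + \<bar>\<Gamma> x\<bar> * norm (H x) powr (p + 1)))"
    proof (rule integral_mono_AE)
      show "integrable lebesgue (\<lambda>x. \<bar>T x\<bar>)" using iT by simp
      show "integrable lebesgue (\<lambda>x. 1/2 * (norm (Y x))\<^sup>2 + v/2 * (norm (H x))\<^sup>2
        + k * (s\<^sup>2 * (\<bar>\<Gamma> x\<bar> * norm (U x) powr (p + 1) + s powr (- (p + 1)) * (\<bar>\<Gamma> x\<bar> * norm (H x) powr (p + 1)))
          + \<bar>\<Gamma> x\<bar> * norm (H x) powr (p + 1)))"
        by (intro Bochner_Integration.integrable_add integrable_mult_right L2_integrable K2 X_D(2)[OF H] X_D(6) U H)
      show "AE x in lebesgue. \<bar>T x\<bar> \<le> 1/2 * (norm (Y x))\<^sup>2 + v/2 * (norm (H x))\<^sup>2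
        + k * (s\<^sup>2 * (\<bar>\<Gamma> x\<bar> * norm (U x) powr (p + 1) + s powr (- (p + 1)) * (\<bar>\<Gamma> x\<bar> * norm (H x) powr (p + 1)))
          + \<bar>\<Gamma> x\<bar> * norm (H x) powr (p + 1))"
        using V_bound
      proof eventually_elim
        case (elim x)
        define R where "R = norm (U x + H x) powr (p + 1) - norm (U x) powr (p + 1)
            - (p + 1) * (norm (U x) powr (p - 1) * (U x \<bullet> H x))"
        define E where "E = norm (U x) powr (p - 1) * (norm (H x))\<^sup>2 + norm (H x) powr (p + 1)"
        have R: "0 \<le> R" "R \<le> (p + 1)\<^sup>2 * 2 powr (p - 1) * E"
          unfolding R_def E_def by (rule norm_powr_expansion[OF p])+
        have T: "T x = 1/2 * (norm (Y x))\<^sup>2 + 1/2 * (V x * (norm (H x))\<^sup>2) + 1/(p + 1) * (\<bar>\<Gamma> x\<bar> * R)"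
        proof -
          have sq: "(norm (a + b))\<^sup>2 = (norm a)\<^sup>2 + 2 * (a \<bullet> b) + (norm b)\<^sup>2" for a b :: "real^3"
            by (simp add: power2_norm_eq_inner inner_simps inner_commute)
          have "norm (U x + H x) powr (p + 1) = R + norm (U x) powr (p + 1) + (p + 1) * (norm (U x) powr (p - 1) * (U x \<bullet> H x))"
            by (simp add: R_def)
          then have "1/(p + 1) * (\<bar>\<Gamma> x\<bar> * norm (U x + H x) powr (p + 1)) = 1/(p + 1) * (\<bar>\<Gamma> x\<bar> * R)
              + 1/(p + 1) * (\<bar>\<Gamma> x\<bar> * norm (U x) powr (p + 1)) + \<bar>\<Gamma> x\<bar> * (norm (U x) powr (p - 1) * (U x \<bullet> H x))"
            using p by (simp add: distrib_left)
          then show ?thesis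
            unfolding T_def dens_alt sq slope_def by (simp add: inner_simps algebra_simps)
        qed
        have "\<bar>1/2 * (V x * (norm (H x))\<^sup>2)\<bar> \<le> v/2 * (norm (H x))\<^sup>2"
          using mult_right_mono[OF elim, of "(norm (H x))\<^sup>2"] by (simp add: abs_mult)
        moreover have "0 \<le> 1/(p + 1) * (\<bar>\<Gamma> x\<bar> * R)" using R p by simp
        moreover have "1/(p + 1) * (\<bar>\<Gamma> x\<bar> * R) \<le> k * (s\<^sup>2 * (\<bar>\<Gamma> x\<bar> * norm (U x) powr (p + 1)
            + s powr (- (p + 1)) * (\<bar>\<Gamma> x\<bar> * norm (H x) powr (p + 1))) + \<bar>\<Gamma> x\<bar> * norm (H x) powr (p + 1))"
        proof -
          have "E \<le> s\<^sup>2 * (norm (U x) powr (p + 1) + s powr (- (p + 1)) * norm (H x) powr (p + 1)) + norm (H x) powr (p + 1)"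
            unfolding E_def using powr_mult_sq_le[OF p, of "norm (U x)" "norm (H x)" s] s by simp
          then have "(k * \<bar>\<Gamma> x\<bar>) * E \<le> (k * \<bar>\<Gamma> x\<bar>) * (s\<^sup>2 * (norm (U x) powr (p + 1)
              + s powr (- (p + 1)) * norm (H x) powr (p + 1)) + norm (H x) powr (p + 1))"
            using k by (intro mult_left_mono) auto
          moreover have "1/(p + 1) * (\<bar>\<Gamma> x\<bar> * R) \<le> 1/(p + 1) * (\<bar>\<Gamma> x\<bar> * ((p + 1)\<^sup>2 * 2 powr (p - 1) * E))"
            using R p by (intro mult_left_mono) auto
          moreover have "1/(p + 1) * (\<bar>\<Gamma> x\<bar> * ((p + 1)\<^sup>2 * 2 powr (p - 1) * E)) = (k * \<bar>\<Gamma> x\<bar>) * E"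
            by (simp add: k_def)
          ultimately show ?thesis by (simp add: algebra_simps)
        qed
        moreover have "0 \<le> 1/2 * (norm (Y x))\<^sup>2" by simp
        ultimately show ?case unfolding T by linarith
      qed
    qed
    also have "\<dots> = 1/2 * (LINT x|lebesgue. (norm (Y x))\<^sup>2) + v/2 * (LINT x|lebesgue. (norm (H x))\<^sup>2)
        + k * (s\<^sup>2 * (A + s powr (- (p + 1)) * (LINT x|lebesgue. \<bar>\<Gamma> x\<bar> * norm (H x) powr (p + 1)))
          + (LINT x|lebesgue. \<bar>\<Gamma> x\<bar> * norm (H x) powr (p + 1)))"
    proof -
      have "(LINT x|lebesgue. a * f1 x + b * f2 x + c * (d * (f3 x + e * f4 x) + f4 x))
          = a * (LINT x|lebesgue. f1 x) + b * (LINT x|lebesgue. f2 x) + c * (d * ((LINT x|lebesgue. f3 x) + e * (LINT x|lebesgue. f4 x)) + (LINT x|lebesgue. f4 x))"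
        if "integrable lebesgue f1" "integrable lebesgue f2" "integrable lebesgue f3" "integrable lebesgue f4"
        for f1 f2 f3 f4 :: "real^3 \<Rightarrow> real" and a b c d e
        using that by simp
      from this[OF L2_integrable[OF K2] L2_integrable[OF X_D(2)[OF H]] X_D(6)[OF U] X_D(6)[OF H]]
      show ?thesis unfolding A_def .
    qed
    also have "\<dots> \<le> 1/2 * s\<^sup>2 + v/2 * s\<^sup>2 + k * (s\<^sup>2 * (A + 1) + s\<^sup>2)"
    proof (intro add_mono mult_left_mono)
      have n: "0 \<le> (LINT x|lebesgue. (norm (H x))\<^sup>2)" "0 \<le> (LINT x|lebesgue. (norm (Y x))\<^sup>2)" by auto
      show "(LINT x|lebesgue. (norm (Y x))\<^sup>2) \<le> s\<^sup>2" "(LINT x|lebesgue. (norm (H x))\<^sup>2) \<le> s\<^sup>2"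
        using hb(1) n unfolding Y_def by linarith+
      have "s powr (- (p + 1)) * (LINT x|lebesgue. \<bar>\<Gamma> x\<bar> * norm (H x) powr (p + 1)) \<le> s powr (- (p + 1)) * s powr (p + 1)"
        by (intro mult_left_mono hb(2)) auto
      also have "\<dots> = 1" using s by (simp add: powr_add[symmetric])
      finally show "s powr (- (p + 1)) * (LINT x|lebesgue. \<bar>\<Gamma> x\<bar> * norm (H x) powr (p + 1)) \<le> 1" .
      have "s powr (p + 1) \<le> s powr 2" using s p by (intro powr_mono') auto
      then show "(LINT x|lebesgue. \<bar>\<Gamma> x\<bar> * norm (H x) powr (p + 1)) \<le> s\<^sup>2"
        using hb(2) s by (simp add: powr_numeral)
    qed (use v k in auto)
    also have "\<dots> = (1/2 + v/2 + k * (A + 2)) * s\<^sup>2" by (simp add: algebra_simps)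
    finally show "\<bar>J p V \<Gamma> (\<lambda>x. U x + H x) - J p V \<Gamma> U - dJ U (weak_curl U) H (weak_curl H)\<bar>
        \<le> (1/2 + v/2 + k * (A + 2)) * s\<^sup>2" by (simp add: W_def Y_def)
  qed
qed

lemma dJ_cong:
  assumes "AE x in lebesgue. H x = H' x" "AE x in lebesgue. Y x = Y' x"
    and m: "U \<in> borel_measurable lebesgue" "W \<in> borel_measurable lebesgue" "H \<in> borel_measurable lebesgue"
      "H' \<in> borel_measurable lebesgue" "Y \<in> borel_measurable lebesgue" "Y' \<in> borel_measurable lebesgue"
  shows "dJ U W H Y = dJ U W H' Y'"
  unfolding dJ_def
proof (rule integral_cong_AE)
  note [measurable] = m slope_measurable[OF m(1)]
  show "(\<lambda>x. W x \<bullet> Y x + slope U x \<bullet> H x) \<in> borel_measurable lebesgue"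
    "(\<lambda>x. W x \<bullet> Y' x + slope U x \<bullet> H' x) \<in> borel_measurable lebesgue" by measurable
  show "AE x in lebesgue. W x \<bullet> Y x + slope U x \<bullet> H x = W x \<bullet> Y' x + slope U x \<bullet> H' x"
    using assms(1,2) by eventually_elim simp
qed

lemma dJ_scale:
  assumes H: "H \<in> X p \<Gamma>" and U: "U \<in> X p \<Gamma>"
  shows "dJ U (weak_curl U) (\<lambda>x. t *\<^sub>R H x) (weak_curl (\<lambda>x. t *\<^sub>R H x)) = t * dJ U (weak_curl U) H (weak_curl H)"
    "norm_X p \<Gamma> (\<lambda>x. t *\<^sub>R H x) = \<bar>t\<bar> * norm_X p \<Gamma> H"
proof -
  have tX: "(\<lambda>x. t *\<^sub>R H x) \<in> X p \<Gamma>" using X_lincomb[OF H H, of t 0] by simp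
  have wc: "AE x in lebesgue. weak_curl (\<lambda>x. t *\<^sub>R H x) x = t *\<^sub>R weak_curl H x"
    using weak_curl_lincomb(2)[OF X_D(1)[OF H] X_D(1)[OF H], of t 0] by simp
  note [measurable] = L2_measurable[OF X_D(4)[OF tX]] L2_measurable[OF X_D(4)[OF H]]
  have "dJ U (weak_curl U) (\<lambda>x. t *\<^sub>R H x) (weak_curl (\<lambda>x. t *\<^sub>R H x)) = dJ U (weak_curl U) (\<lambda>x. t *\<^sub>R H x) (\<lambda>x. t *\<^sub>R weak_curl H x)"
    by (rule dJ_cong[OF _ wc X_D(3)[OF U] L2_measurable[OF X_D(4)[OF U]] X_D(3)[OF tX] X_D(3)[OF tX]]) auto
  also have "\<dots> = (LINT x|lebesgue. t * (weak_curl U x \<bullet> weak_curl H x + slope U x \<bullet> H x))"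
    unfolding dJ_def by (simp add: distrib_left)
  finally show "dJ U (weak_curl U) (\<lambda>x. t *\<^sub>R H x) (weak_curl (\<lambda>x. t *\<^sub>R H x)) = t * dJ U (weak_curl U) H (weak_curl H)"
    by (simp add: dJ_def)
  have "(LINT x|lebesgue. (norm (weak_curl (\<lambda>x. t *\<^sub>R H x) x))\<^sup>2) = (LINT x|lebesgue. t\<^sup>2 * (norm (weak_curl H x))\<^sup>2)"
  proof (rule integral_cong_AE)
    show "AE x in lebesgue. (norm (weak_curl (\<lambda>x. t *\<^sub>R H x) x))\<^sup>2 = t\<^sup>2 * (norm (weak_curl H x))\<^sup>2"
      using wc by eventually_elim (simp add: power_mult_distrib)
  qed measurable
  then have 1: "(LINT x|lebesgue. (norm (weak_curl (\<lambda>x. t *\<^sub>R H x) x))\<^sup>2) = t\<^sup>2 * (LINT x|lebesgue. (norm (weak_curl H x))\<^sup>2)"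
    by simp
  have 2: "(LINT x|lebesgue. (norm (t *\<^sub>R H x))\<^sup>2) = t\<^sup>2 * (LINT x|lebesgue. (norm (H x))\<^sup>2)"
    by (simp add: power_mult_distrib)
  have 3: "(LINT x|lebesgue. \<bar>\<Gamma> x\<bar> * norm (t *\<^sub>R H x) powr (p + 1))
      = \<bar>t\<bar> powr (p + 1) * (LINT x|lebesgue. \<bar>\<Gamma> x\<bar> * norm (H x) powr (p + 1))"
  proof -
    have "(LINT x|lebesgue. \<bar>\<Gamma> x\<bar> * norm (t *\<^sub>R H x) powr (p + 1))
        = (LINT x|lebesgue. \<bar>t\<bar> powr (p + 1) * (\<bar>\<Gamma> x\<bar> * norm (H x) powr (p + 1)))"
      by (intro Bochner_Integration.integral_cong) (auto simp: powr_mult)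
    then show ?thesis by simp
  qed
  have n: "0 \<le> (LINT x|lebesgue. \<bar>\<Gamma> x\<bar> * norm (H x) powr (p + 1))" by (intro integral_nonneg_AE) auto
  show "norm_X p \<Gamma> (\<lambda>x. t *\<^sub>R H x) = \<bar>t\<bar> * norm_X p \<Gamma> H"
  proof -
    have "sqrt (t\<^sup>2 * a + t\<^sup>2 * b) = \<bar>t\<bar> * sqrt (a + b)" for a b
      by (simp only: distrib_left[symmetric] real_sqrt_mult real_sqrt_abs)
    moreover have "(\<bar>t\<bar> powr (p + 1) * b) powr (1 / (p + 1)) = \<bar>t\<bar> * b powr (1 / (p + 1))" if "0 \<le> b" for b
      using that p by (simp add: powr_mult powr_powr)
    ultimately show ?thesis
      unfolding norm_X_def 1 2 3 using n by (simp only: distrib_left)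
  qed
qed

text \<open>One-sided difference quotients along \<open>H\<close> and along -\<open>H\<close>, both
  of which stay in the linear space \<open>X_G1\<close>.\<close>

lemma dJ_zero_of_minimizer:
  assumes U: "U \<in> X_G1 p \<Gamma>" and min: "\<And>W. W \<in> X_G1 p \<Gamma> \<Longrightarrow> J p V \<Gamma> U \<le> J p V \<Gamma> W" and H: "H \<in> X_G1 p \<Gamma>"
  shows "dJ U (weak_curl U) H (weak_curl H) = 0"
proof -
  note UX = X_G1_X[OF U]
  obtain c where c: "0 \<le> c" and ex: "\<And>H s. H \<in> X p \<Gamma> \<Longrightarrow> norm_X p \<Gamma> H \<le> s \<Longrightarrow> 0 < s \<Longrightarrow> s \<le> 1 \<Longrightarrow>
    \<bar>J p V \<Gamma> (\<lambda>x. U x + H x) - J p V \<Gamma> U - dJ U (weak_curl U) H (weak_curl H)\<bar> \<le> c * s\<^sup>2"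
    using J_expansion[OF UX] by blast
  have ge: "0 \<le> dJ U (weak_curl U) H (weak_curl H)" if H: "H \<in> X_G1 p \<Gamma>" for H
  proof (rule field_le_epsilon)
    fix e :: real assume e: "0 < e"
    define n where "n = \<bar>norm_X p \<Gamma> H\<bar> + 1"
    have n: "1 \<le> n" "norm_X p \<Gamma> H \<le> n" by (auto simp: n_def)
    \<comment> \<open>Small enough for t n \<le> 1, the range of the expansion, and for the
      quadratic error divided by \<open>t\<close> to be at most e.\<close>
    define t where "t = min (1 / n) (e / (c * n\<^sup>2 + 1))"
    have cn: "0 < c * n\<^sup>2 + 1" using c by (simp add: add_nonneg_pos)
    have t: "0 < t" "t * n \<le> 1" "t * (c * n\<^sup>2) \<le> e"
    proof -
      show t: "0 < t" using n e cn by (simp add: t_def)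
      have "t \<le> 1 / n" by (simp add: t_def)
      then show "t * n \<le> 1" using n by (simp add: field_simps)
      have "t \<le> e / (c * n\<^sup>2 + 1)" by (simp add: t_def)
      then have "t * (c * n\<^sup>2 + 1) \<le> e" using cn by (simp add: pos_le_divide_eq)
      then show "t * (c * n\<^sup>2) \<le> e" using t by (simp add: distrib_left)
    qed
    have tX: "(\<lambda>x. t *\<^sub>R H x) \<in> X p \<Gamma>" using X_lincomb[OF X_G1_X[OF H] X_G1_X[OF H], of t 0] by simp
    have "(\<lambda>x. 1 *\<^sub>R U x + t *\<^sub>R H x) \<in> X_G1 p \<Gamma>" by (rule X_G1_lincomb[OF U H])
    then have "J p V \<Gamma> U \<le> J p V \<Gamma> (\<lambda>x. U x + t *\<^sub>R H x)" using min by simp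
    moreover have "norm_X p \<Gamma> (\<lambda>x. t *\<^sub>R H x) \<le> t * n"
      unfolding dJ_scale(2)[OF X_G1_X[OF H] UX] using t n by (simp add: mult_left_mono)
    then have "\<bar>J p V \<Gamma> (\<lambda>x. U x + t *\<^sub>R H x) - J p V \<Gamma> U - dJ U (weak_curl U) (\<lambda>x. t *\<^sub>R H x) (weak_curl (\<lambda>x. t *\<^sub>R H x))\<bar> \<le> c * (t * n)\<^sup>2"
      using t n by (intro ex tX) auto
    ultimately have "0 \<le> t * dJ U (weak_curl U) H (weak_curl H) + c * (t * n)\<^sup>2"
      unfolding dJ_scale(1)[OF X_G1_X[OF H] UX] by linarith
    also have "\<dots> = t * (dJ U (weak_curl U) H (weak_curl H) + t * (c * n\<^sup>2))"
      by (simp add: power2_eq_square algebra_simps)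
    finally have "0 \<le> dJ U (weak_curl U) H (weak_curl H) + t * (c * n\<^sup>2)"
      using t by (simp add: zero_le_mult_iff)
    then show "0 \<le> dJ U (weak_curl U) H (weak_curl H) + e" using t(3) by linarith
  qed
  have mH: "(\<lambda>x. (- 1) *\<^sub>R H x) \<in> X_G1 p \<Gamma>" using X_G1_lincomb[OF H H, of "-1" 0] by simp
  show ?thesis
    using ge[OF H] ge[OF mH] unfolding dJ_scale(1)[OF X_G1_X[OF H] UX] by linarith
qed

lemma critical_pointI:
  assumes U: "U \<in> X p \<Gamma>" and zero: "\<And>H. H \<in> X p \<Gamma> \<Longrightarrow> dJ U (weak_curl U) H (weak_curl H) = 0"
  shows "critical_point p V \<Gamma> U"
  unfolding critical_point_def
proof (intro conjI allI impI U)
  fix \<epsilon> :: real assume \<epsilon>: "0 < \<epsilon>"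
  obtain c where c: "0 \<le> c" and ex: "\<And>H s. H \<in> X p \<Gamma> \<Longrightarrow> norm_X p \<Gamma> H \<le> s \<Longrightarrow> 0 < s \<Longrightarrow> s \<le> 1 \<Longrightarrow>
    \<bar>J p V \<Gamma> (\<lambda>x. U x + H x) - J p V \<Gamma> U - dJ U (weak_curl U) H (weak_curl H)\<bar> \<le> c * s\<^sup>2"
    using J_expansion[OF U] by blast
  define \<delta> where "\<delta> = min 1 (\<epsilon> / (c + 1))"
  have \<delta>: "0 < \<delta>" "\<delta> \<le> 1" "c * \<delta> \<le> \<epsilon>"
  proof -
    show d: "0 < \<delta>" "\<delta> \<le> 1" using \<epsilon> c by (auto simp: \<delta>_def)
    have "\<delta> \<le> \<epsilon> / (c + 1)" by (simp add: \<delta>_def)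
    then have "\<delta> * (c + 1) \<le> \<epsilon>" using c by (simp add: pos_le_divide_eq)
    then show "c * \<delta> \<le> \<epsilon>" using d by (simp add: algebra_simps)
  qed
  show "\<exists>\<delta>>0. \<forall>H\<in>X p \<Gamma>. norm_X p \<Gamma> H < \<delta> \<longrightarrow>
      \<bar>J p V \<Gamma> (\<lambda>x. U x + H x) - J p V \<Gamma> U\<bar> \<le> \<epsilon> * norm_X p \<Gamma> H"
  proof (intro exI[of _ \<delta>] conjI ballI impI \<delta>(1))
    fix H assume H: "H \<in> X p \<Gamma>" and nH: "norm_X p \<Gamma> H < \<delta>"
    let ?n = "norm_X p \<Gamma> H"
    have n: "0 \<le> ?n" unfolding norm_X_def by (intro add_nonneg_nonneg real_sqrt_ge_zero integral_nonneg_AE) auto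
    show "\<bar>J p V \<Gamma> (\<lambda>x. U x + H x) - J p V \<Gamma> U\<bar> \<le> \<epsilon> * ?n"
    proof (rule field_le_epsilon)
      fix e :: real assume e: "0 < e"
      \<comment> \<open>The norm may be 0, so it is enlarged by e / \<epsilon>; the cap \<delta>
        keeps c s \<le> \<epsilon>.\<close>
      define s where "s = min \<delta> (?n + e / \<epsilon>)"
      have s: "?n \<le> s" "0 < s" "s \<le> \<delta>" "s \<le> ?n + e / \<epsilon>"
        using nH e \<epsilon> \<delta> n by (auto simp: s_def add_nonneg_pos)
      have "\<bar>J p V \<Gamma> (\<lambda>x. U x + H x) - J p V \<Gamma> U\<bar> \<le> c * s\<^sup>2"
        using ex[OF H s(1,2)] zero[OF H] s(3) \<delta>(2) by simp
      also have "\<dots> = (c * s) * s" by (simp add: power2_eq_square)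
      also have "\<dots> \<le> (c * \<delta>) * s" using s c by (intro mult_right_mono mult_left_mono) auto
      also have "\<dots> \<le> \<epsilon> * s" using s \<delta> by (intro mult_right_mono) auto
      also have "\<dots> \<le> \<epsilon> * (?n + e / \<epsilon>)" using s \<epsilon> by (intro mult_left_mono) auto
      also have "\<dots> = \<epsilon> * ?n + e" using \<epsilon> by (simp add: distrib_left)
      finally show "\<bar>J p V \<Gamma> (\<lambda>x. U x + H x) - J p V \<Gamma> U\<bar> \<le> \<epsilon> * ?n + e" .
    qed
  qed
qed

end

section \<open>Averaging over rotations\<close>

lemma orthogonal_borel:
  fixes L :: "real^3 \<Rightarrow> real^3"
  assumes "orthogonal_transformation L" shows "L \<in> borel_measurable borel"
  by (intro borel_measurable_continuous_onI linear_continuous_on linear_conv_bounded_linear[THEN iffD1]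
      orthogonal_transformation_linear assms)

lemma pd_linear:
  assumes L: "linear L" and f: "smooth f"
  shows "pd j (\<lambda>x. f (L x)) x = (\<Sum>i\<in>UNIV. L (axis j 1) $ i * pd i f (L x))"
proof -
  have "(L has_derivative L) (at x)"
    using L by (intro bounded_linear_imp_has_derivative linear_conv_bounded_linear[THEN iffD1])
  from has_derivative_compose[OF this has_derivative_smooth[OF f]]
  show ?thesis by (rule pd_eqI)
qed

lemma smooth_linear:
  assumes L: "linear L" and f: "smooth f"
  shows "smooth (\<lambda>x. f (L x))"
  using smooth_affine[OF f, of "matrix L" 0] by (simp add: matrix_works[OF linear_matrix_vector_mul_eq[THEN iffD2, OF L]])

lemma test_fun_orthogonal:
  assumes L: "orthogonal_transformation L" and f: "test_fun f"
  shows "test_fun (\<lambda>x. f (L x))"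
  unfolding test_fun_def
proof
  show "smooth (\<lambda>x. f (L x))"
    by (rule smooth_linear[OF orthogonal_transformation_linear[OF L] test_fun_smooth[OF f]])
  obtain R where R: "\<And>x. f x \<noteq> 0 \<Longrightarrow> norm x < R" using test_fun_support[OF f] by blast
  show "bounded {x. f (L x) \<noteq> 0}"
  proof (rule boundedI[of _ R])
    fix x assume "x \<in> {x. f (L x) \<noteq> 0}"
    then show "norm x \<le> R" using R[of "L x"] orthogonal_transformation_norm[OF L, of x] by simp
  qed
qed

lemma pd_lincomb:
  assumes "smooth f" "smooth g"
  shows "pd j (\<lambda>x. a * f x + b * g x) x = a * pd j f x + b * pd j g x"
proof -
  have "(\<lambda>x. a * f x) differentiable (at x)" "(\<lambda>x. b * g x) differentiable (at x)"
    by (intro smooth_differentiable smooth_mult smooth_const assms)+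
  then show ?thesis using assms by (simp add: pd_add pd_cmult smooth_differentiable)
qed

lemma axis_nth_3: "axis (1::3) (1::real) $ 1 = 1" "axis (1::3) (1::real) $ 2 = 0" "axis (1::3) (1::real) $ 3 = 0"
  "axis (2::3) (1::real) $ 1 = 0" "axis (2::3) (1::real) $ 2 = 1" "axis (2::3) (1::real) $ 3 = 0"
  "axis (3::3) (1::real) $ 1 = 0" "axis (3::3) (1::real) $ 2 = 0" "axis (3::3) (1::real) $ 3 = 1"
  by (simp_all add: axis_def)

lemma sin_cos_combine: "cos \<theta> * (cos \<theta> * y) + sin \<theta> * (sin \<theta> * y) = (y :: real)"
proof -
  have "cos \<theta> * (cos \<theta> * y) + sin \<theta> * (sin \<theta> * y) = ((sin \<theta>)\<^sup>2 + (cos \<theta>)\<^sup>2) * y" by algebra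
  then show ?thesis by simp
qed

lemma rot_test_field:
  assumes \<phi>: "\<phi> \<in> test_fields"
  shows "(\<lambda>x. rot \<theta> (\<phi> (rot (- \<theta>) x))) \<in> test_fields"
    "curl (\<lambda>x. rot \<theta> (\<phi> (rot (- \<theta>) x))) x = rot \<theta> (curl \<phi> (rot (- \<theta>) x))"
proof -
  have t: "test_fun (\<lambda>x. \<phi> x $ i)" for i using \<phi> by (simp add: test_fields_iff)
  note s = test_fun_smooth[OF t]
  define g where "g i x = \<phi> (rot (- \<theta>) x) $ i" for i x
  have gt: "test_fun (g i)" for i
    unfolding g_def by (rule test_fun_orthogonal[OF orthogonal_rot t])
  note gs = test_fun_smooth[OF gt]
  define \<psi> where "\<psi> x = rot \<theta> (\<phi> (rot (- \<theta>) x))" for x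
  have \<psi>: "(\<lambda>x. \<psi> x $ 1) = (\<lambda>x. cos \<theta> * g 1 x + (- sin \<theta>) * g 2 x)"
    "(\<lambda>x. \<psi> x $ 2) = (\<lambda>x. sin \<theta> * g 1 x + cos \<theta> * g 2 x)" "(\<lambda>x. \<psi> x $ 3) = g 3"
    by (auto simp: \<psi>_def g_def)
  have lt: "test_fun (\<lambda>x. a * g i x + b * g j x)" for a b i j
    by (intro test_fun_add test_fun_mult_left smooth_const gt)
  have \<psi>t: "\<psi> \<in> test_fields"
    unfolding test_fields_iff forall_3 \<psi> using lt gt by blast
  then show "(\<lambda>x. rot \<theta> (\<phi> (rot (- \<theta>) x))) \<in> test_fields" by (simp add: \<psi>_def[abs_def])
  have s\<psi>: "smooth (\<lambda>x. \<psi> x $ i)" for i using \<psi>t by (auto simp: test_fields_iff intro: test_fun_smooth)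
  have pg: "pd j (g i) x = (\<Sum>k\<in>UNIV. rot (- \<theta>) (axis j 1) $ k * pd k (\<lambda>x. \<phi> x $ i) (rot (- \<theta>) x))" for i j x
    unfolding g_def by (rule pd_linear[OF linear_rot s])
  have "curl \<psi> x = rot \<theta> (curl \<phi> (rot (- \<theta>) x))"
    unfolding curl_vector[OF s\<psi>] curl_vector[OF s] \<psi> pd_lincomb[OF gs gs] pg vec_eq_3
    by (simp add: sum_3 axis_nth_3 algebra_simps sin_cos_combine)
  then show "curl (\<lambda>x. rot \<theta> (\<phi> (rot (- \<theta>) x))) x = rot \<theta> (curl \<phi> (rot (- \<theta>) x))"
    by (simp add: \<psi>_def[abs_def])
qed

text \<open>The curl is a pseudovector and a reflection has determinant -1, whence the sign.\<close>

lemma refl2_test_field: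
  assumes \<phi>: "\<phi> \<in> test_fields"
  shows "(\<lambda>x. refl2 (\<phi> (refl2 x))) \<in> test_fields"
    "curl (\<lambda>x. refl2 (\<phi> (refl2 x))) x = - refl2 (curl \<phi> (refl2 x))"
proof -
  have t: "test_fun (\<lambda>x. \<phi> x $ i)" for i using \<phi> by (simp add: test_fields_iff)
  note s = test_fun_smooth[OF t]
  define g where "g i x = \<phi> (refl2 x) $ i" for i x
  have gt: "test_fun (g i)" for i
    unfolding g_def by (rule test_fun_orthogonal[OF orthogonal_refl2 t])
  note gs = test_fun_smooth[OF gt]
  define \<psi> where "\<psi> x = refl2 (\<phi> (refl2 x))" for x
  have \<psi>: "(\<lambda>x. \<psi> x $ 1) = g 1" "(\<lambda>x. \<psi> x $ 2) = (\<lambda>x. (- 1) * g 2 x + 0 * g 2 x)" "(\<lambda>x. \<psi> x $ 3) = g 3"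
    by (auto simp: \<psi>_def g_def)
  have lt: "test_fun (\<lambda>x. a * g i x + b * g j x)" for a b i j
    by (intro test_fun_add test_fun_mult_left smooth_const gt)
  have \<psi>t: "\<psi> \<in> test_fields"
    unfolding test_fields_iff forall_3 \<psi> using lt gt by blast
  then show "(\<lambda>x. refl2 (\<phi> (refl2 x))) \<in> test_fields" by (simp add: \<psi>_def[abs_def])
  have s\<psi>: "smooth (\<lambda>x. \<psi> x $ i)" for i using \<psi>t by (auto simp: test_fields_iff intro: test_fun_smooth)
  have pg: "pd j (g i) x = (\<Sum>k\<in>UNIV. refl2 (axis j 1) $ k * pd k (\<lambda>x. \<phi> x $ i) (refl2 x))" for i j x
    unfolding g_def by (rule pd_linear[OF linear_refl2 s])
  have "curl \<psi> x = - refl2 (curl \<phi> (refl2 x))"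
    unfolding curl_vector[OF s\<psi>] curl_vector[OF s] \<psi> pd_lincomb[OF gs gs] pg vec_eq_3
    by (simp add: sum_3 axis_nth_3 algebra_simps)
  then show "curl (\<lambda>x. refl2 (\<phi> (refl2 x))) x = - refl2 (curl \<phi> (refl2 x))"
    by (simp add: \<psi>_def[abs_def])
qed

lemma orthogonal_inner_twist:
  fixes L L' :: "real^3 \<Rightarrow> real^3"
  assumes L: "orthogonal_transformation L" "orthogonal_transformation L'"
    and inv: "\<And>x. L (L' x) = x" "\<And>x. L' (L x) = x"
    and F: "F \<in> borel_measurable borel" and Z: "Z \<in> borel_measurable borel"
  shows "(LINT x|lborel. Z x \<bullet> L' (F (L x))) = (LINT x|lborel. L (Z (L' x)) \<bullet> F x)"
proof -
  note [measurable] = F Z orthogonal_borel[OF L(1)] orthogonal_borel[OF L(2)]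
  have "L (Z x) \<bullet> L (L' (F (L x))) = Z x \<bullet> L' (F (L x))" for x
    using L(1) by (simp add: orthogonal_transformation_def)
  then have "(LINT x|lborel. Z x \<bullet> L' (F (L x))) = (LINT x|lborel. L (Z (L' (L x))) \<bullet> F (L x))"
    by (simp add: inv)
  also have "\<dots> = (LINT x|lborel. L (Z (L' x)) \<bullet> F x)"
    by (rule integral_orthogonal[OF L(1)]) measurable
  finally show ?thesis .
qed

lemma integral_lebesgue_inner:
  fixes F Z :: vfield
  assumes [measurable]: "F \<in> borel_measurable borel" "Z \<in> borel_measurable borel"
  shows "(LINT x|lebesgue. F x \<bullet> Z x) = (LINT x|lborel. F x \<bullet> Z x)"
  by (rule integral_completion) measurable

text \<open>Invariance of the inner product moves the transformation onto the test field, where the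
  classical formula holds. \<sigma> is the determinant, 1 for rotations and -1 for
  \<open>refl2\<close>.\<close>

lemma is_weak_curl_twist:
  assumes L: "orthogonal_transformation L" "orthogonal_transformation L'"
    and inv: "\<And>x. L (L' x) = x" "\<And>x. L' (L x) = x"
    and t: "\<And>\<phi>. \<phi> \<in> test_fields \<Longrightarrow> (\<lambda>x. L (\<phi> (L' x))) \<in> test_fields"
    and c: "\<And>\<phi> x. \<phi> \<in> test_fields \<Longrightarrow> curl (\<lambda>x. L (\<phi> (L' x))) x = \<sigma> *\<^sub>R L (curl \<phi> (L' x))"
    and \<sigma>: "\<sigma> * \<sigma> = 1"
    and U [measurable]: "U \<in> borel_measurable borel" and W [measurable]: "W \<in> borel_measurable borel"
    and curl: "is_weak_curl U W"
  shows "is_weak_curl (\<lambda>x. L' (U (L x))) (\<lambda>x. \<sigma> *\<^sub>R L' (W (L x)))"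
  unfolding is_weak_curl_def
proof
  fix \<phi> assume \<phi>: "\<phi> \<in> test_fields"
  note [measurable] = orthogonal_borel[OF L(1)] orthogonal_borel[OF L(2)] test_field_borel[OF \<phi>]
    test_field_borel[OF curl_test_field[OF \<phi>]] test_field_borel[OF t[OF \<phi>]] test_field_borel[OF curl_test_field[OF t[OF \<phi>]]]
  have tw: "(LINT x|lborel. Z x \<bullet> L' (F (L x))) = (LINT x|lborel. L (Z (L' x)) \<bullet> F x)"
    if "F \<in> borel_measurable borel" "Z \<in> borel_measurable borel" for F Z
    by (rule orthogonal_inner_twist[OF L inv that])
  have "(LINT x|lebesgue. L' (U (L x)) \<bullet> curl \<phi> x) = (LINT x|lborel. curl \<phi> x \<bullet> L' (U (L x)))"
    by (subst integral_lebesgue_inner) (auto simp: inner_commute)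
  also have "\<dots> = (LINT x|lborel. L (curl \<phi> (L' x)) \<bullet> U x)" by (rule tw) auto
  also have "\<dots> = (LINT x|lborel. \<sigma> * (U x \<bullet> curl (\<lambda>x. L (\<phi> (L' x))) x))"
    unfolding c[OF \<phi>] inner_scaleR_right mult.assoc[symmetric] \<sigma> by (simp add: inner_commute)
  also have "\<dots> = \<sigma> * (LINT x|lebesgue. U x \<bullet> curl (\<lambda>x. L (\<phi> (L' x))) x)"
    by (subst integral_lebesgue_inner) auto
  also have "\<dots> = \<sigma> * (LINT x|lebesgue. W x \<bullet> L (\<phi> (L' x)))"
    using curl t[OF \<phi>] by (simp add: is_weak_curl_def)
  also have "\<dots> = \<sigma> * (LINT x|lborel. L (\<phi> (L' x)) \<bullet> W x)"
    by (subst integral_lebesgue_inner) (auto simp: inner_commute)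
  also have "\<dots> = \<sigma> * (LINT x|lborel. \<phi> x \<bullet> L' (W (L x)))" by (subst tw) auto
  also have "\<dots> = (LINT x|lebesgue. (\<sigma> *\<^sub>R L' (W (L x))) \<bullet> \<phi> x)"
    by (subst integral_lebesgue_inner) (auto simp: inner_commute)
  finally show "(LINT x|lebesgue. L' (U (L x)) \<bullet> curl \<phi> x) = (LINT x|lebesgue. (\<sigma> *\<^sub>R L' (W (L x))) \<bullet> \<phi> x)" .
qed

lemma is_weak_curl_rot:
  assumes "U \<in> borel_measurable borel" "W \<in> borel_measurable borel" "is_weak_curl U W"
  shows "is_weak_curl (\<lambda>x. rot (- \<theta>) (U (rot \<theta> x))) (\<lambda>x. rot (- \<theta>) (W (rot \<theta> x)))"
  using is_weak_curl_twist[OF orthogonal_rot orthogonal_rot rot_minus_rot(2,1) rot_test_field(1) _ _ assms, of \<theta> 1]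
  by (simp add: rot_test_field(2))

lemma is_weak_curl_refl2:
  assumes "U \<in> borel_measurable borel" "W \<in> borel_measurable borel" "is_weak_curl U W"
  shows "is_weak_curl (\<lambda>x. refl2 (U (refl2 x))) (\<lambda>x. (- 1) *\<^sub>R refl2 (W (refl2 x)))"
  by (rule is_weak_curl_twist[OF orthogonal_refl2 orthogonal_refl2 refl2_refl2 refl2_refl2 refl2_test_field(1) _ _ assms])
    (simp_all add: refl2_test_field(2))

lemma integrable_orthogonal:
  fixes f :: "real^3 \<Rightarrow> real^3" and h :: "real^3 \<Rightarrow> real"
  assumes f: "orthogonal_transformation f" and h: "integrable lborel h"
  shows "integrable lborel (\<lambda>x. h (f x))"
  using integrable_distr_eq[of f lborel borel h] h orthogonal_borel[OF f] by (simp add: distr_orthogonal[OF f])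

lemma L2_borel_iff:
  assumes [measurable]: "U \<in> borel_measurable borel"
  shows "U \<in> L2 \<longleftrightarrow> integrable lborel (\<lambda>x. (norm (U x))\<^sup>2)"
  by (simp add: L2_def integrable_completion measurable_completion)

lemma L2_twist:
  assumes L: "orthogonal_transformation L" "orthogonal_transformation L'"
    and U [measurable]: "U \<in> borel_measurable borel" and U2: "U \<in> L2"
  shows "(\<lambda>x. L' (U (L x))) \<in> L2"
proof -
  note [measurable] = orthogonal_borel[OF L(1)] orthogonal_borel[OF L(2)]
  have "integrable lborel (\<lambda>x. (norm (U (L x)))\<^sup>2)"
    using U2 by (intro integrable_orthogonal[OF L(1)]) (simp add: L2_borel_iff)
  then show ?thesis
    by (simp add: L2_borel_iff orthogonal_transformation_norm[OF L(2)])
qed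

section \<open>The normalised measure on the circle\<close>

abbreviation circle :: "real measure" where "circle \<equiv> unif (- pi) pi"

lemma prob_space_circle: "prob_space circle"
  by (rule prob_space_unif) simp

lemma emeasure_circle:
  assumes "A \<in> sets borel"
  shows "emeasure circle A = ennreal (1 / (2 * pi)) * emeasure lborel (A \<inter> {- pi..pi})"
proof -
  have "emeasure circle A = (\<integral>\<^sup>+x. ennreal (1 / (2 * pi)) * indicator (A \<inter> {- pi..pi}) x \<partial>lborel)"
    unfolding unif_def using assms
    by (subst emeasure_density) (auto intro!: nn_integral_cong simp: indicator_def)
  also have "\<dots> = ennreal (1 / (2 * pi)) * emeasure lborel (A \<inter> {- pi..pi})"
    using assms by (subst nn_integral_cmult_indicator) auto
  finally show ?thesis .
qed

text \<open>Without the right endpoint, a shift modulo 2 pi cuts the interval into disjoint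
  half-open pieces.\<close>

lemma emeasure_circle':
  assumes A: "A \<in> sets borel"
  shows "emeasure circle A = ennreal (1 / (2 * pi)) * emeasure lborel (A \<inter> {- pi..<pi})"
proof -
  have "emeasure lborel (A \<inter> {- pi..pi}) = emeasure lborel (A \<inter> {- pi..<pi})"
  proof (rule emeasure_eq_AE)
    have "AE x in lborel. x \<noteq> pi" by (rule AE_lborel_singleton)
    then show "AE x in lborel. x \<in> A \<inter> {- pi..pi} \<longleftrightarrow> x \<in> A \<inter> {- pi..<pi}"
      by eventually_elim auto
  qed (use A in auto)
  then show ?thesis by (simp add: emeasure_circle[OF A])
qed

lemma emeasure_lborel_translate:
  fixes c :: real
  assumes "A \<in> sets borel"
  shows "emeasure lborel ((\<lambda>x. x + c) -` A) = emeasure lborel A"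
proof -
  have "emeasure (distr lborel borel (\<lambda>x. x + c)) A = emeasure lborel ((\<lambda>x. x + c) -` A)"
    using assms by (subst emeasure_distr) auto
  then show ?thesis by (simp only: distr_translate)
qed

text \<open>A shift modulo 2 pi swaps two pieces of the interval and so preserves the measure;
  periodicity makes \<open>h\<close> blind to the jump.\<close>

lemma circle_shift:
  fixes h :: "real \<Rightarrow> 'a::{banach, second_countable_topology}"
  assumes h [measurable]: "h \<in> borel_measurable borel" and per: "\<And>\<theta> (k::int). h (\<theta> + of_int k * (2 * pi)) = h \<theta>"
  shows "(LINT \<theta>|circle. h (\<theta> + \<phi>)) = (LINT \<theta>|circle. h \<theta>)"
proof -
  \<comment> \<open>Reduces the shift to \<open>a\<close> in [0, 2 pi), so that at most one
    wrap-around occurs in \<open>T\<close>.\<close>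
  define k where "k = \<lfloor>\<phi> / (2 * pi)\<rfloor>"
  define a where "a = \<phi> - of_int k * (2 * pi)"
  have a: "0 \<le> a" "a < 2 * pi"
    using floor_divide_lower[of "2 * pi" \<phi>] floor_divide_upper[of "2 * pi" \<phi>]
    by (auto simp: a_def k_def algebra_simps)
  define T where "T \<theta> = (if \<theta> + a < pi then \<theta> + a else \<theta> + (a - 2 * pi))" for \<theta>
  have T [measurable]: "T \<in> borel_measurable borel" unfolding T_def[abs_def] by measurable
  have hT: "h (\<theta> + \<phi>) = h (T \<theta>)" for \<theta>
  proof -
    have "h (\<theta> + \<phi>) = h (\<theta> + a)" using per[of "\<theta> + a" k] by (simp add: a_def algebra_simps)
    moreover have "h (\<theta> + (a - 2 * pi)) = h (\<theta> + a)" using per[of "\<theta> + a" "-1"] by (simp add: algebra_simps)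
    ultimately show ?thesis by (simp add: T_def)
  qed
  have "distr circle borel T = circle"
  proof (rule measure_eqI)
    fix A assume "A \<in> sets (distr circle borel T)"
    then have A [measurable]: "A \<in> sets borel" by simp
    define B1 where "B1 = A \<inter> {- pi + a..<pi}"
    define B2 where "B2 = A \<inter> {- pi..<- pi + a}"
    have B [measurable]: "B1 \<in> sets borel" "B2 \<in> sets borel" by (auto simp: B1_def B2_def)
    have TA: "T -` A \<in> sets borel" using measurable_sets_borel[OF T A] .
    have m: "(\<lambda>\<theta>. \<theta> + c) -` B \<in> sets borel" if "B \<in> sets borel" for B and c :: real
      by (rule measurable_sets_borel[OF _ that]) measurable
    have "T -` A \<inter> {- pi..<pi} = (\<lambda>\<theta>. \<theta> + a) -` B1 \<union> (\<lambda>\<theta>. \<theta> + (a - 2 * pi)) -` B2"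
      using a by (auto simp: T_def B1_def B2_def split: if_splits)
    moreover have "(\<lambda>\<theta>. \<theta> + a) -` B1 \<inter> (\<lambda>\<theta>. \<theta> + (a - 2 * pi)) -` B2 = {}"
      by (auto simp: B1_def B2_def)
    ultimately have "emeasure lborel (T -` A \<inter> {- pi..<pi})
        = emeasure lborel ((\<lambda>\<theta>. \<theta> + a) -` B1) + emeasure lborel ((\<lambda>\<theta>. \<theta> + (a - 2 * pi)) -` B2)"
      using m B by (simp add: plus_emeasure)
    also have "\<dots> = emeasure lborel B1 + emeasure lborel B2"
      by (simp only: emeasure_lborel_translate[OF B(1)] emeasure_lborel_translate[OF B(2)])
    also have "\<dots> = emeasure lborel (B1 \<union> B2)"
      by (rule plus_emeasure) (auto simp: B1_def B2_def)
    also have "B1 \<union> B2 = A \<inter> {- pi..<pi}" using a by (auto simp: B1_def B2_def)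
    finally show "emeasure (distr circle borel T) A = emeasure circle A"
      using A TA by (simp add: emeasure_distr emeasure_circle')
  qed simp
  then have "(LINT \<theta>|circle. h \<theta>) = (LINT \<theta>|distr circle borel T. h \<theta>)" by simp
  also have "\<dots> = (LINT \<theta>|circle. h (T \<theta>))" by (rule integral_distr) auto
  finally show ?thesis by (simp add: hT)
qed

lemma circle_reflect:
  fixes h :: "real \<Rightarrow> 'a::{banach, second_countable_topology}"
  assumes h [measurable]: "h \<in> borel_measurable borel"
  shows "(LINT \<theta>|circle. h (- \<theta>)) = (LINT \<theta>|circle. h \<theta>)"
proof -
  have "distr circle borel uminus = circle"
  proof (rule measure_eqI)
    fix A assume "A \<in> sets (distr circle borel uminus)"
    then have A [measurable]: "A \<in> sets borel" by simp
    have um: "uminus -` B \<in> sets borel" if "B \<in> sets borel" for B :: "real set"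
      by (rule measurable_sets_borel[OF _ that]) measurable
    have "uminus -` A \<inter> {- pi..pi} = uminus -` (A \<inter> {- pi..pi})" by auto
    moreover have "emeasure lborel (uminus -` (A \<inter> {- pi..pi})) = emeasure (distr lborel borel uminus) (A \<inter> {- pi..pi})"
      by (subst emeasure_distr) auto
    ultimately show "emeasure (distr circle borel uminus) A = emeasure circle A"
      using um[OF A] by (simp add: emeasure_distr emeasure_circle lborel_distr_uminus)
  qed simp
  then have "(LINT \<theta>|circle. h \<theta>) = (LINT \<theta>|distr circle borel uminus. h \<theta>)" by simp
  also have "\<dots> = (LINT \<theta>|circle. h (- \<theta>))" by (rule integral_distr) auto
  finally show ?thesis by simp
qed

text \<open>Averaging commutes with the curl. On fields that are odd under the reflection \<open>refl2\<close>, which takes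
  the place of the symmetry \<open>g1\<close>, it produces fields of the form required in \<open>X_G1\<close>.\<close>

definition avg :: "vfield \<Rightarrow> vfield" where
  "avg f x = (LINT \<theta>|circle. rot (- \<theta>) (f (rot \<theta> x)))"

lemma rot_conj_borel:
  assumes f [measurable]: "f \<in> borel_measurable borel"
  shows "(\<lambda>(\<theta>, x). rot (- \<theta>) (f (rot \<theta> x))) \<in> borel \<Otimes>\<^sub>M borel \<rightarrow>\<^sub>M borel"
proof -
  have "(\<lambda>p. f (rot (fst p) (snd p))) \<in> borel \<Otimes>\<^sub>M borel \<rightarrow>\<^sub>M borel"
    using measurable_compose[OF rot_pair_borel f] by (simp add: case_prod_unfold)
  then have "(\<lambda>p. (- fst p, f (rot (fst p) (snd p)))) \<in> borel \<Otimes>\<^sub>M borel \<rightarrow>\<^sub>M borel \<Otimes>\<^sub>M borel"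
    by (intro measurable_Pair) measurable
  from measurable_compose[OF this rot_pair_borel] show ?thesis by (simp add: case_prod_unfold)
qed

lemma avg_borel: assumes f: "f \<in> borel_measurable borel" shows "avg f \<in> borel_measurable borel"
proof -
  interpret prob_space circle by (rule prob_space_circle)
  have "(\<lambda>(x, \<theta>). rot (- \<theta>) (f (rot \<theta> x))) \<in> borel \<Otimes>\<^sub>M borel \<rightarrow>\<^sub>M borel"
    using measurable_compose[OF measurable_pair_swap' rot_conj_borel[OF f]] by (simp add: case_prod_unfold)
  then have "(\<lambda>(x, \<theta>). rot (- \<theta>) (f (rot \<theta> x))) \<in> borel \<Otimes>\<^sub>M circle \<rightarrow>\<^sub>M borel"
    by (simp cong: measurable_cong_sets sets_pair_measure_cong)
  from borel_measurable_lebesgue_integral[OF this] show ?thesis by (simp add: avg_def[abs_def])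
qed

lemma rot_orbit_borel:
  assumes f: "f \<in> borel_measurable borel"
  shows "(\<lambda>\<theta>. rot (- \<theta>) (f (rot \<theta> x))) \<in> borel_measurable borel"
  using measurable_Pair_compose_split[OF rot_conj_borel[OF f], of "\<lambda>\<theta>. \<theta>" borel "\<lambda>\<theta>. x"] by simp

lemma rot_periodic: "rot (\<theta> + of_int k * (2 * pi)) x = rot \<theta> x"
proof -
  have "cos (\<theta> + of_int k * (2 * pi)) = cos \<theta>" "sin (\<theta> + of_int k * (2 * pi)) = sin \<theta>"
    using cos_int_2pin[of k] sin_int_2pin[of k] by (simp_all add: cos_add sin_add mult.commute)
  then show ?thesis by (simp add: vec_eq_3)
qed

lemma bounded_linear_rot: "bounded_linear (rot \<theta>)"
  using linear_rot by (simp add: linear_conv_bounded_linear)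

lemma bounded_linear_refl2: "bounded_linear refl2"
  using linear_refl2 by (simp add: linear_conv_bounded_linear)

text \<open>The identity holds at every point: the shift of the angle runs over a full period, and
  since rotations are invertible the integral commutes with them even on orbits where it has only
  its default value 0.\<close>

lemma avg_rot:
  assumes f: "f \<in> borel_measurable borel"
  shows "avg f (rot \<phi> x) = rot \<phi> (avg f x)"
proof -
  define h where "h \<theta> = rot \<phi> (rot (- \<theta>) (f (rot \<theta> x)))" for \<theta>
  have h: "h \<in> borel_measurable borel"
    unfolding h_def[abs_def] by (rule measurable_compose[OF rot_orbit_borel[OF f] rot_borel])
  have per: "h (\<theta> + of_int k * (2 * pi)) = h \<theta>" for \<theta> k
  proof -
    have "rot (- (\<theta> + of_int k * (2 * pi))) y = rot (- \<theta>) y" for y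
      using rot_periodic[of "- \<theta>" "- k" y] by (simp add: algebra_simps)
    then show ?thesis by (simp add: h_def rot_periodic)
  qed
  have "avg f (rot \<phi> x) = (LINT \<theta>|circle. h (\<theta> + \<phi>))"
    by (simp add: avg_def h_def rot_add)
  also have "\<dots> = (LINT \<theta>|circle. h \<theta>)" by (rule circle_shift[OF h per])
  also have "\<dots> = rot \<phi> (avg f x)"
    unfolding h_def avg_def
    by (rule integral_bounded_linear'[OF bounded_linear_rot bounded_linear_rot[of "- \<phi>"]]) simp
  finally show ?thesis .
qed

text \<open>Reflecting the point reverses the angle, by \<open>rot_refl2\<close>, and the measure on
  the circle is symmetric.\<close>

lemma avg_refl2:
  assumes f: "f \<in> borel_measurable borel" and odd: "\<And>x. refl2 (f (refl2 x)) = - f x"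
  shows "avg f (refl2 x) = - refl2 (avg f x)"
proof -
  have fr: "f (refl2 y) = - refl2 (f y)" for y
  proof -
    have "refl2 (refl2 (f (refl2 y))) = refl2 (- f y)" by (simp only: odd)
    then show ?thesis by (simp add: vec_eq_3)
  qed
  define h where "h \<theta> = - refl2 (rot (- \<theta>) (f (rot \<theta> x)))" for \<theta>
  have h: "h \<in> borel_measurable borel"
    unfolding h_def[abs_def]
    by (intro borel_measurable_uminus measurable_compose[OF rot_orbit_borel[OF f] refl2_borel])
  have "avg f (refl2 x) = (LINT \<theta>|circle. h (- \<theta>))"
    unfolding avg_def h_def
    by (rule Bochner_Integration.integral_cong[OF refl]) (simp add: rot_refl2 fr vec_eq_3)
  also have "\<dots> = (LINT \<theta>|circle. h \<theta>)" by (rule circle_reflect[OF h])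
  also have "\<dots> = - refl2 (avg f x)"
    unfolding h_def avg_def
    by (rule integral_bounded_linear'[of "\<lambda>y. - refl2 y" "\<lambda>y. - refl2 y"])
      (auto intro!: bounded_linear_minus bounded_linear_refl2 simp: vec_eq_3)
  finally show ?thesis .
qed

text \<open>A rotation carries \<open>x\<close> into the half-plane x2 = 0, x1 > 0, whose points
  \<open>refl2\<close> fixes. There oddness kills the first and third components, and equivariance
  spreads the second over the orbit. This half-plane is a null set, so it matters that both
  symmetries of \<open>avg\<close> hold at every point.\<close>

lemma avg_form:
  assumes f: "f \<in> borel_measurable borel" and odd: "\<And>x. refl2 (f (refl2 x)) = - f x"
    and x: "0 < cyl_radius x"
  shows "avg f x = (avg f (vector [cyl_radius x, 0, x $ 3]) $ 2 / cyl_radius x) *\<^sub>R vector [- (x $ 2), x $ 1, 0]"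
proof -
  define r where "r = cyl_radius x"
  have r: "0 < r" using x by (simp add: r_def)
  have "(x $ 1 / r)\<^sup>2 + (x $ 2 / r)\<^sup>2 = ((x $ 1)\<^sup>2 + (x $ 2)\<^sup>2) / r\<^sup>2"
    by (simp add: power_divide add_divide_distrib)
  also have "r\<^sup>2 = (x $ 1)\<^sup>2 + (x $ 2)\<^sup>2" by (simp add: r_def cyl_radius_def)
  finally have "(x $ 1 / r)\<^sup>2 + (x $ 2 / r)\<^sup>2 = 1" using r \<open>r\<^sup>2 = _\<close> by (metis divide_self power_not_zero less_irrefl)
  then obtain \<phi> where \<phi>: "x $ 1 / r = cos \<phi>" "x $ 2 / r = sin \<phi>" by (metis sincos_total_2pi)
  then have \<phi>': "x $ 1 = r * cos \<phi>" "x $ 2 = r * sin \<phi>" using r by (auto simp: field_simps)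
  define y :: "real^3" where "y = vector [r, 0, x $ 3]"
  have xy: "x = rot \<phi> y" by (simp add: vec_eq_3 y_def \<phi>' mult.commute)
  have "refl2 y = y" by (simp add: vec_eq_3 y_def)
  then have "avg f y = - refl2 (avg f y)" using avg_refl2[OF f odd, of y] by simp
  then have a: "avg f y $ 1 = 0" "avg f y $ 3 = 0"
    unfolding vec_eq_3 by auto
  have "avg f x = rot \<phi> (avg f y)" unfolding xy by (rule avg_rot[OF f])
  also have "\<dots> = (avg f y $ 2 / r) *\<^sub>R vector [- (x $ 2), x $ 1, 0]"
    using r by (simp add: vec_eq_3 a \<phi>')
  finally show ?thesis by (simp add: y_def r_def)
qed

text \<open>Invariance of \<open>Z\<close> lets every slice be rotated back, so all slices have the
  same finite integral.\<close>

lemma rot_product_integrable: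
  fixes Z F :: "real^3 \<Rightarrow> real"
  assumes Z [measurable]: "Z \<in> borel_measurable borel" and F [measurable]: "F \<in> borel_measurable borel"
    and inv: "\<And>\<theta>. AE x in lborel. Z (rot \<theta> x) = Z x" and int: "integrable lborel (\<lambda>x. Z x * F x)"
  shows "integrable (circle \<Otimes>\<^sub>M lborel) (\<lambda>(\<theta>, x). Z x * F (rot \<theta> x))"
proof -
  interpret prob_space circle by (rule prob_space_circle)
  interpret pair_sigma_finite circle "lborel :: (real^3) measure" ..
  have "(\<lambda>p. Z (snd p) * F (rot (fst p) (snd p))) \<in> borel_measurable (borel \<Otimes>\<^sub>M borel)"
    using measurable_compose[OF rot_pair_borel F] by (simp add: case_prod_unfold)
  then have m: "(\<lambda>(\<theta>, x). Z x * F (rot \<theta> x)) \<in> borel_measurable (circle \<Otimes>\<^sub>M lborel)"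
    by (simp add: case_prod_unfold cong: measurable_cong_sets sets_pair_measure_cong)
  show ?thesis
  proof (rule integrableI_bounded[OF m])
    have "(\<integral>\<^sup>+ q. ennreal (norm (case q of (\<theta>, x) \<Rightarrow> Z x * F (rot \<theta> x))) \<partial>(circle \<Otimes>\<^sub>M lborel))
        = (\<integral>\<^sup>+ \<theta>. \<integral>\<^sup>+ x. ennreal (norm (Z x * F (rot \<theta> x))) \<partial>lborel \<partial>circle)"
      using m by (subst lborel.nn_integral_fst[symmetric]) auto
    also have "\<dots> = (\<integral>\<^sup>+ \<theta>. \<integral>\<^sup>+ x. ennreal (norm (Z x * F x)) \<partial>lborel \<partial>circle)"
    proof (rule nn_integral_cong)
      fix \<theta>
      have "(\<integral>\<^sup>+ x. ennreal (norm (Z x * F (rot \<theta> x))) \<partial>lborel) = (\<integral>\<^sup>+ x. ennreal (norm (Z (rot \<theta> x) * F (rot \<theta> x))) \<partial>lborel)"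
      proof (rule nn_integral_cong_AE)
        show "AE x in lborel. ennreal (norm (Z x * F (rot \<theta> x))) = ennreal (norm (Z (rot \<theta> x) * F (rot \<theta> x)))"
          using inv[of \<theta>] by eventually_elim simp
      qed
      also have "\<dots> = (\<integral>\<^sup>+ x. ennreal (norm (Z x * F x)) \<partial>distr lborel borel (rot \<theta>))"
        by (subst nn_integral_distr) auto
      finally show "(\<integral>\<^sup>+ x. ennreal (norm (Z x * F (rot \<theta> x))) \<partial>lborel) = (\<integral>\<^sup>+ x. ennreal (norm (Z x * F x)) \<partial>lborel)"
        by (simp only: distr_orthogonal[OF orthogonal_rot])
    qed
    also have "\<dots> = (\<integral>\<^sup>+ x. ennreal (norm (Z x * F x)) \<partial>lborel) * emeasure circle (space circle)"
      by simp
    also have "\<dots> < \<infinity>"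
      using int emeasure_space_1 by (simp add: integrable_iff_bounded)
    finally show "(\<integral>\<^sup>+ q. ennreal (norm (case q of (\<theta>, x) \<Rightarrow> Z x * F (rot \<theta> x))) \<partial>(circle \<Otimes>\<^sub>M lborel)) < \<infinity>" .
  qed
qed

lemma avg_orbit_integrable:
  assumes f [measurable]: "f \<in> borel_measurable borel" and f2: "f \<in> L2"
  shows "AE x in lborel. integrable circle (\<lambda>\<theta>. rot (- \<theta>) (f (rot \<theta> x)))"
proof -
  interpret prob_space circle by (rule prob_space_circle)
  interpret pair_sigma_finite circle "lborel :: (real^3) measure" ..
  have "integrable (circle \<Otimes>\<^sub>M lborel) (\<lambda>(\<theta>, x). 1 * (norm (f (rot \<theta> x)))\<^sup>2)"
    by (rule rot_product_integrable[of "\<lambda>x. 1" "\<lambda>y. (norm (f y))\<^sup>2"]) (use f2 in \<open>auto simp: L2_borel_iff\<close>)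
  from AE_integrable_snd[OF this] show ?thesis
  proof eventually_elim
    case (elim x)
    have i: "integrable circle (\<lambda>\<theta>. 1 + (norm (f (rot \<theta> x)))\<^sup>2)" using elim by simp
    have m: "(\<lambda>\<theta>. rot (- \<theta>) (f (rot \<theta> x))) \<in> borel_measurable circle"
      using rot_orbit_borel[OF f, of x] by simp
    show ?case
    proof (rule Bochner_Integration.integrable_bound[OF i m])
      have "norm (f (rot \<theta> x)) \<le> 1 + (norm (f (rot \<theta> x)))\<^sup>2" for \<theta>
        using abs_mult_le_sum_sq[of 1 "norm (f (rot \<theta> x))"] by simp
      then show "AE \<theta> in circle. norm (rot (- \<theta>) (f (rot \<theta> x))) \<le> norm (1 + (norm (f (rot \<theta> x)))\<^sup>2)"
        by simp
    qed
  qed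
qed

text \<open>Moving the inner product with \<open>Z x\<close> inside the average is justified on
  integrable orbits, which is almost everywhere; Fubini then exchanges the integrals.\<close>

lemma avg_duality:
  assumes f [measurable]: "f \<in> borel_measurable borel" and f2: "f \<in> L2"
    and Z [measurable]: "Z \<in> borel_measurable borel"
    and int: "integrable (circle \<Otimes>\<^sub>M lborel) (\<lambda>(\<theta>, x). norm (Z x) * norm (f (rot \<theta> x)))"
  shows "(LINT x|lborel. Z x \<bullet> avg f x) = (LINT \<theta>|circle. LINT x|lborel. Z x \<bullet> rot (- \<theta>) (f (rot \<theta> x)))"
proof -
  interpret prob_space circle by (rule prob_space_circle)
  interpret pair_sigma_finite circle "lborel :: (real^3) measure" ..
  have "(\<lambda>q. Z (snd q) \<bullet> (case q of (\<theta>, x) \<Rightarrow> rot (- \<theta>) (f (rot \<theta> x)))) \<in> borel_measurable (borel \<Otimes>\<^sub>M borel)"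
    by (intro borel_measurable_inner rot_conj_borel f) measurable
  then have m: "(\<lambda>(\<theta>, x). Z x \<bullet> rot (- \<theta>) (f (rot \<theta> x))) \<in> borel_measurable (circle \<Otimes>\<^sub>M lborel)"
    by (simp add: case_prod_unfold cong: measurable_cong_sets sets_pair_measure_cong)
  have i: "integrable (circle \<Otimes>\<^sub>M lborel) (\<lambda>(\<theta>, x). Z x \<bullet> rot (- \<theta>) (f (rot \<theta> x)))"
    by (rule Bochner_Integration.integrable_bound[OF int m])
      (auto intro!: AE_I2 order_trans[OF Cauchy_Schwarz_ineq2] simp: case_prod_unfold simp del: rot_nth)
  have "(LINT x|lborel. Z x \<bullet> avg f x) = (LINT x|lborel. LINT \<theta>|circle. Z x \<bullet> rot (- \<theta>) (f (rot \<theta> x)))"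
  proof (rule integral_cong_AE)
    show "AE x in lborel. Z x \<bullet> avg f x = (LINT \<theta>|circle. Z x \<bullet> rot (- \<theta>) (f (rot \<theta> x)))"
      using avg_orbit_integrable[OF f f2] by eventually_elim (simp add: avg_def)
    show "(\<lambda>x. Z x \<bullet> avg f x) \<in> borel_measurable lborel" using avg_borel[OF f] by simp
    show "(\<lambda>x. LINT \<theta>|circle. Z x \<bullet> rot (- \<theta>) (f (rot \<theta> x))) \<in> borel_measurable lborel"
      using borel_measurable_integrable[OF integrable_snd[OF i]] by simp
  qed
  also have "\<dots> = (LINT \<theta>|circle. LINT x|lborel. Z x \<bullet> rot (- \<theta>) (f (rot \<theta> x)))"
    by (rule Fubini_integral[OF i])
  finally show ?thesis .
qed

lemma avg_L2_pair_integrable: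
  assumes f [measurable]: "f \<in> borel_measurable borel" and f2: "f \<in> L2"
    and Z [measurable]: "Z \<in> borel_measurable borel" and Z2: "Z \<in> L2"
  shows "integrable (circle \<Otimes>\<^sub>M lborel) (\<lambda>(\<theta>, x). norm (Z x) * norm (f (rot \<theta> x)))"
proof (rule Bochner_Integration.integrable_bound)
  have 1: "integrable (circle \<Otimes>\<^sub>M lborel) (\<lambda>(\<theta>, x). 1 * (norm (f (rot \<theta> x)))\<^sup>2)"
    by (rule rot_product_integrable[of "\<lambda>x. 1" "\<lambda>y. (norm (f y))\<^sup>2"]) (use f2 in \<open>auto simp: L2_borel_iff\<close>)
  have 2: "integrable (circle \<Otimes>\<^sub>M lborel) (\<lambda>(\<theta>, x). (norm (Z x))\<^sup>2)"
    by (rule shear_integrable[of circle "\<lambda>s x. x" "\<lambda>x. (norm (Z x))\<^sup>2"])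
      (use Z2 prob_space_circle in \<open>auto simp: L2_borel_iff distr_id2 prob_space.finite_measure\<close>)
  show "integrable (circle \<Otimes>\<^sub>M lborel) (\<lambda>q. (case q of (\<theta>, x) \<Rightarrow> (norm (Z x))\<^sup>2) + (case q of (\<theta>, x) \<Rightarrow> 1 * (norm (f (rot \<theta> x)))\<^sup>2))"
    by (rule Bochner_Integration.integrable_add[OF 2 1])
  have "(\<lambda>q. norm (Z (snd q)) * norm (f (rot (fst q) (snd q)))) \<in> borel_measurable (borel \<Otimes>\<^sub>M borel)"
    using measurable_compose[OF rot_pair_borel f] by (simp add: case_prod_unfold)
  then show "(\<lambda>(\<theta>, x). norm (Z x) * norm (f (rot \<theta> x))) \<in> borel_measurable (circle \<Otimes>\<^sub>M lborel)"
    by (simp add: case_prod_unfold cong: measurable_cong_sets sets_pair_measure_cong)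
  have "\<bar>a * b\<bar> \<le> \<bar>a\<^sup>2 + 1 * b\<^sup>2\<bar>" for a b :: real
    using abs_mult_le_sum_sq[of a b] by (simp add: order_trans[OF _ abs_ge_self])
  then show "AE q in circle \<Otimes>\<^sub>M lborel. norm (case q of (\<theta>, x) \<Rightarrow> norm (Z x) * norm (f (rot \<theta> x)))
      \<le> norm ((case q of (\<theta>, x) \<Rightarrow> (norm (Z x))\<^sup>2) + (case q of (\<theta>, x) \<Rightarrow> 1 * (norm (f (rot \<theta> x)))\<^sup>2))"
    by (intro AE_I2) (simp only: case_prod_unfold real_norm_def)
qed

text \<open>Jensen's inequality, by integrating the tangent inequality at the norm of the average.\<close>

lemma avg_powr_le:
  assumes f [measurable]: "f \<in> borel_measurable borel" and s: "1 < s"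
    and i1: "integrable circle (\<lambda>\<theta>. rot (- \<theta>) (f (rot \<theta> x)))"
    and i2: "integrable circle (\<lambda>\<theta>. norm (f (rot \<theta> x)) powr s)"
  shows "norm (avg f x) powr s \<le> (LINT \<theta>|circle. norm (f (rot \<theta> x)) powr s)"
proof -
  interpret prob_space circle by (rule prob_space_circle)
  define a where "a = norm (avg f x)"
  have i3: "integrable circle (\<lambda>\<theta>. norm (f (rot \<theta> x)))" using integrable_norm[OF i1] by simp
  have a: "a \<le> (LINT \<theta>|circle. norm (f (rot \<theta> x)))"
    unfolding a_def avg_def using integral_norm_bound[of circle "\<lambda>\<theta>. rot (- \<theta>) (f (rot \<theta> x))"] by simp
  have a0: "0 \<le> a" by (simp add: a_def)
  have "s * (a powr (s - 1) * a) \<le> s * (a powr (s - 1) * (LINT \<theta>|circle. norm (f (rot \<theta> x))))"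
    using s by (intro mult_left_mono a) auto
  also have "\<dots> = (LINT \<theta>|circle. s * (a powr (s - 1) * norm (f (rot \<theta> x))))" by simp
  also have "\<dots> \<le> (LINT \<theta>|circle. (s - 1) * a powr s + norm (f (rot \<theta> x)) powr s)"
    by (rule integral_mono) (use i2 i3 powr_tangent[OF s a0 norm_ge_zero] in auto)
  also have "\<dots> = (s - 1) * a powr s + (LINT \<theta>|circle. norm (f (rot \<theta> x)) powr s)"
    using i2 prob_space by simp
  finally show ?thesis
    using powr_minus_one_mult[OF a0, of s] by (simp add: a_def algebra_simps)
qed

text \<open>Jensen's inequality on almost every orbit, followed by integration. Being invariant, the
  weight may stand outside the average.\<close>

lemma avg_weighted_integrable:
  fixes Z :: "real^3 \<Rightarrow> real"
  assumes f [measurable]: "f \<in> borel_measurable borel" and f2: "f \<in> L2" and s: "1 < s"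
    and Z [measurable]: "Z \<in> borel_measurable borel" and Z0: "AE x in lborel. 0 < Z x"
    and inv: "\<And>\<theta>. AE x in lborel. Z (rot \<theta> x) = Z x"
    and int: "integrable lborel (\<lambda>x. Z x * norm (f x) powr s)"
  shows "integrable lborel (\<lambda>x. Z x * norm (avg f x) powr s)"
proof -
  interpret prob_space circle by (rule prob_space_circle)
  interpret pair_sigma_finite circle "lborel :: (real^3) measure" ..
  have i: "integrable (circle \<Otimes>\<^sub>M lborel) (\<lambda>(\<theta>, x). Z x * norm (f (rot \<theta> x)) powr s)"
    by (rule rot_product_integrable[of Z "\<lambda>y. norm (f y) powr s", OF Z _ inv int]) measurable
  have i': "integrable lborel (\<lambda>x. LINT \<theta>|circle. Z x * norm (f (rot \<theta> x)) powr s)"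
    using integrable_snd[OF i] by simp
  show ?thesis
  proof (rule Bochner_Integration.integrable_bound[OF i'])
    show "(\<lambda>x. Z x * norm (avg f x) powr s) \<in> borel_measurable lborel"
      using avg_borel[OF f] by simp
    show "AE x in lborel. norm (Z x * norm (avg f x) powr s) \<le> norm (LINT \<theta>|circle. Z x * norm (f (rot \<theta> x)) powr s)"
      using AE_integrable_snd[OF i] avg_orbit_integrable[OF f f2] Z0
    proof eventually_elim
      case (elim x)
      have i2: "integrable circle (\<lambda>\<theta>. norm (f (rot \<theta> x)) powr s)"
        using elim(1) elim(3) by simp
      have "Z x * norm (avg f x) powr s \<le> Z x * (LINT \<theta>|circle. norm (f (rot \<theta> x)) powr s)"
        using elim(3) by (intro mult_left_mono avg_powr_le[OF f s elim(2) i2]) auto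
      then show ?case using elim(3) by (simp add: abs_mult)
    qed
  qed
qed

lemma avg_L2:
  assumes f: "f \<in> borel_measurable borel" and f2: "f \<in> L2"
  shows "avg f \<in> L2"
proof -
  have p2: "norm (g x) powr 2 = (norm (g x))\<^sup>2" for g :: vfield and x by (simp add: powr_numeral)
  have "integrable lborel (\<lambda>x. 1 * norm (avg f x) powr 2)"
    by (rule avg_weighted_integrable[OF f f2]) (use f2 in \<open>auto simp: L2_borel_iff[OF f] p2\<close>)
  then show ?thesis by (simp add: L2_borel_iff[OF avg_borel[OF f]] p2)
qed

text \<open>Rotating one factor of the pairing is undone by rotating the equivariant factor the
  other way, so every angle contributes the same value.\<close>

lemma avg_equivariant:
  assumes f: "f \<in> borel_measurable borel" and f2: "f \<in> L2" and Z: "Z \<in> borel_measurable borel"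
    and int: "integrable (circle \<Otimes>\<^sub>M lborel) (\<lambda>(\<theta>, x). norm (Z x) * norm (f (rot \<theta> x)))"
    and eqv: "\<And>\<theta>. AE x in lborel. Z (rot \<theta> x) = rot \<theta> (Z x)"
  shows "(LINT x|lborel. Z x \<bullet> avg f x) = (LINT x|lborel. Z x \<bullet> f x)"
proof -
  interpret prob_space circle by (rule prob_space_circle)
  note [measurable] = f Z
  have "(LINT x|lborel. Z x \<bullet> rot (- \<theta>) (f (rot \<theta> x))) = (LINT x|lborel. Z x \<bullet> f x)" for \<theta>
  proof -
    have "(LINT x|lborel. Z x \<bullet> rot (- \<theta>) (f (rot \<theta> x))) = (LINT x|lborel. rot \<theta> (Z (rot (- \<theta>) x)) \<bullet> f x)"
      by (rule orthogonal_inner_twist[OF orthogonal_rot orthogonal_rot _ _ f Z]) auto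
    also have "\<dots> = (LINT x|lborel. Z x \<bullet> f x)"
    proof (rule integral_cong_AE)
      show "AE x in lborel. rot \<theta> (Z (rot (- \<theta>) x)) \<bullet> f x = Z x \<bullet> f x"
        using eqv[of "- \<theta>"] by eventually_elim simp
    qed measurable
    finally show ?thesis .
  qed
  then show ?thesis using avg_duality[OF f f2 Z int] prob_space by simp
qed

lemma avg_weak_curl:
  assumes U: "U \<in> borel_measurable borel" "U \<in> L2" and W: "W \<in> borel_measurable borel" "W \<in> L2"
    and curl: "is_weak_curl U W"
  shows "is_weak_curl (avg U) (avg W)"
  unfolding is_weak_curl_def
proof
  fix \<phi> assume \<phi>: "\<phi> \<in> test_fields"
  note c\<phi> = curl_test_field[OF \<phi>]
  note b = test_field_borel[OF \<phi>] test_field_borel[OF c\<phi>]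
  note [measurable] = b U(1) W(1) avg_borel[OF U(1)] avg_borel[OF W(1)]
  have "(LINT x|lebesgue. avg U x \<bullet> curl \<phi> x) = (LINT x|lborel. curl \<phi> x \<bullet> avg U x)"
    by (subst integral_lebesgue_inner) (auto simp: inner_commute)
  also have "\<dots> = (LINT \<theta>|circle. LINT x|lborel. curl \<phi> x \<bullet> rot (- \<theta>) (U (rot \<theta> x)))"
    by (rule avg_duality[OF U b(2) avg_L2_pair_integrable[OF U b(2) test_fields_L2[OF c\<phi>]]])
  also have "\<dots> = (LINT \<theta>|circle. LINT x|lborel. \<phi> x \<bullet> rot (- \<theta>) (W (rot \<theta> x)))"
  proof (rule Bochner_Integration.integral_cong[OF refl])
    fix \<theta>
    have "(LINT x|lborel. curl \<phi> x \<bullet> rot (- \<theta>) (U (rot \<theta> x))) = (LINT x|lebesgue. rot (- \<theta>) (U (rot \<theta> x)) \<bullet> curl \<phi> x)"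
      by (subst integral_lebesgue_inner) (auto simp: inner_commute)
    also have "\<dots> = (LINT x|lebesgue. rot (- \<theta>) (W (rot \<theta> x)) \<bullet> \<phi> x)"
      using is_weak_curl_rot[OF U(1) W(1) curl, of \<theta>] \<phi> by (simp add: is_weak_curl_def)
    also have "\<dots> = (LINT x|lborel. \<phi> x \<bullet> rot (- \<theta>) (W (rot \<theta> x)))"
      by (subst integral_lebesgue_inner) (auto simp: inner_commute)
    finally show "(LINT x|lborel. curl \<phi> x \<bullet> rot (- \<theta>) (U (rot \<theta> x))) = (LINT x|lborel. \<phi> x \<bullet> rot (- \<theta>) (W (rot \<theta> x)))" .
  qed
  also have "\<dots> = (LINT x|lborel. \<phi> x \<bullet> avg W x)"
    by (rule avg_duality[OF W b(1) avg_L2_pair_integrable[OF W b(1) test_fields_L2[OF \<phi>]], symmetric])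
  also have "\<dots> = (LINT x|lebesgue. avg W x \<bullet> \<phi> x)"
    by (subst integral_lebesgue_inner) (auto simp: inner_commute)
  finally show "(LINT x|lebesgue. avg U x \<bullet> curl \<phi> x) = (LINT x|lebesgue. avg W x \<bullet> \<phi> x)" .
qed

section \<open>Symmetric criticality\<close>

lemma cylindrically_symmetric_rot: "cylindrically_symmetric f \<Longrightarrow> f (rot \<theta> x) = f x"
  by (auto simp: cylindrically_symmetric_def)

lemma cylindrically_symmetric_refl2: "cylindrically_symmetric f \<Longrightarrow> f (refl2 x) = f x"
  by (auto simp: cylindrically_symmetric_def)

lemma X_G1_refl2:
  assumes "U \<in> X_G1 p \<Gamma>" shows "AE x in lebesgue. refl2 (U (refl2 x)) = - U x"
proof -
  obtain q where q: "AE x in lebesgue. U x = (q (cyl_radius x, x $ 3) / cyl_radius x) *\<^sub>R vector [- (x $ 2), x $ 1, 0]"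
    using assms by (auto simp: X_G1_def)
  show ?thesis
    using q AE_orthogonal[OF orthogonal_refl2 q] by eventually_elim (simp add: vec_eq_3)
qed

context defocusing
begin

text \<open>Palais' principle made explicit: \<open>H\<close> is replaced first by its odd part
  under \<open>refl2\<close> and then by the rotation average. Neither step changes the pairing with
  the curl and the slope of \<open>U\<close>, which have the matching symmetries, and the result
  lies in \<open>X_G1\<close>.\<close>

lemma symmetric_criticality:
  assumes U: "U \<in> X_G1 p \<Gamma>"
    and zero: "\<And>H. H \<in> X_G1 p \<Gamma> \<Longrightarrow> dJ U (weak_curl U) H (weak_curl H) = 0"
    and H: "H \<in> X p \<Gamma>"
  shows "dJ U (weak_curl U) H (weak_curl H) = 0"
proof -
  note UX = X_G1_X[OF U]
  obtain U' where U': "U' \<in> borel_measurable borel" "U' \<in> L2" "AE x in lebesgue. U x = U' x"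
    by (rule L2_borel_rep[OF X_D(2)[OF UX]])
  obtain W where W: "W \<in> borel_measurable borel" "W \<in> L2" "AE x in lebesgue. weak_curl U x = W x"
    by (rule L2_borel_rep[OF X_D(4)[OF UX]])
  obtain S where S: "S \<in> borel_measurable borel" "AE x in lebesgue. slope U x = S x"
    by (rule borel_rep[OF slope_measurable[OF X_D(3)[OF UX]]])
  obtain G where G: "G \<in> borel_measurable borel" "AE x in lebesgue. \<bar>\<Gamma> x\<bar> = G x"
    using completion_ex_borel_measurable_real[of "\<lambda>x. \<bar>\<Gamma> x\<bar>" lborel] by (auto simp: AE_completion_iff)
  obtain H0 where H0: "H0 \<in> borel_measurable borel" "H0 \<in> L2" "AE x in lebesgue. H x = H0 x"
    by (rule L2_borel_rep[OF X_D(2)[OF H]])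
  obtain Y0 where Y0: "Y0 \<in> borel_measurable borel" "Y0 \<in> L2" "AE x in lebesgue. weak_curl H x = Y0 x"
    by (rule L2_borel_rep[OF X_D(4)[OF H]])
  note [measurable] = U'(1) W(1) S(1) G(1) H0(1) Y0(1)
  have leb: "f \<in> borel_measurable borel \<Longrightarrow> f \<in> borel_measurable lebesgue" for f :: vfield
    by (simp add: measurable_completion)
  have curlU: "is_weak_curl U' W"
    using X_D(5)[OF UX] is_weak_curl_cong_AE[OF U'(3) X_D(3)[OF UX] leb[OF U'(1)]]
      is_weak_curl_cong_AE_right[OF W(3) L2_measurable[OF X_D(4)[OF UX]] leb[OF W(1)]] by simp
  have curlH: "is_weak_curl H0 Y0"
    using X_D(5)[OF H] is_weak_curl_cong_AE[OF H0(3) X_D(3)[OF H] leb[OF H0(1)]]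
      is_weak_curl_cong_AE_right[OF Y0(3) L2_measurable[OF X_D(4)[OF H]] leb[OF Y0(1)]] by simp
  have wt_iff: "integrable lebesgue (\<lambda>x. \<bar>\<Gamma> x\<bar> * norm (f x) powr (p + 1)) \<longleftrightarrow> integrable lborel (\<lambda>x. G x * norm (f x) powr (p + 1))"
    if [measurable]: "f \<in> borel_measurable borel" for f :: vfield
  proof -
    have [measurable]: "f \<in> borel_measurable lebesgue" by (rule leb[OF that])
    have mG [measurable]: "G \<in> borel_measurable lebesgue" using G(1) by (simp add: measurable_completion)
    have "integrable lebesgue (\<lambda>x. \<bar>\<Gamma> x\<bar> * norm (f x) powr (p + 1)) \<longleftrightarrow> integrable lebesgue (\<lambda>x. G x * norm (f x) powr (p + 1))"
    proof (rule integrable_cong_AE)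
      show "AE x in lebesgue. \<bar>\<Gamma> x\<bar> * norm (f x) powr (p + 1) = G x * norm (f x) powr (p + 1)"
        using G(2) by eventually_elim simp
      show "(\<lambda>x. \<bar>\<Gamma> x\<bar> * norm (f x) powr (p + 1)) \<in> borel_measurable lebesgue" by measurable
      show "(\<lambda>x. G x * norm (f x) powr (p + 1)) \<in> borel_measurable lebesgue" by measurable
    qed
    also have "\<dots> \<longleftrightarrow> integrable lborel (\<lambda>x. G x * norm (f x) powr (p + 1))"
      by (rule integrable_completion) measurable
    finally show ?thesis .
  qed
  have G_rot: "AE x in lborel. G (rot \<theta> x) = G x" for \<theta>
  proof -
    have "AE x in lebesgue. G (rot \<theta> x) = G x"
      using G(2) AE_rot[OF G(2), of \<theta>] by eventually_elim (simp add: cylindrically_symmetric_rot[OF \<Gamma>_sym])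
    then show ?thesis by (simp add: AE_completion_iff)
  qed
  have G_pos: "AE x in lborel. 0 < G x"
  proof -
    have "AE x in lebesgue. 0 < G x" using G(2) by eventually_elim (metis \<Gamma>_ge(3))
    then show ?thesis by (simp add: AE_completion_iff)
  qed
  \<comment> \<open>The symmetry of the curl is inferred from that of the field by uniqueness: the
    rotated curl is a weak curl of the same field.\<close>
  have W_rot: "AE x in lborel. W (rot \<theta> x) = rot \<theta> (W x)" for \<theta>
  proof -
    have eq: "AE x in lebesgue. rot (- \<theta>) (U' (rot \<theta> x)) = U' x"
      using azimuthal_cong[OF X_G1_azimuthal[OF U] U'(3), unfolded azimuthal_def, THEN conjunct1, THEN spec[of _ \<theta>]]
      by eventually_elim simp
    have m: "(\<lambda>x. rot (- \<theta>) (U' (rot \<theta> x))) \<in> borel_measurable borel" by measurable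
    have "is_weak_curl U' (\<lambda>x. rot (- \<theta>) (W (rot \<theta> x)))"
      using is_weak_curl_rot[OF U'(1) W(1) curlU, of \<theta>] is_weak_curl_cong_AE[OF eq leb[OF m] leb[OF U'(1)]] by simp
    from is_weak_curl_unique[OF W(2) L2_twist[OF orthogonal_rot orthogonal_rot W(1,2)] curlU this]
    have "AE x in lebesgue. W x = rot (- \<theta>) (W (rot \<theta> x))" .
    then have "AE x in lborel. W x = rot (- \<theta>) (W (rot \<theta> x))" by (simp add: AE_completion_iff)
    then show ?thesis
    proof eventually_elim
      case (elim x)
      have "rot \<theta> (W x) = rot \<theta> (rot (- \<theta>) (W (rot \<theta> x)))" using elim by simp
      then show ?case by simp
    qed
  qed
  \<comment> \<open>The field is odd, but its curl is even because of the sign in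
    \<open>is_weak_curl_refl2\<close>. The same sign in \<open>Yr\<close> below makes the two
    pairings behave alike.\<close>
  have W_refl: "AE x in lborel. refl2 (W (refl2 x)) = W x"
  proof -
    have r: "AE x in lebesgue. refl2 (U' (refl2 x)) = (- 1) *\<^sub>R U' x + 0 *\<^sub>R U' x"
      using X_G1_refl2[OF U] U'(3) AE_orthogonal[OF orthogonal_refl2 U'(3)] by eventually_elim simp
    have m: "(\<lambda>x. refl2 (U' (refl2 x))) \<in> borel_measurable borel"
      "(\<lambda>x. (- 1) *\<^sub>R U' x + 0 *\<^sub>R U' x) \<in> borel_measurable borel" by measurable
    have 1: "is_weak_curl (\<lambda>x. (- 1) *\<^sub>R U' x + 0 *\<^sub>R U' x) (\<lambda>x. (- 1) *\<^sub>R refl2 (W (refl2 x)))"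
      using is_weak_curl_refl2[OF U'(1) W(1) curlU] is_weak_curl_cong_AE[OF r leb[OF m(1)] leb[OF m(2)]] by simp
    have 2: "is_weak_curl (\<lambda>x. (- 1) *\<^sub>R U' x + 0 *\<^sub>R U' x) (\<lambda>x. (- 1) *\<^sub>R W x + 0 *\<^sub>R W x)"
      by (rule is_weak_curl_lincomb[OF U'(2) W(2) curlU U'(2) W(2) curlU])
    have "AE x in lebesgue. (- 1) *\<^sub>R refl2 (W (refl2 x)) = (- 1) *\<^sub>R W x + 0 *\<^sub>R W x"
      by (rule is_weak_curl_unique[OF L2_scaleR[OF L2_twist[OF orthogonal_refl2 orthogonal_refl2 W(1,2)]]
            L2_add[OF L2_scaleR[OF W(2)] L2_scaleR[OF W(2)]] 1 2])
    then show ?thesis by (simp add: AE_completion_iff)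
  qed
  have S_rot: "AE x in lborel. S (rot \<theta> x) = rot \<theta> (S x)" for \<theta>
  proof -
    have "AE x in lebesgue. S (rot \<theta> x) = rot \<theta> (S x)"
      using S(2) AE_rot[OF S(2), of \<theta>] X_G1_azimuthal[OF U, unfolded azimuthal_def, THEN conjunct1, THEN spec[of _ \<theta>]]
    proof eventually_elim
      case (elim x)
      have "S (rot \<theta> x) = slope U (rot \<theta> x)" using elim by simp
      also have "\<dots> = rot \<theta> (slope U x)"
        unfolding slope_def elim(3) cylindrically_symmetric_rot[OF V_sym] cylindrically_symmetric_rot[OF \<Gamma>_sym]
        by (simp add: linear_scale[OF linear_rot])
      finally show ?case using elim by simp
    qed
    then show ?thesis by (simp add: AE_completion_iff)
  qed
  have S_refl: "AE x in lborel. refl2 (S (refl2 x)) = - S x"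
  proof -
    have "AE x in lebesgue. refl2 (S (refl2 x)) = - S x"
      using S(2) AE_orthogonal[OF orthogonal_refl2 S(2)] X_G1_refl2[OF U]
    proof eventually_elim
      case (elim x)
      have "U (refl2 x) = refl2 (refl2 (U (refl2 x)))" by simp
      also have "\<dots> = refl2 (- U x)" by (simp only: elim(3))
      finally have u: "U (refl2 x) = - refl2 (U x)" by (simp add: vec_eq_3)
      have "refl2 (S (refl2 x)) = refl2 (slope U (refl2 x))" using elim by simp
      also have "\<dots> = - slope U x"
        unfolding slope_def u cylindrically_symmetric_refl2[OF V_sym] cylindrically_symmetric_refl2[OF \<Gamma>_sym]
        by (simp add: vec_eq_3)
      finally show ?case using elim by simp
    qed
    then show ?thesis by (simp add: AE_completion_iff)
  qed
  \<comment> \<open>The slope need not lie in \<open>L2\<close>; its pairings rest on the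
    integrability of its product with members of \<open>X\<close>.\<close>
  have S_int: "integrable lborel (\<lambda>x. norm (S x) * norm (f x))"
    if fX: "f \<in> X p \<Gamma>" and [measurable]: "f \<in> borel_measurable borel" for f
  proof -
    have [measurable]: "f \<in> borel_measurable lebesgue" "S \<in> borel_measurable lebesgue" by (rule leb, fact)+
    have "integrable lebesgue (\<lambda>x. norm (S x) * norm (f x))"
    proof (rule integrable_cong_AE_imp[OF slope_mult_integrable[OF UX fX]])
      show "AE x in lebesgue. norm (slope U x) * norm (f x) = norm (S x) * norm (f x)"
        using S(2) by eventually_elim simp
      show "(\<lambda>x. norm (S x) * norm (f x)) \<in> borel_measurable lebesgue" by measurable
    qed
    moreover have "(\<lambda>x. norm (S x) * norm (f x)) \<in> borel_measurable lborel" using that(2) by measurable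
    ultimately show ?thesis by (simp add: integrable_completion)
  qed
  have dJ_eq: "dJ U (weak_curl U) f y = (LINT x|lborel. W x \<bullet> y x) + (LINT x|lborel. S x \<bullet> f x)"
    if fX: "f \<in> X p \<Gamma>" and fm [measurable]: "f \<in> borel_measurable borel"
      and ym [measurable]: "y \<in> borel_measurable borel" and y2: "y \<in> L2" for f y
  proof -
    have i1: "integrable lborel (\<lambda>x. W x \<bullet> y x)"
    proof -
      have "(\<lambda>x. W x \<bullet> y x) \<in> borel_measurable lborel" by measurable
      then show ?thesis using L2_inner_integrable[OF W(2) y2] by (simp add: integrable_completion)
    qed
    have i2: "integrable lborel (\<lambda>x. S x \<bullet> f x)"
      by (rule Bochner_Integration.integrable_bound[OF S_int[OF fX fm]]) (auto simp: Cauchy_Schwarz_ineq2)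
    have "dJ U (weak_curl U) f y = (LINT x|lebesgue. W x \<bullet> y x + S x \<bullet> f x)"
      unfolding dJ_def
    proof (rule integral_cong_AE)
      note [measurable] = L2_measurable[OF X_D(4)[OF UX]] slope_measurable[OF X_D(3)[OF UX]] leb[OF ym] leb[OF fm] leb[OF W(1)] leb[OF S(1)]
      show "(\<lambda>x. weak_curl U x \<bullet> y x + slope U x \<bullet> f x) \<in> borel_measurable lebesgue" by measurable
      show "(\<lambda>x. W x \<bullet> y x + S x \<bullet> f x) \<in> borel_measurable lebesgue" by measurable
      show "AE x in lebesgue. weak_curl U x \<bullet> y x + slope U x \<bullet> f x = W x \<bullet> y x + S x \<bullet> f x"
        using W(3) S(2) by eventually_elim simp
    qed
    also have "\<dots> = (LINT x|lborel. W x \<bullet> y x + S x \<bullet> f x)"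
      by (rule integral_completion) measurable
    finally show ?thesis using i1 i2 by simp
  qed
  have H0X: "H0 \<in> X p \<Gamma>"
    by (rule X_I[OF leb[OF H0(1)] Y0(2) curlH weighted_integrable_cong[OF X_D(3)[OF H] leb[OF H0(1)] H0(3) X_D(6)[OF H]]])
  define Hr where "Hr x = refl2 (H0 (refl2 x))" for x
  define Yr where "Yr x = (- 1) *\<^sub>R refl2 (Y0 (refl2 x))" for x
  have Hr [measurable]: "Hr \<in> borel_measurable borel" unfolding Hr_def[abs_def] by measurable
  have Yr [measurable]: "Yr \<in> borel_measurable borel" unfolding Yr_def[abs_def] by measurable
  have Yr2: "Yr \<in> L2" unfolding Yr_def[abs_def] by (rule L2_scaleR[OF L2_twist[OF orthogonal_refl2 orthogonal_refl2 Y0(1,2)]])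
  have curlr: "is_weak_curl Hr Yr" unfolding Hr_def[abs_def] Yr_def[abs_def] by (rule is_weak_curl_refl2[OF H0(1) Y0(1) curlH])
  have HrX: "Hr \<in> X p \<Gamma>"
  proof (rule X_I[OF leb[OF Hr] Yr2 curlr], unfold wt_iff[OF Hr])
    have i: "integrable lborel (\<lambda>x. G (refl2 x) * norm (H0 (refl2 x)) powr (p + 1))"
      using integrable_orthogonal[OF orthogonal_refl2, of "\<lambda>x. G x * norm (H0 x) powr (p + 1)"]
        X_D(6)[OF H0X] wt_iff[OF H0(1)] by simp
    have "AE x in lebesgue. G (refl2 x) = G x"
      using G(2) AE_orthogonal[OF orthogonal_refl2 G(2)] by eventually_elim (simp add: cylindrically_symmetric_refl2[OF \<Gamma>_sym])
    then have e: "AE x in lborel. G (refl2 x) = G x" by (simp add: AE_completion_iff)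
    show "integrable lborel (\<lambda>x. G x * norm (Hr x) powr (p + 1))"
    proof (rule integrable_cong_AE_imp[OF i])
      show "AE x in lborel. G (refl2 x) * norm (H0 (refl2 x)) powr (p + 1) = G x * norm (Hr x) powr (p + 1)"
        using e by eventually_elim (simp add: Hr_def)
      show "(\<lambda>x. G x * norm (Hr x) powr (p + 1)) \<in> borel_measurable lborel" by measurable
    qed
  qed
  \<comment> \<open>The projection onto fields that change sign under conjugation by
    \<open>refl2\<close>, as azimuthal fields do.\<close>
  define H1 where "H1 x = (1/2) *\<^sub>R H0 x + (- 1/2) *\<^sub>R Hr x" for x
  define Y1 where "Y1 x = (1/2) *\<^sub>R Y0 x + (- 1/2) *\<^sub>R Yr x" for x
  have H1 [measurable]: "H1 \<in> borel_measurable borel" unfolding H1_def[abs_def] by measurable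
  have Y1 [measurable]: "Y1 \<in> borel_measurable borel" unfolding Y1_def[abs_def] by measurable
  have H1X: "H1 \<in> X p \<Gamma>" unfolding H1_def[abs_def] by (rule X_lincomb[OF H0X HrX])
  note H12 = X_D(2)[OF H1X]
  have Y12: "Y1 \<in> L2" unfolding Y1_def[abs_def] by (intro L2_add L2_scaleR Y0 Yr2)
  have curl1: "is_weak_curl H1 Y1"
    unfolding H1_def[abs_def] Y1_def[abs_def]
    by (rule is_weak_curl_lincomb[OF H0(2) Y0(2) curlH X_D(2)[OF HrX] Yr2 curlr])
  have odd: "refl2 (H1 (refl2 x)) = - H1 x" for x
    by (simp add: H1_def Hr_def vec_eq_3)
  define H2 where "H2 = avg H1"
  define Y2 where "Y2 = avg Y1"
  have H2 [measurable]: "H2 \<in> borel_measurable borel" unfolding H2_def by (rule avg_borel[OF H1])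
  have Y2 [measurable]: "Y2 \<in> borel_measurable borel" unfolding Y2_def by (rule avg_borel[OF Y1])
  have Y22: "Y2 \<in> L2" unfolding Y2_def by (rule avg_L2[OF Y1 Y12])
  have curl2: "is_weak_curl H2 Y2" unfolding H2_def Y2_def by (rule avg_weak_curl[OF H1 H12 Y1 Y12 curl1])
  have H2X: "H2 \<in> X p \<Gamma>"
  proof (rule X_I[OF leb[OF H2] Y22 curl2], unfold wt_iff[OF H2])
    show "integrable lborel (\<lambda>x. G x * norm (H2 x) powr (p + 1))"
      unfolding H2_def
      using X_D(6)[OF H1X] wt_iff[OF H1] p by (intro avg_weighted_integrable[OF H1 H12 _ G(1) G_pos G_rot]) auto
  qed
  have H2G: "H2 \<in> X_G1 p \<Gamma>"
  proof -
    \<comment> \<open>The profile is read off on the half-plane x2 = 0, x1 > 0, as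
      \<open>avg_form\<close> prescribes.\<close>
    define q where "q z = H2 (vector [fst z, 0, snd z]) $ 2" for z :: "real \<times> real"
    have "(\<lambda>z::real \<times> real. vector [fst z, 0, snd z] :: real^3) \<in> borel_measurable borel"
    proof (rule borel_measurable_vecI)
      fix i :: 3
      have 1: "(\<lambda>z::real \<times> real. fst z) \<in> borel_measurable borel" "(\<lambda>z::real \<times> real. snd z) \<in> borel_measurable borel"
        by (auto intro!: borel_measurable_continuous_onI continuous_on_fst continuous_on_snd continuous_on_id)
      show "(\<lambda>z::real \<times> real. (vector [fst z, 0, snd z] :: real^3) $ i) \<in> borel_measurable borel"
        using exhaust_3[of i] 1 by auto
    qed
    from measurable_compose[OF this H2] have "q \<in> borel_measurable borel"
      unfolding q_def[abs_def] by (rule borel_measurable_nth)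
    then have q: "q \<in> borel_measurable (lebesgue_on ({0<..} \<times> UNIV))"
      by (intro measurable_restrict_space1 measurable_completion) simp
    have "AE x in lebesgue. H2 x = (q (cyl_radius x, x $ 3) / cyl_radius x) *\<^sub>R vector [- (x $ 2), x $ 1, 0]"
      using AE_cyl_radius_pos
    proof eventually_elim
      case (elim x)
      show ?case using avg_form[OF H1 odd elim] by (simp add: q_def H2_def)
    qed
    then show ?thesis using H2X q unfolding X_G1_def by blast
  qed
  have "dJ U (weak_curl U) H (weak_curl H) = dJ U (weak_curl U) H0 Y0"
    by (rule dJ_cong[OF H0(3) Y0(3) X_D(3)[OF UX] L2_measurable[OF X_D(4)[OF UX]] X_D(3)[OF H] leb[OF H0(1)]
        L2_measurable[OF X_D(4)[OF H]] leb[OF Y0(1)]])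
  also have "\<dots> = dJ U (weak_curl U) H1 Y1"
  proof -
    have i1: "integrable lborel (\<lambda>x. W x \<bullet> y x)" if "y \<in> borel_measurable borel" "y \<in> L2" for y
    proof -
      have "(\<lambda>x. W x \<bullet> y x) \<in> borel_measurable lborel" using that(1) by measurable
      then show ?thesis using L2_inner_integrable[OF W(2) that(2)] by (simp add: integrable_completion)
    qed
    have i2: "integrable lborel (\<lambda>x. S x \<bullet> f x)" if "f \<in> X p \<Gamma>" "f \<in> borel_measurable borel" for f
      by (rule Bochner_Integration.integrable_bound[OF S_int[OF that]]) (use that(2) in \<open>auto simp: Cauchy_Schwarz_ineq2\<close>)
    have "(LINT x|lborel. W x \<bullet> refl2 (Y0 (refl2 x))) = (LINT x|lborel. refl2 (W (refl2 x)) \<bullet> Y0 x)"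
      by (rule orthogonal_inner_twist[OF orthogonal_refl2 orthogonal_refl2 refl2_refl2 refl2_refl2 Y0(1) W(1)])
    also have "\<dots> = (LINT x|lborel. W x \<bullet> Y0 x)"
    proof (rule integral_cong_AE)
      show "AE x in lborel. refl2 (W (refl2 x)) \<bullet> Y0 x = W x \<bullet> Y0 x" using W_refl by eventually_elim simp
    qed measurable
    finally have "(LINT x|lborel. W x \<bullet> Yr x) = - (LINT x|lborel. W x \<bullet> Y0 x)" by (simp add: Yr_def)
    then have y: "(LINT x|lborel. W x \<bullet> Y1 x) = (LINT x|lborel. W x \<bullet> Y0 x)"
      using i1[OF Y0(1,2)] i1[OF Yr Yr2] by (simp add: Y1_def inner_diff_right inner_add_right)
    have "(LINT x|lborel. S x \<bullet> Hr x) = (LINT x|lborel. refl2 (S (refl2 x)) \<bullet> H0 x)"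
      unfolding Hr_def
      by (rule orthogonal_inner_twist[OF orthogonal_refl2 orthogonal_refl2 refl2_refl2 refl2_refl2 H0(1) S(1)])
    also have "\<dots> = (LINT x|lborel. - (S x \<bullet> H0 x))"
    proof (rule integral_cong_AE)
      show "AE x in lborel. refl2 (S (refl2 x)) \<bullet> H0 x = - (S x \<bullet> H0 x)" using S_refl by eventually_elim simp
    qed measurable
    finally have "(LINT x|lborel. S x \<bullet> Hr x) = - (LINT x|lborel. S x \<bullet> H0 x)" by simp
    then have h: "(LINT x|lborel. S x \<bullet> H1 x) = (LINT x|lborel. S x \<bullet> H0 x)"
      using i2[OF H0X H0(1)] i2[OF HrX Hr] by (simp add: H1_def inner_diff_right inner_add_right)
    show ?thesis
      unfolding dJ_eq[OF H0X H0(1) Y0(1,2)] dJ_eq[OF H1X H1 Y1 Y12] y h ..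
  qed
  also have "\<dots> = dJ U (weak_curl U) H2 Y2"
  proof -
    have "(LINT x|lborel. W x \<bullet> avg Y1 x) = (LINT x|lborel. W x \<bullet> Y1 x)"
      by (rule avg_equivariant[OF Y1 Y12 W(1) avg_L2_pair_integrable[OF Y1 Y12 W(1,2)] W_rot])
    moreover have "(LINT x|lborel. S x \<bullet> avg H1 x) = (LINT x|lborel. S x \<bullet> H1 x)"
    proof (rule avg_equivariant[OF H1 H12 S(1) _ S_rot])
      show "integrable (circle \<Otimes>\<^sub>M lborel) (\<lambda>(\<theta>, x). norm (S x) * norm (H1 (rot \<theta> x)))"
      proof (rule rot_product_integrable[of "\<lambda>x. norm (S x)" "\<lambda>x. norm (H1 x)"])
        show "AE x in lborel. norm (S (rot \<theta> x)) = norm (S x)" for \<theta>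
          using S_rot[of \<theta>] by eventually_elim simp
        show "integrable lborel (\<lambda>x. norm (S x) * norm (H1 x))" by (rule S_int[OF H1X H1])
      qed measurable
    qed
    ultimately show ?thesis
      unfolding dJ_eq[OF H1X H1 Y1 Y12] dJ_eq[OF H2X H2 Y2 Y22] by (simp only: H2_def Y2_def)
  qed
  also have "\<dots> = dJ U (weak_curl U) H2 (weak_curl H2)"
  proof (rule dJ_cong[OF _ _ X_D(3)[OF UX] L2_measurable[OF X_D(4)[OF UX]] leb[OF H2] leb[OF H2] leb[OF Y2] L2_measurable[OF X_D(4)[OF H2X]]])
    show "AE x in lebesgue. Y2 x = weak_curl H2 x"
      using weak_curl_eq[OF X_D(2)[OF H2X] Y22 curl2] by eventually_elim simp
  qed simp
  also have "\<dots> = 0" by (rule zero[OF H2G])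
  finally show ?thesis .
qed

lemma J_AE_zero:
  assumes U: "U \<in> X p \<Gamma>" and z: "AE x in lebesgue. U x = 0"
  shows "J p V \<Gamma> U = 0"
proof -
  have "is_weak_curl (\<lambda>x. 0) (\<lambda>x. 0)" by (simp add: is_weak_curl_def)
  then have c: "is_weak_curl U (\<lambda>x. 0)"
    using is_weak_curl_cong_AE[OF z X_D(3)[OF U]] by simp
  have "J p V \<Gamma> U = (LINT x|lebesgue. dens U (\<lambda>x. 0) x)" by (rule J_eq[OF U L2_zero c])
  also have "\<dots> = (LINT x|(lebesgue :: (real^3) measure). 0)"
  proof (rule integral_cong_AE)
    note [measurable] = X_D(3)[OF U]
    show "AE x in lebesgue. dens U (\<lambda>x. 0) x = 0" using z by eventually_elim (simp add: dens_def)
    show "dens U (\<lambda>x. 0) \<in> borel_measurable lebesgue" by measurable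
  qed simp
  finally show ?thesis by simp
qed

theorem ground_state_exists: "\<exists>U. ground_state p V \<Gamma> U"
proof -
  obtain U where U: "U \<in> X_G1 p \<Gamma>" and min: "\<And>W. W \<in> X_G1 p \<Gamma> \<Longrightarrow> J p V \<Gamma> U \<le> J p V \<Gamma> W"
    using minimizer_exists by blast
  obtain W where "W \<in> X_G1 p \<Gamma>" "J p V \<Gamma> W < 0" using negative_energy by blast
  then have "J p V \<Gamma> U < 0" using min[of W] by linarith
  then have "\<not> (AE x in lebesgue. U x = 0)" using J_AE_zero[OF X_G1_X[OF U]] by force
  moreover have "critical_point p V \<Gamma> U"
    by (rule critical_pointI[OF X_G1_X[OF U]])
      (rule symmetric_criticality[OF U dJ_zero_of_minimizer[OF U min]])
  ultimately show ?thesis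
    using U min by (auto simp: ground_state_def weak_solution_def)
qed

end

theorem theorem2:
  fixes p :: real and V \<Gamma> :: "real^3 \<Rightarrow> real"
  assumes "p > 1"
    and "V \<in> borel_measurable lebesgue"
    and "\<Gamma> \<in> borel_measurable lebesgue"
    and "L_inf_loc \<Gamma>"
    and "cylindrically_symmetric V"
    and "cylindrically_symmetric \<Gamma>"
    and "\<exists>\<alpha> C. \<alpha> > 3 / 2 * (p - 1) \<and> C > 0 \<and> (\<forall>x. \<Gamma> x \<le> - C * (1 + norm x) powr \<alpha>)"
    and "L_inf lebesgue V"
    and "esssup lebesgue (\<lambda>x. ereal (V x)) < 0"
  shows "\<exists>U. ground_state p V \<Gamma> U"
proof -
  obtain \<alpha> C where \<alpha>: "3 / 2 * (p - 1) < \<alpha>" "0 < C" "\<And>x. \<Gamma> x \<le> - C * (1 + norm x) powr \<alpha>"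
    using assms(7) by blast
  obtain v where v: "AE x in lebesgue. \<bar>V x\<bar> \<le> v" using assms(8) by (auto simp: L_inf_def)
  \<comment> \<open>A real number in between is taken because the essential supremum is an extended
    real; -z becomes the positive constant \<open>v0\<close>.\<close>
  obtain z where z: "esssup lebesgue (\<lambda>x. ereal (V x)) < ereal z" "ereal z < 0"
    using ereal_dense2[OF assms(9)] by blast
  have neg: "AE x in lebesgue. V x \<le> - (- z)"
    using esssup_AE[of "\<lambda>x. ereal (V x)" lebesgue]
  proof eventually_elim
    case (elim x)
    then have "ereal (V x) < ereal z" using z(1) by (rule le_less_trans)
    then show ?case by simp
  qed
  \<comment> \<open>The locale asks for a positive bound, which |v| + 1 guarantees.\<close>
  have bound: "AE x in lebesgue. \<bar>V x\<bar> \<le> \<bar>v\<bar> + 1" using v by eventually_elim simp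
  interpret defocusing p V \<Gamma> \<alpha> C "\<bar>v\<bar> + 1" "- z"
    by unfold_locales (use assms \<alpha> neg bound z in auto)
  show ?thesis by (rule ground_state_exists)
qed

end
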